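(* Let $n\ge1$, let $\Lambda_n$ be the algebra of lower triangular $n\times n$ matrices over a field, and let $\mathrm{fb}(n)$ be the set of isomorphism classes of basic faithfully balanced $\Lambda_n$-modules with exactly $n$ indecomposable summands, with the partial order $$N\unlhd M\iff \mathrm{cogen}(N)\subseteq\mathrm{cogen}(M)\ \text{ and }\ \mathrm{gen}(N)\supseteq\mathrm{gen}(M).$$ Then: (1) the poset $(\mathrm{fb}(n),\unlhd)$ is a lattice; (2) the Tamari lattice is a sublattice of $(\mathrm{fb}(n),\unlhd)$; (3) the cover relations in $(\mathrm{fb}(n),\unlhd)$ are given by exchanging exactly one indecomposable summand; that is, if $M$ covers $N$, then $N\cong U\oplus X$ and $M\cong U\oplus Y$ for some module $U$ with $n-1$ indecomposable summands and non-isomorphic indecomposable modules $X,Y$.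
   Context: Modules are finitely generated left modules. $M$ is faithfully balanced if the natural map $\Lambda\to\mathrm{End}_E(M)$, $E=\mathrm{End}_\Lambda(M)$, is bijective; basic means that the indecomposable summands occur with multiplicity one. $\mathrm{gen}(M)$ is the category of quotients of finite direct sums of copies of $M$, and $\mathrm{cogen}(M)$ the category of modules embeddable in a finite direct sum of copies of $M$. The Tamari lattice is here realized as the set of isomorphism classes of basic cotilting $\Lambda_n$-modules (for the hereditary algebra $\Lambda_n$ these are the same as the basic tilting modules, i.e. the basic modules $T$ with $\mathrm{Ext}^1(T,T)=0$ and exactly $n$ indecomposable summands), ordered by $T_1\le T_2$ if and only if $\mathrm{Ext}^1(T_1,T_2)=0$; this poset is isomorphic to the classical Tamari lattice on binary trees with $n$ vertices. All these modules lie in $\mathrm{fb}(n)$. Being a sublattice means that the order $\le$ is the restriction of $\unlhd$ and that the subset is closed under the meets and joins of $(\mathrm{fb}(n),\unlhd)$. *)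

theory Defs
  imports "HOL-Algebra.Lattice" "HOL-Algebra.AbelCoset" "HOL-Algebra.Subrings" "Jordan_Normal_Form.Matrix"
begin

section \<open>Left modules over a not necessarily commutative ring\<close>

text \<open>
  The locale \<^locale>\<open>module\<close> of HOL-Algebra requires a commutative ring of scalars, so only its
  record type is reused here. As there, the fields \<open>mult\<close> and \<open>one\<close> of a module are meaningless.
\<close>

locale left_module = R?: ring R + M?: abelian_group M
  for R :: "('r, 'a) ring_scheme" and M :: "('r, 'v, 'b) module_scheme" +
  assumes smult_closed:
      "\<lbrakk>a \<in> carrier R; x \<in> carrier M\<rbrakk> \<Longrightarrow> a \<odot>\<^bsub>M\<^esub> x \<in> carrier M"
    and smult_l_distr:
      "\<lbrakk>a \<in> carrier R; b \<in> carrier R; x \<in> carrier M\<rbrakk> \<Longrightarrow>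
        (a \<oplus>\<^bsub>R\<^esub> b) \<odot>\<^bsub>M\<^esub> x = a \<odot>\<^bsub>M\<^esub> x \<oplus>\<^bsub>M\<^esub> b \<odot>\<^bsub>M\<^esub> x"
    and smult_r_distr:
      "\<lbrakk>a \<in> carrier R; x \<in> carrier M; y \<in> carrier M\<rbrakk> \<Longrightarrow>
        a \<odot>\<^bsub>M\<^esub> (x \<oplus>\<^bsub>M\<^esub> y) = a \<odot>\<^bsub>M\<^esub> x \<oplus>\<^bsub>M\<^esub> a \<odot>\<^bsub>M\<^esub> y"
    and smult_assoc:
      "\<lbrakk>a \<in> carrier R; b \<in> carrier R; x \<in> carrier M\<rbrakk> \<Longrightarrow>
        (a \<otimes>\<^bsub>R\<^esub> b) \<odot>\<^bsub>M\<^esub> x = a \<odot>\<^bsub>M\<^esub> (b \<odot>\<^bsub>M\<^esub> x)"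
    and smult_one:
      "x \<in> carrier M \<Longrightarrow> \<one>\<^bsub>R\<^esub> \<odot>\<^bsub>M\<^esub> x = x"

definition fg_modules :: "'r ring \<Rightarrow> ('r, 'v) module set" where
  "fg_modules R = {M. left_module R M \<and>
     (\<exists>S. finite S \<and> S \<subseteq> carrier M \<and> (\<forall>H. submodule H R M \<and> S \<subseteq> H \<longrightarrow> H = carrier M))}"

definition mod_hom :: "'r ring \<Rightarrow> ('r, 'v) module \<Rightarrow> ('r, 'w) module \<Rightarrow> ('v \<Rightarrow> 'w) set" where
  "mod_hom R M N = {f \<in> carrier M \<rightarrow> carrier N.
     (\<forall>x\<in>carrier M. \<forall>y\<in>carrier M. f (x \<oplus>\<^bsub>M\<^esub> y) = f x \<oplus>\<^bsub>N\<^esub> f y) \<and>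
     (\<forall>r\<in>carrier R. \<forall>x\<in>carrier M. f (r \<odot>\<^bsub>M\<^esub> x) = r \<odot>\<^bsub>N\<^esub> f x)}"

definition mod_iso :: "'r ring \<Rightarrow> ('r, 'v) module \<Rightarrow> ('r, 'w) module \<Rightarrow> ('v \<Rightarrow> 'w) set" where
  "mod_iso R M N = {f \<in> mod_hom R M N. bij_betw f (carrier M) (carrier N)}"

definition isomorphic_mod :: "'r ring \<Rightarrow> ('r, 'v) module \<Rightarrow> ('r, 'w) module \<Rightarrow> bool" where
  "isomorphic_mod R M N \<longleftrightarrow> mod_iso R M N \<noteq> {}"

definition iso_class :: "'r ring \<Rightarrow> ('r, 'v) module \<Rightarrow> ('r, 'v) module set" where
  "iso_class R M = {N \<in> fg_modules R. isomorphic_mod R N M}"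


section \<open>Direct sums, indecomposable summands, gen and cogen\<close>

text \<open>The external direct sum of \<open>F 0, \<dots>, F (m - 1)\<close>; it is the zero module for \<open>m = 0\<close>.\<close>

definition direct_sum :: "nat \<Rightarrow> (nat \<Rightarrow> ('r, 'v) module) \<Rightarrow> ('r, nat \<Rightarrow> 'v) module" where
  "direct_sum m F = \<lparr>
     carrier = (\<Pi>\<^sub>E i\<in>{..<m}. carrier (F i)),
     monoid.mult = undefined, one = undefined,
     zero = (\<lambda>i\<in>{..<m}. \<zero>\<^bsub>F i\<^esub>),
     add = (\<lambda>f g. \<lambda>i\<in>{..<m}. f i \<oplus>\<^bsub>F i\<^esub> g i),
     smult = (\<lambda>r f. \<lambda>i\<in>{..<m}. r \<odot>\<^bsub>F i\<^esub> f i)\<rparr>"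

definition direct_sum2 ::
  "('r, 'v) module \<Rightarrow> ('r, 'w) module \<Rightarrow> ('r, 'v \<times> 'w) module" where
  "direct_sum2 M N = \<lparr>
     carrier = carrier M \<times> carrier N,
     monoid.mult = undefined, one = undefined,
     zero = (\<zero>\<^bsub>M\<^esub>, \<zero>\<^bsub>N\<^esub>),
     add = (\<lambda>(x, y) (x', y'). (x \<oplus>\<^bsub>M\<^esub> x', y \<oplus>\<^bsub>N\<^esub> y')),
     smult = (\<lambda>r (x, y). (r \<odot>\<^bsub>M\<^esub> x, r \<odot>\<^bsub>N\<^esub> y))\<rparr>"

definition indecomposable :: "'r ring \<Rightarrow> ('r, 'v) module \<Rightarrow> bool" where
  "indecomposable R M \<longleftrightarrow> M \<in> fg_modules R \<and> carrier M \<noteq> {\<zero>\<^bsub>M\<^esub>} \<and>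
     (\<forall>A B. submodule A R M \<and> submodule B R M \<and> A \<inter> B = {\<zero>\<^bsub>M\<^esub>} \<and> A <+>\<^bsub>M\<^esub> B = carrier M
        \<longrightarrow> A = {\<zero>\<^bsub>M\<^esub>} \<or> B = {\<zero>\<^bsub>M\<^esub>})"

definition indec_decomposition ::
  "'r ring \<Rightarrow> ('r, 'v) module \<Rightarrow> nat \<Rightarrow> (nat \<Rightarrow> ('r, 'v) module) \<Rightarrow> bool" where
  "indec_decomposition R M m F \<longleftrightarrow>
     (\<forall>i<m. indecomposable R (F i)) \<and> isomorphic_mod R M (direct_sum m F)"

text \<open>
  Over a finite-dimensional algebra the decomposition is unique by the Krull--Schmidt theorem,
  so that it does not matter which decomposition is looked at.
\<close>

definition has_indec_summands :: "'r ring \<Rightarrow> nat \<Rightarrow> ('r, 'v) module \<Rightarrow> bool" where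
  "has_indec_summands R m M \<longleftrightarrow> (\<exists>F. indec_decomposition R M m F)"

definition basic_with_summands :: "'r ring \<Rightarrow> nat \<Rightarrow> ('r, 'v) module \<Rightarrow> bool" where
  "basic_with_summands R m M \<longleftrightarrow> (\<exists>F. indec_decomposition R M m F \<and>
     (\<forall>i<m. \<forall>j<m. i \<noteq> j \<longrightarrow> \<not> isomorphic_mod R (F i) (F j)))"

definition gen :: "'r ring \<Rightarrow> ('r, 'v) module \<Rightarrow> ('r, 'v) module set" where
  "gen R M = {N \<in> fg_modules R.
     \<exists>m. \<exists>f \<in> mod_hom R (direct_sum m (\<lambda>_. M)) N.
       f ` carrier (direct_sum m (\<lambda>_. M)) = carrier N}"

definition cogen :: "'r ring \<Rightarrow> ('r, 'v) module \<Rightarrow> ('r, 'v) module set" where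
  "cogen R M = {N \<in> fg_modules R.
     \<exists>m. \<exists>f \<in> mod_hom R N (direct_sum m (\<lambda>_. M)). inj_on f (carrier N)}"


section \<open>Faithfully balanced modules\<close>

definition End_ring :: "'r ring \<Rightarrow> ('r, 'v) module \<Rightarrow> ('v \<Rightarrow> 'v) ring" where
  "End_ring R M = \<lparr>
     carrier = mod_hom R M M \<inter> extensional (carrier M),
     monoid.mult = compose (carrier M),
     one = (\<lambda>x\<in>carrier M. x),
     zero = (\<lambda>x\<in>carrier M. \<zero>\<^bsub>M\<^esub>),
     add = (\<lambda>f g. \<lambda>x\<in>carrier M. f x \<oplus>\<^bsub>M\<^esub> g x)\<rparr>"

text \<open>The module \<open>M\<close>, regarded as a left module over its endomorphism ring by evaluation.\<close>

definition as_End_module :: "('r, 'v) module \<Rightarrow> ('v \<Rightarrow> 'v, 'v) module" where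
  "as_End_module M = \<lparr>
     carrier = carrier M, monoid.mult = undefined, one = undefined,
     zero = \<zero>\<^bsub>M\<^esub>, add = add M,
     smult = (\<lambda>f x. f x)\<rparr>"

definition faithfully_balanced :: "'r ring \<Rightarrow> ('r, 'v) module \<Rightarrow> bool" where
  "faithfully_balanced R M \<longleftrightarrow>
     bij_betw (\<lambda>r. \<lambda>x\<in>carrier M. r \<odot>\<^bsub>M\<^esub> x)
       (carrier R) (carrier (End_ring (End_ring R M) (as_End_module M)))"


section \<open>First extension groups\<close>

text \<open>
  The underlying set of \<open>Ext\<^sup>1(A, B)\<close> in Yoneda's description: short exact sequences
  \<open>0 \<rightarrow> B \<rightarrow> E \<rightarrow> A \<rightarrow> 0\<close> up to isomorphisms of \<open>E\<close> that are compatible with the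
  identities of \<open>A\<close> and \<open>B\<close>. The middle terms \<open>E\<close> are carried by the same type as \<open>A\<close> and \<open>B\<close>,
  which therefore has to be large enough to accommodate all of them.
\<close>

definition extensions ::
  "'r ring \<Rightarrow> ('r, 'v) module \<Rightarrow> ('r, 'v) module \<Rightarrow>
    (('r, 'v) module \<times> ('v \<Rightarrow> 'v) \<times> ('v \<Rightarrow> 'v)) set" where
  "extensions R A B = {(E, f, g). left_module R E \<and>
     f \<in> mod_hom R B E \<and> inj_on f (carrier B) \<and>
     g \<in> mod_hom R E A \<and> g ` carrier E = carrier A \<and>
     f ` carrier B = {x \<in> carrier E. g x = \<zero>\<^bsub>A\<^esub>}}"

definition ext_equiv ::
  "'r ring \<Rightarrow> ('r, 'v) module \<Rightarrow> ('r, 'v) module \<Rightarrow>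
    (('r, 'v) module \<times> ('v \<Rightarrow> 'v) \<times> ('v \<Rightarrow> 'v)) rel" where
  "ext_equiv R A B = {((E, f, g), (E', f', g')).
     (E, f, g) \<in> extensions R A B \<and> (E', f', g') \<in> extensions R A B \<and>
     (\<exists>h \<in> mod_iso R E E'. (\<forall>b\<in>carrier B. h (f b) = f' b) \<and> (\<forall>x\<in>carrier E. g' (h x) = g x))}"

definition Ext1 ::
  "'r ring \<Rightarrow> ('r, 'v) module \<Rightarrow> ('r, 'v) module \<Rightarrow>
    (('r, 'v) module \<times> ('v \<Rightarrow> 'v) \<times> ('v \<Rightarrow> 'v)) set set" where
  "Ext1 R A B = extensions R A B // ext_equiv R A B"

text \<open>The group \<open>Ext\<^sup>1(A, B)\<close> is zero iff it has only one element.\<close>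

definition Ext1_zero :: "'r ring \<Rightarrow> ('r, 'v) module \<Rightarrow> ('r, 'v) module \<Rightarrow> bool" where
  "Ext1_zero R A B \<longleftrightarrow> is_singleton (Ext1 R A B)"


section \<open>Posets\<close>

definition covers :: "'a gorder \<Rightarrow> 'a \<Rightarrow> 'a \<Rightarrow> bool" where
  "covers L x y \<longleftrightarrow> x \<in> carrier L \<and> y \<in> carrier L \<and> y \<sqsubset>\<^bsub>L\<^esub> x \<and>
     \<not> (\<exists>z\<in>carrier L. y \<sqsubset>\<^bsub>L\<^esub> z \<and> z \<sqsubset>\<^bsub>L\<^esub> x)"

definition sublattice :: "'a gorder \<Rightarrow> 'a gorder \<Rightarrow> bool" where
  "sublattice K L \<longleftrightarrow> carrier K \<subseteq> carrier L \<and>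
     (\<forall>x\<in>carrier K. \<forall>y\<in>carrier K. (x \<sqsubseteq>\<^bsub>K\<^esub> y \<longleftrightarrow> x \<sqsubseteq>\<^bsub>L\<^esub> y) \<and>
        x \<sqinter>\<^bsub>L\<^esub> y \<in> carrier K \<and> x \<squnion>\<^bsub>L\<^esub> y \<in> carrier K)"


section \<open>Lower triangular matrices and the two posets\<close>

definition lower_tri_ring :: "'k::field itself \<Rightarrow> nat \<Rightarrow> 'k mat ring" where
  "lower_tri_ring ty n = (ring_mat ty n ())
     \<lparr>carrier := {A \<in> carrier_mat n n. \<forall>i<n. \<forall>j<n. i < j \<longrightarrow> A $$ (i, j) = 0}\<rparr>"

lemma ring_lower_tri_ring: "ring (lower_tri_ring TYPE('k::field) n)"
proof -
  let ?T = "{A :: 'k mat. A \<in> carrier_mat n n \<and> (\<forall>i<n. \<forall>j<n. i < j \<longrightarrow> A $$ (i, j) = 0)}"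
  let ?M = "ring_mat TYPE('k) n ()"
  interpret ring ?M by (rule ring_mat)
  have inv: "\<ominus>\<^bsub>?M\<^esub> A = - A" if "A \<in> carrier_mat n n" for A
    using that by (intro minus_equality) (auto simp: ring_mat_simps)
  have "subring ?T ?M"
  proof (rule ring.subringI[OF ring_axioms])
    show "?T \<subseteq> carrier ?M" by (auto simp: ring_mat_simps)
    show "\<one>\<^bsub>?M\<^esub> \<in> ?T" by (auto simp: ring_mat_simps)
    show "\<ominus>\<^bsub>?M\<^esub> A \<in> ?T" if "A \<in> ?T" for A
      using that by (auto simp: inv)
    show "A \<otimes>\<^bsub>?M\<^esub> B \<in> ?T" if "A \<in> ?T" "B \<in> ?T" for A B
    proof -
      have "(A * B) $$ (i, j) = 0" if "i < n" "j < n" "i < j" for i j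
      proof -
        have "A $$ (i, k) * B $$ (k, j) = 0" if "k < n" for k
          using \<open>A \<in> ?T\<close> \<open>B \<in> ?T\<close> \<open>i < n\<close> \<open>j < n\<close> \<open>i < j\<close> that
          by (cases "i < k") auto
        then show ?thesis
          using \<open>A \<in> ?T\<close> \<open>B \<in> ?T\<close> \<open>i < n\<close> \<open>j < n\<close>
          by (auto simp: scalar_prod_def intro!: sum.neutral)
      qed
      then show ?thesis using that by (auto simp: ring_mat_simps)
    qed
    show "A \<oplus>\<^bsub>?M\<^esub> B \<in> ?T" if "A \<in> ?T" "B \<in> ?T" for A B
      using that by (auto simp: ring_mat_simps)
  qed
  from subring_is_ring[OF this] show ?thesis
    by (simp add: lower_tri_ring_def)
qed

text \<open>
  All modules over the ring \<open>\<Lambda>\<^sub>n\<close> of lower triangular \<open>n \<times> n\<close> matrices over a field \<open>'k\<close> are taken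
  with a carrier set of elements of type \<^typ>\<open>'k vec\<close>. Nothing is lost: a finitely
  generated \<open>\<Lambda>\<^sub>n\<close>-module has some finite dimension \<open>d\<close> over \<open>'k\<close> and is thus isomorphic to one with
  carrier set \<^term>\<open>carrier_vec d\<close>.
\<close>

definition fb_modules :: "'k::field itself \<Rightarrow> nat \<Rightarrow> ('k mat, 'k vec) module set" where
  "fb_modules ty n = {M \<in> fg_modules (lower_tri_ring ty n).
     basic_with_summands (lower_tri_ring ty n) n M \<and>
     faithfully_balanced (lower_tri_ring ty n) M}"

text \<open>
  The order conditions depend only on the isomorphism classes of the modules involved; on the
  classes they are evaluated at arbitrary representatives.
\<close>

definition fb_poset :: "'k::field itself \<Rightarrow> nat \<Rightarrow> ('k mat, 'k vec) module set gorder" where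
  "fb_poset ty n = \<lparr>
     carrier = iso_class (lower_tri_ring ty n) ` fb_modules ty n,
     eq = (=),
     le = (\<lambda>C D. \<exists>N\<in>C. \<exists>M\<in>D.
       cogen (lower_tri_ring ty n) N \<subseteq> cogen (lower_tri_ring ty n) M \<and>
       gen (lower_tri_ring ty n) N \<supseteq> gen (lower_tri_ring ty n) M)\<rparr>"

text \<open>
  Since \<open>\<Lambda>\<^sub>n\<close> is hereditary with \<open>n\<close> simple modules, the basic cotilting modules are the basic
  tilting modules, i.e. the basic modules with \<open>n\<close> indecomposable summands and without
  self-extensions.
\<close>

definition cotilting_modules :: "'k::field itself \<Rightarrow> nat \<Rightarrow> ('k mat, 'k vec) module set" where
  "cotilting_modules ty n = {T \<in> fg_modules (lower_tri_ring ty n).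
     basic_with_summands (lower_tri_ring ty n) n T \<and>
     Ext1_zero (lower_tri_ring ty n) T T}"

definition tamari_poset :: "'k::field itself \<Rightarrow> nat \<Rightarrow> ('k mat, 'k vec) module set gorder" where
  "tamari_poset ty n = \<lparr>
     carrier = iso_class (lower_tri_ring ty n) ` cotilting_modules ty n,
     eq = (=),
     le = (\<lambda>C D. \<exists>T\<^sub>1\<in>C. \<exists>T\<^sub>2\<in>D. Ext1_zero (lower_tri_ring ty n) T\<^sub>1 T\<^sub>2)\<rparr>"

end

theory Submission
  imports Defs
begin

text \<open>
  The indecomposable modules are the interval modules, so a basic module is a finite set \<open>S\<close> of
  intervals. Computing the bicommutant of the sum of the intervals in \<open>S\<close> shows that it is faithfully
  balanced iff \<open>S\<close> contains the full interval, every other interval of \<open>S\<close> is a proper quotient or a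
  proper submodule of another one, and every inner vertex \<open>i\<close> is an end point of some interval of \<open>S\<close>.
  If \<open>S\<close> has exactly \<open>n\<close> elements, a count of longest intervals shows that each inner vertex is
  a left end or a right end, but not both, so that \<open>S\<close> is encoded by two functions: \<open>c\<close> gives the
  longest interval with a given right end and \<open>r\<close> the longest one with a given left end. These functions
  also determine \<open>cogen\<close> and \<open>gen\<close>, and the order becomes the reverse of the pointwise order of
  \<open>(c, r)\<close>. The join of two codes has \<open>r\<close> equal to the minimum and \<open>c\<close> as large as possible below the
  minimum; meets follow by duality. The vanishing of \<open>Ext\<^sup>1\<close> means that no two intervals
  cross, a condition that joins and meets preserve. If two codes are comparable, one of them
  can be moved towards the other by changing a single value, i.e. by exchanging one summand.
\<close>

section \<open>Sets of intervals\<close>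

text \<open>Rows and columns are kept apart because \<open>gen\<close> sees a summand only through
  longer intervals with the same left end, and \<open>cogen\<close> only through longer ones with
  the same right end. A code records exactly this information. The obstacle to a lattice is that the
  pointwise minimum of two codes need not be a code: an index that is a left end in one code and a
  right end in the other becomes a right end, and an interval attached to it loses its left end.
  Hence \<open>c\<close> of a join is defined by maximality, which is also what keeps joins
  noncrossing. Uniqueness of decompositions is drawn from two sources: single interval modules are
  told apart by their supports, and a class in the poset determines its set of intervals because the
  order on these sets is antisymmetric. The concrete modules have functions as elements, while the
  posets consist of modules on \<open>'k vec\<close>; the structure is moved along an arbitrary
  injection, and the middle terms of extensions are put on this type in the same way.\<close>

text \<open>A pair \<open>(x, y)\<close> with \<open>x < y \<le> n\<close> stands for the indecomposable module supported on the
  vertices \<open>x, \<dots>, y - 1\<close> of the quiver \<open>0 \<rightarrow> 1 \<rightarrow> \<dots> \<rightarrow> n - 1\<close>.\<close>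

definition intervals :: "nat \<Rightarrow> (nat \<times> nat) set" where
  "intervals n = {(x, y). x < y \<and> y \<le> n}"

definition fbset :: "nat \<Rightarrow> (nat \<times> nat) set \<Rightarrow> bool" where
  "fbset n S \<longleftrightarrow> S \<subseteq> intervals n \<and> (0, n) \<in> S \<and>
     (\<forall>x y. (x, y) \<in> S \<longrightarrow> (x, y) \<noteq> (0, n) \<longrightarrow>
        (\<exists>y'>y. (x, y') \<in> S) \<or> (\<exists>x'<x. (x', y) \<in> S)) \<and>
     (\<forall>i. 0 < i \<longrightarrow> i < n \<longrightarrow> (\<exists>y. (i, y) \<in> S) \<or> (\<exists>x. (x, i) \<in> S))"

text \<open>The generator of \<open>(x, y)\<close> sits at \<open>x\<close> and its socle at
  \<open>y - 1\<close>, so submodules keep the right end and quotients keep the left end. The first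
  clause is therefore inclusion of \<open>cogen\<close>, the second inclusion of \<open>gen\<close>
  in the opposite direction.\<close>

definition int_le :: "(nat \<times> nat) set \<Rightarrow> (nat \<times> nat) set \<Rightarrow> bool" where
  "int_le S T \<longleftrightarrow> (\<forall>x y. (x, y) \<in> S \<longrightarrow> (\<exists>x'\<le>x. (x', y) \<in> T)) \<and>
     (\<forall>x y. (x, y) \<in> T \<longrightarrow> (\<exists>y'\<ge>y. (x, y') \<in> S))"

text \<open>The excluded pairs are those with a nonsplit extension of \<open>(x, y)\<close> by
  \<open>(x', y')\<close>, whose middle term is \<open>(x, y')\<close> plus \<open>(x', y)\<close>.
  The case \<open>x' = y\<close> is included: the second summand is then zero and the intervals are
  glued end to end.\<close>

definition no_ext :: "(nat \<times> nat) set \<Rightarrow> (nat \<times> nat) set \<Rightarrow> bool" where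
  "no_ext S T \<longleftrightarrow> (\<forall>x y x' y'. (x, y) \<in> S \<longrightarrow> (x', y') \<in> T \<longrightarrow> \<not> (x < x' \<and> x' \<le> y \<and> y < y'))"

text \<open>A faithfully balanced set with \<open>n\<close> elements is encoded by two functions: \<open>c y\<close> is the smallest
  \<open>x\<close> with \<open>(x, y)\<close> in the set, or \<open>y\<close> if there is none, and \<open>r x\<close> is the largest \<open>y\<close> with
  \<open>(x, y)\<close> in the set, or \<open>x\<close> if there is none.\<close>

definition code :: "nat \<Rightarrow> (nat \<Rightarrow> nat) \<Rightarrow> (nat \<Rightarrow> nat) \<Rightarrow> bool" where
  "code n c r \<longleftrightarrow> c 0 = 0 \<and> r 0 = n \<and> c n = 0 \<and> r n = n \<and>
     (\<forall>i. 0 < i \<longrightarrow> i < n \<longrightarrow> c i \<le> i \<and> i \<le> r i \<and> r i \<le> n \<and> (c i = i \<longleftrightarrow> r i \<noteq> i) \<and>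
       (c i < i \<longrightarrow> c (c i) = c i \<and> i < r (c i)) \<and>
       (i < r i \<longrightarrow> r (r i) = r i \<and> c (r i) < i))"

text \<open>One member per index: a right end has \<open>r i = i\<close> and contributes the longest
  interval of its column, a left end has \<open>c i = i\<close> and contributes the longest one of
  its row. The index \<open>n\<close> would only repeat the full interval, which already comes from
  0.\<close>

definition code_set :: "nat \<Rightarrow> (nat \<Rightarrow> nat) \<Rightarrow> (nat \<Rightarrow> nat) \<Rightarrow> (nat \<times> nat) set" where
  "code_set n c r = (\<lambda>i. (c i, r i)) ` {..<n}"

lemma finite_intervals: "finite (intervals n)"
  by (rule finite_subset[of _ "{..n} \<times> {..n}"]) (auto simp: intervals_def)

section \<open>The interval set of a code\<close>

context
  fixes n :: nat and c r :: "nat \<Rightarrow> nat"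
  assumes n: "n \<ge> 1" and code: "code n c r"
begin

lemma code_ends: "c 0 = 0" "r 0 = n" "c n = 0" "r n = n"
  using code by (auto simp: code_def)

lemma code_le: "i \<le> n \<Longrightarrow> c i \<le> i" "i \<le> n \<Longrightarrow> i \<le> r i" "i \<le> n \<Longrightarrow> r i \<le> n"
  using code unfolding code_def by (metis le_eq_less_or_eq le0 not_gr0)+

text \<open>The outer indices fit the alternative too: 0 is a left end, \<open>n\<close> a right
  end, and \<open>n \<ge> 1\<close> makes them different.\<close>

lemma code_type: "i \<le> n \<Longrightarrow> c i = i \<longleftrightarrow> r i \<noteq> i"
  using code n unfolding code_def
  by (metis le_eq_less_or_eq not_gr0 not_one_le_zero)

lemma code_c: "i < n \<Longrightarrow> c i < i \<Longrightarrow> c (c i) = c i \<and> i < r (c i)"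
  using code unfolding code_def by (metis not_less_zero neq0_conv)

lemma code_r: "0 < i \<Longrightarrow> i < r i \<Longrightarrow> i \<le> n \<Longrightarrow> r (r i) = r i \<and> c (r i) < i"
  using code unfolding code_def by (metis le_eq_less_or_eq)

lemma code_set_coltop: "y \<le> n \<Longrightarrow> c y < y \<Longrightarrow> (c y, y) \<in> code_set n c r"
  using code_type[of y] n code_ends
  by (cases "y = n") (auto simp: code_set_def image_iff intro: bexI[of _ 0] bexI[of _ y])

lemma code_set_rowmax: "x \<le> n \<Longrightarrow> x < r x \<Longrightarrow> (x, r x) \<in> code_set n c r"
  using code_type[of x] code_ends
  by (cases "x = n") (auto simp: code_set_def image_iff intro!: bexI[of _ x])

text \<open>The last two bounds let \<open>c\<close> and \<open>r\<close> be recovered from the set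
  as its extreme members. A right end \<open>i\<close> gives \<open>(c i, i)\<close>, which is
  bounded in its row by the clause \<open>i < r (c i)\<close>; left ends are dual.\<close>

lemma code_set_bounds:
  assumes "(x, y) \<in> code_set n c r"
  shows "x < y" "y \<le> n" "c y \<le> x" "y \<le> r x"
proof -
  obtain i where i: "i < n" "x = c i" "y = r i"
    using assms by (auto simp: code_set_def)
  then have "x < y \<and> y \<le> n \<and> c y \<le> x \<and> y \<le> r x"
  proof (cases "r i = i")
    case True
    then have "c i < i" using code_type[of i] code_le(1)[of i] i by force
    then show ?thesis using i True code_c[of i] by auto
  next
    case False
    then have "c i = i" "i < r i" using code_type[of i] code_le(2)[of i] i by force+
    then show ?thesis
      using i False code_r[of i] code_le(3)[of i] code_ends by (cases "i = 0") auto
  qed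
  then show "x < y" "y \<le> n" "c y \<le> x" "y \<le> r x" by auto
qed

text \<open>An interval produced by two indices would come once from its left and once from its
  right end, hence be longest in its row and in its column. The strict inequalities in
  \<open>code\<close> forbid this, and the full interval is produced by 0 alone because
  \<open>n\<close> is left out.\<close>

lemma code_inj: "inj_on (\<lambda>i. (c i, r i)) {..<n}"
proof (rule linorder_inj_onI)
  fix i j assume ij: "i < j" "i \<in> {..<n}" "j \<in> {..<n}"
  show "(c i, r i) \<noteq> (c j, r j)"
  proof
    assume e: "(c i, r i) = (c j, r j)"
    show False
    proof (cases "c j = j")
      case True
      with e ij code_le(1)[of i] show False by auto
    next
      case False
      then have j: "r j = j" "c j < j" using code_type[of j] code_le(1)[of j] ij by force+
      then have "r i = j" using e by simp
      moreover from this have "c i = i" using code_type[of i] ij by simp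
      ultimately show False using code_c[of j] code_r[of i] j e ij by (cases "i = 0") (auto simp: code_ends)
    qed
  qed
qed auto

lemma card_code_set: "card (code_set n c r) = n"
  using code_inj by (simp add: code_set_def card_image)

lemma fbset_code_set: "fbset n (code_set n c r)"
  unfolding fbset_def
proof (intro conjI allI impI)
  show "code_set n c r \<subseteq> intervals n"
    using code_set_bounds by (auto simp: intervals_def)
  show "(0, n) \<in> code_set n c r"
    using code_set_rowmax[of 0] code_ends n by simp
next
  fix i assume i: "0 < i" "i < n"
  then show "(\<exists>y. (i, y) \<in> code_set n c r) \<or> (\<exists>x. (x, i) \<in> code_set n c r)"
    using code_type[of i] code_set_rowmax[of i] code_set_coltop[of i] code_le(1,2)[of i]
    by (metis le_neq_implies_less less_imp_le)
next
  fix x y assume xy: "(x, y) \<in> code_set n c r" "(x, y) \<noteq> (0, n)"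
  note b = code_set_bounds[OF xy(1)]
  have "c y < y" "x < r x" using b by auto
  then have *: "(c y, y) \<in> code_set n c r" "(x, r x) \<in> code_set n c r"
    using code_set_coltop[of y] code_set_rowmax[of x] b by auto
  \<comment> \<open>Longest in both directions would mean \<open>c (r x) = x\<close>, against
    \<open>c (r x) < x\<close>; only \<open>x = 0\<close> escapes, and there the interval is the
    full one.\<close>
  have "c y < x \<or> y < r x"
  proof (rule ccontr)
    assume "\<not> ?thesis"
    then have e: "c y = x" "r x = y" using b by auto
    show False
    proof (cases "x = 0")
      case True
      then show False using e xy code_ends by auto
    next
      case False
      then show False using code_r[of x] b e by auto
    qed
  qed
  with * show "(\<exists>y'>y. (x, y') \<in> code_set n c r) \<or> (\<exists>x'<x. (x', y) \<in> code_set n c r)"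
    by auto
qed

end

text \<open>Both clauses of \<open>int_le\<close> need testing only on the longest interval of each
  column and row. The default values \<open>c i = i\<close> and \<open>r i = i\<close> make an empty
  column or row the extreme case, so that the comparison is uniform in \<open>i\<close>.\<close>

lemma code_set_le_iff:
  assumes "n \<ge> 1" "code n c r" "code n c' r'"
  shows "int_le (code_set n c r) (code_set n c' r') \<longleftrightarrow> (\<forall>i\<le>n. c' i \<le> c i \<and> r' i \<le> r i)"
    (is "?L \<longleftrightarrow> ?R")
proof
  assume L: ?L
  show ?R
  proof (intro allI impI conjI)
    fix i assume i: "i \<le> n"
    show "c' i \<le> c i"
    proof (cases "c i < i")
      case True
      then have "(c i, i) \<in> code_set n c r" using code_set_coltop[OF assms(1,2)] i by auto
      with L obtain x' where "x' \<le> c i" "(x', i) \<in> code_set n c' r'" unfolding int_le_def by blast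
      then show ?thesis using code_set_bounds[OF assms(1,3)] by fastforce
    next
      case False
      then show ?thesis using code_le(1)[OF assms(1,3), of i] i by auto
    qed
    show "r' i \<le> r i"
    proof (cases "i < r' i")
      case True
      then have "(i, r' i) \<in> code_set n c' r'" using code_set_rowmax[OF assms(1,3)] i by auto
      with L obtain y' where "y' \<ge> r' i" "(i, y') \<in> code_set n c r" unfolding int_le_def by blast
      then show ?thesis using code_set_bounds[OF assms(1,2)] by fastforce
    next
      case False
      then show ?thesis using code_le(2)[OF assms(1,2), of i] i by auto
    qed
  qed
next
  assume R: ?R
  show ?L unfolding int_le_def
  proof (intro conjI allI impI)
    fix x y assume "(x, y) \<in> code_set n c r"
    note b = code_set_bounds[OF assms(1,2) this]
    then show "\<exists>x'\<le>x. (x', y) \<in> code_set n c' r'"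
      using R code_set_coltop[OF assms(1,3), of y] by (intro exI[of _ "c' y"]) (metis le_trans le_less_trans)
  next
    fix x y assume "(x, y) \<in> code_set n c' r'"
    note b = code_set_bounds[OF assms(1,3) this]
    then have "x \<le> n" by simp
    then show "\<exists>y'\<ge>y. (x, y') \<in> code_set n c r"
      using b R code_set_rowmax[OF assms(1,2), of x]
      by (intro exI[of _ "r x"]) (metis le_trans less_le_trans)
  qed
qed

text \<open>Let \<open>X\<close>, \<open>Y\<close> be the left and right ends in use,
  \<open>A\<close> the longest intervals of the rows and \<open>B\<close> those of the columns. All
  of the \<open>n + 1\<close> vertices lie in \<open>X \<union> Y\<close>, and \<open>A\<close>,
  \<open>B\<close> share at most the full interval, so \<open>n + 1 + card (X \<inter> Y)\<close> is
  at most \<open>card (A \<union> B) + 1\<close>, hence at most \<open>n + 1\<close>. Equality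
  throughout gives \<open>X \<inter> Y = {}\<close> and \<open>S = A \<union> B\<close>, which is
  what a code expresses.\<close>

lemma code_exists:
  assumes n: "n \<ge> 1" and S: "fbset n S" "card S = n"
  shows "\<exists>c r. code n c r \<and> S = code_set n c r"
proof -
  have Si: "\<And>x y. (x, y) \<in> S \<Longrightarrow> x < y \<and> y \<le> n" and root: "(0, n) \<in> S"
    using S by (auto simp: fbset_def intervals_def)
  have fin: "finite S" using S n by (metis card.infinite not_one_le_zero)
  define c where "c y = Min (insert y {x. (x, y) \<in> S})" for y
  define r where "r x = Max (insert x {y. (x, y) \<in> S})" for x
  have finc: "finite {x. (x, y) \<in> S}" for y
    using finite_subset[of "{x. (x, y) \<in> S}" "fst ` S"] fin by force
  have finr: "finite {y. (x, y) \<in> S}" for x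
    using finite_subset[of "{y. (x, y) \<in> S}" "snd ` S"] fin by force
  have c1: "c y \<le> x" if "(x, y) \<in> S" for x y
    unfolding c_def using that finc by (intro Min_le) auto
  have r1: "y \<le> r x" if "(x, y) \<in> S" for x y
    unfolding r_def using that finr by (intro Max_ge) auto
  have c2: "c y = y \<or> (c y, y) \<in> S" for y
    using Min_in[of "insert y {x. (x, y) \<in> S}"] finc by (auto simp: c_def)
  have r2: "r x = x \<or> (x, r x) \<in> S" for x
    using Max_in[of "insert x {y. (x, y) \<in> S}"] finr by (auto simp: r_def)
  have c3: "(c y, y) \<in> S" if "(x, y) \<in> S" for x y
    using c2[of y] c1[OF that] Si[OF that] by auto
  have r3: "(x, r x) \<in> S" if "(x, y) \<in> S" for x y
    using r2[of x] r1[OF that] Si[OF that] by auto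
  define X where "X = fst ` S"
  define Y where "Y = snd ` S"
  define A where "A = (\<lambda>x. (x, r x)) ` X"
  define B where "B = (\<lambda>y. (c y, y)) ` Y"
  have AS: "A \<subseteq> S" and BS: "B \<subseteq> S"
    using r3 c3 by (auto simp: A_def B_def X_def Y_def)
  have cA: "card A = card X" and cB: "card B = card Y"
    by (auto simp: A_def B_def card_image inj_on_def)
  have AB: "s = (0, n)" if s: "s \<in> A" "s \<in> B" for s
  proof (rule ccontr)
    assume ne: "s \<noteq> (0, n)"
    obtain x y where xy: "s = (x, y)" by force
    then have "r x = y" "c y = x" "(x, y) \<in> S" using s AS by (auto simp: A_def B_def)
    then show False using S(1) ne xy c1 r1 unfolding fbset_def by (metis not_le)
  qed
  have cov: "{..n} \<subseteq> X \<union> Y"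
  proof
    fix i assume i: "i \<in> {..n}"
    show "i \<in> X \<union> Y"
    proof (cases "i = 0 \<or> i = n")
      case True
      then show ?thesis using root by (force simp: X_def Y_def)
    next
      case False
      then have "(\<exists>y. (i, y) \<in> S) \<or> (\<exists>x. (x, i) \<in> S)" using S(1) i unfolding fbset_def by auto
      then show ?thesis by (force simp: X_def Y_def)
    qed
  qed
  have finXY: "finite X" "finite Y" "finite A" "finite B" using fin by (auto simp: X_def Y_def A_def B_def)
  have "n + 1 \<le> card (X \<union> Y)" using card_mono[OF _ cov] finXY by simp
  then have 1: "n + 1 + card (X \<inter> Y) \<le> card A + card B"
    using card_Un_Int[of X Y] finXY cA cB by simp
  have "A \<inter> B \<subseteq> {(0, n)}" using AB by auto
  then have 2: "card (A \<inter> B) \<le> 1" using card_mono[of "{(0, n)}" "A \<inter> B"] by simp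
  have 3: "card (A \<union> B) + card (A \<inter> B) = card A + card B"
    using card_Un_Int[of A B] finXY by simp
  have 4: "card (A \<union> B) \<le> n" using card_mono[OF fin, of "A \<union> B"] AS BS S(2) by auto
  have "card (X \<inter> Y) = 0" using 1 2 3 4 by linarith
  then have XY: "X \<inter> Y = {}" using finXY by simp
  have "card (A \<union> B) = card S" using 1 2 3 4 S(2) by linarith
  then have SAB: "S = A \<union> B" using card_subset_eq[OF fin] AS BS by blast
  have cX: "c i = i" if "i \<in> X" for i
  proof -
    have "i \<notin> Y" using that XY by auto
    then have "(c i, i) \<notin> S" by (force simp: Y_def)
    then show ?thesis using c2[of i] by auto
  qed
  have rY: "r i = i" if "i \<in> Y" for i
  proof -
    have "i \<notin> X" using that XY by auto
    then have "(i, r i) \<notin> S" by (force simp: X_def)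
    then show ?thesis using r2[of i] by auto
  qed
  have cY: "c i \<in> X \<and> c i < i \<and> i \<le> r (c i)" if "i \<in> Y" for i
  proof -
    have "(c i, i) \<in> S" using that c3 by (auto simp: Y_def)
    then show ?thesis using Si r1 by (force simp: X_def)
  qed
  have rX: "r i \<in> Y \<and> i < r i \<and> c (r i) \<le> i" if "i \<in> X" for i
  proof -
    have "(i, r i) \<in> S" using that r3 by (auto simp: X_def)
    then show ?thesis using Si c1 by (force simp: Y_def)
  qed
  have X0: "0 \<in> X" and Yn: "n \<in> Y" using root by (force simp: X_def Y_def)+
  have rn: "r i \<le> n" if "i \<le> n" for i
    using r2[of i] Si[of i "r i"] that by auto
  have code: "code n c r"
    unfolding code_def
  proof (intro conjI allI impI)
    show "c 0 = 0" using cX X0 by auto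
    show "r n = n" using rY Yn by auto
    show "r 0 = n" using r1[OF root] rn[of 0] by simp
    show "c n = 0" using c1[OF root] by simp
  next
    fix i assume i: "0 < i" "i < n"
    then have iXY: "i \<in> X \<or> i \<in> Y" using subsetD[OF cov, of i] i by auto
    show "c i \<le> i" using c2[of i] Si[of "c i" i] by auto
    show "i \<le> r i" using r2[of i] Si[of i "r i"] by auto
    show "r i \<le> n" using rn i by simp
    show "(c i = i) = (r i \<noteq> i)" using iXY cX[of i] rY[of i] cY[of i] rX[of i] by auto
    { assume "c i < i"
      then have "i \<in> Y" using iXY cX[of i] by auto
      note y = cY[OF this]
      then show "c (c i) = c i" using cX by auto
      show "i < r (c i)"
      proof (rule ccontr)
        assume "\<not> i < r (c i)"
        then have "r (c i) = i" using y by auto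
        then have "(c i, i) \<in> A" "(c i, i) \<in> B" using y \<open>i \<in> Y\<close> by (auto simp: A_def B_def image_iff)
        then show False using AB i by auto
      qed }
    { assume "i < r i"
      then have "i \<in> X" using iXY rY[of i] by auto
      note x = rX[OF this]
      then show "r (r i) = r i" using rY by auto
      show "c (r i) < i"
      proof (rule ccontr)
        assume "\<not> c (r i) < i"
        then have "c (r i) = i" using x by auto
        then have "(i, r i) \<in> A" "(i, r i) \<in> B" using x \<open>i \<in> X\<close> by (auto simp: A_def B_def image_iff)
        then show False using AB i by auto
      qed }
  qed
  have "S = code_set n c r"
  proof (rule card_subset_eq[symmetric])
    show "finite S" by fact
    show "card (code_set n c r) = card S" using card_code_set[OF n code] S by simp
    show "code_set n c r \<subseteq> S"
    proof
      fix s assume "s \<in> code_set n c r"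
      then obtain i where i: "i < n" "s = (c i, r i)" by (auto simp: code_set_def)
      show "s \<in> S"
      proof (cases "i \<in> X")
        case True
        then show ?thesis using AS cX i by (auto simp: A_def)
      next
        case False
        then have "i \<in> Y" using subsetD[OF cov, of i] i by auto
        then show ?thesis using BS rY i by (auto simp: B_def)
      qed
    qed
  qed
  with code show ?thesis by blast
qed

text \<open>In a non-crossing set every interval is maximal in its row or in its column, and no vertex is
  both a left and a right end. Counting the rows and columns in use therefore leaves room for only one
  interval that is maximal in both.\<close>

lemma noncrossing_fbset:
  assumes n: "n \<ge> 1" and S: "S \<subseteq> intervals n" "card S = n" and nc: "no_ext S S"
  shows "fbset n S"
proof -
  have Si: "\<And>x y. (x, y) \<in> S \<Longrightarrow> x < y \<and> y \<le> n"
    using S by (auto simp: intervals_def)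
  have fin: "finite S" using S n by (metis card.infinite not_one_le_zero)
  define A where "A = {(x, y) \<in> S. \<forall>y'>y. (x, y') \<notin> S}"
  define B where "B = {(x, y) \<in> S. \<forall>x'<x. (x', y) \<notin> S}"
  have SAB: "S = A \<union> B"
  proof -
    have "s \<in> A \<union> B" if "s \<in> S" for s
    proof (rule ccontr)
      assume "s \<notin> A \<union> B"
      moreover obtain x y where xy: "s = (x, y)" by force
      ultimately have "\<exists>x'<x. (x', y) \<in> S" "\<exists>y'>y. (x, y') \<in> S" "(x, y) \<in> S"
        using that by (auto simp: A_def B_def)
      then obtain x' y' where "x' < x" "y < y'" "(x', y) \<in> S" "(x, y') \<in> S" "(x, y) \<in> S"
        by blast
      then show False using nc Si[of x y] unfolding no_ext_def by (metis less_imp_le)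
    qed
    then show ?thesis by (auto simp: A_def B_def)
  qed
  have finAB: "finite A" "finite B" using fin SAB by auto
  have injA: "inj_on fst A"
    by (auto simp: inj_on_def A_def) (metis linorder_neqE_nat)
  have injB: "inj_on snd B"
    by (auto simp: inj_on_def B_def) (metis linorder_neqE_nat)
  \<comment> \<open>A right end that is also a left end is a crossing with
    \<open>x' = y\<close>.\<close>
  have disj: "fst ` S \<inter> snd ` S = {}"
  proof (rule ccontr)
    assume "\<not> ?thesis"
    then obtain i x y where "(i, y) \<in> S" "(x, i) \<in> S" by force
    then show False using nc Si[of x i] Si[of i y] unfolding no_ext_def by blast
  qed
  have sub: "fst ` S \<union> snd ` S \<subseteq> {..n}" using Si by fastforce
  have fAB: "fst ` A \<inter> snd ` B = {}" "fst ` A \<union> snd ` B \<subseteq> {..n}"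
    using disj sub SAB by blast+
  have cAB: "card A + card B = card (fst ` A \<union> snd ` B)"
    using fAB(1) finAB card_image[OF injA] card_image[OF injB] by (simp add: card_Un_disjoint)
  also have "\<dots> \<le> n + 1" using card_mono[OF _ fAB(2)] by simp
  finally have le: "card A + card B \<le> n + 1" .
  have un: "card (A \<union> B) + card (A \<inter> B) = card A + card B"
    using card_Un_Int[of A B] finAB by simp
  have AB1: "card (A \<inter> B) \<le> 1" using un le S(2) SAB by simp
  \<comment> \<open>Lengthening an interval within its row or column stops at a member of
    \<open>A \<inter> B\<close>. Once this set is known to be a singleton, its member contains every
    interval of \<open>S\<close>; the count of ends then identifies it as the full interval.\<close>
  have up: "\<exists>t \<in> A \<inter> B. fst t \<le> fst s \<and> snd s \<le> snd t" if "s \<in> S" for s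
    using that
  proof (induction "fst s + (n - snd s)" arbitrary: s rule: less_induct)
    case less
    obtain x y where s: "s = (x, y)" by force
    show ?case
    proof (cases "s \<in> A \<inter> B")
      case False
      then consider y' where "(x, y') \<in> S" "y < y'" | x' where "(x', y) \<in> S" "x' < x"
        using less.prems s by (auto simp: A_def B_def)
      then show ?thesis
      proof cases
        case 1
        then have "\<exists>t\<in>A \<inter> B. fst t \<le> x \<and> y' \<le> snd t"
          using less.hyps[of "(x, y')"] s Si[of x y'] by (simp add: diff_less_mono2)
        then obtain t where "t \<in> A \<inter> B" "fst t \<le> x" "y' \<le> snd t" by blast
        then show ?thesis using s 1(2) by (intro bexI[of _ t]) auto
      next
        case 2
        then have "\<exists>t\<in>A \<inter> B. fst t \<le> x' \<and> y \<le> snd t"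
          using less.hyps[of "(x', y)"] s by simp
        then obtain t where "t \<in> A \<inter> B" "fst t \<le> x'" "y \<le> snd t" by blast
        then show ?thesis using s 2(2) by (intro bexI[of _ t]) auto
      qed
    qed auto
  qed
  have "S \<noteq> {}" using S n by auto
  then obtain t where t: "t \<in> A \<inter> B" using up by blast
  then have "card (A \<inter> B) \<noteq> 0" using finAB by auto
  then have "card A + card B = n + 1" "card (A \<inter> B) = 1" using un S(2) SAB AB1 le by auto
  then have all: "fst ` A \<union> snd ` B = {..n}"
    using cAB card_subset_eq[OF _ fAB(2)] by simp
  obtain t' where "A \<inter> B = {t'}"
    using \<open>card (A \<inter> B) = 1\<close> by (rule card_1_singletonE)
  then have ABt: "A \<inter> B = {t}" using t by simp
  have dom: "fst t \<le> x \<and> y \<le> snd t" if "(x, y) \<in> S" for x y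
    using up[OF that] ABt by auto
  have "0 \<in> fst ` A"
  proof -
    have "0 \<notin> snd ` B" using Si SAB by force
    then show ?thesis using all by auto
  qed
  then have "fst t = 0" using dom SAB by fastforce
  moreover have "n \<in> snd ` B"
  proof -
    have "n \<notin> fst ` A" using Si SAB by force
    then show ?thesis using all by auto
  qed
  then have "snd t = n" using dom SAB Si t by (metis (no_types, lifting) IntD1 UnCI imageE le_antisym prod.collapse)
  ultimately have t0: "t = (0, n)" by (cases t) auto
  show ?thesis unfolding fbset_def
  proof (intro conjI allI impI)
    show "S \<subseteq> intervals n" by fact
    show "(0, n) \<in> S" using t t0 SAB by auto
  next
    fix x y assume "(x, y) \<in> S" "(x, y) \<noteq> (0, n)"
    then have "(x, y) \<notin> A \<inter> B" "(x, y) \<in> S" using ABt t0 by auto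
    then show "(\<exists>y'>y. (x, y') \<in> S) \<or> (\<exists>x'<x. (x', y) \<in> S)"
      by (auto simp: A_def B_def)
  next
    fix i assume "0 < i" "i < n"
    then have "i \<in> fst ` A \<union> snd ` B" using all by auto
    then show "(\<exists>y. (i, y) \<in> S) \<or> (\<exists>x. (x, i) \<in> S)" using SAB by auto
  qed
qed

section \<open>Noncrossing sets and the order\<close>

text \<open>If the first set lies below the second, a crossing can be pulled into the second set by
  replacing \<open>(x, y)\<close> with a longer interval of the same column, which contradicts
  \<open>nc\<close>. Conversely, if column \<open>y\<close> of the second set has nothing as long as
  \<open>(x, y)\<close>, then the row of \<open>c2 y\<close> contains an interval that crosses
  \<open>(x, y)\<close>; rows are dual.\<close>

lemma no_ext_iff_le:
  assumes n: "n \<ge> 1" and c1: "code n c1 r1" and c2: "code n c2 r2"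
    and nc: "no_ext (code_set n c2 r2) (code_set n c2 r2)"
  shows "no_ext (code_set n c1 r1) (code_set n c2 r2) \<longleftrightarrow> int_le (code_set n c1 r1) (code_set n c2 r2)"
    (is "?L \<longleftrightarrow> ?R")
proof
  assume R: ?R
  show ?L unfolding no_ext_def
  proof (intro allI impI notI)
    fix x y x' y'
    assume a: "(x, y) \<in> code_set n c1 r1" "(x', y') \<in> code_set n c2 r2" "x < x' \<and> x' \<le> y \<and> y < y'"
    then obtain x'' where "x'' \<le> x" "(x'', y) \<in> code_set n c2 r2"
      using R unfolding int_le_def by blast
    then show False using a nc unfolding no_ext_def by (metis le_less_trans)
  qed
next
  assume L: ?L
  note b1 = code_set_bounds[OF n c1] and b2 = code_set_bounds[OF n c2]
  show ?R unfolding int_le_def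
  proof (intro conjI allI impI)
    fix x y assume xy: "(x, y) \<in> code_set n c1 r1"
    have "c2 y \<le> x"
    proof (rule ccontr)
      assume "\<not> c2 y \<le> x"
      then have x: "x < c2 y" by simp
      have yn: "y < n" "0 < y" using b1[OF xy] x code_ends[OF n c2] by (cases "y = n", auto)
      show False
      proof (cases "c2 y = y")
        case True
        then have "y < r2 y" using code_type[OF n c2, of y] code_le(2)[OF n c2, of y] yn by force
        then have "(y, r2 y) \<in> code_set n c2 r2" using code_set_rowmax[OF n c2, of y] yn by auto
        then show False using L xy b1[OF xy] \<open>y < r2 y\<close> unfolding no_ext_def by blast
      next
        case False
        then have l: "c2 y < y" using code_le(1)[OF n c2, of y] yn by force
        then have "y < r2 (c2 y)" using code_c[OF n c2, of y] yn by auto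
        moreover from this have "(c2 y, r2 (c2 y)) \<in> code_set n c2 r2"
          using code_set_rowmax[OF n c2, of "c2 y"] yn l by auto
        ultimately show False using L xy x l unfolding no_ext_def by (metis less_imp_le)
      qed
    qed
    then show "\<exists>x'\<le>x. (x', y) \<in> code_set n c2 r2"
      using code_set_coltop[OF n c2, of y] b1[OF xy] by (metis le_less_trans)
  next
    fix x y assume xy: "(x, y) \<in> code_set n c2 r2"
    have xn: "x < n" using b2[OF xy] by auto
    have "y \<le> r1 x"
    proof (rule ccontr)
      assume "\<not> y \<le> r1 x"
      then have x: "r1 x < y" by simp
      have x0: "0 < x" using b2[OF xy] x code_ends[OF n c1] by (cases "x = 0", auto)
      show False
      proof (cases "r1 x = x")
        case True
        then have "c1 x < x" using code_type[OF n c1, of x] code_le(1)[OF n c1, of x] xn by force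
        then have "(c1 x, x) \<in> code_set n c1 r1" using code_set_coltop[OF n c1, of x] xn by auto
        then show False using L xy b2[OF xy] \<open>c1 x < x\<close> unfolding no_ext_def by blast
      next
        case False
        then have l: "x < r1 x" using code_le(2)[OF n c1, of x] xn by force
        then have "c1 (r1 x) < x" using code_r[OF n c1, of x] x0 xn by auto
        moreover from this have "(c1 (r1 x), r1 x) \<in> code_set n c1 r1"
          using code_set_coltop[OF n c1, of "r1 x"] code_le(3)[OF n c1, of x] xn l by auto
        ultimately show False using L xy x l unfolding no_ext_def by (metis less_imp_le)
      qed
    qed
    then show "\<exists>y'\<ge>y. (x, y') \<in> code_set n c1 r1"
      using code_set_rowmax[OF n c1, of x] b2[OF xy] xn by (metis less_le_trans less_imp_le)
  qed
qed

text \<open>A crossing survives when its left interval is replaced by the longest one of its column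
  and its right interval by the longest one of its row. It is thus enough to compare left ends
  \<open>i\<close> with right ends \<open>j\<close>.\<close>

lemma code_noncrossing_iff:
  assumes n: "n \<ge> 1" and c: "code n c r"
  shows "no_ext (code_set n c r) (code_set n c r) \<longleftrightarrow>
    (\<forall>i j. c i = i \<longrightarrow> c j < j \<longrightarrow> i < j \<longrightarrow> j < r i \<longrightarrow> i < n \<longrightarrow> i \<le> c j)" (is "?L \<longleftrightarrow> ?R")
proof
  assume L: ?L
  show ?R
  proof (intro allI impI)
    fix i j assume a: "c i = i" "c j < j" "i < j" "j < r i" "i < n"
    then have jn: "j < n" using code_le(3)[OF n c, of i] by simp
    have "(c j, j) \<in> code_set n c r" "(i, r i) \<in> code_set n c r"
      using code_set_coltop[OF n c, of j] code_set_rowmax[OF n c, of i] a jn by auto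
    then show "i \<le> c j" using L a unfolding no_ext_def by (meson less_imp_le not_le)
  qed
next
  assume R: ?R
  show ?L unfolding no_ext_def
  proof (intro allI impI notI)
    fix x y x' y'
    assume a: "(x, y) \<in> code_set n c r" "(x', y') \<in> code_set n c r" "x < x' \<and> x' \<le> y \<and> y < y'"
    note b = code_set_bounds[OF n c a(1)] code_set_bounds[OF n c a(2)]
    have x'n: "x' < n" using b by simp
    have cy: "c y < y" "c x' = x'" using b a code_type[OF n c, of x'] x'n by auto
    have "x' \<noteq> y" using cy by auto
    then have "x' \<le> c y" using R[rule_format, OF cy(2) cy(1)] a b x'n by auto
    then show False using b a by auto
  qed
qed

section \<open>Joins, and meets by reflection\<close>

text \<open>Left ends of the join are the common left ends. At all other indices one of
  \<open>r1\<close>, \<open>r2\<close> has the default value, so the minimum has it as well and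
  \<open>r\<close> needs no repair. The minimum of \<open>c1\<close> and \<open>c2\<close> does: it
  may point to an index that is not a common left end, or whose row has become too short.\<close>

lemma code_join:
  assumes n: "n \<ge> 1" and c1: "code n c1 r1" and c2: "code n c2 r2"
  shows "\<exists>c r. code n c r \<and>
    (\<forall>i\<le>n. c i \<le> c1 i \<and> c i \<le> c2 i \<and> r i \<le> r1 i \<and> r i \<le> r2 i) \<and>
    (\<forall>c' r'. code n c' r' \<longrightarrow> (\<forall>i\<le>n. c' i \<le> c1 i \<and> c' i \<le> c2 i \<and> r' i \<le> r1 i \<and> r' i \<le> r2 i)
      \<longrightarrow> (\<forall>i\<le>n. c' i \<le> c i \<and> r' i \<le> r i)) \<and>
    (no_ext (code_set n c1 r1) (code_set n c1 r1) \<longrightarrow> no_ext (code_set n c2 r2) (code_set n c2 r2) \<longrightarrow>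
       no_ext (code_set n c r) (code_set n c r))"
proof -
  define R where "R i \<longleftrightarrow> c1 i = i \<and> c2 i = i" for i
  define r where "r i = min (r1 i) (r2 i)" for i
  \<comment> \<open>The admissible values for \<open>c i\<close>. Adding 0 by hand matters at
    \<open>i = n\<close>, where no row reaches beyond \<open>n\<close>; for smaller \<open>i\<close>
    it is admissible anyway since \<open>r 0 = n\<close>.\<close>
  define K where "K i = {k. k = 0 \<or> R k \<and> k \<le> min (c1 i) (c2 i) \<and> i < r k}" for i
  define c where "c i = (if R i then i else Max (K i))" for i
  have finK: "finite (K i)" for i
    by (rule finite_subset[of _ "{..max 0 (c1 i)}"]) (auto simp: K_def)
  have K0: "0 \<in> K i" for i by (simp add: K_def)
  have KMax: "Max (K i) \<in> K i" for i using Max_in[OF finK] K0 by blast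
  have Kge: "k \<le> Max (K i)" if "k \<in> K i" for k i using Max_ge[OF finK that] .
  note e1 = code_ends[OF n c1] and e2 = code_ends[OF n c2]
  note l1 = code_le[OF n c1] and l2 = code_le[OF n c2]
  note t1 = code_type[OF n c1] and t2 = code_type[OF n c2]
  have R0: "R 0" by (simp add: R_def e1 e2)
  have Rn: "\<not> R n" using n by (simp add: R_def e1)
  have notR: "min (c1 i) (c2 i) < i" "r i = i" if "i \<le> n" "\<not> R i" for i
    using that l1(1,2)[of i] l2(1,2)[of i] t1[of i] t2[of i] by (auto simp: R_def r_def)
  have cn: "c i < i \<and> c i \<le> min (c1 i) (c2 i)" if "i \<le> n" "\<not> R i" for i
    using notR[OF that] KMax[of i] that by (cases "i = 0") (auto simp: c_def K_def R0)
  have cR: "R i \<longleftrightarrow> c i = i" if "i \<le> n" for i using cn[OF that] by (auto simp: c_def)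
  have Rr: "i < r i" if "R i" "i \<le> n" for i
    using that t1[of i] t2[of i] l1(2)[of i] l2(2)[of i] by (auto simp: R_def r_def)
  have cle: "c i \<le> c1 i \<and> c i \<le> c2 i" if "i \<le> n" for i
    using cn[OF that] by (cases "R i") (auto simp: c_def R_def)
  have code: "code n c r"
    unfolding code_def
  proof (intro conjI allI impI)
    show "c 0 = 0" using R0 by (simp add: c_def)
    show "r 0 = n" "r n = n" by (auto simp: r_def e1 e2)
    show "c n = 0" using cle[of n] e1 by simp
  next
    fix i assume i: "0 < i" "i < n"
    show "c i \<le> i" using cle[of i] l1(1)[of i] i by simp
    show "i \<le> r i" "r i \<le> n" using l1[of i] l2[of i] i by (auto simp: r_def)
    show "(c i = i) = (r i \<noteq> i)" using cR[of i] Rr[of i] notR[of i] i by auto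
    { assume "c i < i"
      then have nR: "\<not> R i" using cR[of i] i by simp
      have *: "R (c i) \<and> i < r (c i)"
        using KMax[of i] nR R0 i e1 e2 by (auto simp: c_def K_def r_def)
      then show "c (c i) = c i" "i < r (c i)" by (auto simp: c_def) }
    { assume "i < r i"
      then have "R i" using notR[of i] i by auto
      then have i12: "i < r1 i" "i < r2 i" using \<open>i < r i\<close> by (auto simp: r_def)
      have rin: "r i \<le> n" using l1(3)[of i] i by (auto simp: r_def)
      have "min (c1 (r i)) (c2 (r i)) < i"
        using code_r[OF n c1, of i] code_r[OF n c2, of i] i i12 by (auto simp: r_def min_def)
      then have "c (r i) < i" using cle[OF rin] by auto
      then show "c (r i) < i" .
      then have "\<not> R (r i)" using cR[OF rin] \<open>i < r i\<close> by auto
      then show "r (r i) = r i" using notR[OF rin] by auto }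
  qed
  \<comment> \<open>A left end of an upper bound is a left end of both codes, because
    \<open>c' \<le> c1, c2\<close> and neither exceeds the index. So \<open>c' i\<close> is one of
    the candidates in \<open>K i\<close>.\<close>
  have least: "c' i \<le> c i \<and> r' i \<le> r i" if c': "code n c' r'"
    and le: "\<And>i. i \<le> n \<Longrightarrow> c' i \<le> c1 i \<and> c' i \<le> c2 i \<and> r' i \<le> r1 i \<and> r' i \<le> r2 i"
    and i: "i \<le> n" for c' r' i
  proof
    have R': "R k" if "c' k = k" "k \<le> n" for k
      using le[of k] that l1(1)[of k] l2(1)[of k] by (auto simp: R_def)
    show "r' i \<le> r i" using le[OF i] by (auto simp: r_def)
    show "c' i \<le> c i"
    proof (cases "R i \<or> i = n")
      case True
      then show ?thesis using code_le(1)[OF n c' i] code_ends[OF n c'] by (auto simp: c_def)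
    next
      case False
      then have *: "c' i < i" using notR[of i] le[of i] i by auto
      then have "c' (c' i) = c' i" "i < r' (c' i)" using code_c[OF n c', of i] i False by auto
      moreover have "c' i \<le> n" using * i by auto
      ultimately have "c' i \<in> K i"
        using R'[of "c' i"] le[OF i] le[of "c' i"] by (auto simp: K_def r_def)
      then show ?thesis using Kge False by (auto simp: c_def)
    qed
  qed
  \<comment> \<open>Noncrossing of the two given codes puts \<open>i\<close> below both
    \<open>c1 j\<close> and \<open>c2 j\<close>, so \<open>i\<close> is a candidate for
    \<open>c j\<close>, and \<open>c j\<close> is the largest candidate.\<close>
  have nc: "no_ext (code_set n c r) (code_set n c r)"
    if "no_ext (code_set n c1 r1) (code_set n c1 r1)" "no_ext (code_set n c2 r2) (code_set n c2 r2)"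
    unfolding code_noncrossing_iff[OF n code]
  proof (intro allI impI)
    fix i j assume a: "c i = i" "c j < j" "i < j" "j < r i" "i < n"
    have Ri: "R i" using a cR[of i] by simp
    have jn: "j < n" using a l1(3)[of i] by (auto simp: r_def)
    have nRj: "\<not> R j" using a by (auto simp: c_def)
    have i1: "i \<le> c1 j"
    proof (cases "c1 j < j")
      case True
      then show ?thesis using that(1) a Ri unfolding code_noncrossing_iff[OF n c1] by (auto simp: R_def r_def)
    qed (use a in auto)
    have i2: "i \<le> c2 j"
    proof (cases "c2 j < j")
      case True
      then show ?thesis using that(2) a Ri unfolding code_noncrossing_iff[OF n c2] by (auto simp: R_def r_def)
    qed (use a in auto)
    have "i \<in> K j" using i1 i2 Ri a by (auto simp: K_def)
    then show "i \<le> c j" using Kge nRj by (auto simp: c_def)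
  qed
  have le: "c i \<le> c1 i \<and> c i \<le> c2 i \<and> r i \<le> r1 i \<and> r i \<le> r2 i" if "i \<le> n" for i
    using cle[OF that] by (simp add: r_def)
  show ?thesis
  proof (rule exI[of _ c], rule exI[of _ r], intro conjI)
    show "\<forall>c' r'. code n c' r' \<longrightarrow> (\<forall>i\<le>n. c' i \<le> c1 i \<and> c' i \<le> c2 i \<and> r' i \<le> r1 i \<and> r' i \<le> r2 i)
      \<longrightarrow> (\<forall>i\<le>n. c' i \<le> c i \<and> r' i \<le> r i)"
      using least by simp
  qed (use code le nc in auto)
qed

text \<open>The reflection \<open>(x, y)\<close> to \<open>(n - y, n - x)\<close>, which exchanges
  submodules and quotients and reverses the order. It is the combinatorial form of vector space
  duality followed by renumbering the vertices backwards.\<close>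

lemma code_dual:
  assumes n: "n \<ge> 1" and c: "code n c r"
  shows "code n (\<lambda>i. n - r (n - i)) (\<lambda>i. n - c (n - i))"
  unfolding code_def
proof (intro conjI allI impI)
  note e = code_ends[OF n c] and l = code_le[OF n c] and t = code_type[OF n c]
  show "n - r (n - 0) = 0" "n - c (n - 0) = n" "n - r (n - n) = 0" "n - c (n - n) = n"
    by (simp_all add: e)
  fix i assume i: "0 < i" "i < n"
  define j where "j = n - i"
  have j: "0 < j" "j < n" "i = n - j" using i by (auto simp: j_def)
  have lj: "c j \<le> j" "j \<le> r j" "r j \<le> n" using l[of j] j by auto
  show "n - r (n - i) \<le> i" "i \<le> n - c (n - i)" "n - c (n - i) \<le> n"
    unfolding j_def[symmetric] using j lj by auto
  show "(n - r (n - i) = i) = (n - c (n - i) \<noteq> i)"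
    unfolding j_def[symmetric] using j lj t[of j] by auto
  { assume "n - r (n - i) < i"
    then have "j < r j" unfolding j_def[symmetric] using j lj by auto
    with code_r[OF n c, of j] j have *: "r (r j) = r j" "c (r j) < j" by auto
    show "n - r (n - (n - r (n - i))) = n - r (n - i)" "i < n - c (n - (n - r (n - i)))"
      unfolding j_def[symmetric] using * j lj by auto }
  { assume "i < n - c (n - i)"
    then have "c j < j" unfolding j_def[symmetric] using j lj by auto
    with code_c[OF n c, of j] j have *: "c (c j) = c j" "j < r (c j)" by auto
    show "n - c (n - (n - c (n - i))) = n - c (n - i)" "n - r (n - (n - c (n - i))) < i"
      unfolding j_def[symmetric] using * j lj by auto }
qed

lemma code_dual_noncrossing:
  assumes n: "n \<ge> 1" and c: "code n c r" and nc: "no_ext (code_set n c r) (code_set n c r)"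
  defines "c' \<equiv> \<lambda>i. n - r (n - i)" and "r' \<equiv> \<lambda>i. n - c (n - i)"
  shows "no_ext (code_set n c' r') (code_set n c' r')"
proof -
  have c': "code n c' r'" unfolding c'_def r'_def by (rule code_dual[OF n c])
  show ?thesis
    unfolding code_noncrossing_iff[OF n c']
  proof (intro allI impI)
    fix i j assume a: "c' i = i" "c' j < j" "i < j" "j < r' i" "i < n"
    have jn: "j < n" using code_le(3)[OF n c', of i] a by auto
    define p q where "p = n - i" and "q = n - j"
    have pq: "q < p" "p \<le> n" "0 < q" "q < n" using a jn by (auto simp: p_def q_def)
    note l = code_le[OF n c, of p] code_le[OF n c, of q]
    have "r p = p" using a(1) l(3) pq(2) a(5) unfolding c'_def p_def by linarith
    then have "c p < p" using code_type[OF n c, of p] l pq by force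
    have "q < r q" using a(2) l(6) jn unfolding c'_def q_def by linarith
    then have "c q = q" using code_type[OF n c, of q] pq by force
    have "c p < q" using a(4) a by (auto simp: r'_def p_def q_def)
    then have "\<not> p < r q" using nc \<open>c p < p\<close> \<open>c q = q\<close> pq unfolding code_noncrossing_iff[OF n c]
      by (meson not_le)
    then have "r q \<le> p" by simp
    then show "i \<le> c' j" using a(5) unfolding c'_def p_def q_def by linarith
  qed
qed

text \<open>Reflect both codes, take the join and reflect back.\<close>

lemma code_meet:
  assumes n: "n \<ge> 1" and c1: "code n c1 r1" and c2: "code n c2 r2"
  shows "\<exists>c r. code n c r \<and>
    (\<forall>i\<le>n. c1 i \<le> c i \<and> c2 i \<le> c i \<and> r1 i \<le> r i \<and> r2 i \<le> r i) \<and>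
    (\<forall>c' r'. code n c' r' \<longrightarrow> (\<forall>i\<le>n. c1 i \<le> c' i \<and> c2 i \<le> c' i \<and> r1 i \<le> r' i \<and> r2 i \<le> r' i)
      \<longrightarrow> (\<forall>i\<le>n. c i \<le> c' i \<and> r i \<le> r' i)) \<and>
    (no_ext (code_set n c1 r1) (code_set n c1 r1) \<longrightarrow> no_ext (code_set n c2 r2) (code_set n c2 r2) \<longrightarrow>
       no_ext (code_set n c r) (code_set n c r))"
proof -
  define d where "d f = (\<lambda>i. n - f (n - i))" for f :: "nat \<Rightarrow> nat"
  have d: "code n (d r) (d c)" if "code n c r" for c r
    unfolding d_def by (rule code_dual[OF n that])
  have dnc: "no_ext (code_set n (d r) (d c)) (code_set n (d r) (d c))"
    if "code n c r" "no_ext (code_set n c r) (code_set n c r)" for c r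
    unfolding d_def by (rule code_dual_noncrossing[OF n that])
  \<comment> \<open>\<open>d\<close> undoes itself only for values up to \<open>n\<close>, since
    subtraction is truncated. \<open>d1\<close> and \<open>d2\<close> move it from one side of an
    inequality to the other, with the bound where truncation would interfere; \<open>d3\<close> is
    antitonicity.\<close>
  have d1: "f i \<le> d g i" if "g (n - i) \<le> d f (n - i)" "i \<le> n" "f i \<le> n" for f g i
    using that by (auto simp: d_def)
  have d2: "d f i \<le> g i" if "d g (n - i) \<le> f (n - i)" "i \<le> n" for f g i
    using that by (auto simp: d_def)
  have d3: "d f i \<le> d g i" if "g (n - i) \<le> f (n - i)" for f g i
    using that by (simp add: d_def diff_le_mono2)
  obtain c r where code: "code n c r"
    and ub: "\<forall>i\<le>n. c i \<le> d r1 i \<and> c i \<le> d r2 i \<and> r i \<le> d c1 i \<and> r i \<le> d c2 i"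
    and least: "\<forall>c' r'. code n c' r' \<longrightarrow>
        (\<forall>i\<le>n. c' i \<le> d r1 i \<and> c' i \<le> d r2 i \<and> r' i \<le> d c1 i \<and> r' i \<le> d c2 i)
      \<longrightarrow> (\<forall>i\<le>n. c' i \<le> c i \<and> r' i \<le> r i)"
    and nc: "no_ext (code_set n (d r1) (d c1)) (code_set n (d r1) (d c1)) \<longrightarrow>
       no_ext (code_set n (d r2) (d c2)) (code_set n (d r2) (d c2)) \<longrightarrow>
       no_ext (code_set n c r) (code_set n c r)"
    using code_join[OF n d[OF c1] d[OF c2]] by blast
  show ?thesis
  proof (rule exI[of _ "d r"], rule exI[of _ "d c"], intro conjI allI impI)
    show "code n (d r) (d c)" by (rule d[OF code])
    fix i assume i: "i \<le> n"
    have u: "c (n - i) \<le> d r1 (n - i)" "c (n - i) \<le> d r2 (n - i)" "r (n - i) \<le> d c1 (n - i)" "r (n - i) \<le> d c2 (n - i)"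
      using ub by simp_all
    show "c1 i \<le> d r i" using d1[where f = c1 and g = r, OF u(3) i] code_le(1)[OF n c1 i] i by simp
    show "c2 i \<le> d r i" using d1[where f = c2 and g = r, OF u(4) i] code_le(1)[OF n c2 i] i by simp
    show "r1 i \<le> d c i" using d1[where f = r1 and g = c, OF u(1) i] code_le(3)[OF n c1 i] by simp
    show "r2 i \<le> d c i" using d1[where f = r2 and g = c, OF u(2) i] code_le(3)[OF n c2 i] by simp
  next
    fix c' r' i
    assume c': "code n c' r'" and lb: "\<forall>i\<le>n. c1 i \<le> c' i \<and> c2 i \<le> c' i \<and> r1 i \<le> r' i \<and> r2 i \<le> r' i"
      and i: "i \<le> n"
    have "\<forall>i\<le>n. d r' i \<le> d r1 i \<and> d r' i \<le> d r2 i \<and> d c' i \<le> d c1 i \<and> d c' i \<le> d c2 i"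
      using lb by (auto intro!: d3)
    then have "\<forall>i\<le>n. d r' i \<le> c i \<and> d c' i \<le> r i" using least d[OF c'] by blast
    then have "d r' (n - i) \<le> c (n - i)" "d c' (n - i) \<le> r (n - i)" by simp_all
    then show "d r i \<le> c' i" "d c i \<le> r' i" using d2 i by auto
  next
    assume "no_ext (code_set n c1 r1) (code_set n c1 r1)" "no_ext (code_set n c2 r2) (code_set n c2 r2)"
    then show "no_ext (code_set n (d r) (d c)) (code_set n (d r) (d c))"
      using nc dnc[OF c1] dnc[OF c2] dnc[OF code] by blast
  qed
qed

text \<open>If the values of \<open>c\<close> or \<open>r\<close> differ at an index of the same type (left or right end) in both codes,
  one of them can be copied into the other code; otherwise the type of one index is switched.\<close>

lemma code_exchange:
  assumes n: "n \<ge> 1" and c1: "code n c1 r1" and c2: "code n c2 r2"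
    and le: "\<And>i. i \<le> n \<Longrightarrow> c2 i \<le> c1 i \<and> r2 i \<le> r1 i"
    and ne: "code_set n c1 r1 \<noteq> code_set n c2 r2"
  obtains c r j where "code n c r" "\<And>i. i \<le> n \<Longrightarrow> c2 i \<le> c i \<and> c i \<le> c1 i \<and> r2 i \<le> r i \<and> r i \<le> r1 i"
    "j < n" "(c j, r j) \<noteq> (c1 j, r1 j) \<and> (\<forall>i. i \<noteq> j \<longrightarrow> c i = c1 i \<and> r i = r1 i) \<or>
             (c j, r j) \<noteq> (c2 j, r2 j) \<and> (\<forall>i. i \<noteq> j \<longrightarrow> c i = c2 i \<and> r i = r2 i)"
proof -
  note e1 = code_ends[OF n c1] and e2 = code_ends[OF n c2]
  note l1 = code_le[OF n c1] and l2 = code_le[OF n c2]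
  note t1 = code_type[OF n c1] and t2 = code_type[OF n c2]
  note cc1 = code_c[OF n c1] and cc2 = code_c[OF n c2] and cr1 = code_r[OF n c1] and cr2 = code_r[OF n c2]
  \<comment> \<open>From the smaller to the larger code a left end may turn into a right end, but
    not the reverse. Consequently (\<open>cand\<close>, \<open>rand\<close>) \<open>c2 j\<close> is
    an admissible value of \<open>c\<close> in the first code and \<open>r1 j\<close> an admissible
    value of \<open>r\<close> in the second.\<close>
  have R21: "c1 k = k" if "c2 k = k" "k \<le> n" for k using le[of k] l1(1)[of k] that by auto
  have C12: "r2 k = k" if "r1 k = k" "k \<le> n" for k using le[of k] l2(2)[of k] that by auto
  have cand: "c1 (c2 j) = c2 j \<and> j < r1 (c2 j) \<and> c2 j \<le> n" if "j < n" "c2 j < j" for j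
    using cc2[of j] that R21[of "c2 j"] le[of "c2 j"] by auto
  have rand: "r2 (r1 j) = r1 j \<and> c2 (r1 j) < j \<and> r1 j \<le> n" if "0 < j" "j < n" "j < r1 j" for j
    using cr1[of j] that C12[of "r1 j"] le[of "r1 j"] l1(3)[of j] by auto
  consider (A) j where "0 < j" "j < n" "c1 j < j" "c2 j < c1 j"
    | (B) j where "0 < j" "j < n" "j < r2 j" "r2 j < r1 j"
    | (C) "\<forall>j. 0 < j \<longrightarrow> j < n \<longrightarrow> c1 j < j \<longrightarrow> c2 j = c1 j" "\<forall>j. 0 < j \<longrightarrow> j < n \<longrightarrow> j < r2 j \<longrightarrow> r2 j = r1 j"
    using le by (metis le_neq_implies_less less_imp_le)
  then show thesis
  proof cases
    case A
    have t: "r1 j = j" "r2 j = j" using A t1[of j] t2[of j] by auto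
    have code: "code n (c1(j := c2 j)) r1"
      unfolding code_def
    proof (intro conjI allI impI)
      fix i assume i: "0 < i" "i < n"
      show "(c1(j := c2 j)) i \<le> i" "i \<le> r1 i" "r1 i \<le> n" using l1[of i] A i by auto
      show "((c1(j := c2 j)) i = i) = (r1 i \<noteq> i)" using A t t1[of i] i by auto
      { assume "(c1(j := c2 j)) i < i"
        then show "(c1(j := c2 j)) ((c1(j := c2 j)) i) = (c1(j := c2 j)) i" "i < r1 ((c1(j := c2 j)) i)"
          using cand[of j] cc1[of i] A i t by (auto split: if_splits) }
      { assume "i < r1 i"
        then show "r1 (r1 i) = r1 i" "(c1(j := c2 j)) (r1 i) < i"
          using cr1[of i] i A by (auto split: if_splits) }
    qed (use e1 A in auto)
    show thesis
      by (rule that[OF code, of j]) (use A le in \<open>auto\<close>)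
  next
    case B
    have t: "c1 j = j" "c2 j = j" using B t1[of j] t2[of j] by auto
    have code: "code n c2 (r2(j := r1 j))"
      unfolding code_def
    proof (intro conjI allI impI)
      fix i assume i: "0 < i" "i < n"
      show "c2 i \<le> i" "i \<le> (r2(j := r1 j)) i" "(r2(j := r1 j)) i \<le> n" using l2[of i] l1[of i] B i by auto
      show "(c2 i = i) = ((r2(j := r1 j)) i \<noteq> i)" using B t t2[of i] i by auto
      { assume "c2 i < i"
        then show "c2 (c2 i) = c2 i" "i < (r2(j := r1 j)) (c2 i)"
          using cc2[of i] i B by (auto split: if_splits) }
      { assume "i < (r2(j := r1 j)) i"
        then show "(r2(j := r1 j)) ((r2(j := r1 j)) i) = (r2(j := r1 j)) i" "c2 ((r2(j := r1 j)) i) < i"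
          using rand[of j] cr2[of i] B i t by (auto split: if_splits) }
    qed (use e2 B in auto)
    show thesis
      by (rule that[OF code, of j]) (use B le in \<open>auto\<close>)
  next
    case C
    \<comment> \<open>If no index changed its type, case C would leave the two codes equal at every
      index below \<open>n\<close>.\<close>
    have "\<exists>j. 0 < j \<and> j < n \<and> c1 j = j \<and> r2 j = j"
    proof (rule ccontr)
      assume no: "\<not> ?thesis"
      have "c1 i = c2 i \<and> r1 i = r2 i" if i: "i < n" for i
      proof (cases "i = 0")
        case False
        then consider "c1 i < i" | "i < r2 i" "c1 i = i"
          using no i l1(1)[of i] l2(2)[of i] by (metis le_neq_implies_less less_imp_le neq0_conv)
        then show ?thesis
        proof cases
          case 1
          then have "c2 i = c1 i" using C(1) i False by auto
          moreover have "r1 i = i" "r2 i = i" using 1 t1[of i] t2[of i] i le[of i] by auto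
          ultimately show ?thesis by simp
        next
          case 2
          then have "r2 i = r1 i" using C(2) i False by auto
          moreover have "c2 i = i" using 2 t2[of i] i by auto
          ultimately show ?thesis using 2 by simp
        qed
      qed (simp add: e1 e2)
      then show False using ne by (auto simp: code_set_def)
    qed
    then obtain j where j: "0 < j" "j < n" "c1 j = j" "r2 j = j" by blast
    then have tj: "j < r1 j" "c2 j < j" using t1[of j] t2[of j] l1(2)[of j] l2(1)[of j] by force+
    \<comment> \<open>When \<open>j\<close> stops being a left end, no column of the first code may
      be attached to it. An \<open>i\<close> with \<open>c1 i = j\<close> would have
      \<open>c2 i = j\<close> too, but \<open>j\<close> is a right end in the second code.\<close>
    have noc: "c1 i \<noteq> j" if "i \<noteq> j" "i < n" for i
    proof
      assume ij: "c1 i = j"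
      then have "c1 i < i" "0 < i" using l1(1)[of i] that j by force+
      then have "c2 i = j" using C(1) that ij by auto
      moreover have "c2 i < i" using \<open>c1 i < i\<close> le[of i] that by auto
      ultimately show False using cc2[of i] that tj by auto
    qed
    have code: "code n (c1(j := c2 j)) (r1(j := j))"
      unfolding code_def
    proof (intro conjI allI impI)
      fix i assume i: "0 < i" "i < n"
      show "(c1(j := c2 j)) i \<le> i" "i \<le> (r1(j := j)) i" "(r1(j := j)) i \<le> n" using l1[of i] j tj i by auto
      show "((c1(j := c2 j)) i = i) = ((r1(j := j)) i \<noteq> i)" using j tj t1[of i] i by auto
      { assume "(c1(j := c2 j)) i < i"
        then show "(c1(j := c2 j)) ((c1(j := c2 j)) i) = (c1(j := c2 j)) i" "i < (r1(j := j)) ((c1(j := c2 j)) i)"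
          using cand[of j] cc1[of i] j tj i noc[of i] by (auto split: if_splits) }
      { assume a: "i < (r1(j := j)) i"
        then have ij: "i \<noteq> j" "i < r1 i" by (auto split: if_splits)
        then have "r1 i \<noteq> j" using cr1[of i] i tj by auto
        then show "(r1(j := j)) ((r1(j := j)) i) = (r1(j := j)) i" "(c1(j := c2 j)) ((r1(j := j)) i) < i"
          using cr1[of i] i ij by auto }
    qed (use e1 j tj in auto)
    show thesis
      by (rule that[OF code, of j]) (use j tj le in \<open>auto\<close>)
  qed
qed

section \<open>Left modules and their homomorphisms\<close>

lemma mod_homD:
  assumes "f \<in> mod_hom R M N"
  shows "x \<in> carrier M \<Longrightarrow> f x \<in> carrier N"
    "x \<in> carrier M \<Longrightarrow> y \<in> carrier M \<Longrightarrow> f (x \<oplus>\<^bsub>M\<^esub> y) = f x \<oplus>\<^bsub>N\<^esub> f y"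
    "r \<in> carrier R \<Longrightarrow> x \<in> carrier M \<Longrightarrow> f (r \<odot>\<^bsub>M\<^esub> x) = r \<odot>\<^bsub>N\<^esub> f x"
  using assms by (auto simp: mod_hom_def)

lemma mod_homI:
  assumes "\<And>x. x \<in> carrier M \<Longrightarrow> f x \<in> carrier N"
    "\<And>x y. x \<in> carrier M \<Longrightarrow> y \<in> carrier M \<Longrightarrow> f (x \<oplus>\<^bsub>M\<^esub> y) = f x \<oplus>\<^bsub>N\<^esub> f y"
    "\<And>r x. r \<in> carrier R \<Longrightarrow> x \<in> carrier M \<Longrightarrow> f (r \<odot>\<^bsub>M\<^esub> x) = r \<odot>\<^bsub>N\<^esub> f x"
  shows "f \<in> mod_hom R M N"
  using assms by (auto simp: mod_hom_def)

lemma mod_hom_comp: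
  assumes "f \<in> mod_hom R M N" "g \<in> mod_hom R N P"
  shows "(\<lambda>x. g (f x)) \<in> mod_hom R M P"
  using mod_homD[OF assms(1)] mod_homD[OF assms(2)] by (intro mod_homI) simp_all

lemma mod_isoD:
  assumes "f \<in> mod_iso R M N"
  shows "f \<in> mod_hom R M N" "inj_on f (carrier M)" "f ` carrier M = carrier N"
  using assms by (auto simp: mod_iso_def bij_betw_def)

lemma mod_isoI:
  "f \<in> mod_hom R M N \<Longrightarrow> inj_on f (carrier M) \<Longrightarrow> f ` carrier M = carrier N \<Longrightarrow> f \<in> mod_iso R M N"
  by (auto simp: mod_iso_def bij_betw_def)

lemma mod_iso_comp:
  assumes "f \<in> mod_iso R M N" "g \<in> mod_iso R N P"
  shows "(\<lambda>x. g (f x)) \<in> mod_iso R M P"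
proof (rule mod_isoI)
  show "(\<lambda>x. g (f x)) \<in> mod_hom R M P"
    by (rule mod_hom_comp[OF mod_isoD(1)[OF assms(1)] mod_isoD(1)[OF assms(2)]])
  show "inj_on (\<lambda>x. g (f x)) (carrier M)"
    using comp_inj_on[OF mod_isoD(2)[OF assms(1)], of g] mod_isoD(3)[OF assms(1)] mod_isoD(2)[OF assms(2)]
    by (simp add: comp_def)
  show "(\<lambda>x. g (f x)) ` carrier M = carrier P"
    using mod_isoD(3)[OF assms(1)] mod_isoD(3)[OF assms(2)] by (auto simp: image_image[symmetric])
qed

lemma mod_iso_inv:
  assumes M: "left_module R M" and f: "f \<in> mod_iso R M N"
  shows "inv_into (carrier M) f \<in> mod_iso R N M"
proof (rule mod_isoI)
  interpret left_module R M by fact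
  note h = mod_isoD(1)[OF f] and inj = mod_isoD(2)[OF f] and img = mod_isoD(3)[OF f]
  let ?g = "inv_into (carrier M) f"
  have g: "?g y \<in> carrier M" "f (?g y) = y" if "y \<in> carrier N" for y
    using that img by (auto intro: inv_into_into f_inv_into_f)
  show "?g \<in> mod_hom R N M"
  proof (rule mod_homI)
    fix x y assume xy: "x \<in> carrier N" "y \<in> carrier N"
    have "?g (f (?g x \<oplus>\<^bsub>M\<^esub> ?g y)) = ?g x \<oplus>\<^bsub>M\<^esub> ?g y"
      using g xy inj by (intro inv_into_f_f) auto
    then show "?g (x \<oplus>\<^bsub>N\<^esub> y) = ?g x \<oplus>\<^bsub>M\<^esub> ?g y"
      using mod_homD(2)[OF h, of "?g x" "?g y"] g xy by simp
  next
    fix r x assume xy: "r \<in> carrier R" "x \<in> carrier N"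
    have "?g (f (r \<odot>\<^bsub>M\<^esub> ?g x)) = r \<odot>\<^bsub>M\<^esub> ?g x"
      using g xy inj smult_closed by (intro inv_into_f_f) auto
    then show "?g (r \<odot>\<^bsub>N\<^esub> x) = r \<odot>\<^bsub>M\<^esub> ?g x"
      using mod_homD(3)[OF h, of r "?g x"] g xy by simp
  qed (use g in auto)
  show "inj_on ?g (carrier N)" using g by (intro inj_on_inv_into) (use img in auto)
  show "?g ` carrier N = carrier M"
    using inv_into_image_cancel[OF inj, of "carrier M"] img by simp
qed

lemma isomorphic_modI: "f \<in> mod_iso R M N \<Longrightarrow> isomorphic_mod R M N"
  by (auto simp: isomorphic_mod_def)

lemma isomorphic_modE:
  assumes "isomorphic_mod R M N" obtains f where "f \<in> mod_iso R M N"
  using assms by (auto simp: isomorphic_mod_def)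

lemma isomorphic_mod_refl: "isomorphic_mod R M M"
  by (rule isomorphic_modI[of "\<lambda>x. x"]) (auto simp: mod_iso_def mod_hom_def bij_betw_def)

lemma isomorphic_mod_sym: "left_module R M \<Longrightarrow> isomorphic_mod R M N \<Longrightarrow> isomorphic_mod R N M"
  by (meson isomorphic_modE isomorphic_modI mod_iso_inv)

lemma isomorphic_mod_trans: "isomorphic_mod R M N \<Longrightarrow> isomorphic_mod R N P \<Longrightarrow> isomorphic_mod R M P"
  by (meson isomorphic_modE isomorphic_modI mod_iso_comp)

lemma left_moduleI:
  assumes "ring R"
    and "\<And>x y. x \<in> carrier M \<Longrightarrow> y \<in> carrier M \<Longrightarrow> x \<oplus>\<^bsub>M\<^esub> y \<in> carrier M"
    and "\<zero>\<^bsub>M\<^esub> \<in> carrier M"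
    and "\<And>x y z. x \<in> carrier M \<Longrightarrow> y \<in> carrier M \<Longrightarrow> z \<in> carrier M \<Longrightarrow>
      x \<oplus>\<^bsub>M\<^esub> y \<oplus>\<^bsub>M\<^esub> z = x \<oplus>\<^bsub>M\<^esub> (y \<oplus>\<^bsub>M\<^esub> z)"
    and "\<And>x y. x \<in> carrier M \<Longrightarrow> y \<in> carrier M \<Longrightarrow> x \<oplus>\<^bsub>M\<^esub> y = y \<oplus>\<^bsub>M\<^esub> x"
    and "\<And>x. x \<in> carrier M \<Longrightarrow> \<zero>\<^bsub>M\<^esub> \<oplus>\<^bsub>M\<^esub> x = x"
    and "\<And>x. x \<in> carrier M \<Longrightarrow> \<exists>y\<in>carrier M. y \<oplus>\<^bsub>M\<^esub> x = \<zero>\<^bsub>M\<^esub>"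
    and "\<And>a x. a \<in> carrier R \<Longrightarrow> x \<in> carrier M \<Longrightarrow> a \<odot>\<^bsub>M\<^esub> x \<in> carrier M"
    and "\<And>a b x. a \<in> carrier R \<Longrightarrow> b \<in> carrier R \<Longrightarrow> x \<in> carrier M \<Longrightarrow>
      (a \<oplus>\<^bsub>R\<^esub> b) \<odot>\<^bsub>M\<^esub> x = a \<odot>\<^bsub>M\<^esub> x \<oplus>\<^bsub>M\<^esub> b \<odot>\<^bsub>M\<^esub> x"
    and "\<And>a x y. a \<in> carrier R \<Longrightarrow> x \<in> carrier M \<Longrightarrow> y \<in> carrier M \<Longrightarrow>
      a \<odot>\<^bsub>M\<^esub> (x \<oplus>\<^bsub>M\<^esub> y) = a \<odot>\<^bsub>M\<^esub> x \<oplus>\<^bsub>M\<^esub> a \<odot>\<^bsub>M\<^esub> y"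
    and "\<And>a b x. a \<in> carrier R \<Longrightarrow> b \<in> carrier R \<Longrightarrow> x \<in> carrier M \<Longrightarrow>
      (a \<otimes>\<^bsub>R\<^esub> b) \<odot>\<^bsub>M\<^esub> x = a \<odot>\<^bsub>M\<^esub> (b \<odot>\<^bsub>M\<^esub> x)"
    and "\<And>x. x \<in> carrier M \<Longrightarrow> \<one>\<^bsub>R\<^esub> \<odot>\<^bsub>M\<^esub> x = x"
  shows "left_module R M"
  by (intro left_module.intro left_module_axioms.intro abelian_groupI assms) assumption+

context left_module
begin

lemma smult_zero: assumes "a \<in> carrier R" shows "a \<odot>\<^bsub>M\<^esub> \<zero>\<^bsub>M\<^esub> = \<zero>\<^bsub>M\<^esub>"
proof -
  have "a \<odot>\<^bsub>M\<^esub> \<zero>\<^bsub>M\<^esub> \<oplus>\<^bsub>M\<^esub> a \<odot>\<^bsub>M\<^esub> \<zero>\<^bsub>M\<^esub> = a \<odot>\<^bsub>M\<^esub> \<zero>\<^bsub>M\<^esub>"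
    using smult_r_distr[OF assms, of "\<zero>\<^bsub>M\<^esub>" "\<zero>\<^bsub>M\<^esub>"] by simp
  then show ?thesis using assms smult_closed M.add.r_cancel_one by simp
qed

lemma zero_smult: assumes "x \<in> carrier M" shows "\<zero>\<^bsub>R\<^esub> \<odot>\<^bsub>M\<^esub> x = \<zero>\<^bsub>M\<^esub>"
proof -
  have "\<zero>\<^bsub>R\<^esub> \<odot>\<^bsub>M\<^esub> x \<oplus>\<^bsub>M\<^esub> \<zero>\<^bsub>R\<^esub> \<odot>\<^bsub>M\<^esub> x = \<zero>\<^bsub>R\<^esub> \<odot>\<^bsub>M\<^esub> x"
    using smult_l_distr[OF _ _ assms, of "\<zero>\<^bsub>R\<^esub>" "\<zero>\<^bsub>R\<^esub>"] by simp
  then show ?thesis using assms smult_closed M.add.r_cancel_one by simp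
qed

lemma smult_minus: assumes "a \<in> carrier R" "x \<in> carrier M" shows "a \<odot>\<^bsub>M\<^esub> (\<ominus>\<^bsub>M\<^esub> x) = \<ominus>\<^bsub>M\<^esub> (a \<odot>\<^bsub>M\<^esub> x)"
proof -
  have "a \<odot>\<^bsub>M\<^esub> (\<ominus>\<^bsub>M\<^esub> x) \<oplus>\<^bsub>M\<^esub> a \<odot>\<^bsub>M\<^esub> x = \<zero>\<^bsub>M\<^esub>"
    using smult_r_distr[OF assms(1), of "\<ominus>\<^bsub>M\<^esub> x" x] assms smult_zero M.l_neg by simp
  then show ?thesis using assms smult_closed by (metis M.a_inv_closed M.minus_equality)
qed

lemma minus_one_smult: assumes "x \<in> carrier M" shows "(\<ominus>\<^bsub>R\<^esub> \<one>\<^bsub>R\<^esub>) \<odot>\<^bsub>M\<^esub> x = \<ominus>\<^bsub>M\<^esub> x"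
proof -
  have "(\<ominus>\<^bsub>R\<^esub> \<one>\<^bsub>R\<^esub>) \<odot>\<^bsub>M\<^esub> x \<oplus>\<^bsub>M\<^esub> x = \<zero>\<^bsub>M\<^esub>"
    using smult_l_distr[of "\<ominus>\<^bsub>R\<^esub> \<one>\<^bsub>R\<^esub>" "\<one>\<^bsub>R\<^esub>" x] assms smult_one zero_smult R.l_neg[OF R.one_closed]
    by simp
  then show ?thesis using assms smult_closed by (metis M.minus_equality R.one_closed R.a_inv_closed)
qed

lemma submoduleI:
  assumes "H \<subseteq> carrier M" "\<zero>\<^bsub>M\<^esub> \<in> H"
    and "\<And>x y. x \<in> H \<Longrightarrow> y \<in> H \<Longrightarrow> x \<oplus>\<^bsub>M\<^esub> y \<in> H"
    and "\<And>a x. a \<in> carrier R \<Longrightarrow> x \<in> H \<Longrightarrow> a \<odot>\<^bsub>M\<^esub> x \<in> H"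
  shows "submodule H R M"
proof -
  have "\<ominus>\<^bsub>M\<^esub> x \<in> H" if "x \<in> H" for x
    using assms(4)[of "\<ominus>\<^bsub>R\<^esub> \<one>\<^bsub>R\<^esub>" x] minus_one_smult[of x] assms(1) that by auto
  then show ?thesis
    unfolding submodule_def submodule_axioms_def subgroup_def
    using assms by (auto simp: a_inv_def)
qed

lemma submoduleD:
  assumes "submodule H R M"
  shows "H \<subseteq> carrier M" "\<zero>\<^bsub>M\<^esub> \<in> H" "x \<in> H \<Longrightarrow> y \<in> H \<Longrightarrow> x \<oplus>\<^bsub>M\<^esub> y \<in> H"
    "a \<in> carrier R \<Longrightarrow> x \<in> H \<Longrightarrow> a \<odot>\<^bsub>M\<^esub> x \<in> H" "x \<in> H \<Longrightarrow> \<ominus>\<^bsub>M\<^esub> x \<in> H"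
  using assms unfolding submodule_def submodule_axioms_def subgroup_def
  by (auto simp: a_inv_def)

lemma smult_finsum:
  assumes "a \<in> carrier R" "f \<in> A \<rightarrow> carrier M"
  shows "a \<odot>\<^bsub>M\<^esub> finsum M f A = finsum M (\<lambda>i. a \<odot>\<^bsub>M\<^esub> f i) A"
  using assms(2)
proof (induction A rule: infinite_finite_induct)
  case (insert i A)
  then have "f i \<in> carrier M" "f \<in> A \<rightarrow> carrier M" by auto
  then show ?case using insert smult_closed[OF assms(1)] assms(1)
    by (subst (1 2) M.finsum_insert) (auto simp: smult_r_distr)
qed (auto simp: smult_zero assms)

end

lemma mod_hom_zero:
  assumes "left_module R M" "left_module R N" "f \<in> mod_hom R M N"
  shows "f \<zero>\<^bsub>M\<^esub> = \<zero>\<^bsub>N\<^esub>"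
proof -
  interpret M: left_module R M by fact
  interpret N: left_module R N by fact
  have "f \<zero>\<^bsub>M\<^esub> \<oplus>\<^bsub>N\<^esub> f \<zero>\<^bsub>M\<^esub> = f \<zero>\<^bsub>M\<^esub>"
    using mod_homD(2)[OF assms(3), of "\<zero>\<^bsub>M\<^esub>" "\<zero>\<^bsub>M\<^esub>"] by simp
  then show ?thesis using mod_homD(1)[OF assms(3), of "\<zero>\<^bsub>M\<^esub>"] N.add.r_cancel_one by simp
qed

lemma mod_hom_minus:
  assumes "left_module R M" "left_module R N" "f \<in> mod_hom R M N" "x \<in> carrier M"
  shows "f (\<ominus>\<^bsub>M\<^esub> x) = \<ominus>\<^bsub>N\<^esub> f x"
proof -
  interpret M: left_module R M by fact
  interpret N: left_module R N by fact
  show ?thesis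
    using mod_homD(3)[OF assms(3), of "\<ominus>\<^bsub>R\<^esub> \<one>\<^bsub>R\<^esub>" x] M.minus_one_smult N.minus_one_smult
      mod_homD(1)[OF assms(3)] assms(4) by simp
qed

lemma mod_hom_inj_iff:
  assumes "left_module R M" "left_module R N" "f \<in> mod_hom R M N"
  shows "inj_on f (carrier M) \<longleftrightarrow> (\<forall>x\<in>carrier M. f x = \<zero>\<^bsub>N\<^esub> \<longrightarrow> x = \<zero>\<^bsub>M\<^esub>)"
proof -
  interpret M: left_module R M by fact
  interpret N: left_module R N by fact
  note z = mod_hom_zero[OF assms] and h = mod_homD[OF assms(3)]
  show ?thesis
  proof
    assume "inj_on f (carrier M)"
    then show "\<forall>x\<in>carrier M. f x = \<zero>\<^bsub>N\<^esub> \<longrightarrow> x = \<zero>\<^bsub>M\<^esub>"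
      using z by (auto dest: inj_onD[of f _ _ "\<zero>\<^bsub>M\<^esub>"])
  next
    assume k: "\<forall>x\<in>carrier M. f x = \<zero>\<^bsub>N\<^esub> \<longrightarrow> x = \<zero>\<^bsub>M\<^esub>"
    show "inj_on f (carrier M)"
    proof (rule inj_onI)
      fix x y assume xy: "x \<in> carrier M" "y \<in> carrier M" "f x = f y"
      have "f (x \<oplus>\<^bsub>M\<^esub> \<ominus>\<^bsub>M\<^esub> y) = \<zero>\<^bsub>N\<^esub>"
        using xy h mod_hom_minus[OF assms] by (simp add: N.r_neg)
      then have "x \<oplus>\<^bsub>M\<^esub> \<ominus>\<^bsub>M\<^esub> y = \<zero>\<^bsub>M\<^esub>" using k xy by auto
      then have "\<ominus>\<^bsub>M\<^esub> (\<ominus>\<^bsub>M\<^esub> y) = x" using xy by (intro M.minus_equality) auto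
      then show "x = y" using xy by simp
    qed
  qed
qed

text \<open>\<open>N\<close> is only a record here, and homomorphisms do not mention
  \<open>zero\<close>; assumption \<open>z\<close> ties that field to the addition of
  \<open>N\<close>.\<close>

lemma left_module_iso:
  assumes M: "left_module R M" and f: "f \<in> mod_iso R M N" and z: "f \<zero>\<^bsub>M\<^esub> = \<zero>\<^bsub>N\<^esub>"
  shows "left_module R N"
proof -
  interpret left_module R M by fact
  note h = mod_homD[OF mod_isoD(1)[OF f]] and img = mod_isoD(3)[OF f]
  have ex: "\<exists>x'\<in>carrier M. x = f x'" if "x \<in> carrier N" for x using img that by auto
  show ?thesis
  proof (rule left_moduleI)
    show "ring R" by (rule R.ring_axioms)
    show "\<zero>\<^bsub>N\<^esub> \<in> carrier N" using h(1) z by force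
    fix x assume "x \<in> carrier N"
    then obtain x' where x: "x' \<in> carrier M" "x = f x'" using ex by auto
    show "\<zero>\<^bsub>N\<^esub> \<oplus>\<^bsub>N\<^esub> x = x" using x h(2)[of "\<zero>\<^bsub>M\<^esub>" x'] z by simp
    show "\<one>\<^bsub>R\<^esub> \<odot>\<^bsub>N\<^esub> x = x" using x h(3)[of "\<one>\<^bsub>R\<^esub>" x'] smult_one by simp
    show "\<exists>y\<in>carrier N. y \<oplus>\<^bsub>N\<^esub> x = \<zero>\<^bsub>N\<^esub>"
      using x h(1)[of "\<ominus>\<^bsub>M\<^esub> x'"] h(2)[of "\<ominus>\<^bsub>M\<^esub> x'" x'] z M.l_neg[of x'] by (intro bexI[of _ "f (\<ominus>\<^bsub>M\<^esub> x')"]) auto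
    { fix a assume a: "a \<in> carrier R"
      show "a \<odot>\<^bsub>N\<^esub> x \<in> carrier N" using x a h(3)[of a x', symmetric] h(1) smult_closed by simp
      fix b assume b: "b \<in> carrier R"
      show "(a \<oplus>\<^bsub>R\<^esub> b) \<odot>\<^bsub>N\<^esub> x = a \<odot>\<^bsub>N\<^esub> x \<oplus>\<^bsub>N\<^esub> b \<odot>\<^bsub>N\<^esub> x"
        using x a b smult_closed by (simp add: h(2,3)[symmetric] smult_l_distr)
      show "(a \<otimes>\<^bsub>R\<^esub> b) \<odot>\<^bsub>N\<^esub> x = a \<odot>\<^bsub>N\<^esub> (b \<odot>\<^bsub>N\<^esub> x)"
        using x a b smult_closed by (simp add: h(2,3)[symmetric] smult_assoc) }
    fix y assume "y \<in> carrier N"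
    then obtain y' where y: "y' \<in> carrier M" "y = f y'" using ex by auto
    show "x \<oplus>\<^bsub>N\<^esub> y \<in> carrier N" using x y h(2)[of x' y', symmetric] h(1) by simp
    show "x \<oplus>\<^bsub>N\<^esub> y = y \<oplus>\<^bsub>N\<^esub> x" using x y by (simp add: h(2)[symmetric] M.a_comm)
    { fix a assume a: "a \<in> carrier R"
      show "a \<odot>\<^bsub>N\<^esub> (x \<oplus>\<^bsub>N\<^esub> y) = a \<odot>\<^bsub>N\<^esub> x \<oplus>\<^bsub>N\<^esub> a \<odot>\<^bsub>N\<^esub> y"
        using x y a smult_closed by (simp add: h(2,3)[symmetric] smult_r_distr) }
    fix z assume "z \<in> carrier N"
    then obtain z' where z: "z' \<in> carrier M" "z = f z'" using ex by auto
    show "x \<oplus>\<^bsub>N\<^esub> y \<oplus>\<^bsub>N\<^esub> z = x \<oplus>\<^bsub>N\<^esub> (y \<oplus>\<^bsub>N\<^esub> z)"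
      using x y z by (simp add: h(2)[symmetric] M.a_assoc)
  qed
qed

section \<open>Transport of structure along injections\<close>

text \<open>Copies a module onto another carrier type. It serves to put the concrete modules, and
  later the middle terms of extensions, on vectors.\<close>

definition transport :: "('v \<Rightarrow> 'w) \<Rightarrow> ('r, 'v) module \<Rightarrow> ('r, 'w) module" where
  "transport h M = \<lparr>carrier = h ` carrier M, monoid.mult = undefined, one = undefined, zero = h \<zero>\<^bsub>M\<^esub>,
     add = (\<lambda>x y. h (inv_into (carrier M) h x \<oplus>\<^bsub>M\<^esub> inv_into (carrier M) h y)),
     smult = (\<lambda>r x. h (r \<odot>\<^bsub>M\<^esub> inv_into (carrier M) h x))\<rparr>"

lemma transport_iso:
  assumes "inj_on h (carrier M)"
  shows "h \<in> mod_iso R M (transport h M)"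
  using assms by (intro mod_isoI mod_homI) (auto simp: transport_def)

lemma transport_left_module:
  fixes R :: "'r ring"
  assumes "left_module R M" "inj_on h (carrier M)"
  shows "left_module R (transport h M)"
  by (rule left_module_iso[OF assms(1) transport_iso[OF assms(2)]]) (simp add: transport_def)

lemma submodule_vimage:
  assumes M: "left_module R M" and N: "left_module R N" and f: "f \<in> mod_hom R M N" and H: "submodule H R N"
  shows "submodule {x \<in> carrier M. f x \<in> H} R M"
proof -
  interpret M: left_module R M by fact
  interpret N: left_module R N by fact
  show ?thesis
    using mod_homD[OF f] N.submoduleD[OF H] mod_hom_zero[OF M N f]
    by (intro M.submoduleI) (auto simp: M.smult_closed)
qed

lemma fg_modules_iso:
  assumes M: "M \<in> fg_modules R" and N: "left_module R N" and f: "f \<in> mod_iso R M N"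
  shows "N \<in> fg_modules R"
proof -
  obtain S where S: "left_module R M" "finite S" "S \<subseteq> carrier M"
    "\<And>H. submodule H R M \<Longrightarrow> S \<subseteq> H \<Longrightarrow> H = carrier M"
    using M by (auto simp: fg_modules_def)
  note fD = mod_isoD[OF f]
  have "H = carrier N" if H: "submodule H R N" "f ` S \<subseteq> H" for H
  proof -
    have "{x \<in> carrier M. f x \<in> H} = carrier M"
      using S(3) H by (intro S(4) submodule_vimage[OF S(1) N fD(1) H(1)]) auto
    then have "f x \<in> H" if "x \<in> carrier M" for x using that by auto
    then have "carrier N \<subseteq> H" unfolding fD(3)[symmetric] by auto
    then show ?thesis using left_module.submoduleD(1)[OF N H(1)] by blast
  qed
  then show ?thesis
    using N S(2,3) fD(3) by (auto simp: fg_modules_def intro!: exI[of _ "f ` S"])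
qed

lemma indecomposable_iso:
  assumes M: "indecomposable R M" and N: "left_module R N" and f: "f \<in> mod_iso R M N"
  shows "indecomposable R N"
proof -
  have M': "M \<in> fg_modules R" "left_module R M" using M by (auto simp: indecomposable_def fg_modules_def)
  interpret M: left_module R M by fact
  interpret N: left_module R N by fact
  note fD = mod_isoD[OF f] and h = mod_homD[OF mod_isoD(1)[OF f]]
  note z = mod_hom_zero[OF M'(2) N fD(1)]
  show ?thesis
    unfolding indecomposable_def
  proof (intro conjI allI impI)
    show "N \<in> fg_modules R" by (rule fg_modules_iso[OF M'(1) N f])
    show "carrier N \<noteq> {\<zero>\<^bsub>N\<^esub>}"
    proof
      assume "carrier N = {\<zero>\<^bsub>N\<^esub>}"
      then have "carrier M \<subseteq> {\<zero>\<^bsub>M\<^esub>}" using h(1) z inj_onD[OF fD(2) _ _ M.zero_closed] by auto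
      then show False using M M.zero_closed by (auto simp: indecomposable_def)
    qed
    fix A B assume AB: "submodule A R N \<and> submodule B R N \<and> A \<inter> B = {\<zero>\<^bsub>N\<^esub>} \<and> A <+>\<^bsub>N\<^esub> B = carrier N"
    let ?A = "{x \<in> carrier M. f x \<in> A}" and ?B = "{x \<in> carrier M. f x \<in> B}"
    have sub: "submodule ?A R M" "submodule ?B R M"
      using AB submodule_vimage[OF M'(2) N fD(1)] by auto
    have "x = \<zero>\<^bsub>M\<^esub>" if "x \<in> ?A \<inter> ?B" for x
    proof -
      have "f x = f \<zero>\<^bsub>M\<^esub>" using that AB z by auto
      then show ?thesis using fD(2) that by (auto dest: inj_onD)
    qed
    then have int: "?A \<inter> ?B = {\<zero>\<^bsub>M\<^esub>}"
      using M.submoduleD(2)[OF sub(1)] M.submoduleD(2)[OF sub(2)] by blast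
    have "x \<in> ?A <+>\<^bsub>M\<^esub> ?B" if x: "x \<in> carrier M" for x
    proof -
      have "f x \<in> A <+>\<^bsub>N\<^esub> B" using AB h(1) x by auto
      then obtain a b where ab: "a \<in> A" "b \<in> B" "f x = a \<oplus>\<^bsub>N\<^esub> b" by (auto simp: set_add_def')
      have "a \<in> carrier N" "b \<in> carrier N"
        using ab AB N.submoduleD(1)[of A] N.submoduleD(1)[of B] by auto
      then obtain a' b' where a': "a' \<in> carrier M" "f a' = a" and b': "b' \<in> carrier M" "f b' = b"
        unfolding fD(3)[symmetric] by auto
      have "f x = f (a' \<oplus>\<^bsub>M\<^esub> b')" using ab a' b' h by simp
      then have "x = a' \<oplus>\<^bsub>M\<^esub> b'" using fD(2) x a' b' by (auto dest: inj_onD)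
      then show ?thesis using a' b' ab by (auto simp: set_add_def')
    qed
    then have "?A <+>\<^bsub>M\<^esub> ?B = carrier M" by (auto simp: set_add_def')
    then have "?A = {\<zero>\<^bsub>M\<^esub>} \<or> ?B = {\<zero>\<^bsub>M\<^esub>}" using M sub int by (auto simp: indecomposable_def)
    moreover have sub': "H \<subseteq> f ` {x \<in> carrier M. f x \<in> H}" if "submodule H R N" for H
      using N.submoduleD(1)[OF that] unfolding fD(3)[symmetric] by auto
    from AB sub'[of A] sub'[of B] have "A \<subseteq> f ` ?A" "B \<subseteq> f ` ?B" by simp_all
    ultimately have "A \<subseteq> {\<zero>\<^bsub>N\<^esub>} \<or> B \<subseteq> {\<zero>\<^bsub>N\<^esub>}" using z by auto
    then show "A = {\<zero>\<^bsub>N\<^esub>} \<or> B = {\<zero>\<^bsub>N\<^esub>}" using AB N.submoduleD(2) by blast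
  qed
qed

section \<open>Generation and cogeneration\<close>

text \<open>The relation behind \<open>gen\<close>, with separate carrier types for the two modules,
  so that modules on vectors can be compared with the concrete ones on functions.\<close>

definition gens :: "'r ring \<Rightarrow> ('r, 'v) module \<Rightarrow> ('r, 'w) module \<Rightarrow> bool" where
  "gens R M N \<longleftrightarrow> (\<exists>m. \<exists>f \<in> mod_hom R (direct_sum m (\<lambda>_. M)) N.
       f ` carrier (direct_sum m (\<lambda>_. M)) = carrier N)"

definition cogens :: "'r ring \<Rightarrow> ('r, 'v) module \<Rightarrow> ('r, 'w) module \<Rightarrow> bool" where
  "cogens R M N \<longleftrightarrow> (\<exists>m. \<exists>f \<in> mod_hom R N (direct_sum m (\<lambda>_. M)). inj_on f (carrier N))"

lemma direct_sum_simps: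
  "carrier (direct_sum m F) = (\<Pi>\<^sub>E i\<in>{..<m}. carrier (F i))"
  "\<zero>\<^bsub>direct_sum m F\<^esub> = (\<lambda>i\<in>{..<m}. \<zero>\<^bsub>F i\<^esub>)"
  "x \<oplus>\<^bsub>direct_sum m F\<^esub> y = (\<lambda>i\<in>{..<m}. x i \<oplus>\<^bsub>F i\<^esub> y i)"
  "r \<odot>\<^bsub>direct_sum m F\<^esub> x = (\<lambda>i\<in>{..<m}. r \<odot>\<^bsub>F i\<^esub> x i)"
  by (simp_all add: direct_sum_def)

lemma direct_sum_left_module:
  assumes "ring R" "\<And>i. i < m \<Longrightarrow> left_module R (F i)"
  shows "left_module R (direct_sum m F)"
proof (rule left_moduleI)
  show "ring R" by fact
  note [simp] = direct_sum_simps PiE_iff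
  have g: "abelian_group (F i)" if "i < m" for i using assms(2)[OF that] by (simp add: left_module_def)
  note m = abelian_group.axioms(1)[OF g]
  note l = left_module.smult_closed[OF assms(2)]
    left_module.smult_l_distr[OF assms(2)] left_module.smult_r_distr[OF assms(2)]
    left_module.smult_assoc[OF assms(2)] left_module.smult_one[OF assms(2)]
  interpret R: ring R by fact
  fix x y z a b
  assume x: "x \<in> carrier (direct_sum m F)"
  then have xe: "x \<in> extensional {..<m}" by auto
  show "\<zero>\<^bsub>direct_sum m F\<^esub> \<oplus>\<^bsub>direct_sum m F\<^esub> x = x"
    using x by (intro extensionalityI[OF _ xe]) (auto simp: abelian_monoid.l_zero[OF m])
  show "\<one>\<^bsub>R\<^esub> \<odot>\<^bsub>direct_sum m F\<^esub> x = x"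
    using x by (intro extensionalityI[OF _ xe]) (auto simp: l)
  have "(\<lambda>i\<in>{..<m}. \<ominus>\<^bsub>F i\<^esub> x i) \<in> carrier (direct_sum m F)"
    using x by (auto intro: abelian_group.a_inv_closed[OF g])
  moreover have "(\<lambda>i\<in>{..<m}. \<ominus>\<^bsub>F i\<^esub> x i) \<oplus>\<^bsub>direct_sum m F\<^esub> x = \<zero>\<^bsub>direct_sum m F\<^esub>"
    using x by (auto simp: abelian_group.l_neg[OF g] intro!: restrict_ext)
  ultimately show "\<exists>y\<in>carrier (direct_sum m F). y \<oplus>\<^bsub>direct_sum m F\<^esub> x = \<zero>\<^bsub>direct_sum m F\<^esub>" by blast
  { assume a: "a \<in> carrier R"
    show "a \<odot>\<^bsub>direct_sum m F\<^esub> x \<in> carrier (direct_sum m F)" using x a by (auto simp: l)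
    { assume b: "b \<in> carrier R"
      show "(a \<oplus>\<^bsub>R\<^esub> b) \<odot>\<^bsub>direct_sum m F\<^esub> x = a \<odot>\<^bsub>direct_sum m F\<^esub> x \<oplus>\<^bsub>direct_sum m F\<^esub> b \<odot>\<^bsub>direct_sum m F\<^esub> x"
        "(a \<otimes>\<^bsub>R\<^esub> b) \<odot>\<^bsub>direct_sum m F\<^esub> x = a \<odot>\<^bsub>direct_sum m F\<^esub> (b \<odot>\<^bsub>direct_sum m F\<^esub> x)"
        using x a b by (auto simp: l intro!: restrict_ext) } }
  assume y: "y \<in> carrier (direct_sum m F)"
  show "x \<oplus>\<^bsub>direct_sum m F\<^esub> y \<in> carrier (direct_sum m F)"
    using x y by (auto intro: abelian_monoid.a_closed[OF m])
  show "x \<oplus>\<^bsub>direct_sum m F\<^esub> y = y \<oplus>\<^bsub>direct_sum m F\<^esub> x"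
    using x y by (auto simp: abelian_monoid.a_comm[OF m] intro!: restrict_ext)
  { assume a: "a \<in> carrier R"
    show "a \<odot>\<^bsub>direct_sum m F\<^esub> (x \<oplus>\<^bsub>direct_sum m F\<^esub> y) = a \<odot>\<^bsub>direct_sum m F\<^esub> x \<oplus>\<^bsub>direct_sum m F\<^esub> a \<odot>\<^bsub>direct_sum m F\<^esub> y"
      using x y a by (auto simp: l intro!: restrict_ext) }
  assume "z \<in> carrier (direct_sum m F)"
  then show "x \<oplus>\<^bsub>direct_sum m F\<^esub> y \<oplus>\<^bsub>direct_sum m F\<^esub> z = x \<oplus>\<^bsub>direct_sum m F\<^esub> (y \<oplus>\<^bsub>direct_sum m F\<^esub> z)"
    using x y by (auto simp: abelian_monoid.a_assoc[OF m] intro!: restrict_ext)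
next
  show "\<zero>\<^bsub>direct_sum m F\<^esub> \<in> carrier (direct_sum m F)"
    using assms(2) by (auto simp: direct_sum_simps left_module_def abelian_group_def abelian_monoid.zero_closed)
qed

lemma direct_sum_map:
  assumes "\<And>i. i < m \<Longrightarrow> f i \<in> mod_hom R (F i) (G i)"
  shows "(\<lambda>x. \<lambda>i\<in>{..<m}. f i (x i)) \<in> mod_hom R (direct_sum m F) (direct_sum m G)"
  using mod_homD[OF assms] by (intro mod_homI) (auto simp: direct_sum_simps PiE_iff intro!: restrict_ext)

lemma direct_sum_map_iso:
  assumes "\<And>i. i < m \<Longrightarrow> f i \<in> mod_iso R (F i) (G i)"
  shows "(\<lambda>x. \<lambda>i\<in>{..<m}. f i (x i)) \<in> mod_iso R (direct_sum m F) (direct_sum m G)"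
proof (rule mod_isoI)
  show "(\<lambda>x. \<lambda>i\<in>{..<m}. f i (x i)) \<in> mod_hom R (direct_sum m F) (direct_sum m G)" (is "?h \<in> _")
    by (rule direct_sum_map) (rule mod_isoD(1)[OF assms])
  show "inj_on ?h (carrier (direct_sum m F))"
  proof (rule inj_onI)
    fix x y assume xy: "x \<in> carrier (direct_sum m F)" "y \<in> carrier (direct_sum m F)" "?h x = ?h y"
    have "x i = y i" if "i < m" for i
    proof (rule inj_onD[OF mod_isoD(2)[OF assms[OF that]]])
      show "f i (x i) = f i (y i)" using fun_cong[OF xy(3), of i] that by simp
    qed (use xy that in \<open>auto simp: direct_sum_simps\<close>)
    then show "x = y" using xy by (intro PiE_ext[of x "{..<m}"]) (auto simp: direct_sum_simps)
  qed
  show "?h ` carrier (direct_sum m F) = carrier (direct_sum m G)"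
  proof (intro equalityI subsetI)
    fix y assume y: "y \<in> carrier (direct_sum m G)"
    have "\<forall>i\<in>{..<m}. \<exists>x. x \<in> carrier (F i) \<and> f i x = y i"
    proof
      fix i assume "i \<in> {..<m}"
      then have "y i \<in> f i ` carrier (F i)" using y mod_isoD(3)[OF assms, of i] by (auto simp: direct_sum_simps)
      then show "\<exists>x. x \<in> carrier (F i) \<and> f i x = y i" by auto
    qed
    then obtain x where x: "\<forall>i\<in>{..<m}. x i \<in> carrier (F i) \<and> f i (x i) = y i" by metis
    have "y = ?h (restrict x {..<m})"
      using x y by (intro PiE_ext[of y "{..<m}"]) (auto simp: direct_sum_simps)
    moreover have "restrict x {..<m} \<in> carrier (direct_sum m F)" using x by (auto simp: direct_sum_simps)
    ultimately show "y \<in> ?h ` carrier (direct_sum m F)" by blast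
  qed (use mod_homD(1)[OF mod_isoD(1)[OF assms]] in \<open>auto simp: direct_sum_simps PiE_iff\<close>)
qed

lemma gens_trans:
  assumes "gens R M N" "gens R N P"
  shows "gens R M P"
proof -
  obtain m f where f: "f \<in> mod_hom R (direct_sum m (\<lambda>_. M)) N" "f ` carrier (direct_sum m (\<lambda>_. M)) = carrier N"
    using assms(1) by (auto simp: gens_def)
  obtain k g where g: "g \<in> mod_hom R (direct_sum k (\<lambda>_. N)) P" "g ` carrier (direct_sum k (\<lambda>_. N)) = carrier P"
    using assms(2) by (auto simp: gens_def)
  \<comment> \<open>A sum of \<open>k\<close> blocks of \<open>m\<close> copies is indexed by
    \<open>j * m + i\<close>; the way back is \<open>div\<close> and \<open>mod\<close>.\<close>
  have lt: "j * m + i < k * m" if "j < k" "i < m" for i j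
  proof -
    have "j * m + i < Suc j * m" using that by simp
    also have "\<dots> \<le> k * m" using that by (intro mult_le_mono1) simp
    finally show ?thesis .
  qed
  let ?D = "direct_sum (k * m) (\<lambda>_. M)"
  let ?h = "\<lambda>x. \<lambda>j\<in>{..<k}. f (\<lambda>i\<in>{..<m}. x (j * m + i))"
  have blk: "(\<lambda>x. \<lambda>i\<in>{..<m}. x (j * m + i)) \<in> mod_hom R ?D (direct_sum m (\<lambda>_. M))" if "j < k" for j
    using lt[OF that] by (intro mod_homI) (auto simp: direct_sum_simps intro!: restrict_ext)
  have h: "?h \<in> mod_hom R ?D (direct_sum k (\<lambda>_. N))"
    using mod_homD[OF mod_hom_comp[OF blk f(1)]]
    by (intro mod_homI) (auto simp: direct_sum_simps[of k] intro!: restrict_ext)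
  have "?h ` carrier ?D = carrier (direct_sum k (\<lambda>_. N))"
  proof (intro equalityI subsetI)
    fix y assume y: "y \<in> carrier (direct_sum k (\<lambda>_. N))"
    have "\<forall>j\<in>{..<k}. \<exists>x. x \<in> carrier (direct_sum m (\<lambda>_. M)) \<and> f x = y j"
    proof
      fix j assume "j \<in> {..<k}"
      then have "y j \<in> f ` carrier (direct_sum m (\<lambda>_. M))" using y f(2) by (auto simp: direct_sum_simps)
      then show "\<exists>x. x \<in> carrier (direct_sum m (\<lambda>_. M)) \<and> f x = y j" by auto
    qed
    then obtain x where x: "\<And>j. j < k \<Longrightarrow> x j \<in> carrier (direct_sum m (\<lambda>_. M)) \<and> f (x j) = y j"
      by (metis lessThan_iff)
    define z where "z = (\<lambda>l\<in>{..<k*m}. x (l div m) (l mod m))"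
    have zD: "z \<in> carrier ?D"
    proof -
      have "x (l div m) (l mod m) \<in> carrier M" if "l < k * m" for l
      proof -
        have "0 < m" using that by (cases m) auto
        moreover have "x (l div m) \<in> (\<Pi>\<^sub>E i\<in>{..<m}. carrier M)"
          using x[OF less_mult_imp_div_less[OF that]] unfolding direct_sum_simps by blast
        ultimately show ?thesis using PiE_mem[of "x (l div m)" "{..<m}" "\<lambda>_. carrier M" "l mod m"] by simp
      qed
      then show ?thesis by (auto simp: z_def direct_sum_simps)
    qed
    have "(\<lambda>i\<in>{..<m}. z (j * m + i)) = x j" if "j < k" for j
    proof (rule PiE_ext)
      show "x j \<in> (\<Pi>\<^sub>E i\<in>{..<m}. carrier M)" using x[OF that] by (simp add: direct_sum_simps)
      show "(\<lambda>i\<in>{..<m}. z (j * m + i)) \<in> (\<Pi>\<^sub>E i\<in>{..<m}. carrier M)"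
        using mod_homD(1)[OF blk[OF that] zD] by (simp add: direct_sum_simps)
    qed (use lt[OF that] in \<open>auto simp: z_def\<close>)
    then have "?h z = y" using x y
      by (intro PiE_ext[of _ "{..<k}" "\<lambda>_. carrier N"]) (auto simp: direct_sum_simps)
    then show "y \<in> ?h ` carrier ?D" using zD by auto
  next
    fix y assume "y \<in> ?h ` carrier ?D"
    then show "y \<in> carrier (direct_sum k (\<lambda>_. N))" using mod_homD(1)[OF h] by blast
  qed
  then have "(\<lambda>x. g (?h x)) ` carrier ?D = carrier P" using g(2) by (metis image_image)
  then show ?thesis using mod_hom_comp[OF h g(1)] unfolding gens_def by blast
qed

lemma cogens_trans:
  assumes "cogens R M N" "cogens R N P"
  shows "cogens R M P"
proof -
  obtain m f where f: "f \<in> mod_hom R N (direct_sum m (\<lambda>_. M))" "inj_on f (carrier N)"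
    using assms(1) by (auto simp: cogens_def)
  obtain k g where g: "g \<in> mod_hom R P (direct_sum k (\<lambda>_. N))" "inj_on g (carrier P)"
    using assms(2) by (auto simp: cogens_def)
  let ?D = "direct_sum (k * m) (\<lambda>_. M)"
  let ?h = "\<lambda>x. \<lambda>l\<in>{..<k*m}. f (g x (l div m)) (l mod m)"
  have lt: "l div m < k" "l mod m < m" if "l < k * m" for l
    using that by (auto simp: less_mult_imp_div_less intro!: mod_less_divisor) (cases "m = 0", auto)
  have gD: "g x j \<in> carrier N" if "x \<in> carrier P" "j < k" for x j
    using mod_homD(1)[OF g(1) that(1)] that by (auto simp: direct_sum_simps)
  have fD: "f x i \<in> carrier M" if "x \<in> carrier N" "i < m" for x i
    using mod_homD(1)[OF f(1) that(1)] that by (auto simp: direct_sum_simps)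
  have "?h \<in> mod_hom R P ?D"
    using mod_homD(2,3)[OF f(1)] mod_homD(2,3)[OF g(1)] lt gD fD
    by (intro mod_homI) (auto simp: direct_sum_simps intro!: restrict_ext)
  moreover have "inj_on ?h (carrier P)"
  proof (rule inj_onI)
    fix x y assume xy: "x \<in> carrier P" "y \<in> carrier P" "?h x = ?h y"
    have "g x j = g y j" if "j < k" for j
    proof -
      have "f (g x j) i = f (g y j) i" if i: "i < m" for i
      proof -
        have "j * m + i < Suc j * m" using i by simp
        also have "\<dots> \<le> k * m" using \<open>j < k\<close> by (intro mult_le_mono1) simp
        finally show ?thesis using fun_cong[OF xy(3), of "j * m + i"] i by simp
      qed
      then have "f (g x j) = f (g y j)"
        using mod_homD(1)[OF f(1) gD[OF xy(1) that]] mod_homD(1)[OF f(1) gD[OF xy(2) that]]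
        by (intro PiE_ext[of _ "{..<m}" "\<lambda>_. carrier M"]) (auto simp: direct_sum_simps)
      then show ?thesis using f(2) gD[OF xy(1) that] gD[OF xy(2) that] by (auto dest: inj_onD)
    qed
    then have "g x = g y" using mod_homD(1)[OF g(1) xy(1)] mod_homD(1)[OF g(1) xy(2)]
      by (intro PiE_ext[of _ "{..<k}" "\<lambda>_. carrier N"]) (auto simp: direct_sum_simps)
    then show "x = y" using g(2) xy by (auto dest: inj_onD)
  qed
  ultimately show ?thesis unfolding cogens_def by blast
qed

lemma gens_if_surj:
  assumes f: "f \<in> mod_hom R M N" "f ` carrier M = carrier N"
  shows "gens R M N"
proof -
  have "(\<lambda>x. f (x 0)) \<in> mod_hom R (direct_sum 1 (\<lambda>_. M)) N"
    using mod_homD[OF f(1)] by (intro mod_homI) (auto simp: direct_sum_simps PiE_iff)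
  moreover have "(\<lambda>x. f (x 0)) ` carrier (direct_sum 1 (\<lambda>_. M)) = carrier N"
  proof (intro equalityI subsetI)
    fix y assume "y \<in> carrier N"
    then obtain x where x: "x \<in> carrier M" "y = f x" using f(2) by auto
    then show "y \<in> (\<lambda>x. f (x 0)) ` carrier (direct_sum 1 (\<lambda>_. M))"
      by (intro image_eqI[of _ _ "\<lambda>i\<in>{..<1}. x"]) (auto simp: direct_sum_simps)
  qed (use mod_homD(1)[OF f(1)] in \<open>auto simp: direct_sum_simps\<close>)
  ultimately show ?thesis unfolding gens_def by blast
qed

lemma cogens_if_inj:
  assumes f: "f \<in> mod_hom R N M" "inj_on f (carrier N)"
  shows "cogens R M N"
proof -
  have "(\<lambda>x. \<lambda>i\<in>{..<1::nat}. f x) \<in> mod_hom R N (direct_sum 1 (\<lambda>_. M))"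
    using mod_homD[OF f(1)] by (intro mod_homI) (auto simp: direct_sum_simps intro!: restrict_ext)
  moreover have "inj_on (\<lambda>x. \<lambda>i\<in>{..<1::nat}. f x) (carrier N)"
  proof (rule inj_onI)
    fix x y assume xy: "x \<in> carrier N" "y \<in> carrier N" "(\<lambda>i\<in>{..<1::nat}. f x) = (\<lambda>i\<in>{..<1::nat}. f y)"
    have "f x = f y" using fun_cong[OF xy(3), of 0] by (simp only: restrict_apply) simp
    then show "x = y" using f(2) xy by (auto dest: inj_onD)
  qed
  ultimately show ?thesis unfolding cogens_def by blast
qed

text \<open>Since \<open>gens\<close> is transitive and \<open>N\<close> lies in its own
  \<open>gen\<close>, the inclusion is decided at the single module \<open>N\<close>. This removes
  the quantification over all modules from the order.\<close>

lemma gen_subset_iff: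
  assumes "N \<in> fg_modules R"
  shows "gen R N \<subseteq> gen R M \<longleftrightarrow> gens R M N"
proof
  assume "gen R N \<subseteq> gen R M"
  moreover have "gens R N N" by (rule gens_if_surj[of "\<lambda>x. x"]) (auto simp: mod_hom_def)
  then have "N \<in> gen R N" using assms by (simp add: gen_def gens_def)
  ultimately have "N \<in> gen R M" by blast
  then show "gens R M N" by (simp add: gen_def gens_def)
next
  assume g: "gens R M N"
  show "gen R N \<subseteq> gen R M"
    using gens_trans[OF g] unfolding gen_def gens_def[symmetric] by blast
qed

lemma cogen_subset_iff:
  assumes "N \<in> fg_modules R"
  shows "cogen R N \<subseteq> cogen R M \<longleftrightarrow> cogens R M N"
proof
  assume "cogen R N \<subseteq> cogen R M"
  moreover have "cogens R N N" by (rule cogens_if_inj[of "\<lambda>x. x"]) (auto simp: mod_hom_def)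
  then have "N \<in> cogen R N" using assms by (simp add: cogen_def cogens_def)
  ultimately have "N \<in> cogen R M" by blast
  then show "cogens R M N" by (simp add: cogen_def cogens_def)
next
  assume g: "cogens R M N"
  show "cogen R N \<subseteq> cogen R M"
    using cogens_trans[OF g] unfolding cogen_def cogens_def[symmetric] by blast
qed

lemma gens_cogens_iso:
  assumes "isomorphic_mod R M M'"
  shows "gens R M M'" "cogens R M' M"
  using assms by (auto elim!: isomorphic_modE intro: gens_if_surj cogens_if_inj dest: mod_isoD)

section \<open>Modules over lower triangular matrices\<close>

abbreviation Lam :: "nat \<Rightarrow> 'k::field mat ring" where
  "Lam n \<equiv> lower_tri_ring TYPE('k) n"

text \<open>The elements of the left ideal generated by the idempotent at \<open>x\<close>, i.e. of
  the indecomposable projective with support from \<open>x\<close> to \<open>n - 1\<close>. Working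
  with whole columns gives one formula for the action on a generator at \<open>x\<close>.\<close>

definition cl :: "nat \<Rightarrow> nat \<Rightarrow> (nat \<Rightarrow> 'k) \<Rightarrow> 'k::field mat" where
  "cl n x c = mat n n (\<lambda>(i, j). if j = x \<and> x \<le> i then c i else 0)"

text \<open>For \<open>j \<le> i\<close> the matrix unit, which acts as the path from
  \<open>j\<close> to \<open>i\<close>; for \<open>j > i\<close> it is the zero matrix.\<close>

definition Eu :: "nat \<Rightarrow> nat \<Rightarrow> nat \<Rightarrow> 'k::field mat" where
  "Eu n i j = cl n j (\<lambda>p. if p = i then 1 else 0)"

lemma Lam_carrier: "A \<in> carrier (Lam n) \<longleftrightarrow>
    A \<in> carrier_mat n n \<and> (\<forall>i<n. \<forall>j<n. i < j \<longrightarrow> A $$ (i, j) = 0)"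
  by (simp add: lower_tri_ring_def)

lemma Lam_ops: "A \<otimes>\<^bsub>Lam n\<^esub> B = A * B" "A \<oplus>\<^bsub>Lam n\<^esub> B = A + B" "\<one>\<^bsub>Lam n\<^esub> = 1\<^sub>m n" "\<zero>\<^bsub>Lam n\<^esub> = 0\<^sub>m n n"
  by (simp_all add: lower_tri_ring_def ring_mat_simps)

lemma cl_closed: "cl n x c \<in> carrier (Lam n)"
  by (auto simp: Lam_carrier cl_def)

lemma Eu_closed: "Eu n i j \<in> carrier (Lam n)"
  by (simp add: Eu_def cl_closed)

lemma cl_cong: "(\<And>i. x \<le> i \<Longrightarrow> i < n \<Longrightarrow> c i = d i) \<Longrightarrow> cl n x c = cl n x d"
  by (auto simp: cl_def)

lemma cl_add: "cl n x c \<oplus>\<^bsub>Lam n\<^esub> cl n x d = cl n x (\<lambda>i. c i + d i)"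
  by (auto simp: cl_def Lam_ops)

lemma cl_zero: "cl n x (\<lambda>_. 0) = \<zero>\<^bsub>Lam n\<^esub>"
  by (auto simp: cl_def Lam_ops)

lemma mult_cl:
  assumes "A \<in> carrier (Lam n)" "x < n"
  shows "A \<otimes>\<^bsub>Lam n\<^esub> cl n x c = cl n x (\<lambda>i. \<Sum>j\<in>{x..<n}. A $$ (i, j) * c j)" (is "?L = ?R")
proof (rule eq_matI)
  have A: "A \<in> carrier_mat n n" "\<And>i j. i < j \<Longrightarrow> j < n \<Longrightarrow> A $$ (i, j) = 0"
    using assms(1) by (auto simp: Lam_carrier)
  show "dim_row ?L = dim_row ?R" "dim_col ?L = dim_col ?R" using A by (auto simp: Lam_ops cl_def)
  fix i j assume "i < dim_row ?R" "j < dim_col ?R"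
  then have ij: "i < n" "j < n" by (auto simp: cl_def)
  have "?L $$ (i, j) = (\<Sum>k<n. A $$ (i, k) * cl n x c $$ (k, j))"
    using A ij by (auto simp: Lam_ops cl_def scalar_prod_def atLeast0LessThan intro!: sum.cong)
  also have "\<dots> = (\<Sum>k<n. if j = x \<and> x \<le> k then A $$ (i, k) * c k else 0)"
    using ij by (auto simp: cl_def intro!: sum.cong)
  also have "\<dots> = (if j = x then (\<Sum>k\<in>{x..<n}. A $$ (i, k) * c k) else 0)"
    by (auto simp: sum.If_cases intro!: sum.cong)
  also have "\<dots> = ?R $$ (i, j)"
    using ij A(2) by (auto simp: cl_def intro!: sum.neutral)
  finally show "?L $$ (i, j) = ?R $$ (i, j)" .
qed

lemma cl_mult_cl:
  assumes "x \<le> y" "y < n"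
  shows "cl n y d \<otimes>\<^bsub>Lam n\<^esub> cl n x c = cl n x (\<lambda>i. if y \<le> i then d i * c y else 0)"
proof -
  have "(\<Sum>j\<in>{x..<n}. cl n y d $$ (i, j) * c j) = (if y \<le> i then d i * c y else 0)" if "i < n" for i
  proof -
    have "(\<Sum>j\<in>{x..<n}. cl n y d $$ (i, j) * c j) = (\<Sum>j\<in>{x..<n}. if j = y then (if y \<le> i then d i * c y else 0) else 0)"
      using that by (intro sum.cong) (auto simp: cl_def)
    then show ?thesis using assms by (simp add: sum.delta)
  qed
  then show ?thesis using assms
    by (subst mult_cl[OF cl_closed]) (auto intro: cl_cong)
qed

lemma Eu_mult_cl:
  "x \<le> j \<Longrightarrow> j \<le> i \<Longrightarrow> i < n \<Longrightarrow> Eu n i j \<otimes>\<^bsub>Lam n\<^esub> cl n x c = cl n x (\<lambda>p. if p = i then c j else 0)"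
  unfolding Eu_def by (subst cl_mult_cl) (auto intro: cl_cong)

lemma Eu_mult: "k \<le> j \<Longrightarrow> j \<le> i \<Longrightarrow> i < n \<Longrightarrow> Eu n i j \<otimes>\<^bsub>Lam n\<^esub> Eu n j k = Eu n i k"
  by (subst (2) Eu_def, subst Eu_mult_cl) (auto simp: Eu_def)

lemma cl_Eu_scalar:
  assumes "x \<le> i" "i < n"
  shows "cl n i (\<lambda>p. if p = i then a else 0) \<otimes>\<^bsub>Lam n\<^esub> Eu n i x = cl n x (\<lambda>p. if p = i then a else 0)"
  unfolding Eu_def using assms by (subst cl_mult_cl) (auto intro: cl_cong)

lemma left_module_decomp:
  assumes M: "left_module (Lam n) M" and x: "x \<in> carrier M"
  shows "x = finsum M (\<lambda>i. Eu n i i \<odot>\<^bsub>M\<^esub> x) {..<n}"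
proof -
  interpret left_module "Lam n" M by fact
  \<comment> \<open>The partial sums of the idempotents \<open>Eu n i i\<close>, from zero up to the
    identity.\<close>
  define D where "D k = mat n n (\<lambda>(i, j). if i = j \<and> i < k then 1 else (0::'a))" for k
  have Dc: "D k \<in> carrier (Lam n)" for k by (auto simp: D_def Lam_carrier)
  have cl: "Eu n i i \<odot>\<^bsub>M\<^esub> x \<in> carrier M" for i using x Eu_closed smult_closed by blast
  have "D k \<odot>\<^bsub>M\<^esub> x = finsum M (\<lambda>i. Eu n i i \<odot>\<^bsub>M\<^esub> x) {..<k}" if "k \<le> n" for k
    using that
  proof (induction k)
    case 0
    have "D 0 = \<zero>\<^bsub>Lam n\<^esub>" by (auto simp: D_def Lam_ops)
    then show ?case using zero_smult[OF x] by simp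
  next
    case (Suc k)
    have "D (Suc k) = Eu n k k \<oplus>\<^bsub>Lam n\<^esub> D k"
      by (rule eq_matI) (auto simp: D_def Lam_ops Eu_def cl_def)
    then show ?case
      using Suc cl x smult_l_distr[OF Eu_closed Dc x] by (simp add: lessThan_Suc)
  qed
  moreover have "D n = \<one>\<^bsub>Lam n\<^esub>" by (auto simp: D_def Lam_ops)
  ultimately show ?thesis using smult_one[OF x] by (metis order_refl)
qed

section \<open>Direct sums of interval modules\<close>

text \<open>\<open>f s i\<close> is the coordinate of \<open>f\<close> in the summand \<open>s\<close> at the vertex \<open>i\<close>.\<close>

definition Fn :: "nat \<Rightarrow> (nat \<times> nat) set \<Rightarrow> ('k::field mat, nat \<times> nat \<Rightarrow> nat \<Rightarrow> 'k) module" where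
  "Fn n S = \<lparr>carrier = {f. \<forall>s i. f s i \<noteq> 0 \<longrightarrow> s \<in> S \<and> fst s \<le> i \<and> i < snd s},
     monoid.mult = undefined, one = undefined, zero = (\<lambda>_ _. 0), add = (\<lambda>f g s i. f s i + g s i),
     smult = (\<lambda>A f s i. if fst s \<le> i \<and> i < snd s then \<Sum>j<n. A $$ (i, j) * f s j else 0)\<rparr>"

definition dl :: "nat \<times> nat \<Rightarrow> nat \<Rightarrow> 'k \<Rightarrow> nat \<times> nat \<Rightarrow> nat \<Rightarrow> 'k::field" where
  "dl s i a = (\<lambda>t j. if t = s \<and> j = i then a else 0)"

lemma Fn_carrier: "f \<in> carrier (Fn n S) \<longleftrightarrow> (\<forall>s i. f s i \<noteq> 0 \<longrightarrow> s \<in> S \<and> fst s \<le> i \<and> i < snd s)"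
  by (simp add: Fn_def)

lemma Fn_zero_outside:
  "f \<in> carrier (Fn n S) \<Longrightarrow> s \<notin> S \<or> i < fst s \<or> snd s \<le> i \<Longrightarrow> f s i = 0"
  by (meson Fn_carrier not_le)

lemma Fn_ops:
  "\<zero>\<^bsub>Fn n S\<^esub> = (\<lambda>_ _. 0)"
  "f \<oplus>\<^bsub>Fn n S\<^esub> g = (\<lambda>s i. f s i + g s i)"
  "A \<odot>\<^bsub>Fn n S\<^esub> f = (\<lambda>s i. if fst s \<le> i \<and> i < snd s then \<Sum>j<n. A $$ (i, j) * f s j else 0)"
  by (simp_all add: Fn_def)

lemma intervalsD: "S \<subseteq> intervals n \<Longrightarrow> s \<in> S \<Longrightarrow> fst s < snd s \<and> snd s \<le> n"
  by (auto simp: intervals_def)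

lemma dl_carrier: "s \<in> S \<Longrightarrow> fst s \<le> i \<Longrightarrow> i < snd s \<Longrightarrow> dl s i a \<in> carrier (Fn n S)"
  by (auto simp: Fn_carrier dl_def)

lemma Fn_left_module:
  assumes S: "S \<subseteq> intervals n"
  shows "left_module (Lam n) (Fn n S :: ('k::field mat, _) module)"
proof (rule left_moduleI)
  show "ring (Lam n :: 'k mat ring)" by (rule ring_lower_tri_ring)
  show "\<zero>\<^bsub>Fn n S\<^esub> \<in> carrier (Fn n S :: ('k mat, _) module)" by (auto simp: Fn_carrier Fn_ops)
  fix f :: "nat \<times> nat \<Rightarrow> nat \<Rightarrow> 'k" assume f: "f \<in> carrier (Fn n S)"
  note fz = Fn_zero_outside[OF f]
  show "\<zero>\<^bsub>Fn n S\<^esub> \<oplus>\<^bsub>Fn n S\<^esub> f = f" by (simp add: Fn_ops)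
  show "\<exists>g\<in>carrier (Fn n S). g \<oplus>\<^bsub>Fn n S\<^esub> f = \<zero>\<^bsub>Fn n S\<^esub>"
    using f by (intro bexI[of _ "\<lambda>s i. - f s i"]) (auto simp: Fn_carrier Fn_ops)
  show "\<one>\<^bsub>Lam n\<^esub> \<odot>\<^bsub>Fn n S\<^esub> f = f"
  proof (intro ext)
    fix s i
    show "(\<one>\<^bsub>Lam n\<^esub> \<odot>\<^bsub>Fn n S\<^esub> f) s i = f s i"
    proof (cases "s \<in> S \<and> fst s \<le> i \<and> i < snd s")
      case True
      then have "i < n" using intervalsD[OF S] by fastforce
      then have "(\<Sum>j<n. 1\<^sub>m n $$ (i, j) * f s j) = (\<Sum>j<n. if j = i then f s j else 0)"
        by (intro sum.cong) auto
      then show ?thesis using True \<open>i < n\<close> by (simp add: Fn_ops Lam_ops)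
    next
      case False
      then show ?thesis using fz[of s i] fz[of s] by (auto simp: Fn_ops)
    qed
  qed
  { fix A :: "'k mat" assume A: "A \<in> carrier (Lam n)"
    have "(\<Sum>j<n. A $$ (i, j) * f s j) = 0" if "s \<notin> S" for s i using fz[of s] that by simp
    then show "A \<odot>\<^bsub>Fn n S\<^esub> f \<in> carrier (Fn n S)"
      by (auto simp: Fn_carrier Fn_ops split: if_splits)
    fix B :: "'k mat" assume B: "B \<in> carrier (Lam n)"
    have AB: "A \<in> carrier_mat n n" "B \<in> carrier_mat n n"
      "\<And>i j. i < j \<Longrightarrow> j < n \<Longrightarrow> A $$ (i, j) = 0" "\<And>i j. i < j \<Longrightarrow> j < n \<Longrightarrow> B $$ (i, j) = 0"
      using A B by (auto simp: Lam_carrier)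
    show "(A \<oplus>\<^bsub>Lam n\<^esub> B) \<odot>\<^bsub>Fn n S\<^esub> f = A \<odot>\<^bsub>Fn n S\<^esub> f \<oplus>\<^bsub>Fn n S\<^esub> B \<odot>\<^bsub>Fn n S\<^esub> f"
    proof (intro ext)
      fix s i
      show "((A \<oplus>\<^bsub>Lam n\<^esub> B) \<odot>\<^bsub>Fn n S\<^esub> f) s i = (A \<odot>\<^bsub>Fn n S\<^esub> f \<oplus>\<^bsub>Fn n S\<^esub> B \<odot>\<^bsub>Fn n S\<^esub> f) s i"
      proof (cases "s \<in> S \<and> i < snd s")
        case True
        then have "i < n" using intervalsD[OF S] by fastforce
        then show ?thesis using AB by (auto simp: Fn_ops Lam_ops sum.distrib[symmetric] algebra_simps intro!: sum.cong)
      next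
        case False
        then show ?thesis using fz[of s] by (auto simp: Fn_ops)
      qed
    qed
    show "(A \<otimes>\<^bsub>Lam n\<^esub> B) \<odot>\<^bsub>Fn n S\<^esub> f = A \<odot>\<^bsub>Fn n S\<^esub> (B \<odot>\<^bsub>Fn n S\<^esub> f)"
    proof (intro ext)
      fix s i
      show "((A \<otimes>\<^bsub>Lam n\<^esub> B) \<odot>\<^bsub>Fn n S\<^esub> f) s i = (A \<odot>\<^bsub>Fn n S\<^esub> (B \<odot>\<^bsub>Fn n S\<^esub> f)) s i"
      proof (cases "s \<in> S \<and> fst s \<le> i \<and> i < snd s")
        case True
        then have i: "i < n" "snd s \<le> n" using intervalsD[OF S] by fastforce+
        have "(\<Sum>j<n. (A * B) $$ (i, j) * f s j) = (\<Sum>j<n. (\<Sum>k<n. A $$ (i, k) * B $$ (k, j)) * f s j)"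
          using AB i by (auto simp: scalar_prod_def atLeast0LessThan intro!: sum.cong)
        also have "\<dots> = (\<Sum>j<n. \<Sum>k<n. A $$ (i, k) * (B $$ (k, j) * f s j))"
          by (simp add: sum_distrib_right mult.assoc)
        also have "\<dots> = (\<Sum>k<n. \<Sum>j<n. A $$ (i, k) * (B $$ (k, j) * f s j))"
          by (rule sum.swap)
        also have "\<dots> = (\<Sum>k<n. A $$ (i, k) * (\<Sum>j<n. B $$ (k, j) * f s j))"
          by (simp add: sum_distrib_left)
        \<comment> \<open>Cutting the inner vector off at the ends of \<open>s\<close> changes
          nothing: before \<open>fst s\<close> the inner sum vanishes because \<open>B\<close> is
          lower triangular, and for \<open>k \<ge> snd s\<close> one has \<open>i < k\<close>, so
          \<open>A $$ (i, k)\<close> is zero.\<close>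
        also have "\<dots> = (\<Sum>k<n. A $$ (i, k) * (if fst s \<le> k \<and> k < snd s then \<Sum>j<n. B $$ (k, j) * f s j else 0))"
        proof (rule sum.cong[OF refl])
          fix k assume k: "k \<in> {..<n}"
          consider "fst s \<le> k \<and> k < snd s" | "k < fst s" | "snd s \<le> k" by linarith
          then show "A $$ (i, k) * (\<Sum>j<n. B $$ (k, j) * f s j) =
            A $$ (i, k) * (if fst s \<le> k \<and> k < snd s then \<Sum>j<n. B $$ (k, j) * f s j else 0)"
          proof cases
            case 2
            have "B $$ (k, j) * f s j = 0" if "j < n" for j
              using fz[of s j] AB(4)[of k j] 2 that by (cases "k < j") auto
            then have "(\<Sum>j<n. B $$ (k, j) * f s j) = 0" by (intro sum.neutral) auto
            then show ?thesis by simp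
          next
            case 3
            then show ?thesis using AB(3)[of i k] True k by auto
          qed auto
        qed
        finally show ?thesis using True by (simp add: Fn_ops Lam_ops)
      next
        case False
        then show ?thesis using fz[of s] by (auto simp: Fn_ops intro!: sum.neutral)
      qed
    qed }
  fix g :: "nat \<times> nat \<Rightarrow> nat \<Rightarrow> 'k" assume g: "g \<in> carrier (Fn n S)"
  show "f \<oplus>\<^bsub>Fn n S\<^esub> g \<in> carrier (Fn n S)"
    unfolding Fn_carrier Fn_ops
  proof (intro allI impI)
    fix s i assume "f s i + g s i \<noteq> 0"
    then have "f s i \<noteq> 0 \<or> g s i \<noteq> 0" by auto
    then show "s \<in> S \<and> fst s \<le> i \<and> i < snd s" using f g unfolding Fn_carrier by blast
  qed
  show "f \<oplus>\<^bsub>Fn n S\<^esub> g = g \<oplus>\<^bsub>Fn n S\<^esub> f" by (auto simp: Fn_ops add.commute)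
  show "A \<odot>\<^bsub>Fn n S\<^esub> (f \<oplus>\<^bsub>Fn n S\<^esub> g) = A \<odot>\<^bsub>Fn n S\<^esub> f \<oplus>\<^bsub>Fn n S\<^esub> A \<odot>\<^bsub>Fn n S\<^esub> g" for A
    by (auto simp: Fn_ops sum.distrib algebra_simps intro!: ext)
  show "f \<oplus>\<^bsub>Fn n S\<^esub> g \<oplus>\<^bsub>Fn n S\<^esub> h = f \<oplus>\<^bsub>Fn n S\<^esub> (g \<oplus>\<^bsub>Fn n S\<^esub> h)" for h
    by (simp add: Fn_ops add.assoc)
qed

section \<open>Basis vectors and homomorphisms out of sums of interval modules\<close>

context
  fixes n :: nat and S :: "(nat \<times> nat) set"
  assumes S: "S \<subseteq> intervals n"
begin

lemma cl_smult_Fn: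
  fixes f :: "nat \<times> nat \<Rightarrow> nat \<Rightarrow> 'k::field"
  assumes f: "f \<in> carrier (Fn n S)" and x: "x < n"
  shows "(cl n x c \<odot>\<^bsub>Fn n S\<^esub> f) s i = (if x \<le> i \<and> fst s \<le> i \<and> i < snd s then c i * f s x else 0)"
proof (cases "s \<in> S \<and> i < snd s")
  case True
  then have i: "i < n" using intervalsD[OF S] by fastforce
  have "(\<Sum>j<n. cl n x c $$ (i, j) * f s j) = (\<Sum>j<n. if j = x then (if x \<le> i then c i * f s x else 0) else 0)"
    using i by (intro sum.cong) (auto simp: cl_def)
  then show ?thesis using x by (simp add: Fn_ops)
next
  case False
  then show ?thesis using Fn_zero_outside[OF f, of s] by (auto simp: Fn_ops)
qed

lemma Eu_smult_Fn:
  fixes f :: "nat \<times> nat \<Rightarrow> nat \<Rightarrow> 'k::field"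
  assumes f: "f \<in> carrier (Fn n S)" and x: "x < n"
  shows "(Eu n j x \<odot>\<^bsub>Fn n S\<^esub> f) s i = (if i = j \<and> x \<le> i \<and> fst s \<le> i \<and> i < snd s then f s x else 0)"
  unfolding Eu_def by (simp add: cl_smult_Fn[OF f x])

text \<open>There are only finitely many coordinates, so every element is a finite sum of vectors
  \<open>dl s i a\<close>. Additive identities need checking on these alone.\<close>

lemma Fn_induct [consumes 1, case_names zero dl add]:
  fixes f :: "nat \<times> nat \<Rightarrow> nat \<Rightarrow> 'k::field"
  assumes f: "f \<in> carrier (Fn n S)"
    and zero: "P (\<lambda>_ _. 0)"
    and dl: "\<And>s i a. s \<in> S \<Longrightarrow> fst s \<le> i \<Longrightarrow> i < snd s \<Longrightarrow> P (dl s i a)"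
    and add: "\<And>f g. f \<in> carrier (Fn n S) \<Longrightarrow> g \<in> carrier (Fn n S) \<Longrightarrow> P f \<Longrightarrow> P g \<Longrightarrow> P (f \<oplus>\<^bsub>Fn n S\<^esub> g)"
  shows "P f"
proof -
  define J where "J = {(s, i). s \<in> S \<and> fst s \<le> i \<and> i < snd s}"
  have "J \<subseteq> S \<times> {..n}" using intervalsD[OF S] by (fastforce simp: J_def)
  then have finJ: "finite J" by (rule finite_subset) (simp add: finite_subset[OF S finite_intervals])
  define res where "res K = (\<lambda>s i. if (s, i) \<in> K then f s i else 0)" for K
  have resc: "res K \<in> carrier (Fn n S)" for K using f by (auto simp: res_def Fn_carrier)
  have "P (res K)" if "finite K" "K \<subseteq> J" for K
    using that
  proof (induction K rule: finite_induct)
    case empty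
    then show ?case using zero by (simp add: res_def)
  next
    case (insert k K)
    obtain s i where k: "k = (s, i)" by (cases k)
    then have si: "s \<in> S" "fst s \<le> i" "i < snd s" using insert.prems by (auto simp: J_def)
    have "res (insert k K) = dl s i (f s i) \<oplus>\<^bsub>Fn n S\<^esub> res K"
      using insert.hyps k by (auto simp: res_def dl_def Fn_ops intro!: ext)
    then show ?case using add[OF dl_carrier resc] dl insert si by auto
  qed
  moreover have "res J = f"
  proof (intro ext)
    show "res J s i = f s i" for s i using Fn_zero_outside[OF f, of s i] by (auto simp: res_def J_def)
  qed
  ultimately show ?thesis using finJ by auto
qed

lemma dl_eq_cl:
  fixes a :: "'k::field"
  assumes "s \<in> S" "fst s \<le> i" "i < snd s"
  shows "dl s i a = cl n (fst s) (\<lambda>p. if p = i then a else 0) \<odot>\<^bsub>Fn n S\<^esub> dl s (fst s) 1"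
proof (intro ext)
  fix t j
  show "dl s i a t j = (cl n (fst s) (\<lambda>p. if p = i then a else 0) \<odot>\<^bsub>Fn n S\<^esub> dl s (fst s) 1) t j"
    using intervalsD[OF S assms(1)] assms
    by (subst cl_smult_Fn[OF dl_carrier]) (auto simp: dl_def)
qed

lemma Eu_dl:
  fixes a :: "'k::field"
  assumes "s \<in> S" "fst s \<le> i" "i < snd s" "i \<le> j" "j < n"
  shows "Eu n j i \<odot>\<^bsub>Fn n S\<^esub> dl s i a = (if j < snd s then dl s j a else \<zero>\<^bsub>Fn n S\<^esub>)"
proof (intro ext)
  fix t k
  show "(Eu n j i \<odot>\<^bsub>Fn n S\<^esub> dl s i a) t k = (if j < snd s then dl s j a else \<zero>\<^bsub>Fn n S\<^esub>) t k"
    using assms by (subst Eu_smult_Fn[OF dl_carrier]) (auto simp: dl_def Fn_ops)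
qed

lemma Fn_hom_eqI:
  fixes M :: "('k::field mat, 'v) module"
  assumes M: "left_module (Lam n) M" and f: "f \<in> mod_hom (Lam n) (Fn n S) M" and g: "g \<in> mod_hom (Lam n) (Fn n S) M"
    and eq: "\<And>s. s \<in> S \<Longrightarrow> f (dl s (fst s) 1) = g (dl s (fst s) 1)" and h: "h \<in> carrier (Fn n S)"
  shows "f h = g h"
  using h
proof (induction rule: Fn_induct)
  case zero
  show ?case using mod_hom_zero[OF Fn_left_module[OF S] M f] mod_hom_zero[OF Fn_left_module[OF S] M g]
    by (simp add: Fn_ops)
next
  case (dl s i a)
  have "dl s (fst s) 1 \<in> carrier (Fn n S :: ('k mat, _) module)" using dl by (intro dl_carrier) auto
  then show ?case
    unfolding dl_eq_cl[OF dl] using mod_homD(3)[OF f cl_closed] mod_homD(3)[OF g cl_closed] eq[OF dl(1)] by simp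
next
  case (add h h')
  then show ?case using mod_homD(2)[OF f] mod_homD(2)[OF g] by simp
qed

lemma Fn_fg: "(Fn n S :: ('k::field mat, _) module) \<in> fg_modules (Lam n)"
proof -
  let ?G = "(\<lambda>s. dl s (fst s) (1::'k)) ` S"
  have mem: "dl s (fst s) (1::'k) \<in> carrier (Fn n S)" if "s \<in> S" for s
    using intervalsD[OF S that] that by (intro dl_carrier) auto
  have "H = carrier (Fn n S)" if H: "submodule H (Lam n) (Fn n S)" "?G \<subseteq> H" for H
  proof -
    note D = left_module.submoduleD[OF Fn_left_module[OF S] H(1)]
    have "f \<in> H" if "f \<in> carrier (Fn n S)" for f
      using that
    proof (induction rule: Fn_induct)
      case zero show ?case using D(2) by (simp add: Fn_ops)
    next
      case (dl s i a)
      then show ?case unfolding dl_eq_cl[OF dl] using D(4)[OF cl_closed] H(2) by blast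
    next
      case (add f g)
      then show ?case using D(3) by simp
    qed
    then show ?thesis using D(1) by blast
  qed
  then show ?thesis
    using Fn_left_module[OF S] finite_subset[OF S finite_intervals] mem
    by (auto simp: fg_modules_def intro!: exI[of _ ?G])
qed

text \<open>The universal property of a sum of interval modules: \<open>w s\<close> is the intended
  image of the generator of \<open>s\<close>, and the coordinates of \<open>f\<close> in
  \<open>s\<close> are read as a column acting on it.\<close>

definition lift_hom :: "('k::field mat, 'v) module \<Rightarrow> (nat \<times> nat \<Rightarrow> 'v) \<Rightarrow> (nat \<times> nat \<Rightarrow> nat \<Rightarrow> 'k) \<Rightarrow> 'v" where
  "lift_hom M w f = finsum M (\<lambda>s. cl n (fst s) (f s) \<odot>\<^bsub>M\<^esub> w s) S"

text \<open>The interval \<open>(x, y)\<close> is the projective at \<open>x\<close> modulo its part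
  from vertex \<open>y\<close> on, so the only relation to respect is that the path from
  \<open>x\<close> to \<open>y\<close> kills \<open>w s\<close>; for \<open>y = n\<close> there is
  none. The generator goes to the component of \<open>w s\<close> at \<open>x\<close>, since
  \<open>w s\<close> itself may have others.\<close>

lemma lift_hom:
  fixes M :: "('k::field mat, 'v) module"
  assumes M: "left_module (Lam n) M"
    and w: "\<And>s. s \<in> S \<Longrightarrow> w s \<in> carrier M"
    and w0: "\<And>s. s \<in> S \<Longrightarrow> snd s < n \<Longrightarrow> Eu n (snd s) (fst s) \<odot>\<^bsub>M\<^esub> w s = \<zero>\<^bsub>M\<^esub>"
  shows "lift_hom M w \<in> mod_hom (Lam n) (Fn n S) M"
    and "\<And>s. s \<in> S \<Longrightarrow> lift_hom M w (dl s (fst s) 1) = Eu n (fst s) (fst s) \<odot>\<^bsub>M\<^esub> w s"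
proof -
  interpret left_module "Lam n" M by fact
  have finS: "finite S" by (rule finite_subset[OF S finite_intervals])
  have c: "cl n (fst s) d \<odot>\<^bsub>M\<^esub> w s \<in> carrier M" if "s \<in> S" for s d
    using w[OF that] cl_closed smult_closed by blast
  \<comment> \<open>A column whose entries before \<open>snd s\<close> vanish factors through the
    path to \<open>snd s\<close>, hence acts on \<open>w s\<close> by zero.\<close>
  have tail: "cl n (fst s) d \<odot>\<^bsub>M\<^esub> w s = \<zero>\<^bsub>M\<^esub>" if s: "s \<in> S" and d: "\<And>i. i < snd s \<Longrightarrow> d i = 0" for s d
  proof (cases "snd s < n")
    case True
    have "cl n (fst s) d = cl n (snd s) d \<otimes>\<^bsub>Lam n\<^esub> Eu n (snd s) (fst s)"
      unfolding Eu_def using True d intervalsD[OF S s]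
      by (subst cl_mult_cl) (auto intro!: cl_cong)
    then have "cl n (fst s) d \<odot>\<^bsub>M\<^esub> w s = cl n (snd s) d \<odot>\<^bsub>M\<^esub> (Eu n (snd s) (fst s) \<odot>\<^bsub>M\<^esub> w s)"
      using smult_assoc[OF cl_closed Eu_closed w[OF s]] by simp
    then show ?thesis using w0[OF s True] smult_zero[OF cl_closed] by simp
  next
    case False
    then have "cl n (fst s) d = \<zero>\<^bsub>Lam n\<^esub>" using d intervalsD[OF S s]
      by (subst cl_zero[symmetric]) (auto intro!: cl_cong)
    then show ?thesis using zero_smult[OF w[OF s]] by simp
  qed
  have eq: "cl n (fst s) d \<odot>\<^bsub>M\<^esub> w s = cl n (fst s) d' \<odot>\<^bsub>M\<^esub> w s"
    if s: "s \<in> S" and d: "\<And>i. fst s \<le> i \<Longrightarrow> i < snd s \<Longrightarrow> d i = d' i" for s d d'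
  proof -
    define e where "e i = (if fst s \<le> i then d i - d' i else 0)" for i
    have "cl n (fst s) d = cl n (fst s) d' \<oplus>\<^bsub>Lam n\<^esub> cl n (fst s) e"
      unfolding cl_add by (rule cl_cong) (auto simp: e_def)
    then have "cl n (fst s) d \<odot>\<^bsub>M\<^esub> w s = cl n (fst s) d' \<odot>\<^bsub>M\<^esub> w s \<oplus>\<^bsub>M\<^esub> cl n (fst s) e \<odot>\<^bsub>M\<^esub> w s"
      using smult_l_distr[OF cl_closed cl_closed w[OF s]] by simp
    moreover have "cl n (fst s) e \<odot>\<^bsub>M\<^esub> w s = \<zero>\<^bsub>M\<^esub>"
      using d by (intro tail[OF s]) (auto simp: e_def)
    ultimately show ?thesis using c[OF s] by simp
  qed
  show "lift_hom M w \<in> mod_hom (Lam n) (Fn n S) M"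
  proof (rule mod_homI)
    fix f g :: "nat \<times> nat \<Rightarrow> nat \<Rightarrow> 'k" assume fg: "f \<in> carrier (Fn n S)" "g \<in> carrier (Fn n S)"
    have "lift_hom M w (f \<oplus>\<^bsub>Fn n S\<^esub> g) =
      finsum M (\<lambda>s. cl n (fst s) (f s) \<odot>\<^bsub>M\<^esub> w s \<oplus>\<^bsub>M\<^esub> cl n (fst s) (g s) \<odot>\<^bsub>M\<^esub> w s) S"
      unfolding lift_hom_def Fn_ops
      using c w by (intro M.finsum_cong') (auto simp: cl_add[symmetric] smult_l_distr cl_closed)
    also have "\<dots> = lift_hom M w f \<oplus>\<^bsub>M\<^esub> lift_hom M w g"
      unfolding lift_hom_def using c by (intro M.finsum_addf) auto
    finally show "lift_hom M w (f \<oplus>\<^bsub>Fn n S\<^esub> g) = lift_hom M w f \<oplus>\<^bsub>M\<^esub> lift_hom M w g" .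
  next
    fix f :: "nat \<times> nat \<Rightarrow> nat \<Rightarrow> 'k" and A :: "'k mat"
    assume f: "f \<in> carrier (Fn n S)" and A: "A \<in> carrier (Lam n)"
    have "lift_hom M w (A \<odot>\<^bsub>Fn n S\<^esub> f) = finsum M (\<lambda>s. A \<odot>\<^bsub>M\<^esub> (cl n (fst s) (f s) \<odot>\<^bsub>M\<^esub> w s)) S"
      unfolding lift_hom_def
    proof (rule M.finsum_cong'[OF refl])
      fix s assume s: "s \<in> S"
      have x: "fst s < n" using intervalsD[OF S s] by simp
      have "A \<odot>\<^bsub>M\<^esub> (cl n (fst s) (f s) \<odot>\<^bsub>M\<^esub> w s) = cl n (fst s) (\<lambda>i. \<Sum>j\<in>{fst s..<n}. A $$ (i, j) * f s j) \<odot>\<^bsub>M\<^esub> w s"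
        using smult_assoc[OF A cl_closed[of n "fst s" "f s"] w[OF s]] mult_cl[OF A x, of "f s"] by simp
      also have "\<dots> = cl n (fst s) ((A \<odot>\<^bsub>Fn n S\<^esub> f) s) \<odot>\<^bsub>M\<^esub> w s"
      proof (rule eq[OF s])
        fix i assume i: "fst s \<le> i" "i < snd s"
        have "(\<Sum>j\<in>{fst s..<n}. A $$ (i, j) * f s j) = (\<Sum>j<n. A $$ (i, j) * f s j)"
          using Fn_zero_outside[OF f, of s] by (intro sum.mono_neutral_left) auto
        then show "(\<Sum>j\<in>{fst s..<n}. A $$ (i, j) * f s j) = (A \<odot>\<^bsub>Fn n S\<^esub> f) s i"
          using i by (simp add: Fn_ops)
      qed
      finally show "cl n (fst s) ((A \<odot>\<^bsub>Fn n S\<^esub> f) s) \<odot>\<^bsub>M\<^esub> w s = A \<odot>\<^bsub>M\<^esub> (cl n (fst s) (f s) \<odot>\<^bsub>M\<^esub> w s)" ..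
    qed (use c smult_closed[OF A] in auto)
    also have "\<dots> = A \<odot>\<^bsub>M\<^esub> lift_hom M w f"
      unfolding lift_hom_def using c by (intro smult_finsum[OF A, symmetric]) auto
    finally show "lift_hom M w (A \<odot>\<^bsub>Fn n S\<^esub> f) = A \<odot>\<^bsub>M\<^esub> lift_hom M w f" .
  qed (use c in \<open>auto simp: lift_hom_def intro!: M.finsum_closed\<close>)
  fix s assume s: "s \<in> S"
  have "lift_hom M w (dl s (fst s) 1) =
      finsum M (\<lambda>t. if s = t then Eu n (fst t) (fst t) \<odot>\<^bsub>M\<^esub> w t else \<zero>\<^bsub>M\<^esub>) S"
    unfolding lift_hom_def
  proof (rule M.finsum_cong'[OF refl])
    show "(\<lambda>t. if s = t then Eu n (fst t) (fst t) \<odot>\<^bsub>M\<^esub> w t else \<zero>\<^bsub>M\<^esub>) \<in> S \<rightarrow> carrier M"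
      using c by (auto simp: Eu_def)
    fix t assume t: "t \<in> S"
    show "cl n (fst t) (dl s (fst s) 1 t) \<odot>\<^bsub>M\<^esub> w t =
      (if s = t then Eu n (fst t) (fst t) \<odot>\<^bsub>M\<^esub> w t else \<zero>\<^bsub>M\<^esub>)"
    proof (cases "s = t")
      case True
      then show ?thesis by (simp add: Eu_def dl_def)
    next
      case False
      then have "dl s (fst s) 1 t = (\<lambda>_. 0::'k)" by (auto simp: dl_def)
      then show ?thesis using False zero_smult[OF w[OF t]] by (simp add: cl_zero)
    qed
  qed
  also have "\<dots> = Eu n (fst s) (fst s) \<odot>\<^bsub>M\<^esub> w s"
    using M.finsum_singleton[OF s finS, of "\<lambda>t. Eu n (fst t) (fst t) \<odot>\<^bsub>M\<^esub> w t"] c by (auto simp: Eu_def)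
  finally show "lift_hom M w (dl s (fst s) 1) = Eu n (fst s) (fst s) \<odot>\<^bsub>M\<^esub> w s" .
qed

lemma Fn_to_vec: "\<exists>h :: (nat \<times> nat \<Rightarrow> nat \<Rightarrow> 'k::field) \<Rightarrow> 'k vec. inj_on h (carrier (Fn n S))"
proof -
  let ?J = "intervals n \<times> {..<n}"
  have "finite ?J" using finite_intervals by simp
  then obtain e where e: "bij_betw e {0..<card ?J} ?J" using ex_bij_betw_nat_finite by blast
  define h :: "(nat \<times> nat \<Rightarrow> nat \<Rightarrow> 'k) \<Rightarrow> 'k vec" where
    "h f = vec (card ?J) (\<lambda>k. f (fst (e k)) (snd (e k)))" for f
  have "inj_on h (carrier (Fn n S))"
  proof (rule inj_onI)
    fix f g assume fg: "f \<in> carrier (Fn n S)" "g \<in> carrier (Fn n S)" "h f = h g"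
    have "f s i = g s i" for s i
    proof (cases "(s, i) \<in> ?J")
      case True
      then have "(s, i) \<in> e ` {0..<card ?J}" using bij_betw_imp_surj_on[OF e] by simp
      then obtain k where k: "k < card ?J" "e k = (s, i)" by auto
      then have "h f $ k = h g $ k" using fg by simp
      then show ?thesis using k by (simp add: h_def)
    next
      case False
      then have "s \<notin> S \<or> i < fst s \<or> snd s \<le> i" using S intervalsD[OF S, of s] by fastforce
      then show ?thesis using Fn_zero_outside[OF fg(1)] Fn_zero_outside[OF fg(2)] by metis
    qed
    then show "f = g" by blast
  qed
  then show ?thesis by blast
qed

end

text \<open>The representative on \<open>'k vec\<close> that the posets ask for. Any injection will
  do, because addition and action are copied along it and have nothing to do with those of
  vectors.\<close>

definition Vn :: "nat \<Rightarrow> (nat \<times> nat) set \<Rightarrow> ('k::field mat, 'k vec) module" where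
  "Vn n S = transport (SOME h. inj_on h (carrier (Fn n S :: ('k mat, _) module))) (Fn n S)"

lemma Vn_iso:
  assumes "S \<subseteq> intervals n"
  shows "isomorphic_mod (Lam n) (Fn n S :: ('k::field mat, _) module) (Vn n S)"
    and "isomorphic_mod (Lam n) (Vn n S) (Fn n S :: ('k::field mat, _) module)"
    and "left_module (Lam n) (Vn n S :: ('k::field mat, _) module)"
    and "(Vn n S :: ('k::field mat, _) module) \<in> fg_modules (Lam n)"
proof -
  define h :: "(nat \<times> nat \<Rightarrow> nat \<Rightarrow> 'k) \<Rightarrow> 'k vec"
    where "h = (SOME h. inj_on h (carrier (Fn n S :: ('k mat, _) module)))"
  have h: "inj_on h (carrier (Fn n S))"
    unfolding h_def by (rule someI_ex[OF Fn_to_vec[OF assms]])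
  have V: "Vn n S = transport h (Fn n S)" by (simp add: Vn_def h_def)
  note iso = transport_iso[OF h, of "Lam n"]
  show L: "left_module (Lam n) (Vn n S :: ('k mat, _) module)"
    unfolding V by (rule transport_left_module[OF Fn_left_module[OF assms] h])
  show "isomorphic_mod (Lam n) (Fn n S :: ('k mat, _) module) (Vn n S)"
    unfolding V by (rule isomorphic_modI[OF iso])
  then show "isomorphic_mod (Lam n) (Vn n S) (Fn n S :: ('k mat, _) module)"
    by (rule isomorphic_mod_sym[OF Fn_left_module[OF assms]])
  show "(Vn n S :: ('k mat, _) module) \<in> fg_modules (Lam n)"
    using fg_modules_iso[OF Fn_fg[OF assms] _ iso] L unfolding V by blast
qed

subsection \<open>Indecomposable modules\<close>

lemma Fn_single_carrier: "f \<in> carrier (Fn n {s}) \<Longrightarrow> t \<noteq> s \<Longrightarrow> f t i = 0"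
  using Fn_zero_outside[of f n "{s}" t i] by simp

lemma dl_nonzero: "dl s i (1::'k::field) \<noteq> \<zero>\<^bsub>Fn n S\<^esub>"
proof
  assume "dl s i (1::'k) = \<zero>\<^bsub>Fn n S\<^esub>"
  then have "dl s i (1::'k) s i = 0" by (simp add: Fn_ops)
  then show False by (simp add: dl_def)
qed

text \<open>A nonzero coordinate at \<open>i\<close> can be carried to the last vertex and
  normalised by a single matrix. So the socle is simple and lies in every nonzero submodule; two
  nonzero submodules always meet, and a homomorphism that does not kill the socle is
  injective.\<close>

lemma Fn_single_socle:
  assumes s: "s \<in> intervals n" and H: "submodule H (Lam n) (Fn n {s} :: ('k::field mat, _) module)"
    and f: "f \<in> H" "f \<noteq> \<zero>\<^bsub>Fn n {s}\<^esub>"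
  shows "dl s (snd s - 1) 1 \<in> H"
proof -
  have S: "{s} \<subseteq> intervals n" using s by simp
  note D = left_module.submoduleD[OF Fn_left_module[OF S] H]
  have fc: "f \<in> carrier (Fn n {s})" using f D(1) by blast
  obtain i where i: "f s i \<noteq> 0"
    using f(2) Fn_single_carrier[OF fc] by (force simp: Fn_ops intro!: ext)
  then have si: "fst s \<le> i" "i < snd s" using fc unfolding Fn_carrier by blast+
  have n: "snd s \<le> n" "i < n" using intervalsD[OF S, of s] si by auto
  define c where "c = (\<lambda>p. if p = snd s - 1 then inverse (f s i) else 0)"
  have "cl n i c \<odot>\<^bsub>Fn n {s}\<^esub> f = dl s (snd s - 1) 1"
  proof (intro ext)
    fix t j
    show "(cl n i c \<odot>\<^bsub>Fn n {s}\<^esub> f) t j = dl s (snd s - 1) 1 t j"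
      using Fn_single_carrier[OF fc, of t] i si
      by (subst cl_smult_Fn[OF S fc n(2)]) (auto simp: c_def dl_def)
  qed
  then show ?thesis using D(4)[OF cl_closed f(1), of i c] by simp
qed

lemma Fn_single_indecomposable:
  assumes s: "s \<in> intervals n"
  shows "indecomposable (Lam n) (Fn n {s} :: ('k::field mat, _) module)"
  unfolding indecomposable_def
proof (intro conjI allI impI)
  have S: "{s} \<subseteq> intervals n" using s by simp
  have xy: "fst s < snd s" using intervalsD[OF S, of s] by simp
  show "(Fn n {s} :: ('k mat, _) module) \<in> fg_modules (Lam n)" by (rule Fn_fg[OF S])
  have mem: "dl s (snd s - 1) (1::'k) \<in> carrier (Fn n {s})" using xy by (intro dl_carrier) auto
  have ne: "dl s (snd s - 1) (1::'k) \<noteq> \<zero>\<^bsub>Fn n {s}\<^esub>"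
    by (rule dl_nonzero)
  show "carrier (Fn n {s} :: ('k mat, _) module) \<noteq> {\<zero>\<^bsub>Fn n {s}\<^esub>}"
    using mem ne by auto
  fix A B :: "(nat \<times> nat \<Rightarrow> nat \<Rightarrow> 'k) set"
  assume AB: "submodule A (Lam n) (Fn n {s}) \<and> submodule B (Lam n) (Fn n {s}) \<and>
    A \<inter> B = {\<zero>\<^bsub>Fn n {s}\<^esub>} \<and> A <+>\<^bsub>Fn n {s}\<^esub> B = carrier (Fn n {s})"
  show "A = {\<zero>\<^bsub>Fn n {s}\<^esub>} \<or> B = {\<zero>\<^bsub>Fn n {s}\<^esub>}"
  proof (rule ccontr)
    assume "\<not> ?thesis"
    then obtain a b where "a \<in> A" "a \<noteq> \<zero>\<^bsub>Fn n {s}\<^esub>" "b \<in> B" "b \<noteq> \<zero>\<^bsub>Fn n {s}\<^esub>"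
      using AB by blast
    then have "dl s (snd s - 1) 1 \<in> A \<inter> B"
      using AB Fn_single_socle[OF s] by blast
    then show False using AB ne by simp
  qed
qed

lemma submodule_image:
  assumes M: "left_module R M" and N: "left_module R N" and f: "f \<in> mod_hom R M N"
  shows "submodule (f ` carrier M) R N"
proof -
  interpret M: left_module R M by fact
  interpret N: left_module R N by fact
  note h = mod_homD[OF f]
  show ?thesis
  proof (rule N.submoduleI)
    show "f ` carrier M \<subseteq> carrier N" using h(1) by blast
    show "\<zero>\<^bsub>N\<^esub> \<in> f ` carrier M"
      using mod_hom_zero[OF M N f] M.zero_closed by (metis imageI)
    fix x y assume "x \<in> f ` carrier M" "y \<in> f ` carrier M"
    then obtain a b where ab: "a \<in> carrier M" "x = f a" "b \<in> carrier M" "y = f b" by auto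
    then have "x \<oplus>\<^bsub>N\<^esub> y = f (a \<oplus>\<^bsub>M\<^esub> b)" using h(2) by simp
    then show "x \<oplus>\<^bsub>N\<^esub> y \<in> f ` carrier M" using ab by simp
  next
    fix r x assume "r \<in> carrier R" "x \<in> f ` carrier M"
    then obtain a where a: "a \<in> carrier M" "x = f a" "r \<in> carrier R" by auto
    then have "r \<odot>\<^bsub>N\<^esub> x = f (r \<odot>\<^bsub>M\<^esub> a)" using h(3) by simp
    then show "r \<odot>\<^bsub>N\<^esub> x \<in> f ` carrier M" using a M.smult_closed by simp
  qed
qed

context left_module
begin

lemma submodule_finsum:
  assumes "submodule H R M" "f \<in> A \<rightarrow> H"
  shows "finsum M f A \<in> H"
  using assms(2)
proof (induction A rule: infinite_finite_induct)
  case (insert i A)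
  then have "f i \<in> H" "f \<in> A \<rightarrow> carrier M" "f i \<in> carrier M" "finsum M f A \<in> H"
    using submoduleD(1)[OF assms(1)] by auto
  then show ?case using insert submoduleD(3)[OF assms(1)] by simp
qed (auto simp: submoduleD(2)[OF assms(1)])

lemma submodule_add_cyclic:
  assumes B: "submodule B R M" and x: "x \<in> carrier M"
  shows "submodule {b \<oplus>\<^bsub>M\<^esub> r \<odot>\<^bsub>M\<^esub> x | b r. b \<in> B \<and> r \<in> carrier R} R M"
proof (rule submoduleI)
  note D = submoduleD[OF B]
  have DB: "b \<in> carrier M" if "b \<in> B" for b using D(1) that by blast
  show "{b \<oplus>\<^bsub>M\<^esub> r \<odot>\<^bsub>M\<^esub> x | b r. b \<in> B \<and> r \<in> carrier R} \<subseteq> carrier M" (is "?H \<subseteq> _")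
    using DB x smult_closed by auto
  have "\<zero>\<^bsub>M\<^esub> = \<zero>\<^bsub>M\<^esub> \<oplus>\<^bsub>M\<^esub> \<zero>\<^bsub>R\<^esub> \<odot>\<^bsub>M\<^esub> x" using zero_smult[OF x] by simp
  then show "\<zero>\<^bsub>M\<^esub> \<in> ?H" using D(2) by blast
  fix y z assume "y \<in> ?H" "z \<in> ?H"
  then obtain b r c t where e: "y = b \<oplus>\<^bsub>M\<^esub> r \<odot>\<^bsub>M\<^esub> x" "z = c \<oplus>\<^bsub>M\<^esub> t \<odot>\<^bsub>M\<^esub> x" and bc: "b \<in> B" "c \<in> B" and rt: "r \<in> carrier R" "t \<in> carrier R"
    by blast
  then have "y \<oplus>\<^bsub>M\<^esub> z = (b \<oplus>\<^bsub>M\<^esub> c) \<oplus>\<^bsub>M\<^esub> (r \<oplus>\<^bsub>R\<^esub> t) \<odot>\<^bsub>M\<^esub> x"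
    using x DB smult_closed[OF rt(1) x] smult_closed[OF rt(2) x]
    by (simp add: smult_l_distr M.a_ac)
  then show "y \<oplus>\<^bsub>M\<^esub> z \<in> ?H" using D(3)[OF bc] R.a_closed[OF rt] by blast
next
  note D = submoduleD[OF B]
  fix a y assume a: "a \<in> carrier R" and "y \<in> {b \<oplus>\<^bsub>M\<^esub> r \<odot>\<^bsub>M\<^esub> x | b r. b \<in> B \<and> r \<in> carrier R}"
  then obtain b r where e: "y = b \<oplus>\<^bsub>M\<^esub> r \<odot>\<^bsub>M\<^esub> x" and b: "b \<in> B" and r: "r \<in> carrier R" by blast
  have "b \<in> carrier M" using D(1) b by blast
  then have "a \<odot>\<^bsub>M\<^esub> y = a \<odot>\<^bsub>M\<^esub> b \<oplus>\<^bsub>M\<^esub> (a \<otimes>\<^bsub>R\<^esub> r) \<odot>\<^bsub>M\<^esub> x"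
    using e a r x smult_closed by (simp add: smult_r_distr smult_assoc)
  then show "a \<odot>\<^bsub>M\<^esub> y \<in> {b \<oplus>\<^bsub>M\<^esub> r \<odot>\<^bsub>M\<^esub> x | b r. b \<in> B \<and> r \<in> carrier R}"
    using D(4)[OF a b] R.m_closed[OF a r] by blast
qed

text \<open>Zorn's lemma: a chain of submodules that avoid \<open>w\<close> has a union of the same
  kind. The result plays the role of a complement before one is known to exist.\<close>

lemma maximal_submodule_avoiding:
  assumes w: "w \<noteq> \<zero>\<^bsub>M\<^esub>"
  obtains B where "submodule B R M" "w \<notin> B" "\<And>H. submodule H R M \<Longrightarrow> B \<subseteq> H \<Longrightarrow> H \<noteq> B \<Longrightarrow> w \<in> H"
proof -
  let ?A = "{B. submodule B R M \<and> w \<notin> B}"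
  have "submodule {\<zero>\<^bsub>M\<^esub>} R M" by (rule submoduleI) (auto simp: smult_zero)
  then have "?A \<noteq> {}" using w by blast
  moreover have "\<Union>C \<in> ?A" if C: "C \<noteq> {}" "subset.chain ?A C" for C
  proof -
    have CA: "H \<in> C \<Longrightarrow> submodule H R M \<and> w \<notin> H" for H using C(2) by (auto simp: subset.chain_def)
    have dir: "H \<in> C \<Longrightarrow> K \<in> C \<Longrightarrow> H \<subseteq> K \<or> K \<subseteq> H" for H K
      using C(2) by (auto simp: subset.chain_def)
    have "submodule (\<Union>C) R M"
    proof (rule submoduleI)
      show "\<Union>C \<subseteq> carrier M" using CA submoduleD(1) by blast
      show "\<zero>\<^bsub>M\<^esub> \<in> \<Union>C" using CA C(1) submoduleD(2) by blast
      fix x y assume "x \<in> \<Union>C" "y \<in> \<Union>C"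
      then obtain H K where HK: "H \<in> C" "x \<in> H" "K \<in> C" "y \<in> K" by blast
      then have "\<exists>L\<in>C. x \<in> L \<and> y \<in> L" using dir[of H K] by blast
      then show "x \<oplus>\<^bsub>M\<^esub> y \<in> \<Union>C" using CA submoduleD(3) by blast
    next
      fix a x assume "a \<in> carrier R" "x \<in> \<Union>C"
      then show "a \<odot>\<^bsub>M\<^esub> x \<in> \<Union>C" using CA submoduleD(4) by blast
    qed
    then show ?thesis using CA by blast
  qed
  ultimately have "\<exists>B\<in>?A. \<forall>X\<in>?A. B \<subseteq> X \<longrightarrow> X = B" by (rule subset_Zorn_nonempty)
  then show thesis using that by blast
qed

end

lemma Eu_mult_cl_zero:
  assumes "b < i" "i < n"
  shows "Eu n b b \<otimes>\<^bsub>Lam n\<^esub> cl n i c = \<zero>\<^bsub>Lam n\<^esub>"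
proof -
  have "Eu n b b \<otimes>\<^bsub>Lam n\<^esub> cl n i c = cl n i (\<lambda>_. 0)"
    using assms by (subst mult_cl[OF Eu_closed]) (auto intro!: cl_cong sum.neutral simp: Eu_def cl_def)
  then show ?thesis by (simp add: cl_zero)
qed

text \<open>Choose the first vertex \<open>a\<close> where \<open>M\<close> does not vanish, then the last vertex \<open>b\<close> that can be
  reached from there, and \<open>w \<noteq> 0\<close> in the image of \<open>M\<^sub>a \<rightarrow> M\<^sub>b\<close>. A submodule that is maximal among those
  not containing \<open>w\<close> is a complement of the submodule generated by a preimage of \<open>w\<close>.\<close>

lemma indecomposable_interval:
  fixes M :: "('k::field mat, 'v) module"
  assumes M: "indecomposable (Lam n) M"
  shows "\<exists>s\<in>intervals n. isomorphic_mod (Lam n) (Fn n {s} :: ('k mat, _) module) M"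
proof -
  have L: "left_module (Lam n) M" using M by (auto simp: indecomposable_def fg_modules_def)
  interpret left_module "Lam n" M by fact
  note Ec = smult_closed[OF Eu_closed]
  have EE: "Eu n i j \<odot>\<^bsub>M\<^esub> (Eu n j k \<odot>\<^bsub>M\<^esub> x) = Eu n i k \<odot>\<^bsub>M\<^esub> x"
    if "k \<le> j" "j \<le> i" "i < n" "x \<in> carrier M" for i j k x
    using that by (simp add: smult_assoc[OF Eu_closed Eu_closed that(4), symmetric] Eu_mult)
  obtain u where u: "u \<in> carrier M" "u \<noteq> \<zero>\<^bsub>M\<^esub>"
    using M M.zero_closed by (auto simp: indecomposable_def)
  have "\<exists>i<n. Eu n i i \<odot>\<^bsub>M\<^esub> u \<noteq> \<zero>\<^bsub>M\<^esub>"
  proof (rule ccontr)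
    assume "\<not> ?thesis"
    then have "finsum M (\<lambda>i. Eu n i i \<odot>\<^bsub>M\<^esub> u) {..<n} = finsum M (\<lambda>i. \<zero>\<^bsub>M\<^esub>) {..<n}"
      by (intro M.finsum_cong') auto
    then show False using u left_module_decomp[OF L u(1)] by simp
  qed
  then have exa: "\<exists>i. i < n \<and> (\<exists>u\<in>carrier M. Eu n i i \<odot>\<^bsub>M\<^esub> u \<noteq> \<zero>\<^bsub>M\<^esub>)" using u by blast
  define a where "a = (LEAST i. i < n \<and> (\<exists>u\<in>carrier M. Eu n i i \<odot>\<^bsub>M\<^esub> u \<noteq> \<zero>\<^bsub>M\<^esub>))"
  have a: "a < n" "\<exists>u\<in>carrier M. Eu n a a \<odot>\<^bsub>M\<^esub> u \<noteq> \<zero>\<^bsub>M\<^esub>" using LeastI_ex[OF exa] by (auto simp: a_def)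
  have amin: "Eu n i i \<odot>\<^bsub>M\<^esub> x = \<zero>\<^bsub>M\<^esub>" if "i < a" "x \<in> carrier M" for i x
    using not_less_Least[of i "\<lambda>i. i < n \<and> (\<exists>u\<in>carrier M. Eu n i i \<odot>\<^bsub>M\<^esub> u \<noteq> \<zero>\<^bsub>M\<^esub>)"] that a(1)
    by (auto simp: a_def[symmetric])
  define Q where "Q b \<longleftrightarrow> a \<le> b \<and> b < n \<and> (\<exists>u\<in>carrier M. Eu n b a \<odot>\<^bsub>M\<^esub> u \<noteq> \<zero>\<^bsub>M\<^esub>)" for b
  have Qa: "Q a" using a by (auto simp: Q_def)
  have Qn: "Q b \<Longrightarrow> b \<le> n" for b by (auto simp: Q_def)
  define b where "b = (GREATEST b. Q b)"
  have "Q b" unfolding b_def using GreatestI_nat[of Q a n] Qa Qn by blast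
  then have b: "a \<le> b" "b < n" and "\<exists>u\<in>carrier M. Eu n b a \<odot>\<^bsub>M\<^esub> u \<noteq> \<zero>\<^bsub>M\<^esub>" by (auto simp: Q_def)
  then obtain v0 where v0: "v0 \<in> carrier M" "Eu n b a \<odot>\<^bsub>M\<^esub> v0 \<noteq> \<zero>\<^bsub>M\<^esub>" by blast
  have bmax: "Eu n j a \<odot>\<^bsub>M\<^esub> x = \<zero>\<^bsub>M\<^esub>" if "b < j" "j < n" "x \<in> carrier M" for j x
  proof (rule ccontr)
    assume "\<not> ?thesis"
    then have "Q j" using that b by (auto simp: Q_def)
    then have "j \<le> b" unfolding b_def using Greatest_le_nat[of Q j n] Qn by blast
    then show False using that by simp
  qed
  define v where "v = Eu n a a \<odot>\<^bsub>M\<^esub> v0"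
  define w where "w = Eu n b a \<odot>\<^bsub>M\<^esub> v"
  have v: "v \<in> carrier M" "Eu n a a \<odot>\<^bsub>M\<^esub> v = v" using v0 Ec EE[of a a a v0] a by (auto simp: v_def)
  have w: "w \<in> carrier M" "w \<noteq> \<zero>\<^bsub>M\<^esub>" "Eu n b b \<odot>\<^bsub>M\<^esub> w = w"
    using v0 v Ec EE[of a a b v0] EE[of a b b v] b by (auto simp: w_def v_def)
  obtain B where B: "submodule B (Lam n) M" "w \<notin> B"
    and Bmax: "\<And>H. submodule H (Lam n) M \<Longrightarrow> B \<subseteq> H \<Longrightarrow> H \<noteq> B \<Longrightarrow> w \<in> H"
    using maximal_submodule_avoiding[OF w(2)] by blast
  note BD = submoduleD[OF B(1)]
  have Bc: "x \<in> carrier M" if "x \<in> B" for x using BD(1) that by blast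
  \<comment> \<open>By maximality the submodule generated by \<open>B\<close> and any
    \<open>x\<close> outside \<open>B\<close> contains \<open>w\<close>.\<close>
  have key: "\<exists>\<beta>\<in>B. \<exists>r\<in>carrier (Lam n). w = \<beta> \<oplus>\<^bsub>M\<^esub> r \<odot>\<^bsub>M\<^esub> x" if x: "x \<in> carrier M" "x \<notin> B" for x
  proof -
    let ?H = "{\<beta> \<oplus>\<^bsub>M\<^esub> r \<odot>\<^bsub>M\<^esub> x | \<beta> r. \<beta> \<in> B \<and> r \<in> carrier (Lam n)}"
    have "\<beta> \<in> ?H" if "\<beta> \<in> B" for \<beta>
      using that zero_smult[OF x(1)] Bc[OF that] R.zero_closed
      by (intro CollectI exI[of _ \<beta>] exI[of _ "\<zero>\<^bsub>Lam n\<^esub>"]) simp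
    moreover have "x \<in> ?H"
      using x smult_one[OF x(1)] BD(2) R.one_closed
      by (intro CollectI exI[of _ "\<zero>\<^bsub>M\<^esub>"] exI[of _ "\<one>\<^bsub>Lam n\<^esub>"]) simp
    ultimately have "w \<in> ?H" using x(2) by (intro Bmax submodule_add_cyclic[OF B(1) x(1)]) blast+
    then show ?thesis by blast
  qed
  \<comment> \<open>For \<open>z\<close> at vertex \<open>i\<close>, the component of
    \<open>r z\<close> at \<open>b\<close> is the entry \<open>r $$ (b, i)\<close> times the path
    from \<open>i\<close> to \<open>b\<close>. Scalars act on \<open>M\<close> only through
    matrices, so the factor is placed once at \<open>i\<close> before the path and once at
    \<open>b\<close> after it.\<close>
  have comp: "Eu n b b \<odot>\<^bsub>M\<^esub> (r \<odot>\<^bsub>M\<^esub> z) = Eu n b i \<odot>\<^bsub>M\<^esub> (cl n i (\<lambda>p. if p = i then r $$ (b, i) else 0) \<odot>\<^bsub>M\<^esub> z)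
      \<and> Eu n b b \<odot>\<^bsub>M\<^esub> (r \<odot>\<^bsub>M\<^esub> z) = cl n b (\<lambda>p. if p = b then r $$ (b, i) else 0) \<odot>\<^bsub>M\<^esub> (Eu n b i \<odot>\<^bsub>M\<^esub> z)"
    if r: "r \<in> carrier (Lam n)" and z: "z \<in> carrier M" "Eu n i i \<odot>\<^bsub>M\<^esub> z = z" and i: "i \<le> b" for r z i
  proof -
    have "r \<odot>\<^bsub>M\<^esub> z = (r \<otimes>\<^bsub>Lam n\<^esub> Eu n i i) \<odot>\<^bsub>M\<^esub> z"
      using smult_assoc[OF r Eu_closed z(1), of i i] z(2) by simp
    also have "r \<otimes>\<^bsub>Lam n\<^esub> Eu n i i = cl n i (\<lambda>p. r $$ (p, i))"
      unfolding Eu_def using i b by (subst mult_cl[OF r]) (auto intro!: cl_cong simp: sum.delta' if_distrib cong: if_cong)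
    finally have "Eu n b b \<odot>\<^bsub>M\<^esub> (r \<odot>\<^bsub>M\<^esub> z) = (Eu n b b \<otimes>\<^bsub>Lam n\<^esub> cl n i (\<lambda>p. r $$ (p, i))) \<odot>\<^bsub>M\<^esub> z"
      using smult_assoc[OF Eu_closed cl_closed z(1)] by simp
    also have "Eu n b b \<otimes>\<^bsub>Lam n\<^esub> cl n i (\<lambda>p. r $$ (p, i)) = cl n i (\<lambda>p. if p = b then r $$ (b, i) else 0)"
      using i b by (subst Eu_mult_cl) auto
    finally have *: "Eu n b b \<odot>\<^bsub>M\<^esub> (r \<odot>\<^bsub>M\<^esub> z) = cl n i (\<lambda>p. if p = b then r $$ (b, i) else 0) \<odot>\<^bsub>M\<^esub> z" .
    have "Eu n b i \<otimes>\<^bsub>Lam n\<^esub> cl n i (\<lambda>p. if p = i then r $$ (b, i) else 0) = cl n i (\<lambda>p. if p = b then r $$ (b, i) else 0)"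
      using i b by (subst Eu_mult_cl) (auto intro!: cl_cong)
    moreover have "cl n b (\<lambda>p. if p = b then r $$ (b, i) else 0) \<otimes>\<^bsub>Lam n\<^esub> Eu n b i = cl n i (\<lambda>p. if p = b then r $$ (b, i) else 0)"
      by (rule cl_Eu_scalar) (use i b in auto)
    ultimately show ?thesis
      using * smult_assoc[OF Eu_closed cl_closed z(1)] smult_assoc[OF cl_closed Eu_closed z(1)] by metis
  qed
  \<comment> \<open>Otherwise \<open>key\<close> expresses \<open>w\<close> by an element of
    \<open>B\<close> and a multiple of the image of \<open>z\<close> at \<open>b\<close>, which is
    in \<open>B\<close> too.\<close>
  have inB: "z \<in> B" if z: "z \<in> carrier M" "Eu n i i \<odot>\<^bsub>M\<^esub> z = z" "i \<le> b" "Eu n b i \<odot>\<^bsub>M\<^esub> z \<in> B" for z i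
  proof (rule ccontr)
    assume "z \<notin> B"
    then obtain \<beta> r where r: "\<beta> \<in> B" "r \<in> carrier (Lam n)" "w = \<beta> \<oplus>\<^bsub>M\<^esub> r \<odot>\<^bsub>M\<^esub> z"
      using key[OF z(1)] by blast
    have "w = Eu n b b \<odot>\<^bsub>M\<^esub> \<beta> \<oplus>\<^bsub>M\<^esub> Eu n b b \<odot>\<^bsub>M\<^esub> (r \<odot>\<^bsub>M\<^esub> z)"
      using w(3) r(3) smult_r_distr[OF Eu_closed Bc[OF r(1)] smult_closed[OF r(2) z(1)], of b b] by simp
    moreover have "Eu n b b \<odot>\<^bsub>M\<^esub> (r \<odot>\<^bsub>M\<^esub> z) \<in> B"
      using comp[OF r(2) z(1,2,3)] BD(4)[OF cl_closed z(4)] by metis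
    ultimately show False using B(2) BD(3)[OF BD(4)[OF Eu_closed r(1)]] by simp
  qed
  \<comment> \<open>\<open>b\<close> is the last vertex of the support, so the right end is
    \<open>Suc b\<close>; the relation demanded of \<open>v\<close> at that vertex is
    \<open>bmax\<close>.\<close>
  define s where "s = (a, Suc b)"
  have s: "s \<in> intervals n" using b by (auto simp: s_def intervals_def)
  then have S: "{s} \<subseteq> intervals n" by simp
  define \<phi> where "\<phi> = lift_hom n {s} M (\<lambda>_. v)"
  have \<phi>: "\<phi> \<in> mod_hom (Lam n) (Fn n {s}) M" "\<phi> (dl s a 1) = v"
    using lift_hom[OF S L, of "\<lambda>_. v"] v bmax[of "Suc b" v] by (auto simp: \<phi>_def s_def)
  note LF = Fn_left_module[OF S]
  have dla: "dl s a (1::'k) \<in> carrier (Fn n {s})" using b by (intro dl_carrier) (auto simp: s_def)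
  have "Eu n j a \<odot>\<^bsub>Fn n {s}\<^esub> dl s a (1::'k) = dl s j 1" if "a \<le> j" "j \<le> b" for j
    using that b Eu_dl[OF S, of s a j "1::'k"] by (simp add: s_def)
  then have \<phi>j: "\<phi> (dl s j 1) = Eu n j a \<odot>\<^bsub>M\<^esub> v" if "a \<le> j" "j \<le> b" for j
    using mod_homD(3)[OF \<phi>(1) Eu_closed dla, of j a] \<phi>(2) that by simp
  \<comment> \<open>The preimage of \<open>B\<close> is a submodule of an interval module; if
    nonzero it contains the socle, which goes to \<open>w\<close>.\<close>
  have \<phi>B: "f = \<zero>\<^bsub>Fn n {s}\<^esub>" if f: "f \<in> carrier (Fn n {s})" "\<phi> f \<in> B" for f
  proof (rule ccontr)
    assume "f \<noteq> \<zero>\<^bsub>Fn n {s}\<^esub>"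
    then have "dl s (snd s - 1) 1 \<in> {x \<in> carrier (Fn n {s}). \<phi> x \<in> B}"
      using f by (intro Fn_single_socle[OF s submodule_vimage[OF LF L \<phi>(1) B(1)]]) auto
    then have "\<phi> (dl s b 1) \<in> B" by (simp add: s_def)
    then show False using \<phi>j[of b] b B(2) by (simp add: w_def)
  qed
  let ?U = "\<phi> ` carrier (Fn n {s})"
  note U = submodule_image[OF LF L \<phi>(1)]
  note UD = submoduleD[OF U]
  have Uc: "x \<in> carrier M" if "x \<in> ?U" for x using UD(1) that by blast
  define W where "W = ?U <+>\<^bsub>M\<^esub> B"
  have WI: "x \<oplus>\<^bsub>M\<^esub> y \<in> W" if "x \<in> ?U" "y \<in> B" for x y
    using that by (auto simp: W_def set_add_def')
  have WE: "\<exists>x\<in>?U. \<exists>y\<in>B. z = x \<oplus>\<^bsub>M\<^esub> y" if "z \<in> W" for z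
    using that by (auto simp: W_def set_add_def')
  have W: "submodule W (Lam n) M"
  proof (rule submoduleI)
    show "W \<subseteq> carrier M" using WE Uc Bc by fastforce
    show "\<zero>\<^bsub>M\<^esub> \<in> W" using WI[OF UD(2) BD(2)] by simp
    fix x y assume "x \<in> W" "y \<in> W"
    then obtain x1 x2 y1 y2 where e: "x1 \<in> ?U" "x2 \<in> B" "x = x1 \<oplus>\<^bsub>M\<^esub> x2" "y1 \<in> ?U" "y2 \<in> B" "y = y1 \<oplus>\<^bsub>M\<^esub> y2"
      using WE by meson
    have "x \<oplus>\<^bsub>M\<^esub> y = (x1 \<oplus>\<^bsub>M\<^esub> y1) \<oplus>\<^bsub>M\<^esub> (x2 \<oplus>\<^bsub>M\<^esub> y2)"
      using e(3,6) Uc[OF e(1)] Uc[OF e(4)] Bc[OF e(2)] Bc[OF e(5)] by (simp add: M.a_ac)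
    then show "x \<oplus>\<^bsub>M\<^esub> y \<in> W" using WI[OF UD(3)[OF e(1,4)] BD(3)[OF e(2,5)]] by simp
  next
    fix r :: "'k mat" and x assume r: "r \<in> carrier (Lam n)" and "x \<in> W"
    then obtain x1 x2 where e: "x1 \<in> ?U" "x2 \<in> B" "x = x1 \<oplus>\<^bsub>M\<^esub> x2" using WE by meson
    then show "r \<odot>\<^bsub>M\<^esub> x \<in> W"
      using WI[OF UD(4)[OF r e(1)] BD(4)[OF r e(2)]] smult_r_distr[OF r Uc[OF e(1)] Bc[OF e(2)]] by simp
  qed
  note WD = submoduleD[OF W]
  have BW: "x \<in> W" if "x \<in> B" for x using WI[OF UD(2) that] Bc[OF that] by simp
  have UW: "x \<in> W" if "x \<in> ?U" for x using WI[OF that BD(2)] Uc[OF that] by simp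
  have "Eu n i i \<odot>\<^bsub>M\<^esub> x \<in> W" if i: "i < n" and x: "x \<in> carrier M" for i x
  proof (cases "Eu n i i \<odot>\<^bsub>M\<^esub> x \<in> B")
    case True
    then show ?thesis by (rule BW)
  next
    case False
    define z where "z = Eu n i i \<odot>\<^bsub>M\<^esub> x"
    have z: "z \<in> carrier M" "Eu n i i \<odot>\<^bsub>M\<^esub> z = z" using x Ec EE[of i i i x] i by (auto simp: z_def)
    have zB: "z \<notin> B" using False by (simp add: z_def)
    then have ai: "a \<le> i" using amin[of i x] x BD(2) by (cases "i < a") (auto simp: z_def)
    obtain \<beta> r where r: "\<beta> \<in> B" "r \<in> carrier (Lam n)" "w = \<beta> \<oplus>\<^bsub>M\<^esub> r \<odot>\<^bsub>M\<^esub> z"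
      using key[OF z(1) zB] by blast
    have w': "w = Eu n b b \<odot>\<^bsub>M\<^esub> \<beta> \<oplus>\<^bsub>M\<^esub> Eu n b b \<odot>\<^bsub>M\<^esub> (r \<odot>\<^bsub>M\<^esub> z)"
      using w(3) r(3) smult_r_distr[OF Eu_closed Bc[OF r(1)] smult_closed[OF r(2) z(1)], of b b] by simp
    have EB: "Eu n b b \<odot>\<^bsub>M\<^esub> \<beta> \<in> B" using BD(4)[OF Eu_closed r(1)] .
    \<comment> \<open>No element of the algebra leads from a vertex beyond \<open>b\<close> back to
      \<open>b\<close>, so \<open>w\<close> would be the component of \<open>\<beta>\<close> at
      \<open>b\<close> and lie in \<open>B\<close>.\<close>
    have ib: "i \<le> b"
    proof (rule ccontr)
      assume "\<not> i \<le> b"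
      then have bi: "b < i" by simp
      have "r \<odot>\<^bsub>M\<^esub> z = (r \<otimes>\<^bsub>Lam n\<^esub> Eu n i i) \<odot>\<^bsub>M\<^esub> z"
        using smult_assoc[OF r(2) Eu_closed z(1), of i i] z(2) by simp
      also have "r \<otimes>\<^bsub>Lam n\<^esub> Eu n i i = cl n i (\<lambda>p. r $$ (p, i))"
        unfolding Eu_def using i by (subst mult_cl[OF r(2)]) (auto intro!: cl_cong simp: sum.delta' if_distrib cong: if_cong)
      finally have "Eu n b b \<odot>\<^bsub>M\<^esub> (r \<odot>\<^bsub>M\<^esub> z) = (Eu n b b \<otimes>\<^bsub>Lam n\<^esub> cl n i (\<lambda>p. r $$ (p, i))) \<odot>\<^bsub>M\<^esub> z"
        using smult_assoc[OF Eu_closed cl_closed z(1)] by simp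
      also have "\<dots> = \<zero>\<^bsub>M\<^esub>" using Eu_mult_cl_zero[OF bi i] zero_smult[OF z(1)] by metis
      finally show False using w' EB Bc[OF EB] B(2) by simp
    qed
    define c where "c = r $$ (b, i)"
    define x' where "x' = cl n i (\<lambda>p. if p = i then c else 0) \<odot>\<^bsub>M\<^esub> z"
    have x'c: "x' \<in> carrier M" using smult_closed[OF cl_closed z(1)] by (simp add: x'_def)
    have wx: "w = Eu n b b \<odot>\<^bsub>M\<^esub> \<beta> \<oplus>\<^bsub>M\<^esub> Eu n b i \<odot>\<^bsub>M\<^esub> x'"
      using w' comp[OF r(2) z ib] unfolding x'_def c_def by simp
    have c0: "c \<noteq> 0"
    proof
      assume "c = 0"
      then have "cl n i (\<lambda>p. if p = i then c else 0) = \<zero>\<^bsub>Lam n\<^esub>" by (subst cl_zero[symmetric]) (auto intro!: cl_cong)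
      then have "x' = \<zero>\<^bsub>M\<^esub>" using zero_smult[OF z(1)] by (simp add: x'_def)
      then show False using wx EB Bc[OF EB] B(2) smult_zero[OF Eu_closed] by simp
    qed
    define y where "y = Eu n i a \<odot>\<^bsub>M\<^esub> v"
    have "dl s i (1::'k) \<in> carrier (Fn n {s})" using ai ib by (intro dl_carrier) (auto simp: s_def)
    then have yU: "y \<in> ?U" unfolding y_def \<phi>j[OF ai ib, symmetric] by (rule imageI)
    have yc: "y \<in> carrier M" using Uc[OF yU] .
    \<comment> \<open>At \<open>b\<close> the images of \<open>x'\<close> and \<open>y\<close>
      differ by an element of \<open>B\<close>, so \<open>inB\<close> puts \<open>q\<close> into
      \<open>B\<close> and \<open>x'\<close> into \<open>W\<close>. As \<open>c\<close> is
      invertible, \<open>z\<close> follows.\<close>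
    define q where "q = x' \<oplus>\<^bsub>M\<^esub> (\<ominus>\<^bsub>M\<^esub> y)"
    have qc: "q \<in> carrier M" using x'c yc by (simp add: q_def)
    have "Eu n i i \<odot>\<^bsub>M\<^esub> x' = x'"
      using smult_assoc[OF Eu_closed cl_closed z(1), of i i i "\<lambda>p. if p = i then c else 0"]
        Eu_mult_cl[of i i i n "\<lambda>p. if p = i then c else 0"] i
      by (simp add: x'_def if_distrib cong: if_cong)
    moreover have "Eu n i i \<odot>\<^bsub>M\<^esub> y = y" using EE[of a i i v] ai i v by (simp add: y_def)
    ultimately have qi: "Eu n i i \<odot>\<^bsub>M\<^esub> q = q"
      using smult_r_distr[OF Eu_closed x'c M.a_inv_closed[OF yc], of i i] smult_minus[OF Eu_closed yc, of i i]
      by (simp add: q_def)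
    have "Eu n b i \<odot>\<^bsub>M\<^esub> y = w" using EE[of a i b v] ai ib b v by (simp add: y_def w_def)
    then have "Eu n b i \<odot>\<^bsub>M\<^esub> q = Eu n b i \<odot>\<^bsub>M\<^esub> x' \<oplus>\<^bsub>M\<^esub> (\<ominus>\<^bsub>M\<^esub> w)"
      using smult_r_distr[OF Eu_closed x'c M.a_inv_closed[OF yc], of b i] smult_minus[OF Eu_closed yc, of b i]
      by (simp add: q_def)
    also have "\<dots> = \<ominus>\<^bsub>M\<^esub> (Eu n b b \<odot>\<^bsub>M\<^esub> \<beta>)"
    proof -
      have "Y \<oplus>\<^bsub>M\<^esub> (\<ominus>\<^bsub>M\<^esub> (X \<oplus>\<^bsub>M\<^esub> Y)) = \<ominus>\<^bsub>M\<^esub> X" if "X \<in> carrier M" "Y \<in> carrier M" for X Y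
        using that M.minus_add[of X Y] M.a_lcomm[of Y "\<ominus>\<^bsub>M\<^esub> X" "\<ominus>\<^bsub>M\<^esub> Y"] by (simp add: M.r_neg)
      from this[OF Bc[OF EB] Ec[OF x'c]] show ?thesis by (subst wx)
    qed
    finally have "Eu n b i \<odot>\<^bsub>M\<^esub> q \<in> B" using BD(5)[OF EB] by simp
    then have "q \<in> B" using inB[OF qc qi ib] by simp
    moreover have "x' = y \<oplus>\<^bsub>M\<^esub> q" using x'c yc by (simp add: q_def M.a_ac M.r_neg M.r_neg1 M.r_neg2)
    ultimately have "x' \<in> W" using WI[OF yU] by simp
    moreover have "z = cl n i (\<lambda>p. if p = i then inverse c else 0) \<odot>\<^bsub>M\<^esub> x'"
    proof -
      have "cl n i (\<lambda>p. if p = i then inverse c else 0) \<otimes>\<^bsub>Lam n\<^esub> cl n i (\<lambda>p. if p = i then c else 0) = Eu n i i"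
        unfolding Eu_def using i c0 by (subst cl_mult_cl) (auto intro!: cl_cong)
      then show ?thesis using smult_assoc[OF cl_closed cl_closed z(1)] z(2) unfolding x'_def by metis
    qed
    ultimately show ?thesis using WD(4)[OF cl_closed] by (simp add: z_def)
  qed
  then have "x \<in> W" if "x \<in> carrier M" for x
    using submodule_finsum[OF W, of "\<lambda>i. Eu n i i \<odot>\<^bsub>M\<^esub> x" "{..<n}"] left_module_decomp[OF L that] that by auto
  then have "W = carrier M" using WD(1) by blast
  moreover have "?U \<inter> B = {\<zero>\<^bsub>M\<^esub>}"
  proof
    show "?U \<inter> B \<subseteq> {\<zero>\<^bsub>M\<^esub>}" using \<phi>B mod_hom_zero[OF LF L \<phi>(1)] by auto
  qed (use UD(2) BD(2) in auto)
  ultimately have "?U = {\<zero>\<^bsub>M\<^esub>} \<or> B = {\<zero>\<^bsub>M\<^esub>}"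
    using M U B(1) unfolding indecomposable_def W_def by blast
  moreover have "?U \<noteq> {\<zero>\<^bsub>M\<^esub>}"
  proof
    assume "?U = {\<zero>\<^bsub>M\<^esub>}"
    then have "v = \<zero>\<^bsub>M\<^esub>" using \<phi>(2) dla by blast
    then show False using w(2) smult_zero[OF Eu_closed] by (simp add: w_def)
  qed
  ultimately have B0: "B = {\<zero>\<^bsub>M\<^esub>}" by blast
  have "carrier M \<subseteq> ?U"
  proof
    fix x assume "x \<in> carrier M"
    then obtain x1 x2 where "x1 \<in> ?U" "x2 \<in> B" "x = x1 \<oplus>\<^bsub>M\<^esub> x2" using WE \<open>W = carrier M\<close> by blast
    then show "x \<in> ?U" using B0 Uc by simp
  qed
  then have "\<phi> \<in> mod_iso (Lam n) (Fn n {s}) M"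
    using \<phi>B B0 UD(1) by (intro mod_isoI \<phi>(1)) (auto simp: mod_hom_inj_iff[OF LF L \<phi>(1)])
  then show ?thesis using s isomorphic_modI by blast
qed

text \<open>An isomorphism preserves the vertices at which \<open>Eu n i i\<close> acts
  nontrivially, and these form the interval.\<close>

lemma Fn_single_iso_eq:
  assumes s: "s \<in> intervals n" and t: "t \<in> intervals n"
    and iso: "isomorphic_mod (Lam n) (Fn n {s} :: ('k::field mat, _) module) (Fn n {t} :: ('k mat, _) module)"
  shows "s = t"
proof -
  have sub: "{fst s..<snd s} \<subseteq> {fst t..<snd t}"
    if st: "s \<in> intervals n" "t \<in> intervals n"
      and iso: "isomorphic_mod (Lam n) (Fn n {s} :: ('k mat, _) module) (Fn n {t} :: ('k mat, _) module)" for s t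
  proof
    fix i assume i: "i \<in> {fst s..<snd s}"
    have S: "{s} \<subseteq> intervals n" "{t} \<subseteq> intervals n" using st by auto
    obtain f where f: "f \<in> mod_iso (Lam n) (Fn n {s} :: ('k mat, _) module) (Fn n {t} :: ('k mat, _) module)"
      using iso by (rule isomorphic_modE)
    note fD = mod_isoD[OF f]
    have n: "i < n" using i intervalsD[OF S(1), of s] by auto
    have d: "dl s i (1::'k) \<in> carrier (Fn n {s})" using i by (intro dl_carrier) auto
    have "Eu n i i \<odot>\<^bsub>Fn n {s}\<^esub> dl s i (1::'k) = dl s i 1"
      using Eu_dl[OF S(1), of s i i "1::'k"] i n by simp
    then have "f (dl s i 1) = Eu n i i \<odot>\<^bsub>Fn n {t}\<^esub> f (dl s i 1)"
      using mod_homD(3)[OF fD(1) Eu_closed d, of i i] by simp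
    moreover have fc: "f (dl s i 1) \<in> carrier (Fn n {t})" by (rule mod_homD(1)[OF fD(1) d])
    ultimately have e: "f (dl s i 1) u j = (if j = i \<and> i \<le> j \<and> fst u \<le> j \<and> j < snd u then f (dl s i 1) u i else 0)" for u j
      using Eu_smult_Fn[OF S(2) fc n, of i u j] by metis
    have "dl s i (1::'k) \<noteq> \<zero>\<^bsub>Fn n {s}\<^esub>" by (rule dl_nonzero)
    then have "f (dl s i 1) \<noteq> \<zero>\<^bsub>Fn n {t}\<^esub>"
      using fD(2) d mod_hom_inj_iff[OF Fn_left_module[OF S(1)] Fn_left_module[OF S(2)] fD(1)] by blast
    then obtain u j where "f (dl s i 1) u j \<noteq> 0" by (auto simp: Fn_ops fun_eq_iff)
    then have "f (dl s i 1) u i \<noteq> 0" using e[of u j] by (metis)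
    then have "u \<in> {t} \<and> fst u \<le> i \<and> i < snd u" using fc unfolding Fn_carrier by blast
    then show "i \<in> {fst t..<snd t}" by auto
  qed
  have "{fst s..<snd s} = {fst t..<snd t}"
    using sub[OF s t iso] sub[OF t s isomorphic_mod_sym[OF Fn_left_module iso]] s by auto
  moreover have "fst s < snd s" "fst t < snd t" using s t by (auto simp: intervals_def)
  ultimately show ?thesis by (auto simp: atLeastLessThan_eq_iff prod_eq_iff)
qed

subsection \<open>Decompositions\<close>

text \<open>\<open>Fn\<close> takes a set and thus contains each interval once; injectivity of
  \<open>\<sigma>\<close> is multiplicity one.\<close>

lemma Fn_direct_sum:
  fixes F :: "nat \<Rightarrow> ('k::field mat, 'v) module"
  assumes \<sigma>: "inj_on \<sigma> {..<m}" "\<And>i. i < m \<Longrightarrow> \<sigma> i \<in> intervals n"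
    and F: "\<And>i. i < m \<Longrightarrow> isomorphic_mod (Lam n) (Fn n {\<sigma> i} :: ('k mat, _) module) (F i)"
  shows "isomorphic_mod (Lam n) (Fn n (\<sigma> ` {..<m}) :: ('k mat, _) module) (direct_sum m F)"
proof -
  let ?F = "Fn n (\<sigma> ` {..<m}) :: ('k mat, _) module"
  let ?D = "direct_sum m (\<lambda>i. Fn n {\<sigma> i} :: ('k mat, _) module)"
  let ?h = "\<lambda>f. \<lambda>i\<in>{..<m}. (\<lambda>t j. if t = \<sigma> i then f t j else (0::'k))"
  have "?h \<in> mod_iso (Lam n) ?F ?D"
  proof (rule mod_isoI)
    show hom: "?h \<in> mod_hom (Lam n) ?F ?D"
    proof (rule mod_homI)
      fix f assume f: "f \<in> carrier ?F"
      show "?h f \<in> carrier ?D"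
        using f by (auto simp: direct_sum_simps Fn_carrier simp del: split_paired_All split: if_splits)
      show "?h (A \<odot>\<^bsub>?F\<^esub> f) = A \<odot>\<^bsub>?D\<^esub> ?h f" for A
        unfolding direct_sum_simps
      proof (intro restrict_ext ext)
        fix i t j assume "i \<in> {..<m}"
        then show "(if t = \<sigma> i then (A \<odot>\<^bsub>?F\<^esub> f) t j else 0) = (A \<odot>\<^bsub>Fn n {\<sigma> i}\<^esub> ?h f i) t j"
          by (cases "t = \<sigma> i") (simp_all add: Fn_ops)
      qed
      show "?h (f \<oplus>\<^bsub>?F\<^esub> g) = ?h f \<oplus>\<^bsub>?D\<^esub> ?h g" for g
        by (auto simp: direct_sum_simps Fn_ops fun_eq_iff)
    qed
    show "inj_on ?h (carrier ?F)"
    proof (rule inj_onI)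
      fix f g assume fg: "f \<in> carrier ?F" "g \<in> carrier ?F" "?h f = ?h g"
      have "f t j = g t j" for t j
      proof (cases "t \<in> \<sigma> ` {..<m}")
        case True
        then obtain i where i: "i < m" "t = \<sigma> i" by auto
        then have "?h f i t j = ?h g i t j" using fg(3) by simp
        then show ?thesis using i by simp
      next
        case False
        then show ?thesis using Fn_zero_outside[OF fg(1)] Fn_zero_outside[OF fg(2)] by metis
      qed
      then show "f = g" by blast
    qed
    show "?h ` carrier ?F = carrier ?D"
    proof (intro equalityI subsetI)
      fix g assume g: "g \<in> carrier ?D"
      then have gi: "g i \<in> carrier (Fn n {\<sigma> i})" if "i < m" for i using that by (auto simp: direct_sum_simps)
      define f where "f t j = (if t \<in> \<sigma> ` {..<m} then g (the_inv_into {..<m} \<sigma> t) t j else 0)" for t j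
      have fi: "f (\<sigma> i) j = g i (\<sigma> i) j" if "i < m" for i j
        using that the_inv_into_f_f[OF \<sigma>(1)] by (simp add: f_def)
      have "f \<in> carrier ?F"
        unfolding Fn_carrier
      proof (intro allI impI)
        fix t j assume nz: "f t j \<noteq> 0"
        then have "t \<in> \<sigma> ` {..<m}" by (auto simp: f_def split: if_splits)
        then obtain i where i: "i < m" "t = \<sigma> i" by auto
        then have "g i t j \<noteq> 0" using nz fi by simp
        then show "t \<in> \<sigma> ` {..<m} \<and> fst t \<le> j \<and> j < snd t" using gi[OF i(1)] i unfolding Fn_carrier by blast
      qed
      moreover have "?h f = g"
      proof
        fix i show "?h f i = g i"
        proof (cases "i < m")
          case True
          then show ?thesis using fi[OF True] Fn_single_carrier[OF gi[OF True]] by (auto simp: fun_eq_iff)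
        next
          case False
          then show ?thesis using g by (auto simp: direct_sum_simps PiE_def extensional_def)
        qed
      qed
      ultimately show "g \<in> ?h ` carrier ?F" by blast
    next
      fix g assume "g \<in> ?h ` carrier ?F"
      then show "g \<in> carrier ?D" using mod_homD(1)[OF hom] by blast
    qed
  qed
  then have 1: "isomorphic_mod (Lam n) ?F ?D" by (rule isomorphic_modI)
  define f where "f i = (SOME f. f \<in> mod_iso (Lam n) (Fn n {\<sigma> i} :: ('k mat, _) module) (F i))" for i
  have "f i \<in> mod_iso (Lam n) (Fn n {\<sigma> i} :: ('k mat, _) module) (F i)" if "i < m" for i
    using F[OF that] unfolding isomorphic_mod_def f_def by (intro someI_ex[of "\<lambda>f. f \<in> _"]) blast
  then have "isomorphic_mod (Lam n) ?D (direct_sum m F)"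
    by (intro isomorphic_modI[OF direct_sum_map_iso[where f = f]]) auto
  with 1 show ?thesis by (rule isomorphic_mod_trans)
qed

lemma basic_decomposition:
  fixes M :: "('k::field mat, 'v) module"
  assumes M: "basic_with_summands (Lam n) m M" "left_module (Lam n) M"
  shows "\<exists>S. S \<subseteq> intervals n \<and> card S = m \<and> isomorphic_mod (Lam n) (Fn n S :: ('k mat, _) module) M"
proof -
  obtain F :: "nat \<Rightarrow> ('k mat, 'v) module" where F: "\<And>i. i < m \<Longrightarrow> indecomposable (Lam n) (F i)"
    "isomorphic_mod (Lam n) M (direct_sum m F)"
    "\<And>i j. i < m \<Longrightarrow> j < m \<Longrightarrow> i \<noteq> j \<Longrightarrow> \<not> isomorphic_mod (Lam n) (F i) (F j)"
    using M(1) unfolding basic_with_summands_def indec_decomposition_def by blast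
  have "\<forall>i. \<exists>s. i < m \<longrightarrow> s \<in> intervals n \<and> isomorphic_mod (Lam n) (Fn n {s} :: ('k mat, _) module) (F i)"
    using indecomposable_interval[OF F(1)] by blast
  then obtain \<sigma> where \<sigma>: "\<And>i. i < m \<Longrightarrow> \<sigma> i \<in> intervals n"
    "\<And>i. i < m \<Longrightarrow> isomorphic_mod (Lam n) (Fn n {\<sigma> i} :: ('k mat, _) module) (F i)" by metis
  have "inj_on \<sigma> {..<m}"
  proof (rule inj_onI)
    fix i j assume ij: "i \<in> {..<m}" "j \<in> {..<m}" "\<sigma> i = \<sigma> j"
    have "isomorphic_mod (Lam n) (F i) (Fn n {\<sigma> i} :: ('k mat, _) module)"
      by (rule isomorphic_mod_sym[OF Fn_left_module]) (use \<sigma>[of i] ij in auto)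
    then have "isomorphic_mod (Lam n) (F i) (F j)"
      using \<sigma>(2)[of j] ij isomorphic_mod_trans by auto
    then show "i = j" using F(3)[of i j] ij by auto
  qed
  then have "isomorphic_mod (Lam n) (Fn n (\<sigma> ` {..<m}) :: ('k mat, _) module) (direct_sum m F)"
    using \<sigma> by (intro Fn_direct_sum) auto
  then have "isomorphic_mod (Lam n) (Fn n (\<sigma> ` {..<m}) :: ('k mat, _) module) M"
    using isomorphic_mod_trans isomorphic_mod_sym[OF M(2) F(2)] by blast
  moreover have "card (\<sigma> ` {..<m}) = m" using \<open>inj_on \<sigma> {..<m}\<close> by (simp add: card_image)
  moreover have "\<sigma> ` {..<m} \<subseteq> intervals n" using \<sigma>(1) by auto
  ultimately show ?thesis by blast
qed

lemma Vn_single_indecomposable: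
  assumes "s \<in> intervals n"
  shows "indecomposable (Lam n) (Vn n {s} :: ('k::field mat, _) module)"
proof -
  have S: "{s} \<subseteq> intervals n" using assms by simp
  obtain f where "f \<in> mod_iso (Lam n) (Fn n {s} :: ('k mat, _) module) (Vn n {s})"
    using Vn_iso(1)[OF S] by (rule isomorphic_modE)
  then show ?thesis
    by (rule indecomposable_iso[OF Fn_single_indecomposable[OF assms] Vn_iso(3)[OF S]])
qed

lemma Vn_single_iso_eq:
  assumes st: "s \<in> intervals n" "t \<in> intervals n"
    and iso: "isomorphic_mod (Lam n) (Vn n {s} :: ('k::field mat, _) module) (Vn n {t} :: ('k mat, _) module)"
  shows "s = t"
proof (rule Fn_single_iso_eq[OF st])
  have S: "{s} \<subseteq> intervals n" "{t} \<subseteq> intervals n" using st by auto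
  show "isomorphic_mod (Lam n) (Fn n {s} :: ('k mat, _) module) (Fn n {t} :: ('k mat, _) module)"
    using isomorphic_mod_trans[OF Vn_iso(1)[OF S(1)] isomorphic_mod_trans[OF iso Vn_iso(2)[OF S(2)]]] .
qed

lemma Fn_basic:
  fixes M :: "('k::field mat, 'k vec) module"
  assumes S: "S \<subseteq> intervals n" and M: "isomorphic_mod (Lam n) M (Fn n S :: ('k mat, _) module)"
  shows "basic_with_summands (Lam n) (card S) M" "has_indec_summands (Lam n) (card S) M"
proof -
  obtain \<sigma> where \<sigma>: "bij_betw \<sigma> {0..<card S} S"
    using ex_bij_betw_nat_finite[OF finite_subset[OF S finite_intervals]] by blast
  then have img: "\<sigma> ` {..<card S} = S" and inj: "inj_on \<sigma> {..<card S}"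
    by (auto simp: bij_betw_def atLeast0LessThan)
  have \<sigma>i: "\<sigma> i \<in> intervals n" if "i < card S" for i using img S that by auto
  have "isomorphic_mod (Lam n) (Fn n (\<sigma> ` {..<card S}) :: ('k mat, _) module) (direct_sum (card S) (\<lambda>i. Vn n {\<sigma> i}))"
    using inj \<sigma>i by (intro Fn_direct_sum Vn_iso(1)) auto
  then have "isomorphic_mod (Lam n) M (direct_sum (card S) (\<lambda>i. Vn n {\<sigma> i} :: ('k mat, _) module))"
    using M isomorphic_mod_trans img by metis
  then have d: "indec_decomposition (Lam n) M (card S) (\<lambda>i. Vn n {\<sigma> i} :: ('k mat, _) module)"
    unfolding indec_decomposition_def using Vn_single_indecomposable \<sigma>i by blast
  moreover have "\<not> isomorphic_mod (Lam n) (Vn n {\<sigma> i} :: ('k mat, _) module) (Vn n {\<sigma> j} :: ('k mat, _) module)"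
    if "i < card S" "j < card S" "i \<noteq> j" for i j
    using Vn_single_iso_eq[OF \<sigma>i \<sigma>i] inj that by (auto dest: inj_onD)
  ultimately show "basic_with_summands (Lam n) (card S) M"
    unfolding basic_with_summands_def by blast
  show "has_indec_summands (Lam n) (card S) M" using d unfolding has_indec_summands_def by blast
qed

subsection \<open>Generation and cogeneration of sums of interval modules\<close>

lemma left_module_zero: "left_module R M \<Longrightarrow> \<zero>\<^bsub>M\<^esub> \<in> carrier M"
  by (simp add: left_module_def abelian_group_def abelian_monoid.zero_closed)

text \<open>Suppose that all summands of \<open>M\<close> with left end \<open>x\<close> end before \<open>y\<close>. Modulo the image of \<open>M\<close> at \<open>x - 1\<close>,
  every element of \<open>M\<^sub>x\<close> is then mapped to zero at the vertex \<open>y - 1\<close>, which fails in \<open>(x, y)\<close>.\<close>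

lemma gens_Fn_D:
  assumes S: "S \<subseteq> intervals n" and T: "T \<subseteq> intervals n"
    and g: "gens (Lam n) (Fn n S :: ('k::field mat, _) module) (Fn n T :: ('k mat, _) module)"
    and s: "(x, y) \<in> T"
  shows "\<exists>y'\<ge>y. (x, y') \<in> S"
proof (rule ccontr)
  assume no: "\<not> ?thesis"
  let ?S = "Fn n S :: ('k mat, _) module" and ?T = "Fn n T :: ('k mat, _) module"
  obtain m f where f: "f \<in> mod_hom (Lam n) (direct_sum m (\<lambda>_. ?S)) ?T"
    "f ` carrier (direct_sum m (\<lambda>_. ?S)) = carrier ?T"
    using g unfolding gens_def by blast
  let ?D = "direct_sum m (\<lambda>_. ?S)"
  note LS = Fn_left_module[OF S] and LT = Fn_left_module[OF T]
  have LD: "left_module (Lam n) ?D"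
    by (rule direct_sum_left_module[OF ring_lower_tri_ring LS])
  have xy: "x < y" "y \<le> n" using intervalsD[OF T s] by auto
  have y1: "y - 1 < n" "x \<le> y - 1" "x < n" "x - 1 < n" using xy by auto
  have d: "dl (x, y) x (1::'k) \<in> carrier ?T" using s xy by (intro dl_carrier) auto
  then have "dl (x, y) x 1 \<in> f ` carrier ?D" using f(2) by simp
  then obtain h where h: "h \<in> carrier ?D" "f h = dl (x, y) x 1" by auto
  have hk: "h k \<in> carrier ?S" if "k < m" for k using h(1) that by (auto simp: direct_sum_simps)
  define h1 where "h1 = (\<lambda>k\<in>{..<m}. \<lambda>t j. if j = x \<and> fst t = x then h k t x else 0)"
  define h2 where "h2 = (\<lambda>k\<in>{..<m}. \<lambda>t j. if Suc j = x \<and> fst t < x then h k t x else 0)"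
  \<comment> \<open>The arrow from \<open>x - 1\<close> to \<open>x\<close>. The guard
    \<open>0 < x\<close> is there because \<open>x - 1\<close> is truncated: for
    \<open>x = 0\<close> no arrow ends at \<open>x\<close>, and \<open>A\<close> has to be
    zero.\<close>
  define A :: "'k mat" where "A = cl n (x - 1) (\<lambda>p. if p = x \<and> 0 < x then 1 else 0)"
  have Ac: "A \<in> carrier (Lam n)" by (simp add: A_def cl_closed)
  have hnz: "t \<in> S \<and> fst t \<le> x \<and> x < snd t" if "k < m" "h k t x \<noteq> 0" for k t
    using hk[OF that(1)] that(2) unfolding Fn_carrier by blast
  have h1: "h1 \<in> carrier ?D"
  proof -
    have "(\<lambda>t j. if j = x \<and> fst t = x then h k t x else 0) \<in> carrier ?S" if "k < m" for k
      unfolding Fn_carrier using hnz[OF that] by (metis order_refl)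
    then show ?thesis by (auto simp: h1_def direct_sum_simps)
  qed
  have h2: "h2 \<in> carrier ?D"
  proof -
    have "(\<lambda>t j. if Suc j = x \<and> fst t < x then h k t x else 0) \<in> carrier ?S" if "k < m" for k
      unfolding Fn_carrier using hnz[OF that] by (metis Suc_lessD less_Suc_eq_le)
    then show ?thesis by (auto simp: h2_def direct_sum_simps)
  qed
  have h1k: "h1 k \<in> carrier ?S" and h2k: "h2 k \<in> carrier ?S" if "k < m" for k
    using h1 h2 that by (auto simp: direct_sum_simps)
  \<comment> \<open>A coordinate at \<open>x\<close> in a summand that begins before
    \<open>x\<close> comes from vertex \<open>x - 1\<close>; the remaining ones lie in summands with
    left end \<open>x\<close>. The first kind cannot reach \<open>(x, y)\<close>, which vanishes at
    \<open>x - 1\<close>; the second dies on the way to \<open>y - 1\<close>.\<close>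
  have dec: "Eu n x x \<odot>\<^bsub>?D\<^esub> h = h1 \<oplus>\<^bsub>?D\<^esub> A \<odot>\<^bsub>?D\<^esub> h2"
    unfolding direct_sum_simps
  proof (intro restrict_ext ext)
    fix k t j assume "k \<in> {..<m}"
    then have k: "k < m" by simp
    show "(Eu n x x \<odot>\<^bsub>?S\<^esub> h k) t j =
      (h1 k \<oplus>\<^bsub>?S\<^esub> (\<lambda>i\<in>{..<m}. A \<odot>\<^bsub>?S\<^esub> h2 i) k) t j"
      using k hnz[OF k, of t] Eu_smult_Fn[OF S hk[OF k] y1(3), of x t j]
        cl_smult_Fn[OF S h2k[OF k] y1(4), of "\<lambda>p. if p = x \<and> 0 < x then 1 else 0" t j]
      by (auto simp: Fn_ops(2) A_def h1_def h2_def)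
  qed
  have "Eu n (y - 1) x \<odot>\<^bsub>?D\<^esub> h1 = \<zero>\<^bsub>?D\<^esub>"
    unfolding direct_sum_simps
  proof (intro restrict_ext ext)
    fix k t j assume "k \<in> {..<m}"
    then have k: "k < m" by simp
    have "h1 k t x = 0" if "y - 1 < snd t"
    proof (rule ccontr)
      assume "h1 k t x \<noteq> 0"
      then have "fst t = x" "h k t x \<noteq> 0" using k by (auto simp: h1_def split: if_splits)
      then have "(x, snd t) \<in> S" using hnz[OF k, of t] by (cases t) auto
      then show False using no that xy by auto
    qed
    then show "(Eu n (y - 1) x \<odot>\<^bsub>?S\<^esub> h1 k) t j = \<zero>\<^bsub>?S\<^esub> t j"
      using Eu_smult_Fn[OF S h1k[OF k] y1(3), of "y - 1" t j] by (auto simp: Fn_ops(1))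
  qed
  then have "Eu n (y - 1) x \<odot>\<^bsub>?T\<^esub> f h1 = \<zero>\<^bsub>?T\<^esub>"
    using mod_homD(3)[OF f(1) Eu_closed h1, of "y - 1" x] mod_hom_zero[OF LD LT f(1)] by simp
  then have "(Eu n (y - 1) x \<odot>\<^bsub>?T\<^esub> f h1) (x, y) (y - 1) = 0" by (simp add: Fn_ops(1))
  then have 1: "f h1 (x, y) x = 0"
    using Eu_smult_Fn[OF T mod_homD(1)[OF f(1) h1] y1(3), of "y - 1" "(x, y)" "y - 1"] y1 xy by simp
  have "f (A \<odot>\<^bsub>?D\<^esub> h2) (x, y) x = (A \<odot>\<^bsub>?T\<^esub> f h2) (x, y) x"
    using mod_homD(3)[OF f(1) Ac h2] by simp
  also have "\<dots> = 0"
    using cl_smult_Fn[OF T mod_homD(1)[OF f(1) h2] y1(4), of "\<lambda>p. if p = x \<and> 0 < x then 1 else 0" "(x, y)" x]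
      Fn_zero_outside[OF mod_homD(1)[OF f(1) h2], of "(x, y)" "x - 1"] by (auto simp: A_def)
  finally have 2: "f (A \<odot>\<^bsub>?D\<^esub> h2) (x, y) x = 0" .
  have A2: "A \<odot>\<^bsub>?D\<^esub> h2 \<in> carrier ?D" by (rule left_module.smult_closed[OF LD Ac h2])
  have "f (Eu n x x \<odot>\<^bsub>?D\<^esub> h) (x, y) x = f h1 (x, y) x + f (A \<odot>\<^bsub>?D\<^esub> h2) (x, y) x"
    unfolding dec mod_homD(2)[OF f(1) h1 A2] Fn_ops(2) ..
  moreover have "f (Eu n x x \<odot>\<^bsub>?D\<^esub> h) = Eu n x x \<odot>\<^bsub>?T\<^esub> dl (x, y) x 1"
    using mod_homD(3)[OF f(1) Eu_closed h(1), of x x] h(2) by simp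
  moreover have "\<dots> = dl (x, y) x 1"
    using Eu_dl[OF T s, of x x "1::'k"] xy by simp
  ultimately show False using 1 2 by (simp add: dl_def)
qed

text \<open>Take one copy of the module for each \<open>t\<close> in \<open>T\<close>, and of that
  copy use only the summand \<open>\<rho> t\<close>, which has the same left end and projects onto
  \<open>t\<close>.\<close>

lemma gens_Fn_I:
  assumes S: "S \<subseteq> intervals n" and T: "T \<subseteq> intervals n"
    and le: "\<And>x y. (x, y) \<in> T \<Longrightarrow> \<exists>y'\<ge>y. (x, y') \<in> S"
  shows "gens (Lam n) (Fn n S :: ('k::field mat, _) module) (Fn n T :: ('k mat, _) module)"
proof -
  let ?S = "Fn n S :: ('k mat, _) module" and ?T = "Fn n T :: ('k mat, _) module"
  obtain e where e: "bij_betw e T {0..<card T}"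
    using ex_bij_betw_finite_nat[OF finite_subset[OF T finite_intervals]] by blast
  then have einj: "inj_on e T" and elt: "t \<in> T \<Longrightarrow> e t < card T" for t by (auto simp: bij_betw_def)
  define \<rho> where "\<rho> t = (fst t, SOME y'. y' \<ge> snd t \<and> (fst t, y') \<in> S)" for t
  have \<rho>: "\<rho> t \<in> S" "fst (\<rho> t) = fst t" "snd t \<le> snd (\<rho> t)" if "t \<in> T" for t
    using someI_ex[OF le[of "fst t" "snd t", unfolded prod.collapse, OF that]] by (auto simp: \<rho>_def)
  let ?D = "direct_sum (card T) (\<lambda>_. ?S)"
  define f where "f h = (\<lambda>t i. if t \<in> T \<and> fst t \<le> i \<and> i < snd t then h (e t) (\<rho> t) i else (0::'k))" for h
  have hk: "h (e t) \<in> carrier ?S" if "h \<in> carrier ?D" "t \<in> T" for h t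
    using that(1) elt[OF that(2)] unfolding direct_sum_simps by (intro PiE_mem[of h "{..<card T}" "\<lambda>_. carrier ?S"]) auto
  have "f \<in> mod_hom (Lam n) ?D ?T"
  proof (rule mod_homI)
    fix h assume h: "h \<in> carrier ?D"
    show "f h \<in> carrier ?T" unfolding Fn_carrier f_def by metis
    show "f (h \<oplus>\<^bsub>?D\<^esub> h') = f h \<oplus>\<^bsub>?T\<^esub> f h'" for h'
      by (intro ext) (simp add: f_def direct_sum_simps Fn_ops(2) elt)
    fix A :: "'k mat" assume A: "A \<in> carrier (Lam n)"
    show "f (A \<odot>\<^bsub>?D\<^esub> h) = A \<odot>\<^bsub>?T\<^esub> f h"
    proof (intro ext)
      fix t i
      show "f (A \<odot>\<^bsub>?D\<^esub> h) t i = (A \<odot>\<^bsub>?T\<^esub> f h) t i"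
      proof (cases "t \<in> T \<and> fst t \<le> i \<and> i < snd t")
        case True
        then have i: "i < n" using intervalsD[OF T, of t] by auto
        have "A $$ (i, j) * h (e t) (\<rho> t) j = A $$ (i, j) * f h t j" if j: "j < n" for j
        proof (cases "fst t \<le> j \<and> j < snd t")
          case False
          then consider "j < fst t" | "i < j" using True by linarith
          then show ?thesis
          proof cases
            case 1
            then have "h (e t) (\<rho> t) j = 0"
              using Fn_zero_outside[OF hk[OF h], of t "\<rho> t" j] \<rho>(2)[of t] True by simp
            then show ?thesis using False by (simp add: f_def)
          next
            case 2
            then show ?thesis using A i j by (simp add: Lam_carrier)
          qed
        qed (use True in \<open>simp add: f_def\<close>)
        then have "(\<Sum>j<n. A $$ (i, j) * h (e t) (\<rho> t) j) = (\<Sum>j<n. A $$ (i, j) * f h t j)" by (intro sum.cong) auto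
        then show ?thesis using True \<rho>[of t] elt[of t] by (simp add: f_def direct_sum_simps Fn_ops(3))
      next
        case False
        then have "f (A \<odot>\<^bsub>?D\<^esub> h) t i = 0" by (auto simp: f_def)
        moreover have "t \<notin> T \<Longrightarrow> (\<Sum>j<n. A $$ (i, j) * f h t j) = 0" by (simp add: f_def)
        ultimately show ?thesis using False by (auto simp: Fn_ops(3))
      qed
    qed
  qed
  moreover have "f ` carrier ?D = carrier ?T"
  proof (intro equalityI subsetI)
    fix g assume g: "g \<in> carrier ?T"
    define h where "h = (\<lambda>k\<in>{..<card T}. \<lambda>u i. let t = the_inv_into T e k in if u = \<rho> t then g t i else 0)"
    have inv: "the_inv_into T e k \<in> T" if "k < card T" for k
    proof -
      have "k \<in> e ` T" using that bij_betw_imp_surj_on[OF e] by simp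
      then show ?thesis by (rule the_inv_into_into[OF einj]) simp
    qed
    have "h \<in> carrier ?D"
    proof -
      have "(\<lambda>u i. let t = the_inv_into T e k in if u = \<rho> t then g t i else 0) \<in> carrier ?S" if "k < card T" for k
        unfolding Fn_carrier Let_def
      proof (intro allI impI)
        fix u i
        let ?t = "the_inv_into T e k"
        assume "(if u = \<rho> ?t then g ?t i else 0) \<noteq> 0"
        then have u: "u = \<rho> ?t" "g ?t i \<noteq> 0" by (auto split: if_splits)
        then have "fst ?t \<le> i \<and> i < snd ?t" using g unfolding Fn_carrier by blast
        then show "u \<in> S \<and> fst u \<le> i \<and> i < snd u" using u \<rho>[OF inv[OF that]] by auto
      qed
      then show ?thesis by (auto simp: h_def direct_sum_simps)
    qed
    moreover have "f h = g"
    proof (intro ext)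
      fix t i
      show "f h t i = g t i"
      proof (cases "t \<in> T \<and> fst t \<le> i \<and> i < snd t")
        case True
        then show ?thesis using elt[of t] the_inv_into_f_f[OF einj, of t] by (simp add: f_def h_def)
      next
        case False
        then have "g t i = 0" using Fn_zero_outside[OF g, of t i] by auto
        then show ?thesis using False by (auto simp: f_def)
      qed
    qed
    ultimately show "g \<in> f ` carrier ?D" by blast
  next
    fix g assume "g \<in> f ` carrier ?D"
    then show "g \<in> carrier ?T" unfolding Fn_carrier f_def by (auto split: if_splits)
  qed
  ultimately show ?thesis unfolding gens_def by blast
qed

text \<open>Follow the socle vector of \<open>(x, y)\<close>: its image \<open>v\<close> is nonzero
  in some summand \<open>t\<close> and comes from an element \<open>u\<close> at vertex
  \<open>x\<close>, so \<open>t\<close> contains \<open>x\<close> and \<open>y - 1\<close>. The next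
  arrow kills the socle vector, so it must kill \<open>v\<close>, and this fails if \<open>t\<close>
  continues beyond \<open>y\<close>.\<close>

lemma cogens_Fn_D:
  assumes S: "S \<subseteq> intervals n" and T: "T \<subseteq> intervals n"
    and g: "cogens (Lam n) (Fn n S :: ('k::field mat, _) module) (Fn n T :: ('k mat, _) module)"
    and s: "(x, y) \<in> T"
  shows "\<exists>x'\<le>x. (x', y) \<in> S"
proof -
  let ?S = "Fn n S :: ('k mat, _) module" and ?T = "Fn n T :: ('k mat, _) module"
  obtain m f where f: "f \<in> mod_hom (Lam n) ?T (direct_sum m (\<lambda>_. ?S))" "inj_on f (carrier ?T)"
    using g unfolding cogens_def by blast
  let ?D = "direct_sum m (\<lambda>_. ?S)"
  note LS = Fn_left_module[OF S] and LT = Fn_left_module[OF T]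
  have LD: "left_module (Lam n) ?D"
    by (rule direct_sum_left_module[OF ring_lower_tri_ring LS])
  have xy: "x < y" "y \<le> n" using intervalsD[OF T s] by auto
  have d: "dl (x, y) i (1::'k) \<in> carrier ?T" if "x \<le> i" "i < y" for i using s that by (intro dl_carrier) auto
  define v where "v = f (dl (x, y) (y - 1) 1)"
  define u where "u = f (dl (x, y) x 1)"
  have uv: "u \<in> carrier ?D" "v \<in> carrier ?D"
    unfolding u_def v_def using xy by (auto intro!: mod_homD(1)[OF f(1)] d)
  have dy: "dl (x, y) (y - 1) (1::'k) \<in> carrier ?T" using xy by (intro d) auto
  have vnz: "v \<noteq> \<zero>\<^bsub>?D\<^esub>"
    using iffD1[OF mod_hom_inj_iff[OF LT LD f(1)] f(2)] dy dl_nonzero unfolding v_def by blast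
  have "\<exists>k<m. v k \<noteq> \<zero>\<^bsub>?S\<^esub>"
  proof (rule ccontr)
    assume "\<not> ?thesis"
    then have "v = \<zero>\<^bsub>?D\<^esub>" using uv(2)
      by (intro PiE_ext[of v "{..<m}" "\<lambda>_. carrier ?S"]) (use uv(2) left_module_zero[OF LD] in \<open>auto simp: direct_sum_simps\<close>)
    then show False using vnz by simp
  qed
  then obtain k where k: "k < m" "v k \<noteq> \<zero>\<^bsub>?S\<^esub>" by blast
  have uvk: "u k \<in> carrier ?S" "v k \<in> carrier ?S" using uv k by (auto simp: direct_sum_simps)
  obtain t i where ti: "v k t i \<noteq> 0" using k(2) unfolding Fn_ops(1) by (metis ext)
  have "Eu n (y - 1) x \<odot>\<^bsub>?T\<^esub> dl (x, y) x (1::'k) = dl (x, y) (y - 1) 1"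
    using Eu_dl[OF T s, of x "y - 1" "1::'k"] xy by simp
  then have "v = Eu n (y - 1) x \<odot>\<^bsub>?D\<^esub> u"
    using mod_homD(3)[OF f(1) Eu_closed d[of x], of "y - 1" x] xy by (simp add: u_def v_def)
  then have "v k = Eu n (y - 1) x \<odot>\<^bsub>?S\<^esub> u k" using k(1) by (simp add: direct_sum_simps)
  then have "v k t i = (if i = y - 1 \<and> x \<le> i \<and> fst t \<le> i \<and> i < snd t then u k t x else 0)"
    using Eu_smult_Fn[OF S uvk(1), of x "y - 1" t i] xy by simp
  then have i: "i = y - 1" "u k t x \<noteq> 0" "i < snd t" using ti by (auto split: if_splits)
  then have t: "t \<in> S" "fst t \<le> x" using uvk(1) unfolding Fn_carrier by blast+
  have "snd t \<le> y"
  proof (rule ccontr)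
    assume "\<not> snd t \<le> y"
    then have yt: "y < snd t" "y < n" using intervalsD[OF S t(1)] by auto
    have "Eu n y (y - 1) \<odot>\<^bsub>?T\<^esub> dl (x, y) (y - 1) (1::'k) = \<zero>\<^bsub>?T\<^esub>"
      using Eu_dl[OF T s, of "y - 1" y "1::'k"] xy yt by simp
    then have "Eu n y (y - 1) \<odot>\<^bsub>?D\<^esub> v = \<zero>\<^bsub>?D\<^esub>"
      using mod_homD(3)[OF f(1) Eu_closed d[of "y - 1"], of y "y - 1"] xy mod_hom_zero[OF LT LD f(1)] by (simp add: v_def)
    from fun_cong[OF this, of k] have "Eu n y (y - 1) \<odot>\<^bsub>?S\<^esub> v k = \<zero>\<^bsub>?S\<^esub>"
      using k(1) by (simp add: direct_sum_simps)
    then have "(Eu n y (y - 1) \<odot>\<^bsub>?S\<^esub> v k) t y = 0" by (simp add: Fn_ops(1))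
    moreover have "(Eu n y (y - 1) \<odot>\<^bsub>?S\<^esub> v k) t y = v k t (y - 1)"
      using Eu_smult_Fn[OF S uvk(2), of "y - 1" y t y] yt xy t by auto
    ultimately show False using ti i by simp
  qed
  then have "snd t = y" using i xy by auto
  then show ?thesis using t by (cases t) auto
qed

lemma cogens_Fn_I:
  assumes S: "S \<subseteq> intervals n" and T: "T \<subseteq> intervals n"
    and le: "\<And>x y. (x, y) \<in> T \<Longrightarrow> \<exists>x'\<le>x. (x', y) \<in> S"
  shows "cogens (Lam n) (Fn n S :: ('k::field mat, _) module) (Fn n T :: ('k mat, _) module)"
proof -
  let ?S = "Fn n S :: ('k mat, _) module" and ?T = "Fn n T :: ('k mat, _) module"
  obtain e where e: "bij_betw e {0..<card T} T"
    using ex_bij_betw_nat_finite[OF finite_subset[OF T finite_intervals]] by blast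
  then have eT: "k < card T \<Longrightarrow> e k \<in> T" for k by (auto simp: bij_betw_def)
  define \<rho> where "\<rho> t = (SOME x'. x' \<le> fst t \<and> (x', snd t) \<in> S, snd t)" for t
  have \<rho>: "\<rho> t \<in> S" "fst (\<rho> t) \<le> fst t" "snd (\<rho> t) = snd t" if "t \<in> T" for t
    using someI_ex[OF le[of "fst t" "snd t", unfolded prod.collapse, OF that]] by (auto simp: \<rho>_def)
  let ?D = "direct_sum (card T) (\<lambda>_. ?S)"
  define f where "f g = (\<lambda>k\<in>{..<card T}. \<lambda>u i. if u = \<rho> (e k) then g (e k) i else (0::'k))"
    for g :: "nat \<times> nat \<Rightarrow> nat \<Rightarrow> 'k"
  have hom: "f \<in> mod_hom (Lam n) ?T ?D"
  proof (rule mod_homI)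
    fix g assume g: "g \<in> carrier ?T"
    have "(\<lambda>u i. if u = \<rho> (e k) then g (e k) i else 0) \<in> carrier ?S" if "k < card T" for k
      unfolding Fn_carrier
    proof (intro allI impI)
      fix u i
      assume "(if u = \<rho> (e k) then g (e k) i else 0) \<noteq> 0"
      then have u: "u = \<rho> (e k)" "g (e k) i \<noteq> 0" by (auto split: if_splits)
      then have "fst (e k) \<le> i \<and> i < snd (e k)" using g unfolding Fn_carrier by blast
      then show "u \<in> S \<and> fst u \<le> i \<and> i < snd u" using u \<rho>[OF eT[OF that]] by auto
    qed
    then show "f g \<in> carrier ?D" by (auto simp: f_def direct_sum_simps)
    show "f (g \<oplus>\<^bsub>?T\<^esub> g') = f g \<oplus>\<^bsub>?D\<^esub> f g'" for g'
      unfolding f_def direct_sum_simps Fn_ops(2) by (intro restrict_ext ext) simp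
    fix A :: "'k mat" assume A: "A \<in> carrier (Lam n)"
    show "f (A \<odot>\<^bsub>?T\<^esub> g) = A \<odot>\<^bsub>?D\<^esub> f g"
      unfolding direct_sum_simps
      unfolding f_def
    proof (intro restrict_ext ext)
      fix k u i assume k: "k \<in> {..<card T}"
      let ?t = "e k"
      have t: "?t \<in> T" using k eT by simp
      show "(if u = \<rho> ?t then (A \<odot>\<^bsub>?T\<^esub> g) ?t i else 0) =
        (A \<odot>\<^bsub>?S\<^esub> (\<lambda>k\<in>{..<card T}. \<lambda>u i. if u = \<rho> (e k) then g (e k) i else 0) k) u i"
      proof (cases "u = \<rho> ?t")
        case True
        have "(\<Sum>j<n. A $$ (i, j) * g ?t j) = 0" if i: "i < fst ?t" "fst (\<rho> ?t) \<le> i"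
        proof (rule sum.neutral, rule ballI)
          fix j assume "j \<in> {..<n}"
          then show "A $$ (i, j) * g ?t j = 0"
            using A i Fn_zero_outside[OF g, of ?t j] intervalsD[OF T t] by (cases "i < j") (auto simp: Lam_carrier)
        qed
        then show ?thesis using True k \<rho>[OF t] by (auto simp: Fn_ops(3))
      next
        case False
        then show ?thesis using k by (simp add: Fn_ops(3))
      qed
    qed
  qed
  have "inj_on f (carrier ?T)"
  proof (rule inj_onI)
    fix g g' assume gg: "g \<in> carrier ?T" "g' \<in> carrier ?T" "f g = f g'"
    have "g t i = g' t i" for t i
    proof (cases "t \<in> T")
      case True
      then have "t \<in> e ` {0..<card T}" using bij_betw_imp_surj_on[OF e] by simp
      then obtain k where k: "k < card T" "e k = t" by auto
      have "f g k (\<rho> t) i = f g' k (\<rho> t) i" using gg(3) by simp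
      then show ?thesis using k by (simp add: f_def)
    next
      case False
      then show ?thesis using Fn_zero_outside[OF gg(1)] Fn_zero_outside[OF gg(2)] by metis
    qed
    then show "g = g'" by blast
  qed
  then show ?thesis using hom unfolding cogens_def by blast
qed

lemma int_le_iff_gen_cogen:
  fixes M N :: "('k::field mat, 'k vec) module"
  assumes S: "S \<subseteq> intervals n" and T: "T \<subseteq> intervals n"
    and M: "M \<in> fg_modules (Lam n)" "isomorphic_mod (Lam n) (Fn n S :: ('k mat, _) module) M"
    and N: "N \<in> fg_modules (Lam n)" "isomorphic_mod (Lam n) (Fn n T :: ('k mat, _) module) N"
  shows "cogen (Lam n) M \<subseteq> cogen (Lam n) N \<and> gen (Lam n) N \<subseteq> gen (Lam n) M \<longleftrightarrow> int_le S T"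
proof -
  note M' = isomorphic_mod_sym[OF Fn_left_module[OF S] M(2)]
  note N' = isomorphic_mod_sym[OF Fn_left_module[OF T] N(2)]
  have "cogen (Lam n) M \<subseteq> cogen (Lam n) N \<longleftrightarrow> cogens (Lam n) (Fn n T :: ('k mat, _) module) (Fn n S :: ('k mat, _) module)"
    unfolding cogen_subset_iff[OF M(1)]
    using gens_cogens_iso(2)[OF N'] gens_cogens_iso(2)[OF N(2)] gens_cogens_iso(2)[OF M'] gens_cogens_iso(2)[OF M(2)]
      cogens_trans by metis
  moreover have "gen (Lam n) N \<subseteq> gen (Lam n) M \<longleftrightarrow> gens (Lam n) (Fn n S :: ('k mat, _) module) (Fn n T :: ('k mat, _) module)"
    unfolding gen_subset_iff[OF N(1)]
    using gens_cogens_iso(1)[OF N'] gens_cogens_iso(1)[OF N(2)] gens_cogens_iso(1)[OF M'] gens_cogens_iso(1)[OF M(2)]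
      gens_trans by metis
  ultimately show ?thesis
    using gens_Fn_D[OF S T] gens_Fn_I[OF S T] cogens_Fn_D[OF T S] cogens_Fn_I[OF T S]
    unfolding int_le_def by blast
qed

section \<open>Faithfully balanced modules\<close>

text \<open>Linearity over the endomorphism ring, freed from the convention that elements of
  \<open>End_ring\<close> are undefined outside the carrier.\<close>

definition bicomm :: "'r ring \<Rightarrow> ('r, 'v) module \<Rightarrow> ('v \<Rightarrow> 'v) \<Rightarrow> bool" where
  "bicomm R M \<phi> \<longleftrightarrow> (\<forall>x\<in>carrier M. \<phi> x \<in> carrier M) \<and>
     (\<forall>x\<in>carrier M. \<forall>y\<in>carrier M. \<phi> (x \<oplus>\<^bsub>M\<^esub> y) = \<phi> x \<oplus>\<^bsub>M\<^esub> \<phi> y) \<and>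
     (\<forall>f\<in>mod_hom R M M. \<forall>x\<in>carrier M. \<phi> (f x) = f (\<phi> x))"

lemma bicommD:
  assumes "bicomm R M \<phi>"
  shows "x \<in> carrier M \<Longrightarrow> \<phi> x \<in> carrier M"
    "x \<in> carrier M \<Longrightarrow> y \<in> carrier M \<Longrightarrow> \<phi> (x \<oplus>\<^bsub>M\<^esub> y) = \<phi> x \<oplus>\<^bsub>M\<^esub> \<phi> y"
    "f \<in> mod_hom R M M \<Longrightarrow> x \<in> carrier M \<Longrightarrow> \<phi> (f x) = f (\<phi> x)"
  using assms by (auto simp: bicomm_def)

lemma End_End_carrier:
  assumes "left_module R M"
  shows "\<phi> \<in> carrier (End_ring (End_ring R M) (as_End_module M)) \<longleftrightarrow>
    \<phi> \<in> extensional (carrier M) \<and> bicomm R M \<phi>"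
proof -
  interpret left_module R M by fact
  have res: "restrict f (carrier M) \<in> mod_hom R M M \<inter> extensional (carrier M)" if "f \<in> mod_hom R M M" for f
    using mod_homD[OF that] by (intro IntI mod_homI) (auto simp: smult_closed)
  have "(\<forall>x\<in>carrier M. \<phi> (f x) = f (\<phi> x))"
    if "\<forall>x\<in>carrier M. \<phi> x \<in> carrier M"
      and a: "\<forall>f\<in>mod_hom R M M \<inter> extensional (carrier M). \<forall>x\<in>carrier M. \<phi> (f x) = f (\<phi> x)"
      and f: "f \<in> mod_hom R M M" for f
  proof
    fix x assume x: "x \<in> carrier M"
    have "\<phi> (restrict f (carrier M) x) = restrict f (carrier M) (\<phi> x)" using a res[OF f] x by blast
    then show "\<phi> (f x) = f (\<phi> x)" using x that(1) by simp
  qed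
  then have "(\<forall>x\<in>carrier M. \<phi> x \<in> carrier M) \<Longrightarrow>
      (\<forall>f\<in>mod_hom R M M \<inter> extensional (carrier M). \<forall>x\<in>carrier M. \<phi> (f x) = f (\<phi> x)) \<longleftrightarrow>
      (\<forall>f\<in>mod_hom R M M. \<forall>x\<in>carrier M. \<phi> (f x) = f (\<phi> x))"
    by blast
  moreover have "\<phi> \<in> carrier (End_ring (End_ring R M) (as_End_module M)) \<longleftrightarrow>
    \<phi> \<in> extensional (carrier M) \<and> (\<forall>x\<in>carrier M. \<phi> x \<in> carrier M) \<and>
     (\<forall>x\<in>carrier M. \<forall>y\<in>carrier M. \<phi> (x \<oplus>\<^bsub>M\<^esub> y) = \<phi> x \<oplus>\<^bsub>M\<^esub> \<phi> y) \<and>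
     (\<forall>f\<in>mod_hom R M M \<inter> extensional (carrier M). \<forall>x\<in>carrier M. \<phi> (f x) = f (\<phi> x))"
    unfolding End_ring_def as_End_module_def mod_hom_def[of "\<lparr>carrier = _, monoid.mult = _, one = _, zero = _, add = _\<rparr>"]
    by (simp add: Pi_iff) blast
  ultimately show ?thesis unfolding bicomm_def by blast
qed

text \<open>Injectivity of the natural map is faithfulness, surjectivity is the double centralizer
  property.\<close>

lemma faithfully_balanced_iff:
  assumes "left_module R M"
  shows "faithfully_balanced R M \<longleftrightarrow>
    (\<forall>r\<in>carrier R. \<forall>r'\<in>carrier R. (\<forall>x\<in>carrier M. r \<odot>\<^bsub>M\<^esub> x = r' \<odot>\<^bsub>M\<^esub> x) \<longrightarrow> r = r') \<and>
    (\<forall>\<phi>. bicomm R M \<phi> \<longrightarrow> (\<exists>r\<in>carrier R. \<forall>x\<in>carrier M. \<phi> x = r \<odot>\<^bsub>M\<^esub> x))"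
proof -
  interpret left_module R M by fact
  have hom_closed: "f x \<in> carrier M" if "f \<in> mod_hom R M M" "x \<in> carrier M" for f x
    by (rule mod_homD(1)[OF that])
  let ?C = "carrier (End_ring (End_ring R M) (as_End_module M))"
  let ?m = "\<lambda>r. \<lambda>x\<in>carrier M. r \<odot>\<^bsub>M\<^esub> x"
  have mC: "?m r \<in> ?C" if "r \<in> carrier R" for r
    unfolding End_End_carrier[OF assms] bicomm_def
    using that smult_closed smult_r_distr by (auto simp: mod_homD)
  have ext: "?m r = ?m r' \<longleftrightarrow> (\<forall>x\<in>carrier M. r \<odot>\<^bsub>M\<^esub> x = r' \<odot>\<^bsub>M\<^esub> x)" for r r'
    by (auto simp: restrict_def fun_eq_iff)
  have 1: "inj_on ?m (carrier R) \<longleftrightarrow>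
    (\<forall>r\<in>carrier R. \<forall>r'\<in>carrier R. (\<forall>x\<in>carrier M. r \<odot>\<^bsub>M\<^esub> x = r' \<odot>\<^bsub>M\<^esub> x) \<longrightarrow> r = r')"
    unfolding inj_on_def ext ..
  have 2: "?m ` carrier R = ?C \<longleftrightarrow>
    (\<forall>\<phi>. bicomm R M \<phi> \<longrightarrow> (\<exists>r\<in>carrier R. \<forall>x\<in>carrier M. \<phi> x = r \<odot>\<^bsub>M\<^esub> x))"
  proof
    assume img: "?m ` carrier R = ?C"
    show "\<forall>\<phi>. bicomm R M \<phi> \<longrightarrow> (\<exists>r\<in>carrier R. \<forall>x\<in>carrier M. \<phi> x = r \<odot>\<^bsub>M\<^esub> x)"
    proof (intro allI impI)
      fix \<phi> assume b: "bicomm R M \<phi>"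
      have "bicomm R M (restrict \<phi> (carrier M))"
        using bicommD[OF b] hom_closed by (auto simp: bicomm_def)
      then have "restrict \<phi> (carrier M) \<in> ?m ` carrier R"
        unfolding img End_End_carrier[OF assms] by simp
      then obtain r where r: "r \<in> carrier R" "restrict \<phi> (carrier M) = ?m r" by auto
      have "\<phi> x = r \<odot>\<^bsub>M\<^esub> x" if "x \<in> carrier M" for x using fun_cong[OF r(2), of x] that by simp
      then show "\<exists>r\<in>carrier R. \<forall>x\<in>carrier M. \<phi> x = r \<odot>\<^bsub>M\<^esub> x" using r by blast
    qed
  next
    assume R: "\<forall>\<phi>. bicomm R M \<phi> \<longrightarrow> (\<exists>r\<in>carrier R. \<forall>x\<in>carrier M. \<phi> x = r \<odot>\<^bsub>M\<^esub> x)"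
    show "?m ` carrier R = ?C"
    proof (intro equalityI subsetI)
      fix \<phi> assume "\<phi> \<in> ?C"
      then have p: "\<phi> \<in> extensional (carrier M)" "bicomm R M \<phi>" unfolding End_End_carrier[OF assms] by auto
      then obtain r where r: "r \<in> carrier R" "\<forall>x\<in>carrier M. \<phi> x = r \<odot>\<^bsub>M\<^esub> x" using R by blast
      then have "\<phi> = ?m r" using p(1) by (intro extensionalityI[of _ "carrier M"]) auto
      then show "\<phi> \<in> ?m ` carrier R" using r by blast
    qed (use mC in blast)
  qed
  show ?thesis unfolding faithfully_balanced_def bij_betw_def 1 2 ..
qed

lemma faithfully_balanced_iso:
  assumes M: "left_module R M" and N: "left_module R N" and iso: "isomorphic_mod R M N"
    and fb: "faithfully_balanced R M"
  shows "faithfully_balanced R N"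
proof -
  interpret M: left_module R M by fact
  interpret N: left_module R N by fact
  obtain f where f: "f \<in> mod_iso R M N" using iso by (rule isomorphic_modE)
  define g where "g = inv_into (carrier M) f"
  have g: "g \<in> mod_iso R N M" unfolding g_def by (rule mod_iso_inv[OF M f])
  note fh = mod_homD[OF mod_isoD(1)[OF f]] and gh = mod_homD[OF mod_isoD(1)[OF g]]
  have gf: "g (f x) = x" if "x \<in> carrier M" for x
    unfolding g_def using that mod_isoD(2)[OF f] by simp
  have fg: "f (g y) = y" if "y \<in> carrier N" for y
    unfolding g_def using that mod_isoD(3)[OF f] by (simp add: f_inv_into_f)
  note F = fb[unfolded faithfully_balanced_iff[OF M]]
  show ?thesis unfolding faithfully_balanced_iff[OF N]
  proof (intro conjI ballI allI impI)
    fix r r' assume r: "r \<in> carrier R" "r' \<in> carrier R" "\<forall>x\<in>carrier N. r \<odot>\<^bsub>N\<^esub> x = r' \<odot>\<^bsub>N\<^esub> x"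
    have "r \<odot>\<^bsub>M\<^esub> x = r' \<odot>\<^bsub>M\<^esub> x" if x: "x \<in> carrier M" for x
    proof -
      have "f (r \<odot>\<^bsub>M\<^esub> x) = f (r' \<odot>\<^bsub>M\<^esub> x)" using r fh x by simp
      then have "g (f (r \<odot>\<^bsub>M\<^esub> x)) = g (f (r' \<odot>\<^bsub>M\<^esub> x))" by simp
      then show ?thesis using gf M.smult_closed r x by simp
    qed
    then show "r = r'" using F r by blast
  next
    fix \<phi> assume "bicomm R N \<phi>"
    note p = bicommD[OF this]
    have "bicomm R M (\<lambda>x. g (\<phi> (f x)))"
      unfolding bicomm_def
    proof (intro conjI ballI)
      fix x assume x: "x \<in> carrier M"
      show "g (\<phi> (f x)) \<in> carrier M" using x fh gh p by simp
      show "g (\<phi> (f (x \<oplus>\<^bsub>M\<^esub> y))) = g (\<phi> (f x)) \<oplus>\<^bsub>M\<^esub> g (\<phi> (f y))" if "y \<in> carrier M" for y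
        using x that fh gh(2) p(1,2) by simp
      fix h assume h: "h \<in> mod_hom R M M"
      note hh = mod_homD[OF h]
      have "(\<lambda>y. f (h (g y))) \<in> mod_hom R N N"
        by (rule mod_hom_comp[OF mod_isoD(1)[OF g] mod_hom_comp[OF h mod_isoD(1)[OF f]]])
      from p(3)[OF this fh(1)[OF x]] have "\<phi> (f (h x)) = f (h (g (\<phi> (f x))))" using gf x by simp
      then show "g (\<phi> (f (h x))) = h (g (\<phi> (f x)))" using gf hh gh p fh x by simp
    qed
    then obtain r where r: "r \<in> carrier R" "\<forall>x\<in>carrier M. g (\<phi> (f x)) = r \<odot>\<^bsub>M\<^esub> x" using F by blast
    have "\<phi> y = r \<odot>\<^bsub>N\<^esub> y" if y: "y \<in> carrier N" for y
    proof -
      have "g (\<phi> (f (g y))) = r \<odot>\<^bsub>M\<^esub> g y" using r gh(1)[OF y] by blast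
      then have "f (g (\<phi> y)) = f (r \<odot>\<^bsub>M\<^esub> g y)" using fg[OF y] by simp
      then show ?thesis using fg p(1)[OF y] fh(3)[OF r(1) gh(1)[OF y]] fg[OF y] by simp
    qed
    then show "\<exists>r\<in>carrier R. \<forall>x\<in>carrier N. \<phi> x = r \<odot>\<^bsub>N\<^esub> x" using r by blast
  qed
qed

text \<open>The homomorphism between two summands whose image is the interval \<open>(fst s, snd t)\<close>.\<close>

definition tr :: "nat \<times> nat \<Rightarrow> nat \<times> nat \<Rightarrow> (nat \<times> nat \<Rightarrow> nat \<Rightarrow> 'k) \<Rightarrow> nat \<times> nat \<Rightarrow> nat \<Rightarrow> 'k::field" where
  "tr s t h = (\<lambda>u i. if u = t \<and> fst s \<le> i \<and> i < snd t then h s i else 0)"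

lemma tr_apply: "tr s t h u i = (if u = t \<and> fst s \<le> i \<and> i < snd t then h s i else 0)"
  by (simp add: tr_def)

text \<open>Under the two inequalities the interval from \<open>fst s\<close> to
  \<open>snd t\<close> is a quotient of \<open>s\<close> and a submodule of \<open>t\<close>; if it
  is empty, the map is zero.\<close>

lemma tr_hom:
  assumes S: "S \<subseteq> intervals n" and st: "s \<in> S" "t \<in> S" "fst t \<le> fst s" "snd t \<le> snd s"
  shows "tr s t \<in> mod_hom (Lam n) (Fn n S :: ('k::field mat, _) module) (Fn n S)"
proof (rule mod_homI)
  fix h :: "nat \<times> nat \<Rightarrow> nat \<Rightarrow> 'k" assume h: "h \<in> carrier (Fn n S)"
  show "tr s t h \<in> carrier (Fn n S)"
    unfolding Fn_carrier
  proof (intro allI impI)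
    fix u i assume "tr s t h u i \<noteq> 0"
    then show "u \<in> S \<and> fst u \<le> i \<and> i < snd u" using st by (auto simp: tr_def split: if_splits)
  qed
  show "tr s t (h \<oplus>\<^bsub>Fn n S\<^esub> h') = tr s t h \<oplus>\<^bsub>Fn n S\<^esub> tr s t h'" for h'
    by (intro ext) (simp add: tr_def Fn_ops(2))
  fix A :: "'k mat" assume A: "A \<in> carrier (Lam n)"
  have Az: "A $$ (i, j) = 0" if "i < j" "j < n" for i j using A that by (simp add: Lam_carrier)
  have n: "snd s \<le> n" "snd t \<le> n" using intervalsD[OF S] st by auto
  show "tr s t (A \<odot>\<^bsub>Fn n S\<^esub> h) = A \<odot>\<^bsub>Fn n S\<^esub> tr s t h"
  proof (intro ext)
    fix u i
    show "tr s t (A \<odot>\<^bsub>Fn n S\<^esub> h) u i = (A \<odot>\<^bsub>Fn n S\<^esub> tr s t h) u i"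
    proof (cases "u = t \<and> fst t \<le> i \<and> i < snd t")
      case True
      have "(\<Sum>j<n. A $$ (i, j) * tr s t h t j) = (if fst s \<le> i then \<Sum>j<n. A $$ (i, j) * h s j else 0)"
      proof (cases "fst s \<le> i")
        case True
        have "A $$ (i, j) * tr s t h t j = A $$ (i, j) * h s j" if "j < n" for j
          using \<open>u = t \<and> fst t \<le> i \<and> i < snd t\<close> that Az[of i j] Fn_zero_outside[OF h, of s j]
          by (cases "j < fst s"; cases "snd t \<le> j") (auto simp: tr_def)
        then show ?thesis using True by (auto intro!: sum.cong)
      next
        case False
        then show ?thesis using Az by (auto simp: tr_def intro!: sum.neutral)
      qed
      then show ?thesis unfolding tr_apply[of s t "A \<odot>\<^bsub>Fn n S\<^esub> h"]
        using True st by (auto simp: Fn_ops(3))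
    next
      case False
      have "u \<noteq> t \<Longrightarrow> (\<Sum>j<n. A $$ (i, j) * tr s t h u j) = 0" by (simp add: tr_def)
      then show ?thesis unfolding tr_apply[of s t "A \<odot>\<^bsub>Fn n S\<^esub> h"]
        using False st by (auto simp: Fn_ops(3))
    qed
  qed
qed

text \<open>A member of the bicommutant is only known to be additive; commuting with these
  endomorphisms makes it linear over the field.\<close>

lemma scale_hom:
  "(\<lambda>h s i. c * h s i) \<in> mod_hom (Lam n) (Fn n S :: ('k::field mat, _) module) (Fn n S)"
proof (rule mod_homI)
  fix h :: "nat \<times> nat \<Rightarrow> nat \<Rightarrow> 'k" assume h: "h \<in> carrier (Fn n S)"
  then show "(\<lambda>s i. c * h s i) \<in> carrier (Fn n S)" unfolding Fn_carrier by (metis mult_zero_right)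
  show "(\<lambda>s i. c * (A \<odot>\<^bsub>Fn n S\<^esub> h) s i) = A \<odot>\<^bsub>Fn n S\<^esub> (\<lambda>s i. c * h s i)" for A
    by (intro ext) (simp add: Fn_ops(3) sum_distrib_left algebra_simps)
qed (simp add: Fn_ops(2) algebra_simps)

lemma tr_dl:
  assumes "fst s \<le> j" "j < snd s"
  shows "tr s t (dl s j a) = (if j < snd t then dl t j a else (\<lambda>_ _. 0))"
  using assms by (intro ext) (auto simp: tr_def dl_def)

text \<open>An element of the bicommutant acts on each summand by a matrix. Following the chain of summands
  \<open>s, t, \<dots>\<close> up to the full interval, all these matrices are submatrices of the one that belongs to the
  full interval, and the steps of the chain force entries above the diagonal to vanish.\<close>

lemma fbset_faithfully_balanced:
  assumes S: "fbset n S" and n: "n \<ge> 1"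
  shows "faithfully_balanced (Lam n) (Fn n S :: ('k::field mat, _) module)"
proof -
  let ?F = "Fn n S :: ('k mat, _) module"
  have Si: "S \<subseteq> intervals n" and root: "(0, n) \<in> S" using S by (auto simp: fbset_def)
  note L = Fn_left_module[OF Si]
  interpret left_module "Lam n" ?F by (rule L)
  have d: "dl s j (a::'k) \<in> carrier ?F" if "s \<in> S" "fst s \<le> j" "j < snd s" for s j a
    using that by (rule dl_carrier)
  have d0: "dl (0, n) j (1::'k) \<in> carrier ?F" if "j < n" for j using d[OF root] that by simp
  have act0: "(A \<odot>\<^bsub>?F\<^esub> dl (0, n) j 1) (0, n) i = A $$ (i, j)" if "i < n" "j < n" for A i j
  proof -
    have "(\<Sum>k<n. A $$ (i, k) * dl (0, n) j 1 (0, n) k) = (\<Sum>k<n. if k = j then A $$ (i, j) else 0)"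
      by (intro sum.cong) (auto simp: dl_def)
    then show ?thesis using that by (simp add: Fn_ops(3))
  qed
  show ?thesis unfolding faithfully_balanced_iff[OF L]
  proof (intro conjI ballI allI impI)
    fix A B :: "'k mat"
    assume AB: "A \<in> carrier (Lam n)" "B \<in> carrier (Lam n)" "\<forall>x\<in>carrier ?F. A \<odot>\<^bsub>?F\<^esub> x = B \<odot>\<^bsub>?F\<^esub> x"
    show "A = B"
    proof (rule eq_matI)
      show "dim_row A = dim_row B" "dim_col A = dim_col B" using AB by (auto simp: Lam_carrier)
      fix i j assume "i < dim_row B" "j < dim_col B"
      then have ij: "i < n" "j < n" using AB by (auto simp: Lam_carrier)
      then show "A $$ (i, j) = B $$ (i, j)" using AB(3) d0[of j] act0[of i j A] act0[of i j B] by simp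
    qed
  next
    fix \<phi> assume "bicomm (Lam n) ?F \<phi>"
    note p = bicommD[OF this]
    have pc: "\<phi> (dl s j 1) \<in> carrier ?F" if "s \<in> S" "fst s \<le> j" "j < snd s" for s j
      using p(1)[OF d[OF that]] .
    have p0: "\<phi> (\<lambda>_ _. 0) = (\<lambda>_ _. 0)"
    proof -
      have "\<phi> \<zero>\<^bsub>?F\<^esub> \<oplus>\<^bsub>?F\<^esub> \<phi> \<zero>\<^bsub>?F\<^esub> = \<phi> \<zero>\<^bsub>?F\<^esub>" using p(2)[of "\<zero>\<^bsub>?F\<^esub>" "\<zero>\<^bsub>?F\<^esub>"] by simp
      then have "\<phi> \<zero>\<^bsub>?F\<^esub> = \<zero>\<^bsub>?F\<^esub>" using p(1) M.add.r_cancel_one by simp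
      then show ?thesis by (simp add: Fn_ops(1))
    qed
    define a where "a s i j = \<phi> (dl s j 1) s i" for s i j
    \<comment> \<open>\<open>tr s s\<close> is the projection onto the summand \<open>s\<close>. It
      fixes \<open>dl s j 1\<close>, hence also the image of this vector under
      \<open>\<phi>\<close>.\<close>
    have own: "\<phi> (dl s j 1) u i = 0" if "s \<in> S" "fst s \<le> j" "j < snd s" "u \<noteq> s" for s j u i
    proof -
      have "\<phi> (dl s j 1) = tr s s (\<phi> (dl s j 1))"
        using p(3)[OF tr_hom[OF Si that(1,1)] d[OF that(1-3)], of 1] tr_dl[OF that(2,3), of s "1::'k"] that by simp
      then show ?thesis using that(4) by (metis (no_types, lifting) tr_def)
    qed
    have act: "\<phi> h s i = (\<Sum>j<n. a s i j * h s j)" if h: "h \<in> carrier ?F" and s: "s \<in> S" for h s i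
      using h
    proof (induction rule: Fn_induct[OF Si, consumes 1, case_names zero dl add])
      case zero
      show ?case using p0 by simp
    next
      case (dl u j c)
      have "dl u j c = (\<lambda>s i. c * dl u j 1 s i)" by (intro ext) (simp add: dl_def)
      then have e: "\<phi> (dl u j c) s i = c * \<phi> (dl u j 1) s i"
        using p(3)[OF scale_hom d[OF dl], of c 1] by simp
      have "j < n" using intervalsD[OF Si dl(1)] dl by simp
      show ?case
      proof (cases "u = s")
        case True
        have "(\<Sum>j'<n. a s i j' * dl u j c s j') = (\<Sum>j'<n. if j' = j then a s i j * c else 0)"
          using True by (intro sum.cong) (auto simp: dl_def)
        then show ?thesis using e True \<open>j < n\<close> by (simp add: a_def)
      next
        case False
        then have "(\<Sum>j'<n. a s i j' * dl u j c s j') = 0" by (intro sum.neutral) (auto simp: dl_def)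
        then show ?thesis using e False own[OF dl, of s i] by simp
      qed
    next
      case (add f g)
      then show ?case using p(2)[OF add(1,2)] by (simp add: Fn_ops(2) algebra_simps sum.distrib)
    qed
    let ?r = "(0, n)"
    \<comment> \<open>The second clause says that the entry \<open>(q1, q2)\<close> above the
      diagonal vanishes as soon as an end \<open>e\<close> of \<open>s\<close> satisfies
      \<open>q1 < e \<le> q2\<close>. The induction is on the number of vertices outside
      \<open>s\<close>.\<close>
    have chain: "(\<forall>i j. fst s \<le> i \<longrightarrow> i < snd s \<longrightarrow> fst s \<le> j \<longrightarrow> j < snd s \<longrightarrow> a s i j = a ?r i j) \<and>
      (\<forall>q1 q2. q1 < q2 \<longrightarrow> q2 < n \<longrightarrow> fst s \<le> q2 \<longrightarrow> q1 < snd s \<longrightarrow> \<not> (fst s \<le> q1 \<and> q2 < snd s) \<longrightarrow> a ?r q1 q2 = 0)"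
      if "s \<in> S" for s
      using that
    proof (induction "fst s + (n - snd s)" arbitrary: s rule: less_induct)
      case less
      obtain x y where s: "s = (x, y)" by (cases s)
      note xy = intervalsD[OF Si less.prems]
      consider "s = (0, n)" | y' where "(x, y') \<in> S" "y < y'" | x' where "(x', y) \<in> S" "x' < x"
        using S less.prems s unfolding fbset_def by blast
      then show ?case
      proof cases
        case 1
        then show ?thesis by auto
      next
        case (2 y')
        let ?t = "(x, y')"
        have y'n: "y' \<le> n" using intervalsD[OF Si 2(1)] by simp
        have IH: "a ?t i j = a ?r i j" if "x \<le> i" "i < y'" "x \<le> j" "j < y'" for i j
          using less.hyps[OF _ 2(1)] that 2(2) y'n s by simp
        have IH2: "a ?r q1 q2 = 0" if "q1 < q2" "q2 < n" "x \<le> q2" "q1 < y'" "\<not> (x \<le> q1 \<and> q2 < y')" for q1 q2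
          using less.hyps[OF _ 2(1)] that 2(2) y'n s by auto
        have hom: "tr ?t s \<in> mod_hom (Lam n) ?F ?F"
          using less.prems 2 s by (intro tr_hom[OF Si]) auto
        \<comment> \<open>Commuting with the projection of the longer interval onto
          \<open>s\<close>: columns before \<open>y\<close> must agree, and in the columns from
          \<open>y\<close> on the entries of the rows before \<open>y\<close> vanish.\<close>
        have step: "a ?t i j = (if j < y then a s i j else 0)" if "x \<le> i" "i < y" "x \<le> j" "j < y'" for i j
        proof -
          have "\<phi> (tr ?t s (dl ?t j 1)) s i = tr ?t s (\<phi> (dl ?t j 1)) s i"
            using p(3)[OF hom d[OF 2(1)], of j 1] that by simp
          then show ?thesis using that s tr_dl[of ?t j s "1::'k"] p0 by (auto simp: a_def tr_def split: if_splits)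
        qed
        show ?thesis
        proof (intro conjI allI impI)
          fix i j assume "fst s \<le> i" "i < snd s" "fst s \<le> j" "j < snd s"
          then show "a s i j = a ?r i j" using step[of i j] IH[of i j] s 2(2) by simp
        next
          fix q1 q2 assume q: "q1 < q2" "q2 < n" "fst s \<le> q2" "q1 < snd s" "\<not> (fst s \<le> q1 \<and> q2 < snd s)"
          show "a ?r q1 q2 = 0"
          proof (cases "x \<le> q1 \<and> q2 < y'")
            case True
            then show ?thesis using step[of q1 q2] IH[of q1 q2] q s 2(2) by auto
          next
            case False
            then show ?thesis using IH2[of q1 q2] q s 2(2) by auto
          qed
        qed
      next
        case (3 x')
        let ?t = "(x', y)"
        have IH: "a ?t i j = a ?r i j" if "x' \<le> i" "i < y" "x' \<le> j" "j < y" for i j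
          using less.hyps[OF _ 3(1)] that 3(2) s by simp
        have IH2: "a ?r q1 q2 = 0" if "q1 < q2" "q2 < n" "x' \<le> q2" "q1 < y" "\<not> (x' \<le> q1 \<and> q2 < y)" for q1 q2
          using less.hyps[OF _ 3(1)] that 3(2) s by auto
        have hom: "tr s ?t \<in> mod_hom (Lam n) ?F ?F"
          using less.prems 3 s by (intro tr_hom[OF Si]) auto
        \<comment> \<open>Dually, commuting with the embedding of \<open>s\<close>: here the entries
          with \<open>i < x \<le> j\<close> vanish.\<close>
        have step: "a ?t i j = (if x \<le> i then a s i j else 0)" if "x' \<le> i" "i < y" "x \<le> j" "j < y" for i j
        proof -
          have "\<phi> (tr s ?t (dl s j 1)) ?t i = tr s ?t (\<phi> (dl s j 1)) ?t i"
            using p(3)[OF hom d[OF less.prems], of j 1] that s by simp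
          then show ?thesis using that s tr_dl[of s j ?t "1::'k"] by (auto simp: a_def tr_def split: if_splits)
        qed
        show ?thesis
        proof (intro conjI allI impI)
          fix i j assume "fst s \<le> i" "i < snd s" "fst s \<le> j" "j < snd s"
          then show "a s i j = a ?r i j" using step[of i j] IH[of i j] s 3(2) by simp
        next
          fix q1 q2 assume q: "q1 < q2" "q2 < n" "fst s \<le> q2" "q1 < snd s" "\<not> (fst s \<le> q1 \<and> q2 < snd s)"
          show "a ?r q1 q2 = 0"
          proof (cases "x' \<le> q1 \<and> q2 < y")
            case True
            then show ?thesis using step[of q1 q2] IH[of q1 q2] q s 3(2) by auto
          next
            case False
            then show ?thesis using IH2[of q1 q2] q s 3(2) by auto
          qed
        qed
      qed
    qed
    define A where "A = mat n n (\<lambda>(i, j). a ?r i j)"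
    have "a ?r q1 q2 = 0" if q: "q1 < q2" "q2 < n" for q1 q2
    proof -
      \<comment> \<open>\<open>Suc q1\<close> is an inner vertex with
        \<open>q1 < Suc q1 \<le> q2\<close>; as an end of some interval it separates the two indices
        in the sense of \<open>chain\<close>.\<close>
      have "(\<exists>y. (Suc q1, y) \<in> S) \<or> (\<exists>x. (x, Suc q1) \<in> S)" using S q unfolding fbset_def by auto
      then show ?thesis
      proof
        assume "\<exists>y. (Suc q1, y) \<in> S"
        then obtain y where y: "(Suc q1, y) \<in> S" by blast
        show ?thesis using chain[OF y] q intervalsD[OF Si y] by auto
      next
        assume "\<exists>x. (x, Suc q1) \<in> S"
        then obtain x where x: "(x, Suc q1) \<in> S" by blast
        show ?thesis using chain[OF x] q intervalsD[OF Si x] by auto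
      qed
    qed
    then have A: "A \<in> carrier (Lam n)" by (auto simp: A_def Lam_carrier)
    moreover have "\<phi> h = A \<odot>\<^bsub>?F\<^esub> h" if h: "h \<in> carrier ?F" for h
    proof (intro ext)
      fix s i
      show "\<phi> h s i = (A \<odot>\<^bsub>?F\<^esub> h) s i"
      proof (cases "s \<in> S \<and> fst s \<le> i \<and> i < snd s")
        case True
        then have i: "i < n" using intervalsD[OF Si, of s] by auto
        have "a s i j * h s j = A $$ (i, j) * h s j" if "j < n" for j
        proof (cases "fst s \<le> j \<and> j < snd s")
          case True
          then show ?thesis using chain[of s] \<open>s \<in> S \<and> _\<close> i that by (simp add: A_def)
        next
          case False
          then show ?thesis using Fn_zero_outside[OF h, of s j] by auto
        qed
        then have "(\<Sum>j<n. a s i j * h s j) = (\<Sum>j<n. A $$ (i, j) * h s j)" by (intro sum.cong) auto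
        then show ?thesis using act[OF h, of s i] True by (simp add: Fn_ops(3))
      next
        case False
        then have "\<phi> h s i = 0" "(A \<odot>\<^bsub>?F\<^esub> h) s i = 0"
          using Fn_zero_outside[OF p(1)[OF h], of s i] Fn_zero_outside[OF smult_closed[OF A h], of s i] by auto
        then show ?thesis by simp
      qed
    qed
    ultimately show "\<exists>r\<in>carrier (Lam n). \<forall>x\<in>carrier ?F. \<phi> x = r \<odot>\<^bsub>?F\<^esub> x" by blast
  qed
qed

text \<open>If a condition fails, the bicommutant contains an element that is not the action of a lower
  triangular matrix: for a summand \<open>(x, y)\<close> not related to a larger one, the map onto its socle that
  reads off the coordinate at its top; for an inner vertex \<open>i\<close> that is no end point, the map that
  moves the coordinates at \<open>i\<close> back to \<open>i - 1\<close>.\<close>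

lemma faithfully_balanced_fbset:
  assumes S: "S \<subseteq> intervals n" and n: "n \<ge> 1"
    and fb: "faithfully_balanced (Lam n) (Fn n S :: ('k::field mat, _) module)"
  shows "fbset n S"
proof -
  let ?F = "Fn n S :: ('k mat, _) module"
  note L = Fn_left_module[OF S]
  interpret left_module "Lam n" ?F by (rule L)
  note F = fb[unfolded faithfully_balanced_iff[OF L]]
  have d: "dl s j (a::'k) \<in> carrier ?F" if "s \<in> S" "fst s \<le> j" "j < snd s" for s j a
    using that by (rule dl_carrier)
  have act: "(A \<odot>\<^bsub>?F\<^esub> dl s j 1) s i = A $$ (i, j)" if "s \<in> S" "fst s \<le> i" "i < snd s" "fst s \<le> j" "j < snd s" for A s i j
  proof -
    have "(\<Sum>k<n. A $$ (i, k) * dl s j 1 s k) = (\<Sum>k<n. if k = j then A $$ (i, j) else 0)"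
      by (intro sum.cong) (auto simp: dl_def)
    then show ?thesis using that intervalsD[OF S that(1)] by (simp add: Fn_ops(3))
  qed
  have root: "(0, n) \<in> S"
  proof (rule ccontr)
    assume no: "(0, n) \<notin> S"
    \<comment> \<open>A matrix entry is felt only by summands containing both vertices, so the entry
      at \<open>(n - 1, 0)\<close> acts on the full interval alone.\<close>
    have "Eu n (n - 1) 0 \<odot>\<^bsub>?F\<^esub> h = \<zero>\<^bsub>Lam n\<^esub> \<odot>\<^bsub>?F\<^esub> h" if h: "h \<in> carrier ?F" for h
    proof -
      have "(Eu n (n - 1) 0 \<odot>\<^bsub>?F\<^esub> h) s i = 0" for s i
      proof (rule ccontr)
        assume "(Eu n (n - 1) 0 \<odot>\<^bsub>?F\<^esub> h) s i \<noteq> 0"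
        then have *: "i = n - 1" "i < snd s" "h s 0 \<noteq> 0"
          using Eu_smult_Fn[OF S h, of 0 "n - 1" s i] n by (auto split: if_splits)
        then have "s \<in> S" "fst s \<le> 0" using h unfolding Fn_carrier by blast+
        then have "s = (0, n)" using * intervalsD[OF S, of s] n by (cases s) auto
        then show False using no \<open>s \<in> S\<close> by simp
      qed
      then have "Eu n (n - 1) 0 \<odot>\<^bsub>?F\<^esub> h = \<zero>\<^bsub>?F\<^esub>" unfolding Fn_ops(1) by (intro ext) auto
      then show ?thesis using zero_smult[OF h] by simp
    qed
    then have "Eu n (n - 1) 0 = (\<zero>\<^bsub>Lam n\<^esub> :: 'k mat)"
      using F Eu_closed[of n "n - 1" 0] R.zero_closed by blast
    then have "Eu n (n - 1) 0 $$ (n - 1, 0) = (0::'k)" using n by (simp add: Lam_ops)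
    then show False using n by (simp add: Eu_def cl_def)
  qed
  show ?thesis unfolding fbset_def
  proof (intro conjI allI impI)
    show "S \<subseteq> intervals n" by fact
    show "(0, n) \<in> S" by fact
  next
    fix x y assume s: "(x, y) \<in> S" "(x, y) \<noteq> (0, n)"
    let ?s = "(x, y)"
    show "(\<exists>y'>y. (x, y') \<in> S) \<or> (\<exists>x'<x. (x', y) \<in> S)"
    proof (rule ccontr)
      assume no: "\<not> ?thesis"
      have xy: "x < y" "y \<le> n" using intervalsD[OF S s(1)] by auto
      then have xn: "x < n" "y - 1 < n" "x \<le> y - 1" "y - 1 < y" by auto
      define \<phi> where "\<phi> h = dl ?s (y - 1) (h ?s x)" for h :: "nat \<times> nat \<Rightarrow> nat \<Rightarrow> 'k"
      have dlast: "dl ?s (y - 1) (c::'k) \<in> carrier ?F" for c using s xn by (intro d) auto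
      have dfirst: "dl ?s x (c::'k) \<in> carrier ?F" for c using s xy by (intro d) auto
      have comm: "\<phi> (f h) = f (\<phi> h)" if f: "f \<in> mod_hom (Lam n) ?F ?F" and h: "h \<in> carrier ?F" for f h
      proof -
        note fh = mod_homD[OF f]
        have f0: "f (\<lambda>_ _. 0) = (\<lambda>_ _. 0)" using mod_hom_zero[OF L L f] by (simp add: Fn_ops(1))
        define l where "l = f (dl ?s x 1) ?s x"
        \<comment> \<open>\<open>f\<close> acts on the top of \<open>s\<close> by a scalar
          \<open>l\<close>, and no other summand contributes there. One that begins before
          \<open>x\<close> contributes through \<open>x - 1\<close>, where \<open>s\<close> is zero.
          One that begins at \<open>x\<close> is shorter than \<open>s\<close>, so its generator
          dies at a vertex where that of \<open>s\<close> is still alive.\<close>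
        have C1: "f h ?s x = l * h ?s x"
          using h
        proof (induction rule: Fn_induct[OF S, consumes 1, case_names zero dl add])
          case zero
          show ?case using f0 by simp
        next
          case (add g h)
          then show ?case using fh(2)[OF add(1,2)] by (simp add: Fn_ops(2) algebra_simps)
        next
          case (dl u j c)
          have jn: "j < n" using intervalsD[OF S dl(1)] dl by simp
          note du = d[OF dl]
          show ?case
          proof (cases "j = x")
            case False
            have "Eu n j j \<odot>\<^bsub>?F\<^esub> dl u j c = dl u j c" using Eu_dl[OF S dl, of j c] dl jn by simp
            then have "f (dl u j c) = Eu n j j \<odot>\<^bsub>?F\<^esub> f (dl u j c)" using fh(3)[OF Eu_closed du[of c], of j j] by simp
            then have "f (dl u j c) ?s x = 0"
              using Eu_smult_Fn[OF S fh(1)[OF du[of c]] jn, of j ?s x] False by simp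
            then show ?thesis using False by (auto simp: dl_def)
          next
            case j: True
            consider "fst u < x" | "fst u = x" "u \<noteq> ?s" | "u = ?s" using dl(2) j by force
            then show ?thesis
            proof cases
              case 1
              then have x1: "x - 1 < n" "fst u \<le> x - 1" "x - 1 < snd u" "x - 1 \<le> x" using xn dl j by auto
              note du' = d[OF dl(1) x1(2,3)]
              have "Eu n x (x - 1) \<odot>\<^bsub>?F\<^esub> dl u (x - 1) c = dl u x c"
                using Eu_dl[OF S dl(1) x1(2,3,4) xn(1), of c] dl j by simp
              then have "f (dl u x c) = Eu n x (x - 1) \<odot>\<^bsub>?F\<^esub> f (dl u (x - 1) c)"
                using fh(3)[OF Eu_closed du'[of c], of x "x - 1"] by simp
              then have "f (dl u x c) ?s x = f (dl u (x - 1) c) ?s (x - 1)"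
                using Eu_smult_Fn[OF S fh(1)[OF du'[of c]] x1(1), of x ?s x] xy by simp
              also have "\<dots> = 0" using Fn_zero_outside[OF fh(1)[OF du'[of c]], of ?s "x - 1"] 1 by auto
              finally show ?thesis using 1 j by (auto simp: dl_def)
            next
              case 2
              have uy: "snd u < y"
              proof -
                have "(x, snd u) \<in> S" using 2(1) dl(1) by (metis prod.collapse)
                then have "\<not> y < snd u" using no by blast
                moreover have "snd u \<noteq> y" using 2 by (cases u) auto
                ultimately show ?thesis by simp
              qed
              then have un: "snd u < n" "x \<le> snd u" using xy dl j by auto
              have "Eu n (snd u) x \<odot>\<^bsub>?F\<^esub> dl u x c = \<zero>\<^bsub>?F\<^esub>"
                using Eu_dl[OF S dl(1), of x "snd u" c] dl j un 2 by simp
              then have "Eu n (snd u) x \<odot>\<^bsub>?F\<^esub> f (dl u x c) = \<zero>\<^bsub>?F\<^esub>"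
                using fh(3)[OF Eu_closed, of "dl u x c" "snd u" x] du j f0 by (simp add: Fn_ops(1))
              then have "(Eu n (snd u) x \<odot>\<^bsub>?F\<^esub> f (dl u x c)) ?s (snd u) = 0" by (simp add: Fn_ops(1))
              then have "f (dl u x c) ?s x = 0"
                using Eu_smult_Fn[OF S fh(1) xn(1), of "dl u x c" "snd u" ?s "snd u"] du j un uy by simp
              then show ?thesis using 2 j by (auto simp: dl_def)
            next
              case 3
              have "dl ?s x c = cl n x (\<lambda>p. if p = x then c else 0) \<odot>\<^bsub>?F\<^esub> dl ?s x 1"
                using dl_eq_cl[OF S s(1), of x c] xy by simp
              then have "f (dl ?s x c) ?s x = (cl n x (\<lambda>p. if p = x then c else 0) \<odot>\<^bsub>?F\<^esub> f (dl ?s x 1)) ?s x"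
                using fh(3)[OF cl_closed dfirst, of x "\<lambda>p. if p = x then c else 0" 1] by simp
              also have "\<dots> = c * l"
                using cl_smult_Fn[OF S fh(1)[OF dfirst] xn(1), of "\<lambda>p. if p = x then c else 0" 1 ?s x] xy by (simp add: l_def)
              finally show ?thesis using 3 j by (simp add: dl_def)
            qed
          qed
        qed
        \<comment> \<open>Outside \<open>s\<close> no component survives at \<open>y - 1\<close>. In
          a summand reaching beyond \<open>y\<close> the image would have to die at \<open>y\<close>
          but does not, and one that ends at \<open>y\<close> and contains \<open>x\<close> would be
          a longer interval of the column of \<open>s\<close>.\<close>
        have off: "f (dl ?s x 1) u x = 0" if u: "u \<noteq> ?s" "y - 1 < snd u" for u
        proof (rule ccontr)
          assume nz: "f (dl ?s x 1) u x \<noteq> 0"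
          then have uS: "u \<in> S" "fst u \<le> x" "x < snd u" using fh(1)[OF dfirst[of 1]] unfolding Fn_carrier by blast+
          show False
          proof (cases "y < snd u")
            case True
            then have yn: "y < n" using intervalsD[OF S uS(1)] by simp
            have "Eu n y x \<odot>\<^bsub>?F\<^esub> dl ?s x 1 = \<zero>\<^bsub>?F\<^esub>" using Eu_dl[OF S s(1), of x y "1::'k"] xy yn by simp
            then have "Eu n y x \<odot>\<^bsub>?F\<^esub> f (dl ?s x 1) = \<zero>\<^bsub>?F\<^esub>"
              using fh(3)[OF Eu_closed dfirst, of y x 1] f0 by (simp add: Fn_ops(1))
            then have "(Eu n y x \<odot>\<^bsub>?F\<^esub> f (dl ?s x 1)) u y = 0" by (simp add: Fn_ops(1))
            then show False
              using Eu_smult_Fn[OF S fh(1)[OF dfirst] xn(1), of y 1 u y] nz True uS xy by simp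
          next
            case False
            then have "snd u = y" using u xy by simp
            then have "u = (fst u, y)" by (metis prod.collapse)
            then have "fst u < x \<and> (fst u, y) \<in> S" using u(1) uS by (metis le_neq_implies_less)
            then show False using no by blast
          qed
        qed
        have C2: "f (dl ?s (y - 1) c) = dl ?s (y - 1) (l * c)" for c
        proof (intro ext)
          fix u i
          have "dl ?s (y - 1) c = cl n x (\<lambda>p. if p = y - 1 then c else 0) \<odot>\<^bsub>?F\<^esub> dl ?s x 1"
            using dl_eq_cl[OF S s(1), of "y - 1" c] xn by simp
          then have "f (dl ?s (y - 1) c) u i = (cl n x (\<lambda>p. if p = y - 1 then c else 0) \<odot>\<^bsub>?F\<^esub> f (dl ?s x 1)) u i"
            using fh(3)[OF cl_closed dfirst, of x "\<lambda>p. if p = y - 1 then c else 0" 1] by simp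
          also have "\<dots> = (if x \<le> i \<and> fst u \<le> i \<and> i < snd u \<and> i = y - 1 then c * f (dl ?s x 1) u x else 0)"
            using cl_smult_Fn[OF S fh(1)[OF dfirst] xn(1), of "\<lambda>p. if p = y - 1 then c else 0" 1 u i] by simp
          also have "\<dots> = dl ?s (y - 1) (l * c) u i"
            using off[of u] xn by (cases "u = ?s") (auto simp: dl_def l_def)
          finally show "f (dl ?s (y - 1) c) u i = dl ?s (y - 1) (l * c) u i" .
        qed
        show ?thesis unfolding \<phi>_def C1 C2 ..
      qed
      have "bicomm (Lam n) ?F \<phi>"
        unfolding bicomm_def
      proof (intro conjI ballI)
        show "\<phi> h \<in> carrier ?F" for h unfolding \<phi>_def by (rule dlast)
        show "\<phi> (g \<oplus>\<^bsub>?F\<^esub> h) = \<phi> g \<oplus>\<^bsub>?F\<^esub> \<phi> h" for g h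
          unfolding \<phi>_def Fn_ops(2) by (intro ext) (simp add: dl_def)
      qed (rule comm)
      then obtain A where A: "A \<in> carrier (Lam n)" "\<forall>h\<in>carrier ?F. \<phi> h = A \<odot>\<^bsub>?F\<^esub> h" using F by blast
      \<comment> \<open>The same matrix entry is read as 0 on the full interval and as 1 on
        \<open>s\<close>.\<close>
      have dr: "dl (0, n) x (1::'k) \<in> carrier ?F" using root xn by (intro d) auto
      have "\<phi> (dl (0, n) x 1) = (\<lambda>_ _. 0)" using s(2) by (auto simp: \<phi>_def dl_def intro!: ext)
      then have "A $$ (y - 1, x) = 0" using act[OF root, of "y - 1" x A] A(2) dr xn by simp
      moreover have "\<phi> (dl ?s x 1) ?s (y - 1) = 1" by (simp add: \<phi>_def dl_def)
      then have "A $$ (y - 1, x) = 1" using act[OF s(1), of "y - 1" x A] A(2) dfirst[of 1] xn xy by simp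
      ultimately show False by simp
    qed
  next
    fix i assume i: "0 < i" "i < n"
    show "(\<exists>y. (i, y) \<in> S) \<or> (\<exists>x. (x, i) \<in> S)"
    proof (rule ccontr)
      assume no: "\<not> ?thesis"
      \<comment> \<open>Every summand contains both or neither of \<open>i - 1\<close> and
        \<open>i\<close>, so the arrow between them acts bijectively. \<open>\<phi>\<close> is its
        inverse, hence commutes with all endomorphisms, yet it would need an entry above the
        diagonal.\<close>
      have iff: "fst u \<le> i \<and> i < snd u \<longleftrightarrow> fst u \<le> i - 1 \<and> i - 1 < snd u" if "u \<in> S" for u
      proof -
        have "fst u \<noteq> i" "snd u \<noteq> i" using no that by (metis prod.collapse)+
        then show ?thesis using i by auto
      qed
      have i1: "i - 1 < n" "i - 1 \<le> i" using i by auto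
      define \<phi> where "\<phi> h = (\<lambda>u j. if j = i - 1 then h u i else 0)" for h :: "nat \<times> nat \<Rightarrow> nat \<Rightarrow> 'k"
      have pc: "\<phi> h \<in> carrier ?F" if h: "h \<in> carrier ?F" for h
        unfolding Fn_carrier
      proof (intro allI impI)
        fix u j assume "\<phi> h u j \<noteq> 0"
        then have "j = i - 1" "h u i \<noteq> 0" by (auto simp: \<phi>_def split: if_splits)
        then show "u \<in> S \<and> fst u \<le> j \<and> j < snd u" using h iff[of u] unfolding Fn_carrier by blast
      qed
      have comm: "\<phi> (f h) = f (\<phi> h)" if f: "f \<in> mod_hom (Lam n) ?F ?F" and h: "h \<in> carrier ?F" for f h
      proof (intro ext)
        fix u j
        note fh = mod_homD[OF f]
        have "Eu n (i - 1) (i - 1) \<odot>\<^bsub>?F\<^esub> \<phi> h = \<phi> h"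
        proof (intro ext)
          fix u j show "(Eu n (i - 1) (i - 1) \<odot>\<^bsub>?F\<^esub> \<phi> h) u j = \<phi> h u j"
            using Eu_smult_Fn[OF S pc[OF h] i1(1), of "i - 1" u j] Fn_zero_outside[OF pc[OF h], of u j]
            by (auto simp: \<phi>_def)
        qed
        then have "f (\<phi> h) = Eu n (i - 1) (i - 1) \<odot>\<^bsub>?F\<^esub> f (\<phi> h)"
          using fh(3)[OF Eu_closed pc[OF h], of "i - 1" "i - 1"] by simp
        then have e1: "f (\<phi> h) u j = 0" if "j \<noteq> i - 1"
          using Eu_smult_Fn[OF S fh(1)[OF pc[OF h]] i1(1), of "i - 1" u j] that by simp
        have "Eu n i (i - 1) \<odot>\<^bsub>?F\<^esub> \<phi> h = Eu n i i \<odot>\<^bsub>?F\<^esub> h"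
        proof (intro ext)
          fix u j show "(Eu n i (i - 1) \<odot>\<^bsub>?F\<^esub> \<phi> h) u j = (Eu n i i \<odot>\<^bsub>?F\<^esub> h) u j"
            using Eu_smult_Fn[OF S pc[OF h] i1(1), of i u j] Eu_smult_Fn[OF S h i(2), of i u j]
            by (auto simp: \<phi>_def)
        qed
        then have e2: "Eu n i (i - 1) \<odot>\<^bsub>?F\<^esub> f (\<phi> h) = Eu n i i \<odot>\<^bsub>?F\<^esub> f h"
          using fh(3)[OF Eu_closed pc[OF h], of i "i - 1"] fh(3)[OF Eu_closed h, of i i] by simp
        show "\<phi> (f h) u j = f (\<phi> h) u j"
        proof (cases "j = i - 1 \<and> u \<in> S \<and> fst u \<le> i \<and> i < snd u")
          case True
          have "(Eu n i (i - 1) \<odot>\<^bsub>?F\<^esub> f (\<phi> h)) u i = f (\<phi> h) u (i - 1)"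
            using Eu_smult_Fn[OF S fh(1)[OF pc[OF h]] i1(1), of i u i] True i by simp
          moreover have "(Eu n i i \<odot>\<^bsub>?F\<^esub> f h) u i = f h u i"
            using Eu_smult_Fn[OF S fh(1)[OF h] i(2), of i u i] True by simp
          ultimately show ?thesis using e2 True by (simp add: \<phi>_def)
        next
          case False
          then show ?thesis
            using e1 Fn_zero_outside[OF fh(1)[OF pc[OF h]], of u j] Fn_zero_outside[OF fh(1)[OF h], of u i] iff[of u]
            by (cases "j = i - 1") (auto simp: \<phi>_def not_le not_less)
        qed
      qed
      have "bicomm (Lam n) ?F \<phi>"
        unfolding bicomm_def
      proof (intro conjI ballI)
        show "\<phi> (g \<oplus>\<^bsub>?F\<^esub> h) = \<phi> g \<oplus>\<^bsub>?F\<^esub> \<phi> h" for g h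
          unfolding \<phi>_def Fn_ops(2) by (intro ext) simp
      qed (rule pc comm; assumption)+
      then obtain A where A: "A \<in> carrier (Lam n)" "\<forall>h\<in>carrier ?F. \<phi> h = A \<odot>\<^bsub>?F\<^esub> h" using F by blast
      have dr: "dl (0, n) i (1::'k) \<in> carrier ?F" using root i by (intro d) auto
      have "\<phi> (dl (0, n) i 1) (0, n) (i - 1) = 1" by (simp add: \<phi>_def dl_def)
      then have "A $$ (i - 1, i) = 1" using act[OF root, of "i - 1" i A] A(2) dr i by simp
      moreover have "A $$ (i - 1, i) = 0" using A(1) i by (simp add: Lam_carrier)
      ultimately show False by simp
    qed
  qed
qed

section \<open>Extensions\<close>

lemma direct_sum2_simps:
  "carrier (direct_sum2 M N) = carrier M \<times> carrier N"
  "\<zero>\<^bsub>direct_sum2 M N\<^esub> = (\<zero>\<^bsub>M\<^esub>, \<zero>\<^bsub>N\<^esub>)"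
  "p \<oplus>\<^bsub>direct_sum2 M N\<^esub> q = (fst p \<oplus>\<^bsub>M\<^esub> fst q, snd p \<oplus>\<^bsub>N\<^esub> snd q)"
  "r \<odot>\<^bsub>direct_sum2 M N\<^esub> p = (r \<odot>\<^bsub>M\<^esub> fst p, r \<odot>\<^bsub>N\<^esub> snd p)"
  by (simp_all add: direct_sum2_def split: prod.splits)

lemma direct_sum2_left_module:
  assumes M: "left_module R M" and N: "left_module R N"
  shows "left_module R (direct_sum2 M N)"
proof -
  interpret M: left_module R M by fact
  interpret N: left_module R N by fact
  show ?thesis
  proof (rule left_moduleI)
    show "ring R" by (rule M.R.ring_axioms)
    fix p assume p: "p \<in> carrier (direct_sum2 M N)"
    show "\<exists>q\<in>carrier (direct_sum2 M N). q \<oplus>\<^bsub>direct_sum2 M N\<^esub> p = \<zero>\<^bsub>direct_sum2 M N\<^esub>"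
      using p by (intro bexI[of _ "(\<ominus>\<^bsub>M\<^esub> fst p, \<ominus>\<^bsub>N\<^esub> snd p)"])
        (auto simp: direct_sum2_simps M.l_neg N.l_neg)
  qed (auto simp: direct_sum2_simps M.smult_closed N.smult_closed M.smult_l_distr N.smult_l_distr
      M.smult_r_distr N.smult_r_distr M.smult_assoc N.smult_assoc M.smult_one N.smult_one
      M.a_assoc N.a_assoc intro: M.a_comm N.a_comm)
qed

lemma extensionsD:
  assumes "(E, f, g) \<in> extensions R A B"
  shows "left_module R E" "f \<in> mod_hom R B E" "inj_on f (carrier B)" "g \<in> mod_hom R E A"
    "g ` carrier E = carrier A" "f ` carrier B = {x \<in> carrier E. g x = \<zero>\<^bsub>A\<^esub>}"
  using assms by (auto simp: extensions_def)

lemma split_extension_iso: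
  assumes A: "left_module R A" and B: "left_module R B" and E: "(E, f, g) \<in> extensions R A B"
    and \<sigma>: "\<sigma> \<in> mod_hom R A E" "\<And>x. x \<in> carrier A \<Longrightarrow> g (\<sigma> x) = x"
  shows "(\<lambda>p. f (fst p) \<oplus>\<^bsub>E\<^esub> \<sigma> (snd p)) \<in> mod_iso R (direct_sum2 B A) E"
proof -
  note eD = extensionsD[OF E]
  interpret A: left_module R A by fact
  interpret B: left_module R B by fact
  interpret E: left_module R E by (rule eD(1))
  note fh = mod_homD[OF eD(2)] and gh = mod_homD[OF eD(4)] and sh = mod_homD[OF \<sigma>(1)]
  have gf: "g (f b) = \<zero>\<^bsub>A\<^esub>" if "b \<in> carrier B" for b using eD(6) that by blast
  have gs: "g (f b \<oplus>\<^bsub>E\<^esub> \<sigma> a) = a" if "b \<in> carrier B" "a \<in> carrier A" for a b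
    using that fh(1) sh(1) gh(2) gf \<sigma>(2) by simp
  let ?t = "\<lambda>p. f (fst p) \<oplus>\<^bsub>E\<^esub> \<sigma> (snd p)"
  have hom: "?t \<in> mod_hom R (direct_sum2 B A) E"
    by (rule mod_homI) (auto simp: direct_sum2_simps fh sh E.a_ac E.smult_r_distr E.smult_closed)
  show ?thesis
  proof (rule mod_isoI[OF hom])
    show "inj_on ?t (carrier (direct_sum2 B A))"
    proof (rule inj_onI)
      fix p q assume pq: "p \<in> carrier (direct_sum2 B A)" "q \<in> carrier (direct_sum2 B A)" "?t p = ?t q"
      then have c: "fst p \<in> carrier B" "snd p \<in> carrier A" "fst q \<in> carrier B" "snd q \<in> carrier A"
        by (auto simp: direct_sum2_simps)
      have "snd p = snd q" using gs[OF c(1,2)] gs[OF c(3,4)] pq(3) by simp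
      moreover from this have "f (fst p) = f (fst q)"
        using pq(3) fh(1)[OF c(1)] fh(1)[OF c(3)] sh(1)[OF c(4)] by simp
      then have "fst p = fst q" using eD(3) c by (auto dest: inj_onD)
      ultimately show "p = q" by (simp add: prod_eq_iff)
    qed
    show "?t ` carrier (direct_sum2 B A) = carrier E"
    proof (intro equalityI subsetI)
      fix x assume x: "x \<in> carrier E"
      have gx: "g x \<in> carrier A" using gh(1) x .
      have s: "\<sigma> (g x) \<in> carrier E" using sh(1) gx .
      have "g (x \<oplus>\<^bsub>E\<^esub> \<ominus>\<^bsub>E\<^esub> \<sigma> (g x)) = \<zero>\<^bsub>A\<^esub>"
        using gh(2)[OF x E.a_inv_closed[OF s]] mod_hom_minus[OF eD(1) A eD(4) s] \<sigma>(2)[OF gx] gx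
        by (simp add: A.r_neg)
      then have "x \<oplus>\<^bsub>E\<^esub> \<ominus>\<^bsub>E\<^esub> \<sigma> (g x) \<in> f ` carrier B" using eD(6) x s by simp
      then obtain b where b: "b \<in> carrier B" "f b = x \<oplus>\<^bsub>E\<^esub> \<ominus>\<^bsub>E\<^esub> \<sigma> (g x)" by auto
      then have "?t (b, g x) = x" using x s by (simp add: E.a_assoc E.l_neg)
      then show "x \<in> ?t ` carrier (direct_sum2 B A)" using b gx by (force simp: direct_sum2_simps)
    next
      fix x assume "x \<in> ?t ` carrier (direct_sum2 B A)"
      then show "x \<in> carrier E" using mod_homD(1)[OF hom] by blast
    qed
  qed
qed

lemma extension_transport:
  assumes E: "left_module R E" and f: "f \<in> mod_hom R B E" "inj_on f (carrier B)"
    and g: "g \<in> mod_hom R E A" "g ` carrier E = carrier A" "f ` carrier B = {x \<in> carrier E. g x = \<zero>\<^bsub>A\<^esub>}"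
    and h: "inj_on h (carrier E)"
  shows "(transport h E, (\<lambda>x. h (f x)), (\<lambda>x. g (inv_into (carrier E) h x))) \<in> extensions R A B"
proof -
  note iso = transport_iso[OF h, of R]
  note inv = mod_iso_inv[OF E iso]
  have c: "carrier (transport h E) = h ` carrier E" by (simp add: transport_def)
  have fc: "f b \<in> carrier E" if "b \<in> carrier B" for b using mod_homD(1)[OF f(1) that] .
  show ?thesis unfolding extensions_def
  proof (intro CollectI case_prodI conjI)
    show "left_module R (transport h E)" by (rule transport_left_module[OF E h])
    show "(\<lambda>x. h (f x)) \<in> mod_hom R B (transport h E)"
      by (rule mod_hom_comp[OF f(1) mod_isoD(1)[OF iso]])
    show "inj_on (\<lambda>x. h (f x)) (carrier B)"
      using f(2) h fc by (auto simp: inj_on_def)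
    show "(\<lambda>x. g (inv_into (carrier E) h x)) \<in> mod_hom R (transport h E) A"
      by (rule mod_hom_comp[OF mod_isoD(1)[OF inv] g(1)])
    show "(\<lambda>x. g (inv_into (carrier E) h x)) ` carrier (transport h E) = carrier A"
      unfolding c image_image using g(2) h by simp
    show "(\<lambda>x. h (f x)) ` carrier B = {x \<in> carrier (transport h E). g (inv_into (carrier E) h x) = \<zero>\<^bsub>A\<^esub>}"
    proof -
      have "{x \<in> carrier (transport h E). g (inv_into (carrier E) h x) = \<zero>\<^bsub>A\<^esub>} = h ` {x \<in> carrier E. g x = \<zero>\<^bsub>A\<^esub>}"
        unfolding c using h by auto
      also have "\<dots> = h ` f ` carrier B" using g(3) by simp
      finally show ?thesis by (simp add: image_image)
    qed
  qed
qed

section \<open>Vanishing of Ext as splitting of all extensions\<close>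

text \<open>The middle term of an extension has to live on the type of its two ends, so pairs must
  be coded in that type.\<close>

lemma infinite_pair_inj:
  assumes "infinite (UNIV :: 'v set)"
  obtains h :: "'v \<times> 'v \<Rightarrow> 'v" where "inj h"
proof -
  have "(card_of ((UNIV :: 'v set) \<times> (UNIV :: 'v set)), card_of (UNIV :: 'v set)) \<in> ordIso"
    by (rule card_of_Times_same_infinite[OF assms])
  then obtain h :: "'v \<times> 'v \<Rightarrow> 'v" where "bij_betw h (UNIV \<times> UNIV) UNIV"
    using card_of_ordIso by metis
  then have "inj h" by (simp add: bij_betw_def)
  then show thesis by (rule that)
qed

text \<open>The coding of pairs realises the split extension on \<open>'v\<close>, so there is at
  least one class. If it is the only one, the section of the split extension is carried along the
  equivalence. Conversely, two extensions with sections are both identified with the direct sum,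
  compatibly with the outer maps.\<close>

lemma Ext1_zero_iff:
  fixes A B :: "('r, 'v) module"
  assumes inf: "infinite (UNIV :: 'v set)" and A: "left_module R A" and B: "left_module R B"
  shows "Ext1_zero R A B \<longleftrightarrow> (\<forall>E f g. (E, f, g) \<in> extensions R A B \<longrightarrow>
    (\<exists>\<sigma>\<in>mod_hom R A E. \<forall>x\<in>carrier A. g (\<sigma> x) = x))"
proof -
  interpret A: left_module R A by fact
  interpret B: left_module R B by fact
  let ?D = "direct_sum2 B A"
  note LD = direct_sum2_left_module[OF B A]
  obtain h :: "'v \<times> 'v \<Rightarrow> 'v" where "inj h" by (rule infinite_pair_inj[OF inf])
  then have h: "inj_on h (carrier ?D)" by (auto intro: inj_on_subset)
  let ?E0 = "transport h ?D" and ?f0 = "\<lambda>b. h (b, \<zero>\<^bsub>A\<^esub>)" and ?g0 = "\<lambda>x. snd (inv_into (carrier ?D) h x)"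
  have "(?E0, ?f0, ?g0) \<in> extensions R A B"
  proof (rule extension_transport[OF LD _ _ _ _ _ h])
    show "(\<lambda>b. (b, \<zero>\<^bsub>A\<^esub>)) \<in> mod_hom R B ?D"
      by (rule mod_homI) (auto simp: direct_sum2_simps A.smult_zero)
    show "inj_on (\<lambda>b. (b, \<zero>\<^bsub>A\<^esub>)) (carrier B)" by (auto simp: inj_on_def)
    show "snd \<in> mod_hom R ?D A" by (rule mod_homI) (auto simp: direct_sum2_simps)
    show "snd ` carrier ?D = carrier A" using B.zero_closed by (force simp: direct_sum2_simps)
    show "(\<lambda>b. (b, \<zero>\<^bsub>A\<^esub>)) ` carrier B = {x \<in> carrier ?D. snd x = \<zero>\<^bsub>A\<^esub>}" by (auto simp: direct_sum2_simps)
  qed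
  moreover have s0: "(\<lambda>x. h (\<zero>\<^bsub>B\<^esub>, x)) \<in> mod_hom R A ?E0" "\<forall>x\<in>carrier A. ?g0 (h (\<zero>\<^bsub>B\<^esub>, x)) = x"
  proof -
    have "(\<lambda>x. (\<zero>\<^bsub>B\<^esub>, x)) \<in> mod_hom R A ?D"
      by (rule mod_homI) (auto simp: direct_sum2_simps B.smult_zero)
    then show "(\<lambda>x. h (\<zero>\<^bsub>B\<^esub>, x)) \<in> mod_hom R A ?E0"
      by (rule mod_hom_comp[OF _ mod_isoD(1)[OF transport_iso[OF h]]])
    show "\<forall>x\<in>carrier A. ?g0 (h (\<zero>\<^bsub>B\<^esub>, x)) = x"
      using h by (simp add: direct_sum2_simps)
  qed
  ultimately have E0: "(?E0, ?f0, ?g0) \<in> extensions R A B" by blast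
  show ?thesis
  proof
    assume "Ext1_zero R A B"
    then obtain X where X: "extensions R A B // ext_equiv R A B = {X}"
      unfolding Ext1_zero_def Ext1_def is_singleton_def by blast
    show "\<forall>E f g. (E, f, g) \<in> extensions R A B \<longrightarrow> (\<exists>\<sigma>\<in>mod_hom R A E. \<forall>x\<in>carrier A. g (\<sigma> x) = x)"
    proof (intro allI impI)
      fix E f g assume e: "(E, f, g) \<in> extensions R A B"
      have "ext_equiv R A B `` {(?E0, ?f0, ?g0)} = X" "ext_equiv R A B `` {(E, f, g)} = X"
        using X quotientI[OF E0, of "ext_equiv R A B"] quotientI[OF e, of "ext_equiv R A B"] by auto
      moreover have "((E, f, g), (E, f, g)) \<in> ext_equiv R A B"
      proof -
        have "(\<lambda>x. x) \<in> mod_iso R E E" by (auto simp: mod_iso_def mod_hom_def bij_betw_def)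
        then show ?thesis using e unfolding ext_equiv_def by (auto intro!: bexI[of _ "\<lambda>x. x"])
      qed
      ultimately have "((?E0, ?f0, ?g0), (E, f, g)) \<in> ext_equiv R A B" by blast
      then obtain k where k: "k \<in> mod_iso R ?E0 E" "\<forall>x\<in>carrier ?E0. g (k x) = ?g0 x"
        by (auto simp: ext_equiv_def)
      have "(\<lambda>x. k (h (\<zero>\<^bsub>B\<^esub>, x))) \<in> mod_hom R A E"
        by (rule mod_hom_comp[OF s0(1) mod_isoD(1)[OF k(1)]])
      moreover have "\<forall>x\<in>carrier A. g (k (h (\<zero>\<^bsub>B\<^esub>, x))) = x"
        using k(2) s0(2) mod_homD(1)[OF s0(1)] by simp
      ultimately show "\<exists>\<sigma>\<in>mod_hom R A E. \<forall>x\<in>carrier A. g (\<sigma> x) = x"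
        by (intro bexI[of _ "\<lambda>x. k (h (\<zero>\<^bsub>B\<^esub>, x))"])
    qed
  next
    assume R: "\<forall>E f g. (E, f, g) \<in> extensions R A B \<longrightarrow> (\<exists>\<sigma>\<in>mod_hom R A E. \<forall>x\<in>carrier A. g (\<sigma> x) = x)"
    have "(p, q) \<in> ext_equiv R A B" if pq: "p \<in> extensions R A B" "q \<in> extensions R A B" for p q
    proof -
      obtain E f g where p: "p = (E, f, g)" by (metis prod_cases3)
      obtain E' f' g' where q: "q = (E', f', g')" by (metis prod_cases3)
      have e: "(E, f, g) \<in> extensions R A B" and e': "(E', f', g') \<in> extensions R A B" using pq p q by auto
      note eD = extensionsD[OF e] and eD' = extensionsD[OF e']
      interpret E: left_module R E by (rule eD(1))
      interpret E': left_module R E' by (rule eD'(1))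
      obtain \<sigma> where \<sigma>: "\<sigma> \<in> mod_hom R A E" "\<forall>x\<in>carrier A. g (\<sigma> x) = x" using R e by blast
      obtain \<sigma>' where \<sigma>': "\<sigma>' \<in> mod_hom R A E'" "\<forall>x\<in>carrier A. g' (\<sigma>' x) = x" using R e' by blast
      define t where "t = (\<lambda>p. f (fst p) \<oplus>\<^bsub>E\<^esub> \<sigma> (snd p))"
      define t' where "t' = (\<lambda>p. f' (fst p) \<oplus>\<^bsub>E'\<^esub> \<sigma>' (snd p))"
      have t: "t \<in> mod_iso R ?D E" unfolding t_def using \<sigma> by (intro split_extension_iso[OF A B e]) auto
      have t': "t' \<in> mod_iso R ?D E'" unfolding t'_def using \<sigma>' by (intro split_extension_iso[OF A B e']) auto
      define k where "k x = t' (inv_into (carrier ?D) t x)" for x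
      have k: "k \<in> mod_iso R E E'"
        unfolding k_def by (rule mod_iso_comp[OF mod_iso_inv[OF LD t] t'])
      have kt: "k (t d) = t' d" if "d \<in> carrier ?D" for d
        using that mod_isoD(2)[OF t] by (simp add: k_def)
      have "k (f b) = f' b" if b: "b \<in> carrier B" for b
      proof -
        have "t (b, \<zero>\<^bsub>A\<^esub>) = f b" "t' (b, \<zero>\<^bsub>A\<^esub>) = f' b"
          using b mod_hom_zero[OF A eD(1) \<sigma>(1)] mod_hom_zero[OF A eD'(1) \<sigma>'(1)]
            mod_homD(1)[OF eD(2)] mod_homD(1)[OF eD'(2)] by (simp_all add: t_def t'_def)
        then show ?thesis using kt[of "(b, \<zero>\<^bsub>A\<^esub>)"] b by (simp add: direct_sum2_simps)
      qed
      moreover have "g' (k x) = g x" if x: "x \<in> carrier E" for x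
      proof -
        have "x \<in> t ` carrier ?D" using mod_isoD(3)[OF t] x by simp
        then obtain d where d: "d \<in> carrier ?D" "x = t d" by auto
        then have dc: "fst d \<in> carrier B" "snd d \<in> carrier A" by (auto simp: direct_sum2_simps)
        have "g (t d) = snd d"
          using dc mod_homD[OF eD(4)] mod_homD(1)[OF eD(2)] mod_homD(1)[OF \<sigma>(1)] \<sigma>(2) eD(6)
          by (auto simp: t_def)
        moreover have "g' (t' d) = snd d"
          using dc mod_homD[OF eD'(4)] mod_homD(1)[OF eD'(2)] mod_homD(1)[OF \<sigma>'(1)] \<sigma>'(2) eD'(6)
          by (auto simp: t'_def)
        ultimately show ?thesis using kt[OF d(1)] d by simp
      qed
      ultimately show ?thesis using e e' k p q by (auto simp: ext_equiv_def)
    qed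
    then have "ext_equiv R A B `` {p} = extensions R A B" if "p \<in> extensions R A B" for p
      using that by (auto simp: ext_equiv_def)
    then have "extensions R A B // ext_equiv R A B = {extensions R A B}"
      using E0 by (auto simp: quotient_def)
    then show "Ext1_zero R A B" by (simp add: Ext1_zero_def Ext1_def)
  qed
qed

text \<open>If no summand \<open>(x', y')\<close> of \<open>N\<close> satisfies \<open>x < x' \<le> y < y'\<close>, then \<open>N\<^sub>x \<rightarrow> N\<^sub>y\<close> is surjective,
  and a lift of the generator of the summand \<open>(x, y)\<close> can be corrected to one that vanishes at \<open>y\<close>.\<close>

lemma no_ext_section:
  fixes M N E :: "('k::field mat, 'v) module"
  assumes S: "S \<subseteq> intervals n" and T: "T \<subseteq> intervals n" and ne: "no_ext S T"
    and M: "left_module (Lam n) M" and \<psi>: "\<psi> \<in> mod_iso (Lam n) (Fn n S :: ('k mat, _) module) M"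
    and N: "left_module (Lam n) N" and \<chi>: "\<chi> \<in> mod_iso (Lam n) (Fn n T :: ('k mat, _) module) N"
    and ex: "(E, f, g) \<in> extensions (Lam n) M N"
  shows "\<exists>\<sigma>\<in>mod_hom (Lam n) M E. \<forall>x\<in>carrier M. g (\<sigma> x) = x"
proof -
  note eD = extensionsD[OF ex]
  interpret M: left_module "Lam n" M by fact
  interpret N: left_module "Lam n" N by fact
  interpret E: left_module "Lam n" E by (rule eD(1))
  note fh = mod_homD[OF eD(2)] and gh = mod_homD[OF eD(4)]
  note LS = Fn_left_module[OF S] and LT = Fn_left_module[OF T]
  note ph = mod_homD[OF mod_isoD(1)[OF \<psi>]] and ch = mod_homD[OF mod_isoD(1)[OF \<chi>]]
  have surj: "\<exists>\<nu>'\<in>carrier N. Eu n y x \<odot>\<^bsub>N\<^esub> \<nu>' = Eu n y y \<odot>\<^bsub>N\<^esub> \<nu>"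
    if s: "(x, y) \<in> S" and y: "y < n" and \<nu>: "\<nu> \<in> carrier N" for x y \<nu>
  proof -
    have xy: "x < y" "x < n" using intervalsD[OF S s] by auto
    have "\<nu> \<in> \<chi> ` carrier (Fn n T)" using mod_isoD(3)[OF \<chi>] \<nu> by simp
    then obtain h where h: "h \<in> carrier (Fn n T)" "\<nu> = \<chi> h" by auto
    \<comment> \<open>The coordinates at \<open>y\<close> are pulled back to \<open>x\<close>. A
      summand of \<open>N\<close> that is nonzero at \<open>y\<close> begins at or before
      \<open>x\<close>, since otherwise it would cross \<open>(x, y)\<close>.\<close>
    define h' where "h' = (\<lambda>t j. if j = x \<and> fst t \<le> x then h t y else 0)"
    have h': "h' \<in> carrier (Fn n T)"
      unfolding Fn_carrier
    proof (intro allI impI)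
      fix t j assume "h' t j \<noteq> 0"
      then have "j = x" "fst t \<le> x" "h t y \<noteq> 0" by (auto simp: h'_def split: if_splits)
      moreover from this have "t \<in> T \<and> y < snd t" using h(1) unfolding Fn_carrier by blast
      ultimately show "t \<in> T \<and> fst t \<le> j \<and> j < snd t" using xy by auto
    qed
    have "Eu n y x \<odot>\<^bsub>Fn n T\<^esub> h' = Eu n y y \<odot>\<^bsub>Fn n T\<^esub> h"
    proof (intro ext)
      fix t j
      have "h t y = 0" if "\<not> fst t \<le> x"
      proof (rule ccontr)
        assume "h t y \<noteq> 0"
        then have "t \<in> T \<and> fst t \<le> y \<and> y < snd t" using h(1) unfolding Fn_carrier by blast
        then show False using ne s that unfolding no_ext_def by (metis prod.collapse not_le)
      qed
      then show "(Eu n y x \<odot>\<^bsub>Fn n T\<^esub> h') t j = (Eu n y y \<odot>\<^bsub>Fn n T\<^esub> h) t j"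
        using Eu_smult_Fn[OF T h' xy(2), of y t j] Eu_smult_Fn[OF T h(1) y, of y t j] xy
        by (auto simp: h'_def)
    qed
    then have "Eu n y x \<odot>\<^bsub>N\<^esub> \<chi> h' = Eu n y y \<odot>\<^bsub>N\<^esub> \<nu>"
      using ch(3)[OF Eu_closed h', of y x] ch(3)[OF Eu_closed h(1), of y y] h(2) by simp
    then show ?thesis using ch(1)[OF h'] by blast
  qed
  have d: "dl s (fst s) (1::'k) \<in> carrier (Fn n S)" if "s \<in> S" for s
    using that intervalsD[OF S that] by (intro dl_carrier) auto
  have "\<exists>w. w \<in> carrier E \<and> g w = \<psi> (dl s (fst s) 1) \<and> (snd s < n \<longrightarrow> Eu n (snd s) (fst s) \<odot>\<^bsub>E\<^esub> w = \<zero>\<^bsub>E\<^esub>)"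
    if s: "s \<in> S" for s
  proof -
    obtain x y where xy: "s = (x, y)" by (cases s)
    then have lt: "x < y" "y \<le> n" "x < n" using intervalsD[OF S s] by auto
    define m where "m = \<psi> (dl s x 1)"
    have mc: "m \<in> carrier M" unfolding m_def using ph(1)[OF d[OF s]] xy by simp
    then have "m \<in> g ` carrier E" using eD(5) by simp
    then obtain w0 where w0: "w0 \<in> carrier E" "g w0 = m" by auto
    show ?thesis
    proof (cases "y < n")
      case False
      then show ?thesis using w0 xy by (auto simp: m_def)
    next
      case True
      have "Eu n y x \<odot>\<^bsub>Fn n S\<^esub> dl s x (1::'k) = \<zero>\<^bsub>Fn n S\<^esub>"
        using Eu_dl[OF S s, of x y "1::'k"] xy lt True by simp
      then have "Eu n y x \<odot>\<^bsub>M\<^esub> m = \<zero>\<^bsub>M\<^esub>"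
        unfolding m_def using ph(3)[OF Eu_closed d[OF s], of y x] xy mod_hom_zero[OF LS M mod_isoD(1)[OF \<psi>]] by simp
      then have "g (Eu n y x \<odot>\<^bsub>E\<^esub> w0) = \<zero>\<^bsub>M\<^esub>" using gh(3)[OF Eu_closed w0(1), of y x] w0(2) by simp
      then have "Eu n y x \<odot>\<^bsub>E\<^esub> w0 \<in> f ` carrier N" using eD(6) E.smult_closed[OF Eu_closed w0(1)] by simp
      then obtain \<nu> where \<nu>: "\<nu> \<in> carrier N" "f \<nu> = Eu n y x \<odot>\<^bsub>E\<^esub> w0" by auto
      obtain \<nu>' where \<nu>': "\<nu>' \<in> carrier N" "Eu n y x \<odot>\<^bsub>N\<^esub> \<nu>' = Eu n y y \<odot>\<^bsub>N\<^esub> \<nu>"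
        using surj[of x y \<nu>] s xy True \<nu>(1) by blast
      \<comment> \<open>The path from \<open>x\<close> to \<open>y\<close> sends the lift
        \<open>w0\<close> into \<open>N\<close>, where it has a preimage at the start of the path;
        subtracting that does not change the image in \<open>M\<close>.\<close>
      define w where "w = w0 \<oplus>\<^bsub>E\<^esub> \<ominus>\<^bsub>E\<^esub> f \<nu>'"
      have fc: "f \<nu>' \<in> carrier E" using fh(1)[OF \<nu>'(1)] .
      have "g (f \<nu>') = \<zero>\<^bsub>M\<^esub>" using eD(6) \<nu>'(1) by blast
      then have "g w = m"
        unfolding w_def using gh(2)[OF w0(1) E.a_inv_closed[OF fc]] mod_hom_minus[OF eD(1) M eD(4) fc] w0(2) mc by simp
      moreover have "Eu n y x \<odot>\<^bsub>E\<^esub> w = \<zero>\<^bsub>E\<^esub>"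
      proof -
        have "Eu n y x \<odot>\<^bsub>E\<^esub> f \<nu>' = f (Eu n y y \<odot>\<^bsub>N\<^esub> \<nu>)"
          using fh(3)[OF Eu_closed \<nu>'(1), of y x] \<nu>'(2) by simp
        also have "\<dots> = Eu n y y \<odot>\<^bsub>E\<^esub> (Eu n y x \<odot>\<^bsub>E\<^esub> w0)"
          using fh(3)[OF Eu_closed \<nu>(1), of y y] \<nu>(2) by simp
        also have "\<dots> = Eu n y x \<odot>\<^bsub>E\<^esub> w0"
          using lt True by (simp add: E.smult_assoc[OF Eu_closed Eu_closed w0(1), symmetric] Eu_mult)
        finally have "Eu n y x \<odot>\<^bsub>E\<^esub> f \<nu>' = Eu n y x \<odot>\<^bsub>E\<^esub> w0" .
        then show ?thesis
          unfolding w_def using E.smult_r_distr[OF Eu_closed w0(1) E.a_inv_closed[OF fc], of y x]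
            E.smult_minus[OF Eu_closed fc, of y x] E.smult_closed[OF Eu_closed w0(1)] by (simp add: E.r_neg)
      qed
      moreover have "w \<in> carrier E" using w0 fc by (simp add: w_def)
      ultimately show ?thesis using xy by (auto simp: m_def)
    qed
  qed
  then obtain w where w: "\<And>s. s \<in> S \<Longrightarrow> w s \<in> carrier E \<and> g (w s) = \<psi> (dl s (fst s) 1) \<and>
      (snd s < n \<longrightarrow> Eu n (snd s) (fst s) \<odot>\<^bsub>E\<^esub> w s = \<zero>\<^bsub>E\<^esub>)" by metis
  define \<sigma>0 where "\<sigma>0 = lift_hom n S E w"
  have \<sigma>0: "\<sigma>0 \<in> mod_hom (Lam n) (Fn n S) E"
    "\<And>s. s \<in> S \<Longrightarrow> \<sigma>0 (dl s (fst s) 1) = Eu n (fst s) (fst s) \<odot>\<^bsub>E\<^esub> w s"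
    unfolding \<sigma>0_def using lift_hom[OF S eD(1), of w] w by blast+
  have g\<sigma>: "g (\<sigma>0 h) = \<psi> h" if h: "h \<in> carrier (Fn n S)" for h
  proof (rule Fn_hom_eqI[OF S M mod_hom_comp[OF \<sigma>0(1) eD(4)] mod_isoD(1)[OF \<psi>] _ h])
    fix s assume s: "s \<in> S"
    have lt: "fst s < snd s" "fst s < n" using intervalsD[OF S s] by auto
    have wc: "w s \<in> carrier E" "g (w s) = \<psi> (dl s (fst s) 1)" using w[OF s] by auto
    have "g (\<sigma>0 (dl s (fst s) 1)) = Eu n (fst s) (fst s) \<odot>\<^bsub>M\<^esub> \<psi> (dl s (fst s) 1)"
      using \<sigma>0(2)[OF s] gh(3)[OF Eu_closed wc(1), of "fst s" "fst s"] wc(2) by simp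
    also have "\<dots> = \<psi> (Eu n (fst s) (fst s) \<odot>\<^bsub>Fn n S\<^esub> dl s (fst s) 1)"
      using ph(3)[OF Eu_closed d[OF s], of "fst s" "fst s"] by simp
    also have "Eu n (fst s) (fst s) \<odot>\<^bsub>Fn n S\<^esub> dl s (fst s) (1::'k) = dl s (fst s) 1"
      using Eu_dl[OF S s, of "fst s" "fst s" "1::'k"] lt by simp
    finally show "g (\<sigma>0 (dl s (fst s) 1)) = \<psi> (dl s (fst s) 1)" .
  qed
  let ?inv = "inv_into (carrier (Fn n S)) \<psi>"
  have "(\<lambda>x. \<sigma>0 (?inv x)) \<in> mod_hom (Lam n) M E"
    by (rule mod_hom_comp[OF mod_isoD(1)[OF mod_iso_inv[OF LS \<psi>]] \<sigma>0(1)])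
  moreover have "g (\<sigma>0 (?inv x)) = x" if x: "x \<in> carrier M" for x
  proof -
    have "x \<in> \<psi> ` carrier (Fn n S)" using x mod_isoD(3)[OF \<psi>] by simp
    then show ?thesis using g\<sigma> by (simp add: inv_into_into f_inv_into_f)
  qed
  ultimately show ?thesis by (intro bexI[of _ "\<lambda>x. \<sigma>0 (?inv x)"] ballI)
qed

text \<open>For crossing summands \<open>s = (x, y)\<close> and \<open>t = (x', y')\<close> with \<open>x < x' \<le> y < y'\<close>, the action on the direct
  sum is twisted by a cocycle that continues the interval \<open>s\<close> into \<open>t\<close> at the vertex \<open>y\<close>.\<close>

definition twist :: "nat \<Rightarrow> nat \<times> nat \<Rightarrow> nat \<times> nat \<Rightarrow> 'k::field mat \<Rightarrow> (nat \<times> nat \<Rightarrow> nat \<Rightarrow> 'k) \<Rightarrow>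
    nat \<times> nat \<Rightarrow> nat \<Rightarrow> 'k" where
  "twist n s t A \<mu> = (\<lambda>u i. if u = t \<and> snd s \<le> i \<and> i < snd t then \<Sum>j<n. A $$ (i, j) * \<mu> s j else 0)"

definition twisted_sum :: "nat \<Rightarrow> (nat \<times> nat) set \<Rightarrow> (nat \<times> nat) set \<Rightarrow> nat \<times> nat \<Rightarrow> nat \<times> nat \<Rightarrow>
    ('k::field mat, (nat \<times> nat \<Rightarrow> nat \<Rightarrow> 'k) \<times> (nat \<times> nat \<Rightarrow> nat \<Rightarrow> 'k)) module" where
  "twisted_sum n S T s t = (direct_sum2 (Fn n T) (Fn n S))
     \<lparr>smult := \<lambda>A p. (A \<odot>\<^bsub>Fn n T\<^esub> fst p \<oplus>\<^bsub>Fn n T\<^esub> twist n s t A (snd p), A \<odot>\<^bsub>Fn n S\<^esub> snd p)\<rparr>"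

lemma twisted_sum_simps:
  "carrier (twisted_sum n S T s t) = carrier (Fn n T) \<times> carrier (Fn n S)"
  "\<zero>\<^bsub>twisted_sum n S T s t\<^esub> = (\<zero>\<^bsub>Fn n T\<^esub>, \<zero>\<^bsub>Fn n S\<^esub>)"
  "p \<oplus>\<^bsub>twisted_sum n S T s t\<^esub> q = (fst p \<oplus>\<^bsub>Fn n T\<^esub> fst q, snd p \<oplus>\<^bsub>Fn n S\<^esub> snd q)"
  "A \<odot>\<^bsub>twisted_sum n S T s t\<^esub> p = (A \<odot>\<^bsub>Fn n T\<^esub> fst p \<oplus>\<^bsub>Fn n T\<^esub> twist n s t A (snd p), A \<odot>\<^bsub>Fn n S\<^esub> snd p)"
  using direct_sum2_simps[of "Fn n T" "Fn n S"] by (simp_all add: twisted_sum_def)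

text \<open>The coordinates of \<open>s\<close>, followed by those of \<open>t\<close> from
  \<open>snd s\<close> on, form the interval from \<open>fst s\<close> to \<open>snd t\<close>;
  \<open>twist\<close> is the block of its action that leads from the first part to the second. The
  cocycle identity \<open>mult\<close> is associativity on that interval, and \<open>cross\<close>
  keeps the values inside \<open>t\<close>.\<close>

lemma twisted_sum_left_module:
  assumes S: "S \<subseteq> intervals n" and T: "T \<subseteq> intervals n" and s: "s \<in> S" and t: "t \<in> T"
    and cross: "fst t \<le> snd s"
  shows "left_module (Lam n) (twisted_sum n S T s t :: ('k::field mat, _) module)"
proof -
  interpret S: left_module "Lam n" "Fn n S :: ('k mat, _) module" by (rule Fn_left_module[OF S])
  interpret T: left_module "Lam n" "Fn n T :: ('k mat, _) module" by (rule Fn_left_module[OF T])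
  interpret D: left_module "Lam n" "direct_sum2 (Fn n T) (Fn n S) :: ('k mat, _) module"
    by (rule direct_sum2_left_module[OF Fn_left_module[OF T] Fn_left_module[OF S]])
  have nt: "snd t \<le> n" "fst t < snd t" "snd s \<le> n" using intervalsD[OF T t] intervalsD[OF S s] by auto
  have tc: "twist n s t A \<mu> \<in> carrier (Fn n T)" for A :: "'k mat" and \<mu>
    unfolding Fn_carrier
  proof (intro allI impI)
    fix u i assume "twist n s t A \<mu> u i \<noteq> 0"
    then show "u \<in> T \<and> fst u \<le> i \<and> i < snd u" using t cross by (auto simp: twist_def split: if_splits)
  qed
  have add_r: "twist n s t A (\<mu> \<oplus>\<^bsub>Fn n S\<^esub> \<mu>') = twist n s t A \<mu> \<oplus>\<^bsub>Fn n T\<^esub> twist n s t A \<mu>'" for A :: "'k mat" and \<mu> \<mu>'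
    by (intro ext) (simp add: twist_def Fn_ops(2) algebra_simps sum.distrib)
  have add_l: "twist n s t (A \<oplus>\<^bsub>Lam n\<^esub> B) \<mu> = twist n s t A \<mu> \<oplus>\<^bsub>Fn n T\<^esub> twist n s t B \<mu>"
    if AB: "A \<in> carrier (Lam n)" "B \<in> carrier (Lam n)" for A B :: "'k mat" and \<mu>
  proof (intro ext)
    fix u i
    show "twist n s t (A \<oplus>\<^bsub>Lam n\<^esub> B) \<mu> u i = (twist n s t A \<mu> \<oplus>\<^bsub>Fn n T\<^esub> twist n s t B \<mu>) u i"
      using AB nt by (auto simp: twist_def Fn_ops(2) Lam_ops Lam_carrier sum.distrib[symmetric] algebra_simps intro!: sum.cong)
  qed
  have one: "twist n s t \<one>\<^bsub>Lam n\<^esub> \<mu> = \<zero>\<^bsub>Fn n T\<^esub>" if \<mu>: "\<mu> \<in> carrier (Fn n S)" for \<mu> :: "nat \<times> nat \<Rightarrow> nat \<Rightarrow> 'k"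
  proof (intro ext)
    fix u i
    have "(\<Sum>j<n. 1\<^sub>m n $$ (i, j) * \<mu> s j) = 0" if "snd s \<le> i" "i < n"
    proof (rule sum.neutral, rule ballI)
      fix j assume "j \<in> {..<n}"
      then show "1\<^sub>m n $$ (i, j) * \<mu> s j = 0" using that Fn_zero_outside[OF \<mu>, of s j] by (cases "i = j") auto
    qed
    then show "twist n s t \<one>\<^bsub>Lam n\<^esub> \<mu> u i = \<zero>\<^bsub>Fn n T\<^esub> u i" using nt by (auto simp: twist_def Fn_ops(1) Lam_ops)
  qed
  have mult: "twist n s t (A \<otimes>\<^bsub>Lam n\<^esub> B) \<mu> = A \<odot>\<^bsub>Fn n T\<^esub> twist n s t B \<mu> \<oplus>\<^bsub>Fn n T\<^esub> twist n s t A (B \<odot>\<^bsub>Fn n S\<^esub> \<mu>)"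
    if A: "A \<in> carrier (Lam n)" and B: "B \<in> carrier (Lam n)" and \<mu>: "\<mu> \<in> carrier (Fn n S)" for A B :: "'k mat" and \<mu>
  proof (intro ext)
    fix u i
    have AB: "A \<in> carrier_mat n n" "B \<in> carrier_mat n n"
      "\<And>i j. i < j \<Longrightarrow> j < n \<Longrightarrow> A $$ (i, j) = 0" "\<And>i j. i < j \<Longrightarrow> j < n \<Longrightarrow> B $$ (i, j) = 0"
      using A B by (auto simp: Lam_carrier)
    show "twist n s t (A \<otimes>\<^bsub>Lam n\<^esub> B) \<mu> u i =
      (A \<odot>\<^bsub>Fn n T\<^esub> twist n s t B \<mu> \<oplus>\<^bsub>Fn n T\<^esub> twist n s t A (B \<odot>\<^bsub>Fn n S\<^esub> \<mu>)) u i"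
    proof (cases "u = t \<and> snd s \<le> i \<and> i < snd t")
      case True
      then have i: "i < n" "fst t \<le> i" using nt cross by auto
      define b where "b k = (\<Sum>j<n. B $$ (k, j) * \<mu> s j)" for k
      have "(\<Sum>j<n. (A * B) $$ (i, j) * \<mu> s j) = (\<Sum>j<n. (\<Sum>k<n. A $$ (i, k) * B $$ (k, j)) * \<mu> s j)"
        using AB i by (auto simp: scalar_prod_def atLeast0LessThan intro!: sum.cong)
      also have "\<dots> = (\<Sum>j<n. \<Sum>k<n. A $$ (i, k) * (B $$ (k, j) * \<mu> s j))"
        by (simp add: sum_distrib_right mult.assoc)
      also have "\<dots> = (\<Sum>k<n. \<Sum>j<n. A $$ (i, k) * (B $$ (k, j) * \<mu> s j))" by (rule sum.swap)
      also have "\<dots> = (\<Sum>k<n. A $$ (i, k) * b k)" by (simp add: b_def sum_distrib_left)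
      \<comment> \<open>The intermediate vertex \<open>k\<close> of the product lies in the
        continued part, which gives \<open>A\<close> after the twist, or in \<open>s\<close>, which
        gives the twist after \<open>B\<close>. Elsewhere \<open>b k\<close> or
        \<open>A $$ (i, k)\<close> is zero.\<close>
      also have "\<dots> = (\<Sum>k<n. A $$ (i, k) * (if snd s \<le> k \<and> k < snd t then b k else 0) +
          A $$ (i, k) * (if fst s \<le> k \<and> k < snd s then b k else 0))"
      proof (rule sum.cong[OF refl])
        fix k assume k: "k \<in> {..<n}"
        consider "k < fst s" | "fst s \<le> k" "k < snd s" | "snd s \<le> k" "k < snd t" | "snd s \<le> k" "snd t \<le> k" by linarith
        then show "A $$ (i, k) * b k = A $$ (i, k) * (if snd s \<le> k \<and> k < snd t then b k else 0) +
          A $$ (i, k) * (if fst s \<le> k \<and> k < snd s then b k else 0)"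
        proof cases
          case 1
          have "B $$ (k, j) * \<mu> s j = 0" if "j < n" for j
            using Fn_zero_outside[OF \<mu>, of s j] AB(4)[of k j] 1 that by (cases "k < j") auto
          then have "b k = 0" unfolding b_def by (intro sum.neutral) auto
          then show ?thesis by simp
        next
          case 4
          then have "A $$ (i, k) = 0" using AB(3)[of i k] True k by auto
          then show ?thesis by simp
        qed auto
      qed
      finally have "(\<Sum>j<n. (A * B) $$ (i, j) * \<mu> s j) =
        (\<Sum>k<n. A $$ (i, k) * (if snd s \<le> k \<and> k < snd t then b k else 0)) +
        (\<Sum>k<n. A $$ (i, k) * (if fst s \<le> k \<and> k < snd s then b k else 0))" by (simp add: sum.distrib)
      then show ?thesis using True i unfolding twist_def Fn_ops(2,3) Lam_ops b_def by simp
    next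
      case False
      have "(A \<odot>\<^bsub>Fn n T\<^esub> twist n s t B \<mu>) u i = 0"
      proof (cases "u = t \<and> i < snd s")
        case True
        have "(\<Sum>k<n. A $$ (i, k) * twist n s t B \<mu> u k) = 0"
          using AB(3) True by (intro sum.neutral) (auto simp: twist_def)
        then show ?thesis by (simp add: Fn_ops(3))
      next
        case F2: False
        have "u \<noteq> t \<Longrightarrow> (\<Sum>k<n. A $$ (i, k) * twist n s t B \<mu> u k) = 0" by (simp add: twist_def)
        then show ?thesis using False F2 by (auto simp: Fn_ops(3))
      qed
      then show ?thesis using False by (auto simp: twist_def Fn_ops(2))
    qed
  qed
  let ?E = "twisted_sum n S T s t :: ('k mat, _) module"
  show ?thesis
  proof (rule left_moduleI)
    show "ring (Lam n :: 'k mat ring)" by (rule ring_lower_tri_ring)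
    show "\<zero>\<^bsub>?E\<^esub> \<in> carrier ?E" using D.zero_closed by (simp add: twisted_sum_simps direct_sum2_simps)
    fix p assume p: "p \<in> carrier ?E"
    show "\<zero>\<^bsub>?E\<^esub> \<oplus>\<^bsub>?E\<^esub> p = p" using p by (auto simp: twisted_sum_simps)
    show "\<exists>q\<in>carrier ?E. q \<oplus>\<^bsub>?E\<^esub> p = \<zero>\<^bsub>?E\<^esub>"
      using p by (intro bexI[of _ "(\<ominus>\<^bsub>Fn n T\<^esub> fst p, \<ominus>\<^bsub>Fn n S\<^esub> snd p)"])
        (auto simp: twisted_sum_simps S.l_neg T.l_neg)
    show "\<one>\<^bsub>Lam n\<^esub> \<odot>\<^bsub>?E\<^esub> p = p"
      using p one[of "snd p"] by (auto simp: twisted_sum_simps S.smult_one T.smult_one)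
    { fix A :: "'k mat" assume A: "A \<in> carrier (Lam n)"
      show "A \<odot>\<^bsub>?E\<^esub> p \<in> carrier ?E"
        using p A tc by (auto simp: twisted_sum_simps S.smult_closed T.smult_closed)
      fix B :: "'k mat" assume B: "B \<in> carrier (Lam n)"
      show "(A \<oplus>\<^bsub>Lam n\<^esub> B) \<odot>\<^bsub>?E\<^esub> p = A \<odot>\<^bsub>?E\<^esub> p \<oplus>\<^bsub>?E\<^esub> B \<odot>\<^bsub>?E\<^esub> p"
        using p A B tc T.smult_closed S.smult_closed
        by (auto simp: twisted_sum_simps S.smult_l_distr T.smult_l_distr add_l T.a_ac)
      show "(A \<otimes>\<^bsub>Lam n\<^esub> B) \<odot>\<^bsub>?E\<^esub> p = A \<odot>\<^bsub>?E\<^esub> (B \<odot>\<^bsub>?E\<^esub> p)"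
        using p A B tc T.smult_closed S.smult_closed
        by (auto simp: twisted_sum_simps S.smult_assoc T.smult_assoc T.smult_r_distr mult T.a_ac) }
    fix q assume q: "q \<in> carrier ?E"
    show "p \<oplus>\<^bsub>?E\<^esub> q \<in> carrier ?E" using p q by (auto simp: twisted_sum_simps)
    show "p \<oplus>\<^bsub>?E\<^esub> q = q \<oplus>\<^bsub>?E\<^esub> p" using p q by (auto simp: twisted_sum_simps S.a_comm T.a_comm)
    { fix A :: "'k mat" assume A: "A \<in> carrier (Lam n)"
      show "A \<odot>\<^bsub>?E\<^esub> (p \<oplus>\<^bsub>?E\<^esub> q) = A \<odot>\<^bsub>?E\<^esub> p \<oplus>\<^bsub>?E\<^esub> A \<odot>\<^bsub>?E\<^esub> q"
        using p q A tc T.smult_closed S.smult_closed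
        by (auto simp: twisted_sum_simps S.smult_r_distr T.smult_r_distr add_r T.a_ac) }
    fix r assume r: "r \<in> carrier ?E"
    then show "p \<oplus>\<^bsub>?E\<^esub> q \<oplus>\<^bsub>?E\<^esub> r = p \<oplus>\<^bsub>?E\<^esub> (q \<oplus>\<^bsub>?E\<^esub> r)"
      using p q by (auto simp: twisted_sum_simps S.a_assoc T.a_assoc)
  qed
qed

text \<open>Vectors of all dimensions share the type, so it is infinite even over a finite
  field.\<close>

lemma infinite_vec: "infinite (UNIV :: 'a::zero vec set)"
proof
  assume "finite (UNIV :: 'a vec set)"
  then have "finite (range (\<lambda>m. 0\<^sub>v m :: 'a vec))" by (rule finite_subset[rotated]) simp
  moreover have "inj (\<lambda>m. 0\<^sub>v m :: 'a vec)" by (rule injI) (metis index_zero_vec(2))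
  ultimately show False using finite_imageD infinite_UNIV_nat by blast
qed

text \<open>For a crossing pair the twisted sum, moved to \<open>'k vec\<close>, does not split. A
  section would lift the generator of \<open>s\<close> to a pair killed by the path from
  \<open>x\<close> to \<open>y\<close>. In the coordinate \<open>(t, y)\<close> the twist
  contributes 1 to the result, while the first component contributes its value at \<open>x\<close>,
  which is 0 because \<open>t\<close> begins after \<open>x\<close>.\<close>

lemma Ext1_zero_no_ext:
  fixes M N :: "('k::field mat, 'k vec) module"
  assumes S: "S \<subseteq> intervals n" and T: "T \<subseteq> intervals n"
    and M: "left_module (Lam n) M" "isomorphic_mod (Lam n) (Fn n S :: ('k mat, _) module) M"
    and N: "left_module (Lam n) N" "isomorphic_mod (Lam n) (Fn n T :: ('k mat, _) module) N"
  shows "Ext1_zero (Lam n) M N \<longleftrightarrow> no_ext S T"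
proof -
  obtain \<psi> where \<psi>: "\<psi> \<in> mod_iso (Lam n) (Fn n S :: ('k mat, _) module) M" using M(2) by (rule isomorphic_modE)
  obtain \<chi> where \<chi>: "\<chi> \<in> mod_iso (Lam n) (Fn n T :: ('k mat, _) module) N" using N(2) by (rule isomorphic_modE)
  note LS = Fn_left_module[OF S] and LT = Fn_left_module[OF T]
  note iff = Ext1_zero_iff[OF infinite_vec M(1) N(1)]
  show ?thesis
  proof
    assume "no_ext S T"
    then show "Ext1_zero (Lam n) M N"
      unfolding iff using no_ext_section[OF S T _ M(1) \<psi> N(1) \<chi>] by blast
  next
    assume ext: "Ext1_zero (Lam n) M N"
    show "no_ext S T"
      unfolding no_ext_def
    proof (intro allI impI notI)
      fix x y x' y' assume s: "(x, y) \<in> S" and t: "(x', y') \<in> T" and cr: "x < x' \<and> x' \<le> y \<and> y < y'"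
      have xy: "x < y" "x < n" "y < n" "y' \<le> n" using intervalsD[OF S s] intervalsD[OF T t] cr by auto
      let ?s = "(x, y)" and ?t = "(x', y')"
      let ?E = "twisted_sum n S T ?s ?t :: ('k mat, _) module"
      have LE: "left_module (Lam n) ?E" using cr by (intro twisted_sum_left_module[OF S T s t]) simp
      obtain h1 :: "(nat \<times> nat \<Rightarrow> nat \<Rightarrow> 'k) \<Rightarrow> 'k vec" where h1: "inj_on h1 (carrier (Fn n T))" using Fn_to_vec[OF T] by blast
      obtain h2 :: "(nat \<times> nat \<Rightarrow> nat \<Rightarrow> 'k) \<Rightarrow> 'k vec" where h2: "inj_on h2 (carrier (Fn n S))" using Fn_to_vec[OF S] by blast
      obtain pr :: "'k vec \<times> 'k vec \<Rightarrow> 'k vec" where pr: "inj pr" by (rule infinite_pair_inj[OF infinite_vec])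
      define h where "h p = pr (h1 (fst p), h2 (snd p))" for p
      have h: "inj_on h (carrier ?E)"
      proof (rule inj_onI)
        fix p q assume pq: "p \<in> carrier ?E" "q \<in> carrier ?E" "h p = h q"
        then have "h1 (fst p) = h1 (fst q)" "h2 (snd p) = h2 (snd q)" using injD[OF pr] by (auto simp: h_def)
        then show "p = q" using pq h1 h2 by (auto simp: twisted_sum_simps prod_eq_iff dest: inj_onD)
      qed
      let ?\<chi>i = "inv_into (carrier (Fn n T)) \<chi>"
      note \<chi>i = mod_iso_inv[OF LT \<chi>]
      have ext0: "(transport h ?E, (\<lambda>b. h (?\<chi>i b, \<zero>\<^bsub>Fn n S\<^esub>)), (\<lambda>z. \<psi> (snd (inv_into (carrier ?E) h z)))) \<in> extensions (Lam n) M N"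
      proof (rule extension_transport[OF LE _ _ _ _ _ h])
        have c0: "(\<lambda>\<nu>. (\<nu>, \<zero>\<^bsub>Fn n S\<^esub>)) \<in> mod_hom (Lam n) (Fn n T) ?E"
        proof (rule mod_homI)
          fix A :: "'k mat" and \<nu> assume A: "A \<in> carrier (Lam n)" and \<nu>: "\<nu> \<in> carrier (Fn n T :: ('k mat, _) module)"
          have "twist n ?s ?t A \<zero>\<^bsub>Fn n S\<^esub> = \<zero>\<^bsub>Fn n T\<^esub>"
            unfolding twist_def Fn_ops(1) by (simp cong: if_cong)
          then show "(A \<odot>\<^bsub>Fn n T\<^esub> \<nu>, \<zero>\<^bsub>Fn n S\<^esub>) = A \<odot>\<^bsub>?E\<^esub> (\<nu>, \<zero>\<^bsub>Fn n S\<^esub>)"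
            using left_module.smult_zero[OF LS A] by (simp add: twisted_sum_simps) (simp add: Fn_ops(1,2))
        qed (auto simp: twisted_sum_simps Fn_carrier Fn_ops(1,2))
        show "(\<lambda>b. (?\<chi>i b, \<zero>\<^bsub>Fn n S\<^esub>)) \<in> mod_hom (Lam n) N ?E"
          by (rule mod_hom_comp[OF mod_isoD(1)[OF \<chi>i] c0])
        show "inj_on (\<lambda>b. (?\<chi>i b, \<zero>\<^bsub>Fn n S\<^esub>)) (carrier N)"
          using mod_isoD(2)[OF \<chi>i] by (auto simp: inj_on_def)
        have "snd \<in> mod_hom (Lam n) ?E (Fn n S)" by (rule mod_homI) (auto simp: twisted_sum_simps)
        then show "(\<lambda>p. \<psi> (snd p)) \<in> mod_hom (Lam n) ?E M"
          by (rule mod_hom_comp[OF _ mod_isoD(1)[OF \<psi>]])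
        have "snd ` carrier ?E = carrier (Fn n S)"
          using left_module_zero[OF LT] by (force simp: twisted_sum_simps)
        then show "(\<lambda>p. \<psi> (snd p)) ` carrier ?E = carrier M"
          using mod_isoD(3)[OF \<psi>] by (metis image_image)
        have "\<psi> \<mu> = \<zero>\<^bsub>M\<^esub> \<longleftrightarrow> \<mu> = \<zero>\<^bsub>Fn n S\<^esub>" if "\<mu> \<in> carrier (Fn n S)" for \<mu>
          using mod_hom_inj_iff[OF LS M(1) mod_isoD(1)[OF \<psi>]] mod_isoD(2)[OF \<psi>] that mod_hom_zero[OF LS M(1) mod_isoD(1)[OF \<psi>]] by blast
        then have "{p \<in> carrier ?E. \<psi> (snd p) = \<zero>\<^bsub>M\<^esub>} = (\<lambda>\<nu>. (\<nu>, \<zero>\<^bsub>Fn n S\<^esub>)) ` carrier (Fn n T)"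
          using left_module_zero[OF LS] by (auto simp: twisted_sum_simps)
        also have "\<dots> = (\<lambda>\<nu>. (\<nu>, \<zero>\<^bsub>Fn n S\<^esub>)) ` ?\<chi>i ` carrier N" using mod_isoD(3)[OF \<chi>i] by simp
        finally show "(\<lambda>b. (?\<chi>i b, \<zero>\<^bsub>Fn n S\<^esub>)) ` carrier N = {p \<in> carrier ?E. \<psi> (snd p) = \<zero>\<^bsub>M\<^esub>}"
          by (simp add: image_image)
      qed
      obtain \<sigma> where \<sigma>: "\<sigma> \<in> mod_hom (Lam n) M (transport h ?E)"
        "\<forall>z\<in>carrier M. \<psi> (snd (inv_into (carrier ?E) h (\<sigma> z))) = z"
        using ext ext0 unfolding iff by blast
      define k where "k \<mu> = inv_into (carrier ?E) h (\<sigma> (\<psi> \<mu>))" for \<mu>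
      have k: "k \<in> mod_hom (Lam n) (Fn n S) ?E"
        unfolding k_def
        by (rule mod_hom_comp[OF mod_hom_comp[OF mod_isoD(1)[OF \<psi>] \<sigma>(1)]
              mod_isoD(1)[OF mod_iso_inv[OF LE transport_iso[OF h]]]])
      have d: "dl ?s x (1::'k) \<in> carrier (Fn n S)" using s xy by (intro dl_carrier) auto
      obtain \<nu> \<mu> where km: "k (dl ?s x 1) = (\<nu>, \<mu>)" by (cases "k (dl ?s x 1)")
      have c: "\<nu> \<in> carrier (Fn n T)" "\<mu> \<in> carrier (Fn n S)" using mod_homD(1)[OF k d] km by (auto simp: twisted_sum_simps)
      have "\<psi> \<mu> = \<psi> (dl ?s x 1)"
        using \<sigma>(2) mod_homD(1)[OF mod_isoD(1)[OF \<psi>] d] km unfolding k_def by (metis snd_conv)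
      then have \<mu>: "\<mu> = dl ?s x 1" using mod_isoD(2)[OF \<psi>] c(2) d by (auto dest: inj_onD)
      have "Eu n y x \<odot>\<^bsub>Fn n S\<^esub> dl ?s x (1::'k) = \<zero>\<^bsub>Fn n S\<^esub>" using Eu_dl[OF S s, of x y "1::'k"] xy by simp
      then have "Eu n y x \<odot>\<^bsub>?E\<^esub> (\<nu>, \<mu>) = \<zero>\<^bsub>?E\<^esub>"
        using mod_homD(3)[OF k Eu_closed d, of y x] km mod_hom_zero[OF LS LE k] by simp
      then have "(Eu n y x \<odot>\<^bsub>Fn n T\<^esub> \<nu> \<oplus>\<^bsub>Fn n T\<^esub> twist n ?s ?t (Eu n y x) \<mu>) ?t y = 0"
        by (simp add: twisted_sum_simps) (simp add: Fn_ops(1))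
      moreover have "(Eu n y x \<odot>\<^bsub>Fn n T\<^esub> \<nu>) ?t y = 0"
        using Eu_smult_Fn[OF T c(1) xy(2), of y ?t y] Fn_zero_outside[OF c(1), of ?t x] cr by simp
      moreover have "twist n ?s ?t (Eu n y x) \<mu> ?t y = 1"
      proof -
        have "(\<Sum>j<n. Eu n y x $$ (y, j) * \<mu> ?s j) = (\<Sum>j<n. if j = x then 1 else 0)"
          using xy by (intro sum.cong) (auto simp: Eu_def cl_def \<mu> dl_def)
        then show ?thesis using cr xy by (simp add: twist_def)
      qed
      ultimately show False by (simp add: Fn_ops(2))
    qed
  qed
qed

section \<open>The lattice\<close>

definition fbn :: "nat \<Rightarrow> (nat \<times> nat) set set" where
  "fbn n = {S. fbset n S \<and> card S = n}"

lemma fbn_intervals: "S \<in> fbn n \<Longrightarrow> S \<subseteq> intervals n"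
  by (simp add: fbn_def fbset_def)

lemma fbn_code:
  assumes "n \<ge> 1" "S \<in> fbn n"
  obtains c r where "code n c r" "S = code_set n c r"
  using code_exists[OF assms(1), of S] assms(2) by (auto simp: fbn_def)

lemma code_set_fbn: "n \<ge> 1 \<Longrightarrow> code n c r \<Longrightarrow> code_set n c r \<in> fbn n"
  by (simp add: fbn_def fbset_code_set card_code_set)

lemma int_le_refl: "int_le S S"
  by (auto simp: int_le_def)

lemma int_le_trans: "int_le S T \<Longrightarrow> int_le T U \<Longrightarrow> int_le S U"
  unfolding int_le_def by (meson order_trans)

lemma int_le_antisym:
  assumes n: "n \<ge> 1" and S: "S \<in> fbn n" and T: "T \<in> fbn n" and le: "int_le S T" "int_le T S"
  shows "S = T"
proof -
  obtain c r where c: "code n c r" "S = code_set n c r" using fbn_code[OF n S] .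
  obtain c' r' where c': "code n c' r'" "T = code_set n c' r'" using fbn_code[OF n T] .
  have "c i = c' i \<and> r i = r' i" if "i < n" for i
    using le that unfolding c(2) c'(2) code_set_le_iff[OF n c(1) c'(1)] code_set_le_iff[OF n c'(1) c(1)]
    by (metis le_antisym less_imp_le)
  then show ?thesis unfolding c(2) c'(2) code_set_def by (intro image_cong) auto
qed

text \<open>The clause on noncrossing belongs to the same \<open>J\<close> because the sublattice
  claim is about this very join.\<close>

lemma fbn_join:
  assumes n: "n \<ge> 1" and S: "S \<in> fbn n" and T: "T \<in> fbn n"
  shows "\<exists>J\<in>fbn n. int_le S J \<and> int_le T J \<and> (\<forall>U\<in>fbn n. int_le S U \<longrightarrow> int_le T U \<longrightarrow> int_le J U) \<and>
    (no_ext S S \<longrightarrow> no_ext T T \<longrightarrow> no_ext J J)"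
proof -
  obtain c1 r1 where c1: "code n c1 r1" "S = code_set n c1 r1" using fbn_code[OF n S] .
  obtain c2 r2 where c2: "code n c2 r2" "T = code_set n c2 r2" using fbn_code[OF n T] .
  obtain c r where c: "code n c r"
    and ub: "\<forall>i\<le>n. c i \<le> c1 i \<and> c i \<le> c2 i \<and> r i \<le> r1 i \<and> r i \<le> r2 i"
    and least: "\<forall>c' r'. code n c' r' \<longrightarrow> (\<forall>i\<le>n. c' i \<le> c1 i \<and> c' i \<le> c2 i \<and> r' i \<le> r1 i \<and> r' i \<le> r2 i)
      \<longrightarrow> (\<forall>i\<le>n. c' i \<le> c i \<and> r' i \<le> r i)"
    and nc: "no_ext (code_set n c1 r1) (code_set n c1 r1) \<longrightarrow> no_ext (code_set n c2 r2) (code_set n c2 r2) \<longrightarrow>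
       no_ext (code_set n c r) (code_set n c r)"
    using code_join[OF n c1(1) c2(1)] by blast
  have "int_le (code_set n c r) U" if U: "U \<in> fbn n" "int_le S U" "int_le T U" for U
  proof -
    obtain c' r' where c': "code n c' r'" "U = code_set n c' r'" using fbn_code[OF n U(1)] .
    show ?thesis
      using U(2,3) least c'(1)
      unfolding c'(2) c1(2) c2(2) code_set_le_iff[OF n c1(1) c'(1)] code_set_le_iff[OF n c2(1) c'(1)]
        code_set_le_iff[OF n c c'(1)] by blast
  qed
  moreover have "int_le S (code_set n c r)" "int_le T (code_set n c r)"
    unfolding c1(2) c2(2) code_set_le_iff[OF n c1(1) c] code_set_le_iff[OF n c2(1) c] using ub by auto
  ultimately show ?thesis using code_set_fbn[OF n c] nc c1(2) c2(2) by blast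
qed

lemma fbn_meet:
  assumes n: "n \<ge> 1" and S: "S \<in> fbn n" and T: "T \<in> fbn n"
  shows "\<exists>J\<in>fbn n. int_le J S \<and> int_le J T \<and> (\<forall>U\<in>fbn n. int_le U S \<longrightarrow> int_le U T \<longrightarrow> int_le U J) \<and>
    (no_ext S S \<longrightarrow> no_ext T T \<longrightarrow> no_ext J J)"
proof -
  obtain c1 r1 where c1: "code n c1 r1" "S = code_set n c1 r1" using fbn_code[OF n S] .
  obtain c2 r2 where c2: "code n c2 r2" "T = code_set n c2 r2" using fbn_code[OF n T] .
  obtain c r where c: "code n c r"
    and lb: "\<forall>i\<le>n. c1 i \<le> c i \<and> c2 i \<le> c i \<and> r1 i \<le> r i \<and> r2 i \<le> r i"
    and greatest: "\<forall>c' r'. code n c' r' \<longrightarrow> (\<forall>i\<le>n. c1 i \<le> c' i \<and> c2 i \<le> c' i \<and> r1 i \<le> r' i \<and> r2 i \<le> r' i)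
      \<longrightarrow> (\<forall>i\<le>n. c i \<le> c' i \<and> r i \<le> r' i)"
    and nc: "no_ext (code_set n c1 r1) (code_set n c1 r1) \<longrightarrow> no_ext (code_set n c2 r2) (code_set n c2 r2) \<longrightarrow>
       no_ext (code_set n c r) (code_set n c r)"
    using code_meet[OF n c1(1) c2(1)] by blast
  have "int_le U (code_set n c r)" if U: "U \<in> fbn n" "int_le U S" "int_le U T" for U
  proof -
    obtain c' r' where c': "code n c' r'" "U = code_set n c' r'" using fbn_code[OF n U(1)] .
    show ?thesis
      using U(2,3) greatest c'(1)
      unfolding c'(2) c1(2) c2(2) code_set_le_iff[OF n c'(1) c1(1)] code_set_le_iff[OF n c'(1) c2(1)]
        code_set_le_iff[OF n c'(1) c] by blast
  qed
  moreover have "int_le (code_set n c r) S" "int_le (code_set n c r) T"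
    unfolding c1(2) c2(2) code_set_le_iff[OF n c c1(1)] code_set_le_iff[OF n c c2(1)] using lb by auto
  ultimately show ?thesis using code_set_fbn[OF n c] nc c1(2) c2(2) by blast
qed

text \<open>Indices correspond bijectively to members, so new values at one index replace exactly
  one interval.\<close>

lemma code_set_exchange:
  assumes n: "n \<ge> 1" and c: "code n c r" and c': "code n c' r'" and j: "j < n"
    and ne: "(c' j, r' j) \<noteq> (c j, r j)" and eq: "\<And>i. i \<noteq> j \<Longrightarrow> c' i = c i \<and> r' i = r i"
  shows "\<exists>U s t. s \<notin> U \<and> t \<notin> U \<and> s \<noteq> t \<and> code_set n c r = insert s U \<and> code_set n c' r' = insert t U"
proof (intro exI conjI)
  let ?U = "(\<lambda>i. (c i, r i)) ` ({..<n} - {j})"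
  have U: "?U = (\<lambda>i. (c' i, r' i)) ` ({..<n} - {j})" using eq by (intro image_cong) auto
  show "code_set n c r = insert (c j, r j) ?U" using j by (auto simp: code_set_def)
  show "code_set n c' r' = insert (c' j, r' j) ?U" unfolding U using j by (auto simp: code_set_def)
  show "(c j, r j) \<notin> ?U" using code_inj[OF n c] j unfolding inj_on_def by fastforce
  show "(c' j, r' j) \<notin> ?U" unfolding U using code_inj[OF n c'] j unfolding inj_on_def by fastforce
  show "(c j, r j) \<noteq> (c' j, r' j)" using ne by metis
qed

lemma fbn_exchange:
  assumes n: "n \<ge> 1" and S: "S \<in> fbn n" and T: "T \<in> fbn n" and le: "int_le S T" and ne: "S \<noteq> T"
  shows "\<exists>Z\<in>fbn n. int_le S Z \<and> int_le Z T \<and>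
    (\<exists>U s t. s \<notin> U \<and> t \<notin> U \<and> s \<noteq> t \<and>
      (S = insert s U \<and> Z = insert t U \<or> Z = insert s U \<and> T = insert t U))"
proof -
  obtain c1 r1 where c1: "code n c1 r1" "S = code_set n c1 r1" using fbn_code[OF n S] .
  obtain c2 r2 where c2: "code n c2 r2" "T = code_set n c2 r2" using fbn_code[OF n T] .
  have le': "c2 i \<le> c1 i \<and> r2 i \<le> r1 i" if "i \<le> n" for i
    using le that unfolding c1(2) c2(2) code_set_le_iff[OF n c1(1) c2(1)] by blast
  have ne': "code_set n c1 r1 \<noteq> code_set n c2 r2" using ne c1(2) c2(2) by simp
  obtain c r j where c: "code n c r" and bt: "\<And>i. i \<le> n \<Longrightarrow> c2 i \<le> c i \<and> c i \<le> c1 i \<and> r2 i \<le> r i \<and> r i \<le> r1 i"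
    and j: "j < n" and ex: "(c j, r j) \<noteq> (c1 j, r1 j) \<and> (\<forall>i. i \<noteq> j \<longrightarrow> c i = c1 i \<and> r i = r1 i) \<or>
             (c j, r j) \<noteq> (c2 j, r2 j) \<and> (\<forall>i. i \<noteq> j \<longrightarrow> c i = c2 i \<and> r i = r2 i)"
    using code_exchange[OF n c1(1) c2(1) le' ne'] by blast
  have "int_le S (code_set n c r)" "int_le (code_set n c r) T"
    unfolding c1(2) c2(2) code_set_le_iff[OF n c1(1) c] code_set_le_iff[OF n c c2(1)] using bt by auto
  moreover have "\<exists>U s t. s \<notin> U \<and> t \<notin> U \<and> s \<noteq> t \<and>
      (S = insert s U \<and> code_set n c r = insert t U \<or> code_set n c r = insert s U \<and> T = insert t U)"
    using ex
  proof
    assume a: "(c j, r j) \<noteq> (c1 j, r1 j) \<and> (\<forall>i. i \<noteq> j \<longrightarrow> c i = c1 i \<and> r i = r1 i)"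
    show ?thesis using code_set_exchange[OF n c1(1) c j] a unfolding c1(2) by blast
  next
    assume a: "(c j, r j) \<noteq> (c2 j, r2 j) \<and> (\<forall>i. i \<noteq> j \<longrightarrow> c i = c2 i \<and> r i = r2 i)"
    show ?thesis using code_set_exchange[OF n c2(1) c j] a unfolding c2(2) by metis
  qed
  ultimately show ?thesis using code_set_fbn[OF n c] by blast
qed

section \<open>From interval sets to isomorphism classes\<close>

definition Vcl :: "nat \<Rightarrow> (nat \<times> nat) set \<Rightarrow> ('k::field mat, 'k vec) module set" where
  "Vcl n S = iso_class (Lam n) (Vn n S)"

lemma mem_Vcl:
  assumes S: "S \<subseteq> intervals n" and M: "M \<in> Vcl n S"
  shows "M \<in> fg_modules (Lam n)" "left_module (Lam n) M"
    "isomorphic_mod (Lam n) (Fn n S :: ('k::field mat, _) module) (M :: ('k mat, 'k vec) module)"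
proof -
  have M': "M \<in> fg_modules (Lam n)" "isomorphic_mod (Lam n) M (Vn n S)" using M by (auto simp: Vcl_def iso_class_def)
  then show L: "M \<in> fg_modules (Lam n)" "left_module (Lam n) M" by (auto simp: fg_modules_def)
  show "isomorphic_mod (Lam n) (Fn n S :: ('k mat, _) module) M"
    by (rule isomorphic_mod_trans[OF Vn_iso(1)[OF S] isomorphic_mod_sym[OF L(2) M'(2)]])
qed

lemma Vn_in_Vcl: "S \<subseteq> intervals n \<Longrightarrow> Vn n S \<in> Vcl n S"
  by (simp add: Vcl_def iso_class_def Vn_iso(4) isomorphic_mod_refl)

lemma iso_class_Vcl:
  fixes M :: "('k::field mat, 'k vec) module"
  assumes S: "S \<subseteq> intervals n" and M: "left_module (Lam n) M"
    and iso: "isomorphic_mod (Lam n) (Fn n S :: ('k mat, _) module) M"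
  shows "iso_class (Lam n) M = Vcl n S"
proof -
  have 1: "isomorphic_mod (Lam n) (Vn n S) M"
    by (rule isomorphic_mod_trans[OF Vn_iso(2)[OF S] iso])
  then have 2: "isomorphic_mod (Lam n) M (Vn n S)"
    by (rule isomorphic_mod_sym[OF Vn_iso(3)[OF S]])
  show ?thesis
    unfolding Vcl_def iso_class_def using isomorphic_mod_trans[OF _ 1] isomorphic_mod_trans[OF _ 2] by blast
qed

lemma fb_modules_Vcl:
  fixes M :: "('k::field mat, 'k vec) module"
  assumes n: "n \<ge> 1" and M: "M \<in> fb_modules TYPE('k) n"
  obtains S where "S \<in> fbn n" "isomorphic_mod (Lam n) (Fn n S :: ('k mat, _) module) M" "left_module (Lam n) M"
proof -
  have M': "left_module (Lam n) M" "basic_with_summands (Lam n) n M" "faithfully_balanced (Lam n) M"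
    using M by (auto simp: fb_modules_def fg_modules_def)
  obtain S where S: "S \<subseteq> intervals n" "card S = n" "isomorphic_mod (Lam n) (Fn n S :: ('k mat, _) module) M"
    using basic_decomposition[OF M'(2,1)] by blast
  have "faithfully_balanced (Lam n) (Fn n S :: ('k mat, _) module)"
    by (rule faithfully_balanced_iso[OF M'(1) Fn_left_module[OF S(1)]
          isomorphic_mod_sym[OF Fn_left_module[OF S(1)] S(3)] M'(3)])
  then have "S \<in> fbn n" using faithfully_balanced_fbset[OF S(1) n] S(2) by (auto simp: fbn_def)
  then show thesis using that S(3) M'(1) by blast
qed

lemma Vn_fb_modules:
  assumes n: "n \<ge> 1" and S: "S \<in> fbn n"
  shows "(Vn n S :: ('k::field mat, 'k vec) module) \<in> fb_modules TYPE('k) n"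
proof -
  have Si: "S \<subseteq> intervals n" and fb: "fbset n S" and card: "card S = n" using S by (auto simp: fbn_def fbset_def)
  have "basic_with_summands (Lam n) n (Vn n S :: ('k mat, 'k vec) module)"
    using Fn_basic(1)[OF Si Vn_iso(2)[OF Si]] card by simp
  moreover have "faithfully_balanced (Lam n) (Vn n S :: ('k mat, 'k vec) module)"
    by (rule faithfully_balanced_iso[OF Fn_left_module[OF Si] Vn_iso(3)[OF Si] Vn_iso(1)[OF Si]
          fbset_faithfully_balanced[OF fb n]])
  ultimately show ?thesis using Vn_iso(4)[OF Si] by (simp add: fb_modules_def)
qed

lemma fb_poset_carrier:
  assumes n: "n \<ge> 1"
  shows "carrier (fb_poset TYPE('k::field) n) = Vcl n ` fbn n"
proof (intro equalityI subsetI)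
  fix C assume "C \<in> carrier (fb_poset TYPE('k) n)"
  then obtain M where M: "M \<in> fb_modules TYPE('k) n" "C = iso_class (Lam n) M" by (auto simp: fb_poset_def)
  obtain S where "S \<in> fbn n" "isomorphic_mod (Lam n) (Fn n S :: ('k mat, _) module) M" "left_module (Lam n) M"
    using fb_modules_Vcl[OF n M(1)] .
  then show "C \<in> Vcl n ` fbn n" using iso_class_Vcl fbn_intervals M(2) by blast
next
  fix C :: "('k mat, 'k vec) module set" assume "C \<in> Vcl n ` fbn n"
  then show "C \<in> carrier (fb_poset TYPE('k) n)"
    using Vn_fb_modules[OF n] by (auto simp: fb_poset_def Vcl_def)
qed

text \<open>The order asks for some pair of representatives; the criterion has the same value for
  all of them, so the quantifiers collapse.\<close>

lemma fb_poset_le: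
  assumes S: "S \<subseteq> intervals n" and T: "T \<subseteq> intervals n"
  shows "Vcl n S \<sqsubseteq>\<^bsub>fb_poset TYPE('k::field) n\<^esub> Vcl n T \<longleftrightarrow> int_le S T"
proof -
  have iff: "cogen (Lam n) N \<subseteq> cogen (Lam n) M \<and> gen (Lam n) M \<subseteq> gen (Lam n) N \<longleftrightarrow> int_le S T"
    if "N \<in> Vcl n S" "M \<in> Vcl n T" for N M :: "('k mat, 'k vec) module"
    using int_le_iff_gen_cogen[OF S T mem_Vcl(1,3)[OF S that(1)] mem_Vcl(1,3)[OF T that(2)]] .
  have "Vcl n S \<sqsubseteq>\<^bsub>fb_poset TYPE('k) n\<^esub> Vcl n T \<longleftrightarrow> (\<exists>N\<in>Vcl n S. \<exists>M\<in>Vcl n T.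
    cogen (Lam n :: 'k mat ring) N \<subseteq> cogen (Lam n) M \<and> gen (Lam n) M \<subseteq> gen (Lam n) N)"
    by (simp add: fb_poset_def)
  then show ?thesis using iff Vn_in_Vcl[OF S] Vn_in_Vcl[OF T] by blast
qed

text \<open>Tilting modules enter \<open>fbn\<close> through \<open>noncrossing_fbset\<close>:
  without self-extensions, \<open>n\<close> summands already force faithful balance.\<close>

lemma tamari_poset_carrier:
  assumes n: "n \<ge> 1"
  shows "carrier (tamari_poset TYPE('k::field) n) = Vcl n ` {S \<in> fbn n. no_ext S S}"
proof (intro equalityI subsetI)
  fix C assume "C \<in> carrier (tamari_poset TYPE('k) n)"
  then obtain M :: "('k mat, 'k vec) module" where M: "M \<in> fg_modules (Lam n)" "basic_with_summands (Lam n) n M"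
    "Ext1_zero (Lam n) M M" "C = iso_class (Lam n) M" by (auto simp: tamari_poset_def cotilting_modules_def)
  have L: "left_module (Lam n) M" using M(1) by (simp add: fg_modules_def)
  obtain S where S: "S \<subseteq> intervals n" "card S = n" "isomorphic_mod (Lam n) (Fn n S :: ('k mat, _) module) M"
    using basic_decomposition[OF M(2) L] by blast
  have "no_ext S S" using Ext1_zero_no_ext[OF S(1) S(1) L S(3) L S(3)] M(3) by simp
  moreover from this have "S \<in> fbn n" using noncrossing_fbset[OF n S(1,2)] S(2) by (simp add: fbn_def)
  ultimately show "C \<in> Vcl n ` {S \<in> fbn n. no_ext S S}" using iso_class_Vcl[OF S(1) L S(3)] M(4) by blast
next
  fix C :: "('k mat, 'k vec) module set" assume "C \<in> Vcl n ` {S \<in> fbn n. no_ext S S}"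
  then obtain S where S: "S \<in> fbn n" "no_ext S S" "C = Vcl n S" by blast
  note Si = fbn_intervals[OF S(1)]
  note V = Vn_iso[OF Si, where 'k = 'k]
  have "Ext1_zero (Lam n) (Vn n S :: ('k mat, 'k vec) module) (Vn n S)"
    using Ext1_zero_no_ext[OF Si Si V(3,1) V(3,1)] S(2) by simp
  then have "(Vn n S :: ('k mat, 'k vec) module) \<in> cotilting_modules TYPE('k) n"
    using V(4) Vn_fb_modules[OF n S(1), where 'k = 'k] by (simp add: cotilting_modules_def fb_modules_def)
  then show "C \<in> carrier (tamari_poset TYPE('k) n)" using S(3) by (auto simp: tamari_poset_def Vcl_def)
qed

lemma tamari_poset_le:
  assumes S: "S \<subseteq> intervals n" and T: "T \<subseteq> intervals n"
  shows "Vcl n S \<sqsubseteq>\<^bsub>tamari_poset TYPE('k::field) n\<^esub> Vcl n T \<longleftrightarrow> no_ext S T"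
proof -
  have iff: "Ext1_zero (Lam n) N M \<longleftrightarrow> no_ext S T"
    if "N \<in> Vcl n S" "M \<in> Vcl n T" for N M :: "('k mat, 'k vec) module"
    using Ext1_zero_no_ext[OF S T mem_Vcl(2,3)[OF S that(1)] mem_Vcl(2,3)[OF T that(2)]] .
  have "Vcl n S \<sqsubseteq>\<^bsub>tamari_poset TYPE('k) n\<^esub> Vcl n T \<longleftrightarrow>
    (\<exists>N\<in>Vcl n S. \<exists>M\<in>Vcl n T. Ext1_zero (Lam n :: 'k mat ring) N M)"
    by (simp add: tamari_poset_def)
  then show ?thesis using iff Vn_in_Vcl[OF S] Vn_in_Vcl[OF T] by blast
qed

text \<open>Equal classes are comparable in both directions, and the order on interval sets is
  antisymmetric. This supplies the uniqueness of decompositions for the modules in the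
  poset.\<close>

lemma Vcl_inj:
  assumes n: "n \<ge> 1" and S: "S \<in> fbn n" and T: "T \<in> fbn n"
    and eq: "Vcl n S = (Vcl n T :: ('k::field mat, 'k vec) module set)"
  shows "S = T"
proof -
  note Si = fbn_intervals[OF S] and Ti = fbn_intervals[OF T]
  have "Vcl n S \<sqsubseteq>\<^bsub>fb_poset TYPE('k) n\<^esub> Vcl n S" "Vcl n T \<sqsubseteq>\<^bsub>fb_poset TYPE('k) n\<^esub> Vcl n T"
    unfolding fb_poset_le[OF Si Si] fb_poset_le[OF Ti Ti] by (rule int_le_refl)+
  then have "int_le S T" "int_le T S"
    using fb_poset_le[OF Si Ti, where 'k = 'k] fb_poset_le[OF Ti Si, where 'k = 'k] eq by simp_all
  then show ?thesis by (rule int_le_antisym[OF n S T])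
qed

lemma fb_poset_join:
  assumes n: "n \<ge> 1" and S: "S \<in> fbn n" and T: "T \<in> fbn n"
  shows "\<exists>J\<in>fbn n. least (fb_poset TYPE('k::field) n) (Vcl n J) (Upper (fb_poset TYPE('k) n) {Vcl n S, Vcl n T}) \<and>
    (no_ext S S \<longrightarrow> no_ext T T \<longrightarrow> no_ext J J)"
proof -
  let ?L = "fb_poset TYPE('k) n"
  note le = fb_poset_le[OF fbn_intervals fbn_intervals, where 'k = 'k] and car = fb_poset_carrier[OF n, where 'k = 'k]
  obtain J where J: "J \<in> fbn n" "int_le S J" "int_le T J"
    "\<And>U. U \<in> fbn n \<Longrightarrow> int_le S U \<Longrightarrow> int_le T U \<Longrightarrow> int_le J U" "no_ext S S \<longrightarrow> no_ext T T \<longrightarrow> no_ext J J"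
    using fbn_join[OF n S T] by blast
  have "least ?L (Vcl n J) (Upper ?L {Vcl n S, Vcl n T})"
  proof (rule least_UpperI)
    fix x :: "('k mat, 'k vec) module set" assume "x \<in> {Vcl n S, Vcl n T}"
    then show "x \<sqsubseteq>\<^bsub>?L\<^esub> Vcl n J" using le[OF S J(1)] le[OF T J(1)] J(2,3) by auto
  next
    fix y assume y: "y \<in> Upper ?L {Vcl n S, Vcl n T}"
    have sub: "{Vcl n S, Vcl n T} \<subseteq> carrier ?L" using S T car by auto
    have y': "y \<in> carrier ?L" "Vcl n S \<sqsubseteq>\<^bsub>?L\<^esub> y" "Vcl n T \<sqsubseteq>\<^bsub>?L\<^esub> y"
      using Upper_memD[OF y _ sub] by auto
    then obtain U where U: "U \<in> fbn n" "y = Vcl n U" using car by auto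
    then show "Vcl n J \<sqsubseteq>\<^bsub>?L\<^esub> y" using y' le[OF S U(1)] le[OF T U(1)] le[OF J(1) U(1)] J(4) by simp
  qed (use S T J(1) car in auto)
  then show ?thesis using J(1,5) by blast
qed

lemma fb_poset_meet:
  assumes n: "n \<ge> 1" and S: "S \<in> fbn n" and T: "T \<in> fbn n"
  shows "\<exists>J\<in>fbn n. greatest (fb_poset TYPE('k::field) n) (Vcl n J) (Lower (fb_poset TYPE('k) n) {Vcl n S, Vcl n T}) \<and>
    (no_ext S S \<longrightarrow> no_ext T T \<longrightarrow> no_ext J J)"
proof -
  let ?L = "fb_poset TYPE('k) n"
  note le = fb_poset_le[OF fbn_intervals fbn_intervals, where 'k = 'k] and car = fb_poset_carrier[OF n, where 'k = 'k]
  obtain J where J: "J \<in> fbn n" "int_le J S" "int_le J T"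
    "\<And>U. U \<in> fbn n \<Longrightarrow> int_le U S \<Longrightarrow> int_le U T \<Longrightarrow> int_le U J" "no_ext S S \<longrightarrow> no_ext T T \<longrightarrow> no_ext J J"
    using fbn_meet[OF n S T] by blast
  have "greatest ?L (Vcl n J) (Lower ?L {Vcl n S, Vcl n T})"
  proof (rule greatest_LowerI)
    fix x :: "('k mat, 'k vec) module set" assume "x \<in> {Vcl n S, Vcl n T}"
    then show "Vcl n J \<sqsubseteq>\<^bsub>?L\<^esub> x" using le[OF J(1) S] le[OF J(1) T] J(2,3) by auto
  next
    fix y assume y: "y \<in> Lower ?L {Vcl n S, Vcl n T}"
    have sub: "{Vcl n S, Vcl n T} \<subseteq> carrier ?L" using S T car by auto
    have y': "y \<in> carrier ?L" "y \<sqsubseteq>\<^bsub>?L\<^esub> Vcl n S" "y \<sqsubseteq>\<^bsub>?L\<^esub> Vcl n T"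
      using Lower_memD[OF y _ sub] by auto
    then obtain U where U: "U \<in> fbn n" "y = Vcl n U" using car by auto
    then show "y \<sqsubseteq>\<^bsub>?L\<^esub> Vcl n J" using y' le[OF U(1) S] le[OF U(1) T] le[OF U(1) J(1)] J(4) by simp
  qed (use S T J(1) car in auto)
  then show ?thesis using J(1,5) by blast
qed

lemma fb_poset_lattice:
  assumes n: "n \<ge> 1"
  shows "Lattice.lattice (fb_poset TYPE('k::field) n)"
proof -
  let ?L = "fb_poset TYPE('k) n"
  note le = fb_poset_le[OF fbn_intervals fbn_intervals, where 'k = 'k] and car = fb_poset_carrier[OF n, where 'k = 'k]
  have eq: "eq ?L = (=)" by (simp add: fb_poset_def)
  have po: "partial_order ?L"
  proof unfold_locales
    show "x .=\<^bsub>?L\<^esub> x" "x .=\<^bsub>?L\<^esub> y \<Longrightarrow> y .=\<^bsub>?L\<^esub> x" "x .=\<^bsub>?L\<^esub> y \<Longrightarrow> y .=\<^bsub>?L\<^esub> z \<Longrightarrow> x .=\<^bsub>?L\<^esub> z" for x y z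
      by (simp_all add: eq)
    show "(.=\<^bsub>?L\<^esub>) = (=)" by (rule eq)
    fix x assume "x \<in> carrier ?L"
    then obtain S where S: "S \<in> fbn n" "x = Vcl n S" using car by auto
    show "x \<sqsubseteq>\<^bsub>?L\<^esub> x" using le[OF S(1) S(1)] S(2) int_le_refl by simp
    fix y assume "y \<in> carrier ?L"
    then obtain T where T: "T \<in> fbn n" "y = Vcl n T" using car by auto
    show "x .=\<^bsub>?L\<^esub> y" if "x \<sqsubseteq>\<^bsub>?L\<^esub> y" "y \<sqsubseteq>\<^bsub>?L\<^esub> x"
      using that le[OF S(1) T(1)] le[OF T(1) S(1)] int_le_antisym[OF n S(1) T(1)] S(2) T(2) by (simp add: eq)
    fix z assume z: "z \<in> carrier ?L"
    then obtain U where U: "U \<in> fbn n" "z = Vcl n U" using car by auto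
    show "x \<sqsubseteq>\<^bsub>?L\<^esub> z" if "x \<sqsubseteq>\<^bsub>?L\<^esub> y" "y \<sqsubseteq>\<^bsub>?L\<^esub> z"
      using that le[OF S(1) T(1)] le[OF T(1) U(1)] le[OF S(1) U(1)] int_le_trans[of S T U] S(2) T(2) U(2) by simp
    show "x \<sqsubseteq>\<^bsub>?L\<^esub> z \<longleftrightarrow> y \<sqsubseteq>\<^bsub>?L\<^esub> w" if "x .=\<^bsub>?L\<^esub> y" "z .=\<^bsub>?L\<^esub> w" for w
      using that by (simp add: eq)
  qed
  show ?thesis
  proof (intro lattice.intro upper_semilattice.intro lower_semilattice.intro po
      upper_semilattice_axioms.intro lower_semilattice_axioms.intro)
    fix x y assume "x \<in> carrier ?L" "y \<in> carrier ?L"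
    then obtain S T where S: "S \<in> fbn n" "x = Vcl n S" and T: "T \<in> fbn n" "y = Vcl n T" using car by auto
    show "\<exists>s. least ?L s (Upper ?L {x, y})" using fb_poset_join[OF n S(1) T(1), where 'k = 'k] S(2) T(2) by blast
    show "\<exists>s. greatest ?L s (Lower ?L {x, y})" using fb_poset_meet[OF n S(1) T(1), where 'k = 'k] S(2) T(2) by blast
  qed
qed

lemma tamari_sublattice:
  assumes n: "n \<ge> 1"
  shows "sublattice (tamari_poset TYPE('k::field) n) (fb_poset TYPE('k) n)"
proof -
  let ?L = "fb_poset TYPE('k) n" and ?K = "tamari_poset TYPE('k) n"
  note car = fb_poset_carrier[OF n, where 'k = 'k] and tar = tamari_poset_carrier[OF n, where 'k = 'k]
  interpret L: Lattice.lattice ?L by (rule fb_poset_lattice[OF n])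
  show ?thesis
    unfolding sublattice_def
  proof (intro conjI ballI)
    show "carrier ?K \<subseteq> carrier ?L" using car tar by auto
    fix x y assume xy: "x \<in> carrier ?K" "y \<in> carrier ?K"
    then obtain S T where S: "S \<in> fbn n" "no_ext S S" "x = Vcl n S" and T: "T \<in> fbn n" "no_ext T T" "y = Vcl n T"
      using tar by auto
    have xyL: "x \<in> carrier ?L" "y \<in> carrier ?L" using S T car by auto
    note Si = fbn_intervals[OF S(1)] and Ti = fbn_intervals[OF T(1)]
    obtain c1 r1 where c1: "code n c1 r1" "S = code_set n c1 r1" using fbn_code[OF n S(1)] .
    obtain c2 r2 where c2: "code n c2 r2" "T = code_set n c2 r2" using fbn_code[OF n T(1)] .
    have "no_ext S T \<longleftrightarrow> int_le S T"
      using no_ext_iff_le[OF n c1(1) c2(1)] T(2) unfolding c1(2) c2(2) by simp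
    then show "x \<sqsubseteq>\<^bsub>?K\<^esub> y \<longleftrightarrow> x \<sqsubseteq>\<^bsub>?L\<^esub> y"
      unfolding S(3) T(3) fb_poset_le[OF Si Ti] tamari_poset_le[OF Si Ti] .
    obtain J where J: "J \<in> fbn n" "least ?L (Vcl n J) (Upper ?L {x, y})" "no_ext J J"
      using fb_poset_join[OF n S(1) T(1), where 'k = 'k] S T by blast
    \<comment> \<open>The join is defined by choice; uniqueness of least elements identifies it with
      the class of the noncrossing \<open>J\<close>.\<close>
    show "x \<squnion>\<^bsub>?L\<^esub> y \<in> carrier ?K"
    proof (rule L.joinI[OF _ xyL])
      fix l assume "least ?L l (Upper ?L {x, y})"
      then have "l = Vcl n J" using J(2) by (rule L.least_unique)
      then show "l \<in> carrier ?K" using tar J by auto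
    qed
    obtain I where I: "I \<in> fbn n" "greatest ?L (Vcl n I) (Lower ?L {x, y})" "no_ext I I"
      using fb_poset_meet[OF n S(1) T(1), where 'k = 'k] S T by blast
    show "x \<sqinter>\<^bsub>?L\<^esub> y \<in> carrier ?K"
    proof (rule L.meetI[OF _ xyL])
      fix l assume "greatest ?L l (Lower ?L {x, y})"
      then have "l = Vcl n I" using I(2) by (rule L.greatest_unique)
      then show "l \<in> carrier ?K" using tar I by auto
    qed
  qed
qed

section \<open>Cover relations and the exchange of one summand\<close>

lemma Fn_insert_iso:
  assumes s: "s \<notin> U"
  shows "isomorphic_mod (Lam n) (Fn n (insert s U) :: ('k::field mat, _) module) (direct_sum2 (Fn n U) (Fn n {s}))"
proof (rule isomorphic_modI)
  let ?F = "Fn n (insert s U) :: ('k mat, _) module"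
  let ?D = "direct_sum2 (Fn n U) (Fn n {s}) :: ('k mat, _) module"
  let ?h = "\<lambda>f. (\<lambda>t i. if t = s then 0 else f t i, \<lambda>t i. if t = s then f t i else (0::'k))"
  have hom: "?h \<in> mod_hom (Lam n) ?F ?D"
  proof (rule mod_homI)
    fix f assume f: "f \<in> carrier ?F"
    have "(\<lambda>t i. if t = s then 0 else f t i) \<in> carrier (Fn n U)"
      using f unfolding Fn_carrier by (metis insert_iff)
    moreover have "(\<lambda>t i. if t = s then f t i else 0) \<in> carrier (Fn n {s})"
      using f unfolding Fn_carrier by (metis singletonI)
    ultimately show "?h f \<in> carrier ?D" by (simp add: direct_sum2_simps)
    show "?h (f \<oplus>\<^bsub>?F\<^esub> g) = ?h f \<oplus>\<^bsub>?D\<^esub> ?h g" for g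
      unfolding direct_sum2_simps Fn_ops(2) by (auto intro!: ext)
    show "?h (A \<odot>\<^bsub>?F\<^esub> f) = A \<odot>\<^bsub>?D\<^esub> ?h f" for A
    proof -
      have "(if t = s then 0 else (A \<odot>\<^bsub>?F\<^esub> f) t i) = (A \<odot>\<^bsub>Fn n U\<^esub> (\<lambda>t i. if t = s then 0 else f t i)) t i" for t i
        by (cases "t = s") (simp_all add: Fn_ops(3))
      moreover have "(if t = s then (A \<odot>\<^bsub>?F\<^esub> f) t i else 0) = (A \<odot>\<^bsub>Fn n {s}\<^esub> (\<lambda>t i. if t = s then f t i else 0)) t i" for t i
        by (cases "t = s") (simp_all add: Fn_ops(3))
      ultimately show ?thesis unfolding direct_sum2_simps by (simp add: fun_eq_iff)
    qed
  qed
  show "?h \<in> mod_iso (Lam n) ?F ?D"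
  proof (rule mod_isoI[OF hom])
    show "inj_on ?h (carrier ?F)"
    proof (rule inj_onI)
      fix f g assume e: "?h f = ?h g"
      have "f t i = g t i" for t i
        using fun_cong[OF fun_cong[OF conjunct1[OF e[unfolded prod.inject]]], of t i]
          fun_cong[OF fun_cong[OF conjunct2[OF e[unfolded prod.inject]]], of t i] by (cases "t = s") simp_all
      then show "f = g" by blast
    qed
    show "?h ` carrier ?F = carrier ?D"
    proof (intro equalityI subsetI)
      fix p assume p: "p \<in> carrier ?D"
      then have p': "fst p \<in> carrier (Fn n U)" "snd p \<in> carrier (Fn n {s})" by (auto simp: direct_sum2_simps)
      define f where "f t i = (if t = s then snd p t i else fst p t i)" for t i
      have "f \<in> carrier ?F" using p' unfolding Fn_carrier f_def by (metis insertCI singletonD)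
      moreover have "?h f = p"
        using Fn_zero_outside[OF p'(1), of s] Fn_single_carrier[OF p'(2)] s
        by (auto simp: prod_eq_iff f_def intro!: ext)
      ultimately show "p \<in> ?h ` carrier ?F" by blast
    next
      fix p assume "p \<in> ?h ` carrier ?F"
      then show "p \<in> carrier ?D" using mod_homD(1)[OF hom] by blast
    qed
  qed
qed

lemma direct_sum2_iso:
  assumes "isomorphic_mod R M M'" "isomorphic_mod R N N'"
  shows "isomorphic_mod R (direct_sum2 M N) (direct_sum2 M' N')"
proof -
  obtain f where f: "f \<in> mod_iso R M M'" using assms(1) by (rule isomorphic_modE)
  obtain g where g: "g \<in> mod_iso R N N'" using assms(2) by (rule isomorphic_modE)
  note fh = mod_homD[OF mod_isoD(1)[OF f]] and gh = mod_homD[OF mod_isoD(1)[OF g]]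
  have "map_prod f g \<in> mod_iso R (direct_sum2 M N) (direct_sum2 M' N')"
  proof (rule mod_isoI)
    show "map_prod f g \<in> mod_hom R (direct_sum2 M N) (direct_sum2 M' N')"
      using fh gh by (intro mod_homI) (auto simp: direct_sum2_simps)
    show "inj_on (map_prod f g) (carrier (direct_sum2 M N))"
      unfolding direct_sum2_simps by (rule map_prod_inj_on[OF mod_isoD(2)[OF f] mod_isoD(2)[OF g]])
    show "map_prod f g ` carrier (direct_sum2 M N) = carrier (direct_sum2 M' N')"
      unfolding direct_sum2_simps by (rule map_prod_surj_on[OF mod_isoD(3)[OF f] mod_isoD(3)[OF g]])
  qed
  then show ?thesis by (rule isomorphic_modI)
qed

text \<open>Between any two comparable sets there is a \<open>Z\<close> that differs from one of
  them by an exchange. A cover leaves no room for a third set, so the exchange is between the two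
  sets themselves.\<close>

lemma fb_covers_exchange:
  fixes M N :: "('k::field mat, 'k vec) module"
  assumes n: "n \<ge> 1" and M: "M \<in> fb_modules TYPE('k) n" and N: "N \<in> fb_modules TYPE('k) n"
    and cov: "covers (fb_poset TYPE('k) n) (iso_class (Lam n) M) (iso_class (Lam n) N)"
  shows "\<exists>(U :: ('k mat, 'k vec) module) (V :: ('k mat, 'k vec) module) (W :: ('k mat, 'k vec) module).
        U \<in> fg_modules (Lam n) \<and> has_indec_summands (Lam n) (n - 1) U \<and>
        indecomposable (Lam n) V \<and> indecomposable (Lam n) W \<and> \<not> isomorphic_mod (Lam n) V W \<and>
        isomorphic_mod (Lam n) N (direct_sum2 U V) \<and> isomorphic_mod (Lam n) M (direct_sum2 U W)"
proof -
  let ?L = "fb_poset TYPE('k) n"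
  obtain T where T: "T \<in> fbn n" and MT: "isomorphic_mod (Lam n) (Fn n T :: ('k mat, _) module) M" "left_module (Lam n) M"
    using fb_modules_Vcl[OF n M] .
  obtain S where S: "S \<in> fbn n" and NS: "isomorphic_mod (Lam n) (Fn n S :: ('k mat, _) module) N" "left_module (Lam n) N"
    using fb_modules_Vcl[OF n N] .
  note Si = fbn_intervals[OF S] and Ti = fbn_intervals[OF T]
  note le = fb_poset_le[OF fbn_intervals fbn_intervals, where 'k = 'k] and car = fb_poset_carrier[OF n, where 'k = 'k]
  have cM: "iso_class (Lam n) M = Vcl n T" by (rule iso_class_Vcl[OF Ti MT(2,1)])
  have cN: "iso_class (Lam n) N = Vcl n S" by (rule iso_class_Vcl[OF Si NS(2,1)])
  have lless: "A \<sqsubset>\<^bsub>?L\<^esub> B \<longleftrightarrow> A \<sqsubseteq>\<^bsub>?L\<^esub> B \<and> A \<noteq> B" for A B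
    by (simp add: lless_def fb_poset_def)
  have ST: "int_le S T" "S \<noteq> T" and
    btw: "\<And>Z. Z \<in> fbn n \<Longrightarrow> int_le S Z \<Longrightarrow> int_le Z T \<Longrightarrow> Z = S \<or> Z = T"
  proof -
    have "Vcl n S \<sqsubset>\<^bsub>?L\<^esub> Vcl n T" using cov unfolding covers_def cM cN by blast
    then show "int_le S T" "S \<noteq> T" using le[OF S T] by (auto simp: lless)
    fix Z assume Z: "Z \<in> fbn n" "int_le S Z" "int_le Z T"
    have "Vcl n Z \<in> carrier ?L" using Z(1) car by auto
    then have "\<not> (Vcl n S \<sqsubset>\<^bsub>?L\<^esub> Vcl n Z \<and> Vcl n Z \<sqsubset>\<^bsub>?L\<^esub> Vcl n T)"
      using cov unfolding covers_def cM cN by blast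
    then have "Vcl n S = (Vcl n Z :: ('k mat, 'k vec) module set) \<or> Vcl n Z = (Vcl n T :: ('k mat, 'k vec) module set)"
      using le[OF S Z(1)] le[OF Z(1) T] Z(2,3) by (auto simp: lless)
    then show "Z = S \<or> Z = T" using Vcl_inj[OF n S Z(1)] Vcl_inj[OF n Z(1) T] by blast
  qed
  obtain Z U s t where Z: "Z \<in> fbn n" "int_le S Z" "int_le Z T" and st: "s \<notin> U" "t \<notin> U" "s \<noteq> t"
    "S = insert s U \<and> Z = insert t U \<or> Z = insert s U \<and> T = insert t U"
    using fbn_exchange[OF n S T ST] by blast
  have ne: "insert s U \<noteq> insert t U" using st by auto
  \<comment> \<open>\<open>Z\<close> equals \<open>S\<close> or \<open>T\<close>, and an exchange
    changes the set, so the exchanged pair can only be \<open>S\<close> and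
    \<open>T\<close>.\<close>
  have SU: "S = insert s U" and TU: "T = insert t U" using btw[OF Z] st(4) ne by auto
  have U: "U \<subseteq> intervals n" and s: "s \<in> intervals n" and t: "t \<in> intervals n" using SU TU Si Ti by auto
  have finU: "finite U" by (rule finite_subset[OF U finite_intervals])
  have "card U = n - 1" using S SU st(1) finU by (auto simp: fbn_def)
  then have "has_indec_summands (Lam n) (n - 1) (Vn n U :: ('k mat, 'k vec) module)"
    using Fn_basic(2)[OF U Vn_iso(2)[OF U]] by simp
  moreover have iso: "isomorphic_mod (Lam n) X (direct_sum2 (Vn n U) (Vn n {u}))"
    if "u \<notin> U" "u \<in> intervals n" "left_module (Lam n) X" "isomorphic_mod (Lam n) (Fn n (insert u U) :: ('k mat, _) module) X"
    for u and X :: "('k mat, 'k vec) module"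
  proof -
    have u: "{u} \<subseteq> intervals n" "insert u U \<subseteq> intervals n" using that(2) U by auto
    have a: "isomorphic_mod (Lam n) X (Fn n (insert u U) :: ('k mat, _) module)"
      by (rule isomorphic_mod_sym[OF Fn_left_module[OF u(2)] that(4)])
    have b: "isomorphic_mod (Lam n) (Fn n (insert u U) :: ('k mat, _) module) (direct_sum2 (Vn n U) (Vn n {u}))"
      by (rule isomorphic_mod_trans[OF Fn_insert_iso[OF that(1)] direct_sum2_iso[OF Vn_iso(1)[OF U] Vn_iso(1)[OF u(1)]]])
    show ?thesis by (rule isomorphic_mod_trans[OF a b])
  qed
  moreover have "\<not> isomorphic_mod (Lam n) (Vn n {s} :: ('k mat, 'k vec) module) (Vn n {t} :: ('k mat, 'k vec) module)"
    using Vn_single_iso_eq[OF s t] st(3) by blast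
  ultimately show ?thesis
    using Vn_iso(4)[OF U] Vn_single_indecomposable[OF s] Vn_single_indecomposable[OF t]
      iso[OF st(1) s NS(2)] iso[OF st(2) t MT(2)] NS(1) MT(1) unfolding SU TU by blast
qed

theorem theorem1p6:
  fixes n :: nat
  assumes "n \<ge> 1"
  shows "Lattice.lattice (fb_poset TYPE('k::field) n) \<and>
    sublattice (tamari_poset TYPE('k) n) (fb_poset TYPE('k) n) \<and>
    (\<forall>M \<in> fb_modules TYPE('k) n. \<forall>N \<in> fb_modules TYPE('k) n.
      covers (fb_poset TYPE('k) n)
        (iso_class (lower_tri_ring TYPE('k) n) M) (iso_class (lower_tri_ring TYPE('k) n) N) \<longrightarrow>
      (\<exists>(U :: ('k mat, 'k vec) module) (V :: ('k mat, 'k vec) module) (W :: ('k mat, 'k vec) module).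
        U \<in> fg_modules (lower_tri_ring TYPE('k) n) \<and>
        has_indec_summands (lower_tri_ring TYPE('k) n) (n - 1) U \<and>
        indecomposable (lower_tri_ring TYPE('k) n) V \<and>
        indecomposable (lower_tri_ring TYPE('k) n) W \<and>
        \<not> isomorphic_mod (lower_tri_ring TYPE('k) n) V W \<and>
        isomorphic_mod (lower_tri_ring TYPE('k) n) N (direct_sum2 U V) \<and>
        isomorphic_mod (lower_tri_ring TYPE('k) n) M (direct_sum2 U W)))"
proof (intro conjI ballI impI)
  show "Lattice.lattice (fb_poset TYPE('k) n)" by (rule fb_poset_lattice[OF assms])
  show "sublattice (tamari_poset TYPE('k) n) (fb_poset TYPE('k) n)" by (rule tamari_sublattice[OF assms])
qed (rule fb_covers_exchange[OF assms])

end
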